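(* Let $\bm k\in\{0,1\}^{n\times d}$ be a missing structure and $\bm y_{(\bm k)}$ a realized observed response. Suppose that $\int_0^\infty w^{d/2}\,P_{\rm mix}(dw)<\infty$, and that the conditional distribution of $(\bm B,\bm\Sigma)$ given $(\bm W,\bm Y_{(\bm k)})=(\bm w,\bm y_{(\bm k)})$ is proper for every $\bm w=(w_1,\dots,w_n)^\top\in(0,\infty)^n$. If any one of the following conditions holds, then the posterior $\pi_{\bm k}(\cdot\mid\bm y_{(\bm k)})$ is proper and the Markov chain $(\bm B(t),\bm\Sigma(t))_{t=0}^\infty$ underlying the DA algorithm targeting $\pi_{\bm k}(\cdot\mid\bm y_{(\bm k)})$ is geometrically ergodic: 1. $P_{\rm mix}$ is zero near the origin; 2. $P_{\rm mix}$ is faster than polynomial near the origin; or 3. $P_{\rm mix}$ is polynomial near the origin with power $c>c_1$, where $$c_1=\frac{n-p+m-\min\{d_1,\dots,d_n\}}{2},$$ and $d_i$ is the number of nonzero entries in the $i$th row of $\bm k$.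
   Context: Setting. Fix positive integers $n,p,d$; a design matrix $\bm x\in\mathbb R^{n\times p}$ with $i$th row $\bm x_i^\top$; $m\in\mathbb R$; a symmetric positive semi-definite $\bm a\in\mathbb R^{d\times d}$; and a probability measure $P_{\rm mix}$ on $(0,\infty)$. Let $S$ be the set of symmetric positive definite real $d\times d$ matrices. Integrals $d\bm\beta$ and $d\bm\varsigma$ are with respect to Lebesgue measure on $\mathbb R^{p\times d}$ and on (the free entries of) $S$. Model. The (improper) prior density is $p_{\rm prior}(\bm\beta,\bm\varsigma)\propto|\bm\varsigma|^{-(m+1)/2}\exp\{-\frac12\operatorname{tr}(\bm\varsigma^{-1}\bm a)\}$ on $\mathbb R^{p\times d}\times S$. The joint measure of $(\bm Y,\bm W,\bm B,\bm\Sigma)$ on $\mathbb R^{n\times d}\times(0,\infty)^n\times\mathbb R^{p\times d}\times S$ is $p_{\rm joint}(\bm y,\bm w,\bm\beta,\bm\varsigma)\,d\bm y\,\prod_iP_{\rm mix}(dw_i)\,d\bm\beta\,d\bm\varsigma$, where, with $\bm y_i^\top$ the $i$th row of $\bm y$, $$p_{\rm joint}\propto p_{\rm prior}(\bm\beta,\bm\varsigma)\prod_{i=1}^n\frac{w_i^{d/2}}{|\bm\varsigma|^{1/2}}\exp\Big\{-\frac{w_i}{2}(\bm y_i-\bm\beta^\top\bm x_i)^\top\bm\varsigma^{-1}(\bm y_i-\bm\beta^\top\bm x_i)\Big\}.$$ All conditional distributions are defined through $p_{\rm joint}$. Missing data. A missing structure is $\bm k=(k_{i,j})\in\{0,1\}^{n\times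 d}$ each of whose rows has at least one $1$; $k_{i,j}=1$ means $Y_{i,j}$ is observed. $\bm y_{(\bm k)}=(y_{i,j})_{k_{i,j}=1}$. If the $1$'s in row $i$ are at positions $j_1<\dots<j_{d_i}$, $\bm c_{i,(\bm k)}$ is the $d_i\times d$ matrix whose $\ell$th row has a $1$ in position $j_\ell$ and $0$ elsewhere; $\bm y_{i,(\bm k)}=\bm c_{i,(\bm k)}\bm y_i$. Put $$r_{i,(\bm k)}=(\bm y_{i,(\bm k)}-\bm c_{i,(\bm k)}\bm\beta^\top\bm x_i)^\top(\bm c_{i,(\bm k)}\bm\varsigma\bm c_{i,(\bm k)}^\top)^{-1}(\bm y_{i,(\bm k)}-\bm c_{i,(\bm k)}\bm\beta^\top\bm x_i).$$ Conditionals and posterior (given $\bm Y_{(\bm k)}=\bm y_{(\bm k)}$). (a) The conditional distribution of $\bm W$ given $(\bm B,\bm\Sigma,\bm Y_{(\bm k)})=(\bm\beta,\bm\varsigma,\bm y_{(\bm k)})$ is $\propto\prod_i w_i^{d_i/2}\exp(-r_{i,(\bm k)}w_i/2)P_{\rm mix}(dw_i)$. (b) The conditional distribution of $(\bm B,\bm\Sigma)$ given $(\bm W,\bm Y_{(\bm k)})=(\bm w,\bm y_{(\bm k)})$ has density $\propto p_{\rm prior}(\bm\beta,\bm\varsigma)\prod_i w_i^{d_i/2}|\bm c_{i,(\bm k)}\bm\varsigma\bm c_{i,(\bm k)}^\top|^{-1/2}\exp(-r_{i,(\bm k)}w_i/2)$. (c) The posterior density is $\pi_{\bm k}(\bm\beta,\bm\varsigma\mid\bm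 y_{(\bm k)})\propto p_{\rm prior}(\bm\beta,\bm\varsigma)\prod_i\int_0^\infty w^{d_i/2}|\bm c_{i,(\bm k)}\bm\varsigma\bm c_{i,(\bm k)}^\top|^{-1/2}\exp(-r_{i,(\bm k)}w/2)P_{\rm mix}(dw)$. Such a distribution is proper if the displayed unnormalized density has finite total integral. DA algorithm. A Markov chain on $\mathbb R^{p\times d}\times S$: from $(\bm B(t),\bm\Sigma(t))=(\bm\beta,\bm\varsigma)$, draw $\bm w$ from (a); then draw $(\bm B(t+1),\bm\Sigma(t+1))$ from (b) with that $\bm w$. Behavior of $P_{\rm mix}$ near $0$. Zero near the origin: there is $\theta>0$ with $\int_0^\theta P_{\rm mix}(dw)=0$. If $P_{\rm mix}$ has a Lebesgue density $p_{\rm mix}$: it is polynomial near the origin with power $c>-1$ if $\lim_{w\to0}p_{\rm mix}(w)/w^c$ exists in $(0,\infty)$; it is faster than polynomial near the origin if for every $c>0$ there is $\kappa_c>0$ such that $p_{\rm mix}(w)/w^c$ is strictly increasing on $(0,\kappa_c)$. Ergodicity. A $\phi$-irreducible aperiodic chain with kernel $K$ on $\mathcal X$ and stationary probability $\pi$ is Harris ergodic if $\|K^t(x,\cdot)-\pi\|_{TV}\to0$ for all $x\in\mathcal X$; it is geometrically ergodic if it is Harris ergodic and there are $\rho\in[0,1)$ and $M:\mathcal X\to[0,\infty)$ with $\|K^t(x,\cdot)-\pi\|_{TV}\le M(x)\rho^t$ for all $x\in\mathcal X$, $t\in\{1,2,\dots\}$. *)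

theory Defs
  imports
    "HOL-Probability.Probability"
    "Jordan_Normal_Form.Determinant"
    "Jordan_Normal_Form.Gauss_Jordan_Elimination"
begin

no_notation Matrix.vec_index (infixl "$" 100)
no_notation Matrix.scalar_prod (infix "\<bullet>" 70)

type_synonym 'c rvec = "real^'c"
type_synonym ('r, 'c) rmat = "real^'c^'r"
type_synonym ('r, 'c) bmat = "bool^'c^'r"

definition psd_matrix :: "('d::finite, 'd) rmat \<Rightarrow> bool" where
  "psd_matrix A \<longleftrightarrow> Finite_Cartesian_Product.transpose A = A \<and> (\<forall>v. 0 \<le> v \<bullet> (A *v v))"

definition spd_matrices :: "('d::finite, 'd) rmat set" where
  "spd_matrices = {A. Finite_Cartesian_Product.transpose A = A \<and> (\<forall>v. v \<noteq> 0 \<longrightarrow> 0 < v \<bullet> (A *v v))}"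

definition sym_of_upper :: "('d::{finite,linorder} \<times> 'd \<Rightarrow> real) \<Rightarrow> ('d, 'd) rmat" where
  "sym_of_upper u = (\<chi> i j. if i \<le> j then u (i, j) else u (j, i))"

text \<open>The free entries of a symmetric matrix are those on and above the diagonal.\<close>

definition lborel_spd :: "('d::{finite,linorder}, 'd) rmat measure" where
  "lborel_spd = restrict_space
     (distr (Pi\<^sub>M {(i, j). i \<le> j} (\<lambda>_. lborel)) borel sym_of_upper) spd_matrices"

definition param_space :: "(('p::finite, 'd::{finite,linorder}) rmat \<times> ('d, 'd) rmat) measure" where
  "param_space = lborel \<Otimes>\<^sub>M lborel_spd"

definition proper_density :: "'a measure \<Rightarrow> ('a \<Rightarrow> ennreal) \<Rightarrow> bool" where
  "proper_density M f \<longleftrightarrow> (\<integral>\<^sup>+z. f z \<partial>M) < \<infinity>"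

definition normalized_density :: "'a measure \<Rightarrow> ('a \<Rightarrow> ennreal) \<Rightarrow> 'a measure" where
  "normalized_density M f = density M (\<lambda>z. f z / (\<integral>\<^sup>+z. f z \<partial>M))"

text \<open>
  The number of observed entries varies from row to row, so the selection matrices and the
  objects built from them are matrices and vectors with explicit dimensions; positions in
  \<open>'d\<close> are numbered from \<open>0\<close> in increasing order.
\<close>

definition nth_index :: "nat \<Rightarrow> 'd::{finite,linorder}" where
  "nth_index l = sorted_list_of_set UNIV ! l"

definition to_mat :: "('r::{finite,linorder}, 'c::{finite,linorder}) rmat \<Rightarrow> real Matrix.mat" where
  "to_mat A = Matrix.mat CARD('r) CARD('c) (\<lambda>(l, q). A $ nth_index l $ nth_index q)"

definition to_vec :: "'d::{finite,linorder} rvec \<Rightarrow> real Matrix.vec" where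
  "to_vec v = Matrix.vec CARD('d) (\<lambda>l. v $ nth_index l)"

definition missing_structure :: "('n::finite, 'd::finite) bmat \<Rightarrow> bool" where
  "missing_structure k \<longleftrightarrow> (\<forall>i. \<exists>j. k $ i $ j)"

definition num_obs :: "('n::finite, 'd::finite) bmat \<Rightarrow> 'n \<Rightarrow> nat" where
  "num_obs k i = card {j. k $ i $ j}"

definition sel_mat :: "('n::finite, 'd::{finite,linorder}) bmat \<Rightarrow> 'n \<Rightarrow> real Matrix.mat" where
  "sel_mat k i = Matrix.mat (num_obs k i) CARD('d)
     (\<lambda>(l, q). if nth_index q = sorted_list_of_set {j. k $ i $ j} ! l then 1 else 0)"

definition obs_scale :: "('n::finite, 'd::{finite,linorder}) bmat \<Rightarrow> 'n \<Rightarrow> ('d, 'd) rmat \<Rightarrow> real Matrix.mat" where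
  "obs_scale k i \<Sigma> = sel_mat k i * to_mat \<Sigma> * transpose_mat (sel_mat k i)"

definition obs_resid ::
  "('n::finite, 'p::finite) rmat \<Rightarrow> ('n, 'd::{finite,linorder}) bmat \<Rightarrow> ('n, 'd) rmat
     \<Rightarrow> 'n \<Rightarrow> ('p, 'd) rmat \<Rightarrow> real Matrix.vec" where
  "obs_resid x k y i \<beta> =
     sel_mat k i *\<^sub>v to_vec (y $ i)
       - sel_mat k i *\<^sub>v to_vec (Finite_Cartesian_Product.transpose \<beta> *v (x $ i))"

text \<open>
  For positive definite \<open>\<Sigma>\<close> the matrix \<open>obs_scale k i \<Sigma>\<close> is invertible,
  so \<open>mat_inverse\<close> returns its inverse.
\<close>

definition quad_resid ::
  "('n::finite, 'p::finite) rmat \<Rightarrow> ('n, 'd::{finite,linorder}) bmat \<Rightarrow> ('n, 'd) rmat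
     \<Rightarrow> 'n \<Rightarrow> ('p, 'd) rmat \<Rightarrow> ('d, 'd) rmat \<Rightarrow> real" where
  "quad_resid x k y i \<beta> \<Sigma> =
     scalar_prod (obs_resid x k y i \<beta>)
       (the (mat_inverse (obs_scale k i \<Sigma>)) *\<^sub>v obs_resid x k y i \<beta>)"

definition prior_dens :: "real \<Rightarrow> ('d::finite, 'd) rmat \<Rightarrow> ('d, 'd) rmat \<Rightarrow> real" where
  "prior_dens m a \<Sigma> =
     Determinants.det \<Sigma> powr (- (m + 1) / 2) * exp (- (1 / 2) * Determinants.trace (matrix_inv \<Sigma> ** a))"

definition weight_dens ::
  "('n::finite, 'p::finite) rmat \<Rightarrow> ('n, 'd::{finite,linorder}) bmat \<Rightarrow> ('n, 'd) rmat
     \<Rightarrow> ('p, 'd) rmat \<times> ('d, 'd) rmat \<Rightarrow> ('n \<Rightarrow> real) \<Rightarrow> ennreal" where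
  "weight_dens x k y = (\<lambda>(\<beta>, \<Sigma>) w. ennreal
     (\<Prod>i\<in>UNIV. w i powr (num_obs k i / 2) * exp (- quad_resid x k y i \<beta> \<Sigma> * w i / 2)))"

definition param_dens ::
  "('n::finite, 'p::finite) rmat \<Rightarrow> real \<Rightarrow> ('d::{finite,linorder}, 'd) rmat \<Rightarrow> ('n, 'd) bmat \<Rightarrow> ('n, 'd) rmat
     \<Rightarrow> ('n \<Rightarrow> real) \<Rightarrow> ('p, 'd) rmat \<times> ('d, 'd) rmat \<Rightarrow> ennreal" where
  "param_dens x m a k y w = (\<lambda>(\<beta>, \<Sigma>). ennreal (prior_dens m a \<Sigma> *
     (\<Prod>i\<in>UNIV. w i powr (num_obs k i / 2) * Determinant.det (obs_scale k i \<Sigma>) powr (- 1 / 2)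
        * exp (- quad_resid x k y i \<beta> \<Sigma> * w i / 2))))"

definition posterior_dens ::
  "('n::finite, 'p::finite) rmat \<Rightarrow> real \<Rightarrow> ('d::{finite,linorder}, 'd) rmat \<Rightarrow> real measure
     \<Rightarrow> ('n, 'd) bmat \<Rightarrow> ('n, 'd) rmat \<Rightarrow> ('p, 'd) rmat \<times> ('d, 'd) rmat \<Rightarrow> ennreal" where
  "posterior_dens x m a Pmix k y = (\<lambda>(\<beta>, \<Sigma>). ennreal (prior_dens m a \<Sigma>) *
     (\<Prod>i\<in>UNIV. \<integral>\<^sup>+w. ennreal (w powr (num_obs k i / 2)
        * Determinant.det (obs_scale k i \<Sigma>) powr (- 1 / 2)
        * exp (- quad_resid x k y i \<beta> \<Sigma> * w / 2)) \<partial>Pmix))"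

definition posterior ::
  "('n::finite, 'p::finite) rmat \<Rightarrow> real \<Rightarrow> ('d::{finite,linorder}, 'd) rmat \<Rightarrow> real measure
     \<Rightarrow> ('n, 'd) bmat \<Rightarrow> ('n, 'd) rmat \<Rightarrow> (('p, 'd) rmat \<times> ('d, 'd) rmat) measure" where
  "posterior x m a Pmix k y = normalized_density param_space (posterior_dens x m a Pmix k y)"

definition da_kernel ::
  "('n::finite, 'p::finite) rmat \<Rightarrow> real \<Rightarrow> ('d::{finite,linorder}, 'd) rmat \<Rightarrow> real measure
     \<Rightarrow> ('n, 'd) bmat \<Rightarrow> ('n, 'd) rmat
     \<Rightarrow> ('p, 'd) rmat \<times> ('d, 'd) rmat \<Rightarrow> (('p, 'd) rmat \<times> ('d, 'd) rmat) measure" where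
  "da_kernel x m a Pmix k y z =
     normalized_density (Pi\<^sub>M UNIV (\<lambda>_. Pmix)) (weight_dens x k y z)
       \<bind> (\<lambda>w. normalized_density param_space (param_dens x m a k y w))"

definition mixing_distribution :: "real measure \<Rightarrow> bool" where
  "mixing_distribution P \<longleftrightarrow> prob_space P \<and> space P = {0<..} \<and> sets P = sets (restrict_space borel {0<..})"

definition has_lebesgue_density :: "real measure \<Rightarrow> (real \<Rightarrow> real) \<Rightarrow> bool" where
  "has_lebesgue_density P f \<longleftrightarrow>
     f \<in> borel_measurable (restrict_space lborel {0<..}) \<and> (\<forall>w>0. 0 \<le> f w) \<and>
     P = density (restrict_space lborel {0<..}) (\<lambda>w. ennreal (f w))"

definition zero_near_origin :: "real measure \<Rightarrow> bool" where
  "zero_near_origin P \<longleftrightarrow> (\<exists>\<theta>>0. emeasure P {0<..<\<theta>} = 0)"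

text \<open>A density is determined only almost everywhere; some version has to behave as required.\<close>

definition polynomial_near_origin :: "real measure \<Rightarrow> real \<Rightarrow> bool" where
  "polynomial_near_origin P c \<longleftrightarrow> c > - 1 \<and>
     (\<exists>f. has_lebesgue_density P f \<and> (\<exists>L>0. ((\<lambda>w. f w / w powr c) \<longlongrightarrow> L) (at_right 0)))"

definition faster_than_polynomial_near_origin :: "real measure \<Rightarrow> bool" where
  "faster_than_polynomial_near_origin P \<longleftrightarrow>
     (\<exists>f. has_lebesgue_density P f \<and>
        (\<forall>c>0. \<exists>\<kappa>>0. strict_mono_on {0<..<\<kappa>} (\<lambda>w. f w / w powr c)))"

definition tv_dist :: "'a measure \<Rightarrow> 'a measure \<Rightarrow> real" where
  "tv_dist M N = (SUP A\<in>sets M. \<bar>measure M A - measure N A\<bar>)"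

primrec kernel_pow :: "'a measure \<Rightarrow> ('a \<Rightarrow> 'a measure) \<Rightarrow> nat \<Rightarrow> 'a \<Rightarrow> 'a measure" where
  "kernel_pow X K 0 z = return X z"
| "kernel_pow X K (Suc t) z = kernel_pow X K t z \<bind> K"

definition stationary :: "'a measure \<Rightarrow> ('a \<Rightarrow> 'a measure) \<Rightarrow> 'a measure \<Rightarrow> bool" where
  "stationary X K \<pi> \<longleftrightarrow> \<pi> \<in> space (prob_algebra X) \<and> \<pi> \<bind> K = \<pi>"

definition phi_irreducible :: "'a measure \<Rightarrow> ('a \<Rightarrow> 'a measure) \<Rightarrow> bool" where
  "phi_irreducible X K \<longleftrightarrow>
     (\<exists>\<phi>. sigma_finite_measure \<phi> \<and> sets \<phi> = sets X \<and> emeasure \<phi> (space \<phi>) > 0 \<and>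
        (\<forall>A\<in>sets X. emeasure \<phi> A > 0 \<longrightarrow>
           (\<forall>z\<in>space X. \<exists>t\<ge>1. emeasure (kernel_pow X K t z) A > 0)))"

definition aperiodic :: "'a measure \<Rightarrow> ('a \<Rightarrow> 'a measure) \<Rightarrow> 'a measure \<Rightarrow> bool" where
  "aperiodic X K \<pi> \<longleftrightarrow>
     \<not> (\<exists>(q::nat) D. q \<ge> 2 \<and> (\<forall>i<q. D i \<in> sets X) \<and> disjoint_family_on D {..<q} \<and>
          (\<forall>i<q. \<forall>z\<in>D i. emeasure (K z) (D (Suc i mod q)) = 1) \<and> emeasure \<pi> (D 0) > 0)"

definition harris_ergodic :: "'a measure \<Rightarrow> ('a \<Rightarrow> 'a measure) \<Rightarrow> 'a measure \<Rightarrow> bool" where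
  "harris_ergodic X K \<pi> \<longleftrightarrow>
     K \<in> measurable X (prob_algebra X) \<and> stationary X K \<pi> \<and> phi_irreducible X K \<and> aperiodic X K \<pi> \<and>
     (\<forall>z\<in>space X. (\<lambda>t. tv_dist (kernel_pow X K t z) \<pi>) \<longlonglongrightarrow> 0)"

definition geometrically_ergodic :: "'a measure \<Rightarrow> ('a \<Rightarrow> 'a measure) \<Rightarrow> 'a measure \<Rightarrow> bool" where
  "geometrically_ergodic X K \<pi> \<longleftrightarrow> harris_ergodic X K \<pi> \<and>
     (\<exists>\<rho> M. 0 \<le> \<rho> \<and> \<rho> < (1::real) \<and>
        (\<forall>z\<in>space X. 0 \<le> M z \<and> (\<forall>t\<ge>1. tv_dist (kernel_pow X K t z) \<pi> \<le> M z * \<rho> ^ t)))"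

end

theory Submission
  imports Defs
begin

text \<open>
  The drift function is \<open>V = (\<Sum>i. r i)\<close>, the sum of the quadratic residuals of the observed
  entries. Put \<open>\<nu> = n - p + m - d\<close> and let \<open>Z w\<close> be the normalizing integral of
  conditional (b). Given the weights, \<open>r i\<close> has mean at most \<open>(\<nu> + d i) / w i\<close>; this
  follows from \<open>Z (w(i := t * w i)) \<ge> t powr (- \<nu> / 2) * Z w\<close> for \<open>t \<ge> 1\<close> by
  differentiating at \<open>t = 1\<close>. To prove that inequality, write conditional (b) as a marginal of a
  complete-data density, in which the effect of one weight on the scatter matrix is absorbed by an
  affine substitution in \<open>\<beta>\<close> and a congruence of \<open>\<Sigma>\<close>, both rank-one perturbations of the
  identity. The inequality also bounds \<open>Z w\<close> by a product of powers of the \<open>w i\<close>, which makes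
  the posterior proper.

  Given the parameters, the mean of \<open>1 / w i\<close> is at most \<open>l * r i + L\<close> with
  \<open>(\<nu> + d i) * l < 1\<close>: this is where the behaviour of the mixing distribution near the origin
  enters, through a comparison with the Gamma density. Composing the two bounds gives a drift
  condition for \<open>V\<close>. On the set where \<open>V \<le> R\<close> the weights dominate a fixed measure, which
  gives a minorization, and the theorem of Harris in the form of Hairer and Mattingly applies.
\<close>

subsection \<open>Geometric ergodicity from drift and minorization\<close>

text \<open>The two bounds of the drift fit together exactly. If the mixing density behaves like
  \<open>w powr c\<close> near 0, the law of \<open>w i\<close> given the parameters resembles a
  Gamma law there, with mean of \<open>1 / w i\<close> about \<open>r i / (2 * c + d i)\<close>.
  Composed with \<open>(\<nu> + d i) / w i\<close> this gives the factor
  \<open>(\<nu> + d i) / (2 * c + d i)\<close>, which is below 1 precisely when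
  \<open>c > \<nu> / 2\<close>. The obstacle is \<open>Z\<close>: for general missing patterns there
  is no closed form to work with, and the design matrix and \<open>a\<close> may be rank deficient.
  So \<open>Z\<close> is never evaluated. The weight inequality holds with the same factor for each
  completed data set and therefore survives integration over the completions. Inverses of possibly
  singular matrices are replaced by solutions of linear systems, which exist because the right-hand
  side is dominated by the quadratic form. The inequality needs \<open>\<nu> \<ge> 0\<close>. This
  is extracted from propriety: for negative \<nu> a dilation of the parameters would bound a finite
  positive integral below by a larger multiple of itself.\<close>

lemma exists_common_center:
  fixes f g :: "'a \<Rightarrow> real"
  assumes "\<And>x y. x \<in> S \<Longrightarrow> y \<in> S \<Longrightarrow> f x - f y \<le> g x + g y"
  shows "\<exists>c. \<forall>x\<in>S. \<bar>f x - c\<bar> \<le> g x"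
proof (cases "S = {}")
  case False
  then obtain y where y: "y \<in> S" by blast
  \<comment> \<open>The intervals from \<open>f x - g x\<close> to \<open>f x + g x\<close> meet
    pairwise, hence have a common point; the supremum of the left ends is one.\<close>
  let ?c = "SUP x\<in>S. f x - g x"
  have bdd: "bdd_above ((\<lambda>x. f x - g x) ` S)"
    using assms[OF _ y] by (intro bdd_aboveI2[where M="f y + g y"]) (simp add: algebra_simps)
  have "f x - g x \<le> ?c" if "x \<in> S" for x
    by (rule cSUP_upper[OF that bdd])
  moreover have "?c \<le> f x + g x" if "x \<in> S" for x
    using False assms[OF _ that] by (intro cSUP_least) (auto simp: algebra_simps)
  ultimately show ?thesis
    by (intro exI[of _ ?c] ballI) (simp add: abs_le_iff diff_le_eq le_diff_eq add.commute)
qed auto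

text \<open>The minorization is asked for every level \<open>R\<close>, because the level that the
  contraction needs depends on \<open>l\<close> and \<open>b\<close>. The minorizing measure is left
  unnormalized: only a lower bound on its total mass enters.\<close>

locale drift_minorization =
  fixes X :: "'a measure" and K :: "'a \<Rightarrow> 'a measure" and V :: "'a \<Rightarrow> real" and l b :: real
    and \<pi> :: "'a measure"
  assumes K[measurable]: "K \<in> measurable X (prob_algebra X)"
    and V[measurable]: "V \<in> borel_measurable X"
    and V_nonneg: "\<And>z. z \<in> space X \<Longrightarrow> 0 \<le> V z"
    and l: "0 \<le> l" "l < 1" and b: "0 \<le> b"
    and drift: "\<And>z. z \<in> space X \<Longrightarrow> (\<integral>\<^sup>+u. ennreal (V u) \<partial>K z) \<le> ennreal (l * V z + b)"
    and minorization: "\<And>R. \<exists>\<nu>. finite_measure \<nu> \<and> sets \<nu> = sets X \<and> emeasure \<nu> (space X) > 0 \<and>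
        (\<forall>z\<in>space X. V z \<le> R \<longrightarrow> (\<forall>A\<in>sets X. emeasure \<nu> A \<le> emeasure (K z) A))"
    and stationary: "stationary X K \<pi>"
begin

lemma K_prob: "z \<in> space X \<Longrightarrow> prob_space (K z)"
  and K_sets: "z \<in> space X \<Longrightarrow> sets (K z) = sets X"
  using measurable_space[OF K] by (auto simp: space_prob_algebra)

lemma pi_prob: "prob_space \<pi>" and pi_sets: "sets \<pi> = sets X" and pi_bind: "\<pi> \<bind> K = \<pi>"
  using stationary by (auto simp: stationary_def space_prob_algebra)

lemma pi_space: "space \<pi> = space X"
  using pi_sets by (rule sets_eq_imp_space_eq)

lemma K_space: "z \<in> space X \<Longrightarrow> space (K z) = space X"
  using K_sets by (intro sets_eq_imp_space_eq)

lemma V_integrable: assumes "z \<in> space X" shows "integrable (K z) V"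
proof -
  have "V \<in> borel_measurable (K z)"
    using V measurable_cong_sets[OF K_sets[OF assms] refl] by blast
  moreover have "(\<integral>\<^sup>+u. ennreal (norm (V u)) \<partial>K z) = (\<integral>\<^sup>+u. ennreal (V u) \<partial>K z)"
    by (intro nn_integral_cong) (simp add: V_nonneg K_space[OF assms])
  ultimately show ?thesis
    using drift[OF assms] by (intro integrableI_bounded) (auto simp: less_top[symmetric] top_unique)
qed

lemma V_integral: assumes "z \<in> space X" shows "(\<integral>u. V u \<partial>K z) \<le> l * V z + b"
proof -
  have "ennreal (\<integral>u. V u \<partial>K z) = (\<integral>\<^sup>+u. ennreal (V u) \<partial>K z)"
    using V_integrable[OF assms]
    by (intro nn_integral_eq_integral[symmetric]) (auto simp: V_nonneg K_space[OF assms])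
  with drift[OF assms] show ?thesis
    using V_nonneg[OF assms] l b by (metis add_nonneg_nonneg ennreal_le_iff mult_nonneg_nonneg)
qed

text \<open>Integrating the drift inequality against \<pi> says nothing while the integral of
  \<open>V\<close> may be infinite. Stationarity is therefore applied to \<open>V\<close> truncated
  at \<open>N\<close>, which bounds the integral of \<open>V\<close> over \<open>V \<le> N\<close>
  by \<open>b / (1 - l)\<close> uniformly in \<open>N\<close>; monotone convergence
  finishes.\<close>

lemma pi_V_integrable: "integrable \<pi> V"
proof -
  interpret P: prob_space \<pi> by (rule pi_prob)
  have Vpi[measurable]: "V \<in> borel_measurable \<pi>"
    using V measurable_cong_sets[OF pi_sets refl] by blast
  have Kpi: "K \<in> measurable \<pi> (subprob_algebra X)"
    using K measurable_cong_sets[OF pi_sets refl] measurable_prob_algebraD by blast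
  have bound: "(\<integral>u. V u * indicator {u\<in>space X. V u \<le> real N} u \<partial>\<pi>) \<le> b / (1 - l)" for N :: nat
  proof -
    let ?W = "\<lambda>u. min (V u) (real N)"
    have Wint: "integrable M ?W" if "prob_space M" "sets M = sets X" for M
    proof -
      interpret M: prob_space M by fact
      have [measurable]: "V \<in> borel_measurable M"
        using V measurable_cong_sets[OF that(2) refl] by blast
      show ?thesis
        using sets_eq_imp_space_eq[OF that(2)] V_nonneg
        by (intro M.integrable_const_bound[where B="real N"]) auto
    qed
    have KW: "(\<integral>u. ?W u \<partial>K z) \<le> min (l * V z + b) (real N)" if z: "z \<in> space X" for z
    proof -
      interpret Kz: prob_space "K z" by (rule K_prob[OF z])
      have "(\<integral>u. ?W u \<partial>K z) \<le> (\<integral>u. V u \<partial>K z)"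
        by (intro integral_mono Wint V_integrable K_prob K_sets z) auto
      moreover have "(\<integral>u. ?W u \<partial>K z) \<le> (\<integral>u. real N \<partial>K z)"
        by (intro integral_mono Wint K_prob K_sets z) auto
      ultimately show ?thesis using V_integral[OF z] by (simp add: Kz.prob_space)
    qed
    have "ennreal (\<integral>u. ?W u \<partial>\<pi>) = (\<integral>\<^sup>+u. ennreal (?W u) \<partial>\<pi>)"
      by (intro nn_integral_eq_integral[symmetric] Wint pi_prob pi_sets)
        (auto simp: pi_space V_nonneg)
    also have "\<dots> = (\<integral>\<^sup>+u. ennreal (?W u) \<partial>(\<pi> \<bind> K))" by (simp add: pi_bind)
    also have "\<dots> = (\<integral>\<^sup>+z. \<integral>\<^sup>+u. ennreal (?W u) \<partial>K z \<partial>\<pi>)"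
      by (rule nn_integral_bind[OF _ Kpi]) measurable
    also have "\<dots> = (\<integral>\<^sup>+z. ennreal (\<integral>u. ?W u \<partial>K z) \<partial>\<pi>)"
      by (intro nn_integral_cong nn_integral_eq_integral Wint K_prob K_sets)
        (auto simp: pi_space V_nonneg K_space)
    also have "\<dots> \<le> (\<integral>\<^sup>+z. ennreal (min (l * V z + b) (real N)) \<partial>\<pi>)"
      by (intro nn_integral_mono ennreal_leI KW) (simp add: pi_space)
    also have "\<dots> = ennreal (\<integral>z. min (l * V z + b) (real N) \<partial>\<pi>)"
      using V_nonneg l b
      by (intro nn_integral_eq_integral P.integrable_const_bound[where B="real N"])
        (auto simp: pi_space)
    finally have *: "(\<integral>u. ?W u \<partial>\<pi>) \<le> (\<integral>z. min (l * V z + b) (real N) \<partial>\<pi>)"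
      using V_nonneg l b
      by (subst (asm) ennreal_le_iff) (auto intro!: integral_nonneg_AE simp: pi_space)
    have Iint: "integrable \<pi> (\<lambda>u. V u * indicator {u\<in>space X. V u \<le> real N} u)"
      using V_nonneg
      by (intro P.integrable_const_bound[where B="real N"]) (auto simp: pi_space[symmetric] split: split_indicator)
    have Mint: "integrable \<pi> (\<lambda>z. min (l * V z + b) (real N))"
      using V_nonneg l b
      by (intro P.integrable_const_bound[where B="real N"]) (auto simp: pi_space)
    \<comment> \<open>Pointwise: where \<open>V u \<le> N\<close> the difference of the minima is at
      least \<open>V u - (l * V u + b)\<close>, and where \<open>V u > N\<close> it is
      nonnegative.\<close>
    have "(\<integral>u. (1 - l) * (V u * indicator {u\<in>space X. V u \<le> real N} u) - b \<partial>\<pi>)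
        \<le> (\<integral>u. ?W u - min (l * V u + b) (real N) \<partial>\<pi>)"
      using l b Iint Mint Wint[OF pi_prob pi_sets]
      by (intro integral_mono) (auto simp: pi_space min_def algebra_simps split: split_indicator)
    also have "\<dots> \<le> 0"
      using * Mint Wint[OF pi_prob pi_sets] by simp
    finally have "(1 - l) * (\<integral>u. V u * indicator {u\<in>space X. V u \<le> real N} u \<partial>\<pi>) \<le> b"
      using Iint by (simp add: P.prob_space)
    then show ?thesis using l by (simp add: field_simps)
  qed
  have "(\<integral>\<^sup>+u. ennreal (V u) \<partial>\<pi>) \<le> ennreal (b / (1 - l))"
  proof (rule order_trans)
    have "(\<integral>\<^sup>+u. ennreal (V u) \<partial>\<pi>)
        = (\<integral>\<^sup>+u. (SUP N. ennreal (V u * indicator {u\<in>space X. V u \<le> real N} u)) \<partial>\<pi>)"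
    proof (intro nn_integral_cong antisym)
      fix u assume u: "u \<in> space \<pi>"
      obtain N where "V u \<le> real N" using real_arch_simple by blast
      then have "ennreal (V u) = ennreal (V u * indicator {u\<in>space X. V u \<le> real N} u)"
        using u by (simp add: pi_space)
      then show "ennreal (V u) \<le> (SUP N. ennreal (V u * indicator {u\<in>space X. V u \<le> real N} u))"
        by (metis (lifting) UNIV_I SUP_upper)
      show "(SUP N. ennreal (V u * indicator {u\<in>space X. V u \<le> real N} u)) \<le> ennreal (V u)"
        using V_nonneg u by (intro SUP_least ennreal_leI) (auto simp: pi_space split: split_indicator)
    qed
    also have "\<dots> = (SUP N. \<integral>\<^sup>+u. ennreal (V u * indicator {u\<in>space X. V u \<le> real N} u) \<partial>\<pi>)"
    proof (intro nn_integral_monotone_convergence_SUP_AE AE_I2 ennreal_leI)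
      fix i and u assume "u \<in> space \<pi>"
      then show "V u * indicator {u\<in>space X. V u \<le> real i} u \<le> V u * indicator {u\<in>space X. V u \<le> real (Suc i)} u"
        using V_nonneg by (auto simp: pi_space split: split_indicator)
    qed (auto simp: pi_space[symmetric])
    finally show "(\<integral>\<^sup>+u. ennreal (V u) \<partial>\<pi>) \<le> (SUP N. ennreal (\<integral>u. V u * indicator {u\<in>space X. V u \<le> real N} u \<partial>\<pi>))"
      using V_nonneg
      by (subst nn_integral_eq_integral[symmetric])
        (auto intro!: P.integrable_const_bound[where B="real _"] simp: pi_space[symmetric] split: split_indicator)
  qed (intro SUP_least ennreal_leI bound)
  moreover have "(\<integral>\<^sup>+u. ennreal (norm (V u)) \<partial>\<pi>) = (\<integral>\<^sup>+u. ennreal (V u) \<partial>\<pi>)"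
    by (intro nn_integral_cong) (simp add: V_nonneg pi_space)
  ultimately show ?thesis
    by (intro integrableI_bounded) (auto simp: less_top[symmetric] top_unique)
qed

lemma bounded_integrable:
  assumes "prob_space M" "sets M = sets X" "\<phi> \<in> borel_measurable X" "\<And>z. z \<in> space X \<Longrightarrow> \<phi> z \<in> {0..1::real}"
  shows "integrable M \<phi>"
proof -
  interpret M: prob_space M by fact
  have "\<phi> \<in> borel_measurable M"
    using assms(3) measurable_cong_sets[OF assms(2) refl] by blast
  then show ?thesis
    using assms(4) sets_eq_imp_space_eq[OF assms(2)]
    by (intro M.integrable_const_bound[where B=1]) auto
qed

text \<open>The contraction of Hairer and Mattingly: one step of the kernel shrinks the oscillation of a
  function relative to the weight \<open>1 + \<beta> V\<close> by a fixed factor. Pairs of points with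
  large \<open>V\<close> use the drift, pairs with small \<open>V\<close> the minorization.\<close>

lemma contraction:
  obtains \<alpha> \<beta> where "0 < \<alpha>" "\<alpha> < 1" "0 < \<beta>"
    "\<And>\<phi> C c. \<phi> \<in> borel_measurable X \<Longrightarrow> (\<And>z. z \<in> space X \<Longrightarrow> \<phi> z \<in> {0..1}) \<Longrightarrow> 0 \<le> C \<Longrightarrow>
       (\<And>z. z \<in> space X \<Longrightarrow> \<bar>\<phi> z - c\<bar> \<le> C * (1 + \<beta> * V z)) \<Longrightarrow>
       \<exists>c'. \<forall>z\<in>space X. \<bar>(\<integral>u. \<phi> u \<partial>K z) - c'\<bar> \<le> \<alpha> * C * (1 + \<beta> * V z)"
proof -
  \<comment> \<open>The level makes \<open>(1 - l) / 2 * R = 2 * (b + 1)\<close>. Beyond it the gap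
    between \<alpha> and the drift rate covers both the constant \<open>b\<close> at each of the two
    points and the loss \<open>2 * (1 - \<alpha>) \<le> 2 * \<beta>\<close> in the constant
    term.\<close>
  define R where "R = 4 * (b + 1) / (1 - l)"
  obtain \<nu> where \<nu>: "finite_measure \<nu>" "sets \<nu> = sets X" "emeasure \<nu> (space X) > 0"
    and min: "\<And>z A. z \<in> space X \<Longrightarrow> V z \<le> R \<Longrightarrow> A \<in> sets X \<Longrightarrow> emeasure \<nu> A \<le> emeasure (K z) A"
    using minorization[of R] by auto
  interpret N: finite_measure \<nu> by fact
  have N_space: "space \<nu> = space X" by (rule sets_eq_imp_space_eq) fact
  define e where "e = Min {1, measure \<nu> (space X)}"
  have e: "0 < e" "e \<le> 1" "e \<le> measure \<nu> (space X)"
    using \<nu>(3) by (auto simp: e_def N.emeasure_eq_measure)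
  \<comment> \<open>Small enough that the drift constant \<open>2 * \<beta> * b\<close> uses up at
    most \<open>e\<close>, half of the gain \<open>2 * e\<close> from the minorization.\<close>
  define \<beta> where "\<beta> = e / (2 * (b + 1))"
  have \<beta>: "0 < \<beta>" "2 * \<beta> * b \<le> e" using e b by (auto simp: \<beta>_def field_simps)
  \<comment> \<open>\<open>1 - e / 2\<close> absorbs what remains of the minorization gain,
    \<open>(1 + l) / 2\<close> keeps a gap of \<open>(1 - l) / 2\<close> above the drift rate, and
    \<open>1 - \<beta>\<close> limits the loss in the constant term for large pairs.\<close>
  define \<alpha> where "\<alpha> = max (1 - e / 2) (max ((1 + l) / 2) (1 - \<beta>))"
  have \<alpha>: "1 - e / 2 \<le> \<alpha>" "(1 + l) / 2 \<le> \<alpha>" "1 - \<beta> \<le> \<alpha>" "\<alpha> < 1"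
    using e \<beta> l by (simp_all add: \<alpha>_def le_max_iff_disj)
  have "0 < \<alpha>" using \<alpha>(2) l(1) by simp
  have *: "\<exists>c'. \<forall>z\<in>space X. \<bar>(\<integral>u. \<phi> u \<partial>K z) - c'\<bar> \<le> \<alpha> * C * (1 + \<beta> * V z)"
    if [measurable]: "\<phi> \<in> borel_measurable X" and \<phi>: "\<And>z. z \<in> space X \<Longrightarrow> \<phi> z \<in> {0..1}" and C: "0 \<le> C"
      and osc: "\<And>z. z \<in> space X \<Longrightarrow> \<bar>\<phi> z - c\<bar> \<le> C * (1 + \<beta> * V z)" for \<phi> C c
  proof (rule exists_common_center)
    fix x y assume x: "x \<in> space X" and y: "y \<in> space X"
    define P where "P z = (\<integral>u. \<phi> u \<partial>K z)" for z
    \<comment> \<open>Nonnegative for both signs by the oscillation bound. In the integral of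
      \<open>g (-1)\<close> at \<open>x\<close> plus that of \<open>g 1\<close> at \<open>y\<close>
      the constant \<open>c\<close> cancels and \<open>P x - P y\<close> occurs with a minus sign,
      so a lower bound on the sum bounds \<open>P x - P y\<close> from above.\<close>
    define g where "g s u = C * (1 + \<beta> * V u) + s * (\<phi> u - c)" for s u
    have g_nonneg: "0 \<le> g s u" if "s \<in> {1, -1}" "u \<in> space X" for s u
      using osc[OF that(2)] that(1) by (auto simp: g_def abs_le_iff)
    have [measurable]: "g s \<in> borel_measurable X" for s
      by (simp add: g_def[abs_def])
    have phi_int: "integrable (K z) \<phi>" if "z \<in> space X" for z
      by (intro bounded_integrable K_prob K_sets that \<phi>) measurable
    have g_int: "integrable (K z) (g s)" if z: "z \<in> space X" for z s
    proof -
      interpret Kz: prob_space "K z" by (rule K_prob[OF that])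
      show ?thesis unfolding g_def
        using V_integrable[OF that] phi_int[OF that]
        by (intro Bochner_Integration.integrable_add integrable_mult_right Bochner_Integration.integrable_diff) auto
    qed
    have g_K: "(\<integral>u. g s u \<partial>K z) = C * (1 + \<beta> * (\<integral>u. V u \<partial>K z)) + s * (P z - c)" if "z \<in> space X" for z s
    proof -
      interpret Kz: prob_space "K z" by (rule K_prob[OF that])
      show ?thesis unfolding g_def P_def
        using V_integrable[OF that] phi_int[OF that]
        by (simp add: Kz.prob_space algebra_simps)
    qed
    have "P x - P y \<le> \<alpha> * C * (2 + \<beta> * (V x + V y))"
    proof (cases "V x + V y \<ge> R")
      case True
      have "(\<integral>u. g (-1) u \<partial>K x) \<ge> 0"
        by (intro integral_nonneg_AE AE_I2 g_nonneg) (simp_all add: K_space x)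
      moreover have "(\<integral>u. g 1 u \<partial>K y) \<ge> 0"
        by (intro integral_nonneg_AE AE_I2 g_nonneg) (simp_all add: K_space y)
      ultimately have "P x - P y \<le> C * (2 + \<beta> * ((\<integral>u. V u \<partial>K x) + (\<integral>u. V u \<partial>K y)))"
        by (simp add: g_K x y algebra_simps)
      also have "\<dots> \<le> C * (2 + \<beta> * ((l * V x + b) + (l * V y + b)))"
        using V_integral[OF x] V_integral[OF y] C \<beta> by (intro mult_left_mono add_left_mono add_mono) auto
      also have "\<dots> \<le> C * (\<alpha> * (2 + \<beta> * (V x + V y)))"
      proof (intro mult_left_mono C)
        have "2 * (b + 1) = (1 - l) / 2 * R" using l by (simp add: R_def field_simps)
        also have "\<dots> \<le> (\<alpha> - l) * (V x + V y)"
          using \<alpha> l True b by (intro mult_mono) (auto simp: R_def)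
        finally have "\<beta> * (2 * (b + 1)) \<le> \<beta> * ((\<alpha> - l) * (V x + V y))"
          using \<beta> by (intro mult_left_mono) auto
        then show "2 + \<beta> * ((l * V x + b) + (l * V y + b)) \<le> \<alpha> * (2 + \<beta> * (V x + V y))"
          using \<alpha> by (simp add: algebra_simps)
      qed
      finally show ?thesis by (simp add: algebra_simps)
    next
      case False
      then have R: "V x \<le> R" "V y \<le> R" using V_nonneg[OF x] V_nonneg[OF y] by auto
      \<comment> \<open>Both kernels dominate the same \<nu>, and
        \<open>g (-1) u + g 1 u \<ge> 2 * C\<close> pointwise; so the sum of the two integrals is at
        least \<open>2 * C\<close> times the mass of \<nu> instead of merely nonnegative.\<close>
      have low: "(\<integral>\<^sup>+u. ennreal (g s u) \<partial>\<nu>) \<le> ennreal (\<integral>u. g s u \<partial>K z)"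
        if z: "z \<in> space X" "V z \<le> R" and s: "s \<in> {1, -1}" for z s
      proof -
        have "(\<integral>\<^sup>+u. ennreal (g s u) \<partial>\<nu>) \<le> (\<integral>\<^sup>+u. ennreal (g s u) \<partial>K z)"
          using z min K_sets[OF z(1)] \<nu>(2) by (intro nn_integral_mono_measure) (auto simp: le_measure)
        also have "\<dots> = ennreal (\<integral>u. g s u \<partial>K z)"
          using g_nonneg[OF s] z by (intro nn_integral_eq_integral g_int) (auto simp: K_space)
        finally show ?thesis .
      qed
      have "ennreal (C * 2 * measure \<nu> (space X)) = (\<integral>\<^sup>+u. ennreal (C * 2) \<partial>\<nu>)"
        using C by (simp add: N_space N.emeasure_eq_measure ennreal_mult)
      also have "\<dots> \<le> (\<integral>\<^sup>+u. ennreal (g (-1) u) + ennreal (g 1 u) \<partial>\<nu>)"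
      proof (intro nn_integral_mono)
        fix u assume "u \<in> space \<nu>"
        then have u: "u \<in> space X" by (simp add: N_space)
        have "C * 2 \<le> g (-1) u + g 1 u"
          using C \<beta> V_nonneg[OF u] by (simp add: g_def algebra_simps)
        then show "ennreal (C * 2) \<le> ennreal (g (-1) u) + ennreal (g 1 u)"
          using g_nonneg[OF _ u] by (simp add: ennreal_plus[symmetric] ennreal_leI del: ennreal_plus)
      qed
      also have "\<dots> = (\<integral>\<^sup>+u. ennreal (g (-1) u) \<partial>\<nu>) + (\<integral>\<^sup>+u. ennreal (g 1 u) \<partial>\<nu>)"
        by (intro nn_integral_add) (simp_all add: measurable_cong_sets[OF \<nu>(2) refl])
      also have "\<dots> \<le> ennreal (\<integral>u. g (-1) u \<partial>K x) + ennreal (\<integral>u. g 1 u \<partial>K y)"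
        by (intro add_mono low x y R) auto
      also have "\<dots> = ennreal ((\<integral>u. g (-1) u \<partial>K x) + (\<integral>u. g 1 u \<partial>K y))"
        by (intro ennreal_plus[symmetric] integral_nonneg_AE AE_I2 g_nonneg) (simp_all add: K_space x y)
      finally have "C * 2 * measure \<nu> (space X) \<le> (\<integral>u. g (-1) u \<partial>K x) + (\<integral>u. g 1 u \<partial>K y)"
        by (subst (asm) ennreal_le_iff) (auto intro!: add_nonneg_nonneg integral_nonneg_AE AE_I2 g_nonneg simp: K_space x y)
      then have "P x - P y \<le> C * (2 + \<beta> * ((\<integral>u. V u \<partial>K x) + (\<integral>u. V u \<partial>K y))) - C * 2 * measure \<nu> (space X)"
        by (simp add: g_K x y algebra_simps)
      also have "\<dots> \<le> C * (2 + \<beta> * ((l * V x + b) + (l * V y + b))) - C * 2 * e"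
        using V_integral[OF x] V_integral[OF y] C \<beta> e
        by (intro diff_mono mult_left_mono add_left_mono add_mono) auto
      also have "\<dots> = C * (2 - 2 * e + 2 * \<beta> * b + l * (\<beta> * (V x + V y)))"
        by (simp add: algebra_simps)
      also have "\<dots> \<le> C * (\<alpha> * (2 + \<beta> * (V x + V y)))"
      proof (intro mult_left_mono C)
        have "l * (\<beta> * (V x + V y)) \<le> \<alpha> * (\<beta> * (V x + V y))"
          using \<alpha> l \<beta> V_nonneg[OF x] V_nonneg[OF y] by (intro mult_right_mono) auto
        then show "2 - 2 * e + 2 * \<beta> * b + l * (\<beta> * (V x + V y)) \<le> \<alpha> * (2 + \<beta> * (V x + V y))"
          using \<alpha> \<beta> by (simp add: distrib_left)
      qed
      finally show ?thesis by (simp add: algebra_simps)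
    qed
    then show "(\<integral>u. \<phi> u \<partial>K x) - (\<integral>u. \<phi> u \<partial>K y) \<le> \<alpha> * C * (1 + \<beta> * V x) + \<alpha> * C * (1 + \<beta> * V y)"
      by (simp add: P_def algebra_simps)
  qed
  show thesis by (rule that[OF \<open>0 < \<alpha>\<close> \<alpha>(4) \<beta>(1) *])
qed

lemma kernel_pow_measurable: "kernel_pow X K t \<in> measurable X (prob_algebra X)"
proof (induction t)
  case 0
  then show ?case by (simp add: measurable_return_prob_space[unfolded return_def] cong: measurable_cong)
next
  case (Suc t)
  note Suc[measurable]
  show ?case by simp
qed

lemma geometric_convergence:
  "\<exists>\<rho> M. 0 \<le> \<rho> \<and> \<rho> < 1 \<and> (\<forall>z\<in>space X. 0 \<le> M z \<and> (\<forall>t. tv_dist (kernel_pow X K t z) \<pi> \<le> M z * \<rho> ^ t))"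
proof -
  obtain \<alpha> \<beta> where \<alpha>: "0 < \<alpha>" "\<alpha> < 1" and \<beta>: "0 < \<beta>" and contr:
    "\<And>\<phi> C c. \<phi> \<in> borel_measurable X \<Longrightarrow> (\<And>z. z \<in> space X \<Longrightarrow> \<phi> z \<in> {0..1}) \<Longrightarrow> 0 \<le> C \<Longrightarrow>
       (\<And>z. z \<in> space X \<Longrightarrow> \<bar>\<phi> z - c\<bar> \<le> C * (1 + \<beta> * V z)) \<Longrightarrow>
       \<exists>c'. \<forall>z\<in>space X. \<bar>(\<integral>u. \<phi> u \<partial>K z) - c'\<bar> \<le> \<alpha> * C * (1 + \<beta> * V z)"
    using contraction by blast
  interpret P: prob_space \<pi> by (rule pi_prob)
  have Kpi: "K \<in> measurable \<pi> (subprob_algebra X)"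
    using K measurable_cong_sets[OF pi_sets refl] measurable_prob_algebraD by blast
  define v where "v = (\<integral>u. V u \<partial>\<pi>)"
  have v: "0 \<le> v" unfolding v_def by (intro integral_nonneg_AE AE_I2) (simp add: V_nonneg pi_space)
  \<comment> \<open>One centre \<open>c'\<close> has to serve the iterates and \<pi> at once, since
    the total variation bound compares the two through it. The test function is generalized because
    the induction applies \<open>K\<close> to it first.\<close>
  have iter: "\<exists>c'. (\<forall>z\<in>space X. \<bar>(\<integral>u. \<phi> u \<partial>kernel_pow X K t z) - c'\<bar> \<le> \<alpha> ^ t * C * (1 + \<beta> * V z)) \<and>
      \<bar>(\<integral>u. \<phi> u \<partial>\<pi>) - c'\<bar> \<le> \<alpha> ^ t * C * (1 + \<beta> * v)"
    if "\<phi> \<in> borel_measurable X" "\<And>z. z \<in> space X \<Longrightarrow> \<phi> z \<in> {0..1}" "0 \<le> C"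
       "\<And>z. z \<in> space X \<Longrightarrow> \<bar>\<phi> z - c\<bar> \<le> C * (1 + \<beta> * V z)" for \<phi> C c t
    using that
  proof (induction t arbitrary: \<phi> C c)
    case 0
    note int = bounded_integrable[OF pi_prob pi_sets 0(1,2)]
    have "\<bar>(\<integral>u. \<phi> u \<partial>\<pi>) - c\<bar> = \<bar>\<integral>u. \<phi> u - c \<partial>\<pi>\<bar>"
      using int by (simp add: P.prob_space)
    also have "\<dots> \<le> (\<integral>u. \<bar>\<phi> u - c\<bar> \<partial>\<pi>)" by (rule integral_abs_bound)
    also have "\<dots> \<le> (\<integral>u. C * (1 + \<beta> * V u) \<partial>\<pi>)"
      using int pi_V_integrable 0 by (intro integral_mono) (auto simp: pi_space)
    also have "\<dots> = C * (1 + \<beta> * v)"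
      using pi_V_integrable by (simp add: v_def P.prob_space)
    finally show ?case using 0 by (intro exI[of _ c]) (simp add: integral_return)
  next
    case (Suc t)
    define \<psi> where "\<psi> z = (\<integral>u. \<phi> u \<partial>K z)" for z
    have \<psi>m: "\<psi> \<in> borel_measurable X"
      unfolding \<psi>_def using Suc.prems(1) measurable_prob_algebraD[OF K]
      by (intro measurable_compose[OF _ integral_measurable_subprob_algebra]) auto
    have \<psi>b: "\<psi> z \<in> {0..1}" if z: "z \<in> space X" for z
    proof -
      interpret Kz: prob_space "K z" by (rule K_prob[OF z])
      have "\<psi> z \<le> (\<integral>u. 1 \<partial>K z)" unfolding \<psi>_def using Suc.prems(2)
        by (intro integral_mono bounded_integrable[OF K_prob K_sets Suc.prems(1,2)] z) (auto simp: K_space z)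
      also have "\<dots> = 1" using Kz.prob_space by simp
      finally show ?thesis using Suc.prems(2)
        by (auto simp: \<psi>_def K_space z intro!: integral_nonneg_AE)
    qed
    obtain c' where c': "\<And>z. z \<in> space X \<Longrightarrow> \<bar>\<psi> z - c'\<bar> \<le> \<alpha> * C * (1 + \<beta> * V z)"
      using contr[OF Suc.prems] unfolding \<psi>_def by blast
    have bind: "(\<integral>u. \<phi> u \<partial>(M \<bind> K)) = (\<integral>z. \<psi> z \<partial>M)" if M: "prob_space M" "sets M = sets X" for M
    proof -
      interpret M: prob_space M by fact
      have KM: "K \<in> measurable M (subprob_algebra X)"
        using K measurable_cong_sets[OF M(2) refl] measurable_prob_algebraD by blast
      show ?thesis unfolding \<psi>_def
        using Suc.prems(1,2) KM M.not_empty M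
        by (intro integral_bind[where B=1 and B'=1 and K=X])
          (auto simp: sets_eq_imp_space_eq[OF M(2)] K_prob prob_space.emeasure_space_1 space_subprob_algebra)
    qed
    have pow: "prob_space (kernel_pow X K t z)" "sets (kernel_pow X K t z) = sets X" if "z \<in> space X" for z
      using measurable_space[OF kernel_pow_measurable that] by (auto simp: space_prob_algebra)
    obtain c'' where "(\<forall>z\<in>space X. \<bar>(\<integral>u. \<psi> u \<partial>kernel_pow X K t z) - c''\<bar> \<le> \<alpha> ^ t * (\<alpha> * C) * (1 + \<beta> * V z)) \<and>
      \<bar>(\<integral>u. \<psi> u \<partial>\<pi>) - c''\<bar> \<le> \<alpha> ^ t * (\<alpha> * C) * (1 + \<beta> * v)"
      using Suc.IH[OF \<psi>m \<psi>b _ c'] \<alpha> Suc.prems(3) by auto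
    then show ?case
      using bind[OF pi_prob pi_sets] bind[OF pow] by (intro exI[of _ c'']) (simp add: pi_bind mult_ac)
  qed
  have tv: "tv_dist (kernel_pow X K t z) \<pi> \<le> (2 + \<beta> * V z + \<beta> * v) * \<alpha> ^ t" if z: "z \<in> space X" for t z
  proof -
    have pow: "prob_space (kernel_pow X K t z)" "sets (kernel_pow X K t z) = sets X"
      using measurable_space[OF kernel_pow_measurable z] by (auto simp: space_prob_algebra)
    interpret Q: prob_space "kernel_pow X K t z" by (rule pow)
    have "\<bar>measure (kernel_pow X K t z) A - measure \<pi> A\<bar> \<le> (2 + \<beta> * V z + \<beta> * v) * \<alpha> ^ t"
      if A: "A \<in> sets X" for A
    proof -
      have "\<exists>c'. (\<forall>z\<in>space X. \<bar>(\<integral>u. indicator A u \<partial>kernel_pow X K t z) - c'\<bar> \<le> \<alpha> ^ t * 1 * (1 + \<beta> * V z)) \<and>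
        \<bar>(\<integral>u. indicator A u \<partial>\<pi>) - c'\<bar> \<le> \<alpha> ^ t * 1 * (1 + \<beta> * v)"
        using A \<beta> V_nonneg by (intro iter[of _ 1 0]) (auto split: split_indicator)
      then show ?thesis using z A pow pi_sets by (auto simp: algebra_simps)
    qed
    then show ?thesis unfolding tv_dist_def by (intro cSUP_least) (auto simp: pow)
  qed
  show ?thesis
    using \<alpha> \<beta> v V_nonneg tv
    by (intro exI[of _ \<alpha>] exI[of _ "\<lambda>z. 2 + \<beta> * V z + \<beta> * v"]) auto
qed

end

lemma tv_dist_nonneg:
  assumes "prob_space M" "prob_space N" shows "0 \<le> tv_dist M N"
proof -
  interpret M: prob_space M by fact
  interpret N: prob_space N by fact
  have "bdd_above ((\<lambda>A. \<bar>measure M A - measure N A\<bar>) ` sets M)"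
    using M.prob_le_1 N.prob_le_1 measure_nonneg[of M] measure_nonneg[of N]
    by (intro bdd_aboveI2[where M=1]) (smt (verit))
  from cSUP_upper[OF _ this, of "{}"] show ?thesis by (simp add: tv_dist_def)
qed

lemma (in drift_minorization) geometrically_ergodic:
  assumes "phi_irreducible X K" "aperiodic X K \<pi>"
  shows "geometrically_ergodic X K \<pi>"
proof -
  obtain \<rho> M where \<rho>: "0 \<le> \<rho>" "\<rho> < 1"
    and M: "\<And>z. z \<in> space X \<Longrightarrow> 0 \<le> M z" "\<And>z t. z \<in> space X \<Longrightarrow> tv_dist (kernel_pow X K t z) \<pi> \<le> M z * \<rho> ^ t"
    using geometric_convergence by blast
  have "(\<lambda>t. tv_dist (kernel_pow X K t z) \<pi>) \<longlonglongrightarrow> 0" if z: "z \<in> space X" for z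
  proof (rule tendsto_sandwich)
    show "\<forall>\<^sub>F t in sequentially. 0 \<le> tv_dist (kernel_pow X K t z) \<pi>"
      using measurable_space[OF kernel_pow_measurable z]
      by (intro always_eventually allI tv_dist_nonneg pi_prob) (simp add: space_prob_algebra)
    show "\<forall>\<^sub>F t in sequentially. tv_dist (kernel_pow X K t z) \<pi> \<le> M z * \<rho> ^ t"
      using M z by simp
    show "(\<lambda>t. M z * \<rho> ^ t) \<longlonglongrightarrow> 0"
      using LIMSEQ_realpow_zero[OF \<rho>] by (rule tendsto_mult_right_zero)
  qed auto
  with assms K stationary have "harris_ergodic X K \<pi>" by (simp add: harris_ergodic_def)
  with \<rho> M show ?thesis unfolding geometrically_ergodic_def by blast
qed

subsection \<open>Data augmentation kernels\<close>

lemma mult_divide_cancel_ennreal: "0 < c \<Longrightarrow> c < \<top> \<Longrightarrow> c * (u / c) = (u :: ennreal)"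
  by (metis ennreal_times_divide less_irrefl mult.commute mult_divide_eq_ennreal)

lemma sets_normalized_density [simp]: "sets (normalized_density M f) = sets M"
  and space_normalized_density [simp]: "space (normalized_density M f) = space M"
  by (simp_all add: normalized_density_def)

lemma emeasure_normalized_density:
  assumes [measurable]: "f \<in> borel_measurable M" "A \<in> sets M"
  shows "emeasure (normalized_density M f) A = (\<integral>\<^sup>+z. f z * indicator A z \<partial>M) / (\<integral>\<^sup>+z. f z \<partial>M)"
  unfolding normalized_density_def
  by (simp add: emeasure_density nn_integral_divide[symmetric] ennreal_times_divide ennreal_divide_times)

lemma nn_integral_normalized_density:
  assumes [measurable]: "f \<in> borel_measurable M" "g \<in> borel_measurable M"
  shows "(\<integral>\<^sup>+z. g z \<partial>normalized_density M f) = (\<integral>\<^sup>+z. f z * g z \<partial>M) / (\<integral>\<^sup>+z. f z \<partial>M)"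
  unfolding normalized_density_def
  by (simp add: nn_integral_density nn_integral_divide[symmetric] ennreal_times_divide ennreal_divide_times)

lemma prob_space_normalized_density:
  assumes [measurable]: "f \<in> borel_measurable M" and "0 < (\<integral>\<^sup>+z. f z \<partial>M)" "(\<integral>\<^sup>+z. f z \<partial>M) < \<infinity>"
  shows "prob_space (normalized_density M f)"
proof
  have "(\<integral>\<^sup>+z. f z * indicator (space M) z \<partial>M) = (\<integral>\<^sup>+z. f z \<partial>M)"
    by (intro nn_integral_cong) simp
  then show "emeasure (normalized_density M f) (space (normalized_density M f)) = 1"
    using assms(2,3) by (simp add: emeasure_normalized_density)
qed

text \<open>Conditional (a) omits the factors of the joint density that do not depend on the
  weights; this identifies it with the normalized joint density.\<close>

lemma normalized_density_scale:
  assumes [measurable]: "f \<in> borel_measurable M" and "\<And>z. z \<in> space M \<Longrightarrow> g z = c * f z" "0 < c" "c < \<infinity>"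
  shows "normalized_density M g = normalized_density M f"
proof -
  have "(\<integral>\<^sup>+z. g z \<partial>M) = c * (\<integral>\<^sup>+z. f z \<partial>M)"
    using assms(2) by (subst nn_integral_cmult[symmetric]) (auto intro!: nn_integral_cong)
  moreover have "(c * u) / (c * v) = u / v" for u v :: ennreal
  proof -
    have "c * inverse c = 1"
      using assms(3,4) by (simp flip: divide_ennreal_def)
    moreover have "inverse (c * v) = inverse c * inverse v"
      using assms(3,4) by (intro ennreal_inverse_mult') auto
    ultimately show ?thesis
      by (simp add: divide_ennreal_def) (metis mult.assoc mult.commute mult.right_neutral)
  qed
  ultimately have "g z / (\<integral>\<^sup>+z. g z \<partial>M) = f z / (\<integral>\<^sup>+z. f z \<partial>M)" if "z \<in> space M" for z
    using assms(2)[OF that] by simp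
  moreover have "g \<in> borel_measurable M"
    using assms(2) by (subst measurable_cong[of _ _ "\<lambda>z. c * f z"]) auto
  ultimately show ?thesis unfolding normalized_density_def by (intro density_cong AE_I2) auto
qed

lemma measurable_normalized_density:
  assumes "sigma_finite_measure M" and f[measurable]: "(\<lambda>(x, y). f x y) \<in> borel_measurable (N \<Otimes>\<^sub>M M)"
    and pos: "\<And>x. x \<in> space N \<Longrightarrow> 0 < (\<integral>\<^sup>+y. f x y \<partial>M)" and fin: "\<And>x. x \<in> space N \<Longrightarrow> (\<integral>\<^sup>+y. f x y \<partial>M) < \<infinity>"
  shows "(\<lambda>x. normalized_density M (f x)) \<in> measurable N (prob_algebra M)"
proof -
  interpret sigma_finite_measure M by fact
  have fx[measurable]: "f x \<in> borel_measurable M" if "x \<in> space N" for x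
    using measurable_Pair2[OF f that] by simp
  have prob: "prob_space (normalized_density M (f x))" if "x \<in> space N" for x
    by (intro prob_space_normalized_density fx pos fin that)
  show ?thesis
  proof (intro measurable_prob_algebraI measurable_subprob_algebra prob)
    fix A assume [measurable]: "A \<in> sets M"
    have "(\<lambda>x. (\<integral>\<^sup>+y. f x y * indicator A y \<partial>M) / (\<integral>\<^sup>+y. f x y \<partial>M)) \<in> borel_measurable N"
      by measurable
    then show "(\<lambda>x. emeasure (normalized_density M (f x)) A) \<in> borel_measurable N"
      by (rule measurable_cong[THEN iffD1, rotated]) (simp add: emeasure_normalized_density fx)
  qed (auto simp: prob prob_space_imp_subprob_space)
qed

lemma nn_integral_pos:
  assumes [measurable]: "f \<in> borel_measurable M" "A \<in> sets M" and "\<And>x. x \<in> A \<Longrightarrow> 0 < f x" "0 < emeasure M A"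
  shows "0 < (\<integral>\<^sup>+x. f x * indicator A x \<partial>M)"
proof (rule ccontr)
  assume "\<not> ?thesis"
  then have "AE x in M. f x * indicator A x = 0" by (simp add: nn_integral_0_iff_AE)
  then have "AE x in M. x \<notin> A" by (rule eventually_mono) (use assms(3) in \<open>force split: split_indicator_asm\<close>)
  then have "emeasure M A = 0" using AE_iff_measurable[OF \<open>A \<in> sets M\<close>, of "\<lambda>x. x \<notin> A"] sets.sets_into_space[OF \<open>A \<in> sets M\<close>] by auto
  with assms(4) show False by simp
qed

text \<open>A two-block chain read off from one joint density \<open>h\<close> that is positive
  everywhere. \<open>cond\<close> is a separate parameter, tied to \<open>h\<close> only on
  \<open>space X\<close>: the weight conditional of the model normalizes a different function, and
  the two normalizations are shown equal only at such points.\<close>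

locale data_augmentation =
  fixes X :: "'a measure" and Q :: "'b measure" and h :: "'a \<Rightarrow> 'b \<Rightarrow> ennreal"
    and cond :: "'a \<Rightarrow> 'b measure"
  assumes X: "sigma_finite_measure X" "0 < emeasure X (space X)"
    and Q: "sigma_finite_measure Q" "0 < emeasure Q (space Q)"
    and h[measurable]: "(\<lambda>(z, w). h z w) \<in> borel_measurable (X \<Otimes>\<^sub>M Q)"
    and h_pos: "\<And>z w. z \<in> space X \<Longrightarrow> w \<in> space Q \<Longrightarrow> 0 < h z w"
    and fin_Q: "\<And>z. z \<in> space X \<Longrightarrow> (\<integral>\<^sup>+w. h z w \<partial>Q) < \<infinity>"
    and fin_X: "\<And>w. w \<in> space Q \<Longrightarrow> (\<integral>\<^sup>+z. h z w \<partial>X) < \<infinity>"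
    and fin: "(\<integral>\<^sup>+z. \<integral>\<^sup>+w. h z w \<partial>Q \<partial>X) < \<infinity>"
    and cond: "\<And>z. z \<in> space X \<Longrightarrow> cond z = normalized_density Q (h z)"
begin

sublocale X: sigma_finite_measure X by (rule X)
sublocale Q: sigma_finite_measure Q by (rule Q)
sublocale XQ: pair_sigma_finite X Q ..

definition "update w = normalized_density X (\<lambda>z. h z w)"
definition "step z = cond z \<bind> update"
definition "target = normalized_density X (\<lambda>z. \<integral>\<^sup>+w. h z w \<partial>Q)"

lemma h1[measurable]: "z \<in> space X \<Longrightarrow> h z \<in> borel_measurable Q"
  using measurable_Pair2[OF h] by simp

lemma h2[measurable]: "w \<in> space Q \<Longrightarrow> (\<lambda>z. h z w) \<in> borel_measurable X"
  using measurable_Pair1[OF h] by simp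

lemma hswap[measurable]: "(\<lambda>(w, z). h z w) \<in> borel_measurable (Q \<Otimes>\<^sub>M X)"
  using measurable_pair_swap[OF h] by simp

lemma pos_Q: assumes "z \<in> space X" shows "0 < (\<integral>\<^sup>+w. h z w \<partial>Q)"
proof -
  have "0 < (\<integral>\<^sup>+w. h z w * indicator (space Q) w \<partial>Q)"
    using assms h_pos Q by (intro nn_integral_pos) auto
  also have "\<dots> = (\<integral>\<^sup>+w. h z w \<partial>Q)" by (intro nn_integral_cong) simp
  finally show ?thesis .
qed

lemma pos_X: assumes "w \<in> space Q" shows "0 < (\<integral>\<^sup>+z. h z w \<partial>X)"
proof -
  have "0 < (\<integral>\<^sup>+z. h z w * indicator (space X) z \<partial>X)"
    using assms h_pos X by (intro nn_integral_pos) auto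
  also have "\<dots> = (\<integral>\<^sup>+z. h z w \<partial>X)" by (intro nn_integral_cong) simp
  finally show ?thesis .
qed

lemma pos: "0 < (\<integral>\<^sup>+z. \<integral>\<^sup>+w. h z w \<partial>Q \<partial>X)"
proof -
  have "0 < (\<integral>\<^sup>+z. (\<integral>\<^sup>+w. h z w \<partial>Q) * indicator (space X) z \<partial>X)"
    using pos_Q X by (intro nn_integral_pos) auto
  also have "\<dots> = (\<integral>\<^sup>+z. \<integral>\<^sup>+w. h z w \<partial>Q \<partial>X)" by (intro nn_integral_cong) simp
  finally show ?thesis .
qed

lemma update_measurable: "update \<in> measurable Q (prob_algebra X)"
  unfolding update_def[abs_def] by (intro measurable_normalized_density X hswap pos_X fin_X)

lemma update_subprob: "update \<in> measurable Q (subprob_algebra X)"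
  by (rule measurable_prob_algebraD[OF update_measurable])

lemma cond_measurable: "cond \<in> measurable X (prob_algebra Q)"
  by (subst measurable_cong[OF cond]) (auto intro!: measurable_normalized_density Q h pos_Q fin_Q)

lemma kernel_measurable: "step \<in> measurable X (prob_algebra X)"
proof -
  note cond_measurable[measurable] update_measurable[measurable]
  show ?thesis unfolding step_def[abs_def] by measurable
qed

lemma emeasure_update:
  assumes "w \<in> space Q" "A \<in> sets X"
  shows "emeasure (update w) A = (\<integral>\<^sup>+z. h z w * indicator A z \<partial>X) / (\<integral>\<^sup>+z. h z w \<partial>X)"
  unfolding update_def using assms by (intro emeasure_normalized_density) auto

lemma nn_integral_kernel:
  assumes z: "z \<in> space X" and f[measurable]: "f \<in> borel_measurable X"
  shows "(\<integral>\<^sup>+u. f u \<partial>step z) = (\<integral>\<^sup>+w. h z w * (\<integral>\<^sup>+u. f u \<partial>update w) \<partial>Q) / (\<integral>\<^sup>+w. h z w \<partial>Q)"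
proof -
  have m: "(\<lambda>w. \<integral>\<^sup>+u. f u \<partial>update w) \<in> borel_measurable Q"
    by (rule measurable_compose[OF update_subprob nn_integral_measurable_subprob_algebra[OF f]])
  have "update \<in> measurable (normalized_density Q (h z)) (subprob_algebra X)"
    using update_subprob by (subst measurable_cong_sets[OF sets_normalized_density refl])
  then show ?thesis unfolding step_def
    using z by (simp add: cond nn_integral_bind[OF f] nn_integral_normalized_density m)
qed

lemma sets_kernel: "z \<in> space X \<Longrightarrow> sets (step z) = sets X"
  and prob_kernel: "z \<in> space X \<Longrightarrow> prob_space (step z)"
  using measurable_space[OF kernel_measurable] by (auto simp: space_prob_algebra)

lemma emeasure_update_measurable:
  assumes "A \<in> sets X" shows "(\<lambda>w. emeasure (update w) A) \<in> borel_measurable Q"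
  using update_subprob assms by (rule measurable_emeasure_kernel)

lemma emeasure_kernel:
  assumes z: "z \<in> space X" and A: "A \<in> sets X"
  shows "emeasure (step z) A = (\<integral>\<^sup>+w. h z w * emeasure (update w) A \<partial>Q) / (\<integral>\<^sup>+w. h z w \<partial>Q)"
proof -
  have "emeasure (step z) A = (\<integral>\<^sup>+u. indicator A u \<partial>step z)"
    using A by (simp add: sets_kernel z)
  also have "\<dots> = (\<integral>\<^sup>+w. h z w * (\<integral>\<^sup>+u. indicator A u \<partial>update w) \<partial>Q) / (\<integral>\<^sup>+w. h z w \<partial>Q)"
    using A by (intro nn_integral_kernel z) auto
  finally show ?thesis using A by (simp add: update_def)
qed

lemma target_prob: "prob_space target"
  unfolding target_def by (intro prob_space_normalized_density pos fin) measurable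

lemma sets_target: "sets target = sets X"
  by (simp add: target_def)

lemma emeasure_target:
  "A \<in> sets X \<Longrightarrow> emeasure target A = (\<integral>\<^sup>+z. (\<integral>\<^sup>+w. h z w \<partial>Q) * indicator A z \<partial>X) / (\<integral>\<^sup>+z. \<integral>\<^sup>+w. h z w \<partial>Q \<partial>X)"
  unfolding target_def by (intro emeasure_normalized_density) auto

text \<open>Drawing from \<open>cond\<close> at a point distributed as \<open>target\<close>
  recreates the normalized joint law. Its marginal on \<open>Q\<close> is proportional to the
  normalizer of \<open>update\<close>, which therefore cancels once the integrals are
  exchanged.\<close>

lemma stationary_target: "stationary X step target"
proof -
  let ?T = "\<integral>\<^sup>+z. \<integral>\<^sup>+w. h z w \<partial>Q \<partial>X"
  have km: "step \<in> measurable target (subprob_algebra X)"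
    using measurable_prob_algebraD[OF kernel_measurable] measurable_cong_sets[OF sets_target refl] by blast
  have "target \<bind> step = target"
  proof (rule measure_eqI)
    have ne: "space target \<noteq> {}" using prob_space.not_empty[OF target_prob] .
    show "sets (target \<bind> step) = sets target"
      using ne sets_bind[OF _ ne, of step X] sets_kernel sets_eq_imp_space_eq[OF sets_target] by (simp add: sets_target)
    fix A assume "A \<in> sets (target \<bind> step)"
    then have A[measurable]: "A \<in> sets X"
      using ne sets_bind[OF _ ne, of step X] sets_kernel sets_eq_imp_space_eq[OF sets_target] by simp
    note emeasure_update_measurable[OF A, measurable]
    have "emeasure (target \<bind> step) A = (\<integral>\<^sup>+z. emeasure (step z) A \<partial>target)"
      by (rule emeasure_bind[OF ne km A])
    also have "\<dots> = (\<integral>\<^sup>+z. (\<integral>\<^sup>+w. h z w \<partial>Q) * emeasure (step z) A \<partial>X) / ?T"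
      unfolding target_def
      by (intro nn_integral_normalized_density measurable_emeasure_kernel[OF measurable_prob_algebraD[OF kernel_measurable] A]) measurable
    also have "(\<integral>\<^sup>+z. (\<integral>\<^sup>+w. h z w \<partial>Q) * emeasure (step z) A \<partial>X) = (\<integral>\<^sup>+z. \<integral>\<^sup>+w. h z w * emeasure (update w) A \<partial>Q \<partial>X)"
    proof (rule nn_integral_cong)
      fix z assume z: "z \<in> space X"
      show "(\<integral>\<^sup>+w. h z w \<partial>Q) * emeasure (step z) A = (\<integral>\<^sup>+w. h z w * emeasure (update w) A \<partial>Q)"
        using pos_Q[OF z] fin_Q[OF z] by (simp add: emeasure_kernel[OF z A] mult_divide_cancel_ennreal)
    qed
    also have "\<dots> = (\<integral>\<^sup>+w. \<integral>\<^sup>+z. h z w * emeasure (update w) A \<partial>X \<partial>Q)"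
      by (rule XQ.Fubini'[symmetric]) measurable
    also have "\<dots> = (\<integral>\<^sup>+w. \<integral>\<^sup>+z. h z w * indicator A z \<partial>X \<partial>Q)"
    proof (rule nn_integral_cong)
      fix w assume w: "w \<in> space Q"
      have "(\<integral>\<^sup>+z. h z w * emeasure (update w) A \<partial>X) = (\<integral>\<^sup>+z. h z w \<partial>X) * emeasure (update w) A"
        using w by (simp add: nn_integral_multc)
      also have "\<dots> = (\<integral>\<^sup>+z. h z w * indicator A z \<partial>X)"
        using pos_X[OF w] fin_X[OF w] by (simp add: emeasure_update[OF w A] mult_divide_cancel_ennreal)
      finally show "(\<integral>\<^sup>+z. h z w * emeasure (update w) A \<partial>X) = (\<integral>\<^sup>+z. h z w * indicator A z \<partial>X)" .
    qed
    also have "\<dots> = (\<integral>\<^sup>+z. \<integral>\<^sup>+w. h z w * indicator A z \<partial>Q \<partial>X)"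
      by (rule XQ.Fubini') measurable
    also have "\<dots> = (\<integral>\<^sup>+z. (\<integral>\<^sup>+w. h z w \<partial>Q) * indicator A z \<partial>X)"
      by (intro nn_integral_cong) (simp add: nn_integral_multc)
    also have "\<dots> / ?T = emeasure target A"
      by (simp add: emeasure_target[OF A])
    finally show "emeasure (target \<bind> step) A = emeasure target A" .
  qed
  then show ?thesis by (simp add: stationary_def space_prob_algebra target_prob sets_target)
qed

text \<open>Because \<open>h\<close> is positive, each \<open>update w\<close> charges every set
  that is not null for \<open>X\<close>. Irreducibility and aperiodicity both follow from this
  one-step statement: in a cycle of length at least 2 the first set could not be reached from itself
  in one step.\<close>

lemma kernel_pos:
  assumes z: "z \<in> space X" and A[measurable]: "A \<in> sets X" and pos: "0 < emeasure target A"
  shows "0 < emeasure (step z) A"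
proof -
  have "emeasure X A \<noteq> 0"
  proof
    assume "emeasure X A = 0"
    then have "AE z in X. z \<notin> A" using A by (intro AE_not_in) (auto simp: null_sets_def)
    then have "(\<integral>\<^sup>+z. (\<integral>\<^sup>+w. h z w \<partial>Q) * indicator A z \<partial>X) = 0"
      by (subst nn_integral_0_iff_AE) (auto elim: eventually_mono)
    with pos show False by (simp add: emeasure_target[OF A])
  qed
  then have up: "0 < emeasure (update w) A" if w: "w \<in> space Q" for w
    using nn_integral_pos[of "\<lambda>z. h z w" X A] h_pos w sets.sets_into_space[OF A] fin_X[OF w]
    by (auto simp: emeasure_update[OF w A] ennreal_zero_less_divide zero_less_iff_neq_zero subset_eq)
  note emeasure_update_measurable[OF A, measurable]
  have "0 < (\<integral>\<^sup>+w. (h z w * emeasure (update w) A) * indicator (space Q) w \<partial>Q)"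
    using z Q up h_pos[OF z] by (intro nn_integral_pos) (auto simp: ennreal_zero_less_mult_iff)
  also have "\<dots> = (\<integral>\<^sup>+w. h z w * emeasure (update w) A \<partial>Q)" by (intro nn_integral_cong) simp
  finally show ?thesis using fin_Q[OF z] by (simp add: emeasure_kernel[OF z A] ennreal_zero_less_divide)
qed

lemma irreducible: "phi_irreducible X step"
proof -
  interpret T: prob_space target by (rule target_prob)
  have "0 < emeasure (kernel_pow X step 1 z) A" if "z \<in> space X" "A \<in> sets X" "0 < emeasure target A" for z A
    using kernel_pos[OF that] that bind_return[OF measurable_prob_algebraD[OF kernel_measurable]] by simp
  then show ?thesis unfolding phi_irreducible_def
    using T.sigma_finite_measure_axioms T.emeasure_space_1 sets_target by (intro exI[of _ target]) auto
qed

lemma aperiodic: "aperiodic X step target"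
  unfolding aperiodic_def
proof (rule notI, elim exE conjE)
  fix q :: nat and D
  assume q: "2 \<le> q" and D: "\<forall>i<q. D i \<in> sets X" and disj: "disjoint_family_on D {..<q}"
    and cyc: "\<forall>i<q. \<forall>z\<in>D i. emeasure (step z) (D (Suc i mod q)) = 1" and D0: "0 < emeasure target (D 0)"
  obtain z where z: "z \<in> D 0" using D0 by fastforce
  then have zX: "z \<in> space X" using D q sets.sets_into_space by fastforce
  interpret Kz: prob_space "step z" by (rule prob_kernel[OF zX])
  have D01: "D 0 \<in> sets X" "D 1 \<in> sets X" using D q by auto
  have 1: "emeasure (step z) (D 1) = 1" using cyc q z by (auto dest!: spec[of _ 0])
  have "D 0 \<inter> D 1 = {}" using disj q by (auto simp: disjoint_family_on_def)
  then have "emeasure (step z) (D 0) + emeasure (step z) (D 1) = emeasure (step z) (D 0 \<union> D 1)"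
    using D01 by (intro plus_emeasure) (auto simp: sets_kernel[OF zX])
  also have "\<dots> \<le> 1" by (rule Kz.emeasure_le_1)
  finally have "1 + emeasure (step z) (D 0) \<le> 1 + 0" using 1 by (simp add: add.commute)
  then have "emeasure (step z) (D 0) = 0"
    by (subst (asm) ennreal_add_left_cancel_le) simp
  with kernel_pos[OF zX D01(1) D0] show False by simp
qed

text \<open>If \<open>q\<close> lies below the normalized density of \<open>cond z\<close> for all
  \<open>z\<close> in \<open>S\<close>, then its image under \<open>update\<close> lies below all
  these kernels, and it keeps the mass of \<open>q\<close> since \<open>update\<close> is a
  probability kernel.\<close>

lemma minorization:
  assumes [measurable]: "q \<in> borel_measurable Q" and "0 < (\<integral>\<^sup>+w. q w \<partial>Q)" "(\<integral>\<^sup>+w. q w \<partial>Q) < \<infinity>"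
    and le: "\<And>z w. z \<in> S \<Longrightarrow> w \<in> space Q \<Longrightarrow> q w * (\<integral>\<^sup>+w. h z w \<partial>Q) \<le> h z w" and S: "S \<subseteq> space X"
  shows "\<exists>\<nu>. finite_measure \<nu> \<and> sets \<nu> = sets X \<and> emeasure \<nu> (space X) > 0 \<and>
    (\<forall>z\<in>S. \<forall>A\<in>sets X. emeasure \<nu> A \<le> emeasure (step z) A)"
proof -
  let ?\<nu> = "density Q q \<bind> update"
  have ne: "space (density Q q) \<noteq> {}" using Q(2) by auto
  have um: "update \<in> measurable (density Q q) (subprob_algebra X)"
    using update_subprob by (subst measurable_cong_sets[OF sets_density refl])
  have sets: "sets ?\<nu> = sets X" using ne by (intro sets_bind) (auto simp: update_def)
  have em: "emeasure ?\<nu> A = (\<integral>\<^sup>+w. q w * emeasure (update w) A \<partial>Q)" if A: "A \<in> sets X" for A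
    using emeasure_bind[OF ne um A] emeasure_update_measurable[OF A] by (simp add: nn_integral_density)
  have one: "emeasure (update w) (space X) = 1" if "w \<in> space Q" for w
    using measurable_space[OF update_measurable that] prob_space.emeasure_space_1[of "update w"]
    by (simp add: space_prob_algebra update_def)
  have tot: "emeasure ?\<nu> (space X) = (\<integral>\<^sup>+w. q w \<partial>Q)"
    by (subst em) (auto intro!: nn_integral_cong simp: one)
  have "emeasure ?\<nu> A \<le> emeasure (step z) A" if z: "z \<in> S" and A: "A \<in> sets X" for z A
  proof -
    have zX: "z \<in> space X" using z S by blast
    note emeasure_update_measurable[OF A, measurable]
    have "emeasure ?\<nu> A \<le> (\<integral>\<^sup>+w. h z w * emeasure (update w) A / (\<integral>\<^sup>+w. h z w \<partial>Q) \<partial>Q)"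
      unfolding em[OF A]
    proof (intro nn_integral_mono)
      fix w assume w: "w \<in> space Q"
      have "q w = q w * (\<integral>\<^sup>+w. h z w \<partial>Q) / (\<integral>\<^sup>+w. h z w \<partial>Q)"
        using pos_Q[OF zX] fin_Q[OF zX] by (simp add: mult_divide_eq_ennreal)
      also have "\<dots> \<le> h z w / (\<integral>\<^sup>+w. h z w \<partial>Q)"
        by (intro divide_right_mono_ennreal le z w)
      finally have "q w * emeasure (update w) A \<le> h z w / (\<integral>\<^sup>+w. h z w \<partial>Q) * emeasure (update w) A"
        by (rule mult_right_mono) simp
      then show "q w * emeasure (update w) A \<le> h z w * emeasure (update w) A / (\<integral>\<^sup>+w. h z w \<partial>Q)"
        by (simp add: ennreal_divide_times ennreal_times_divide)
    qed
    also have "\<dots> = emeasure (step z) A"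
      using zX by (simp add: emeasure_kernel[OF zX A] nn_integral_divide)
    finally show ?thesis .
  qed
  moreover have "finite_measure ?\<nu>"
    using assms(3) tot sets_eq_imp_space_eq[OF sets] by (intro finite_measureI) auto
  ultimately show ?thesis using sets tot assms(2) by (intro exI[of _ ?\<nu>]) auto
qed

end

subsection \<open>Linear changes of variables in products of Lebesgue measures\<close>

abbreviation "mtranspose \<equiv> Finite_Cartesian_Product.transpose"
abbreviation "mdet \<equiv> Determinants.det"
abbreviation "mtrace \<equiv> Determinants.trace"
abbreviation "id_mat \<equiv> Finite_Cartesian_Product.mat 1"

interpretation PL: product_sigma_finite "\<lambda>_. lborel :: real measure"
  by standard

abbreviation lborel_fun :: "'i set \<Rightarrow> ('i \<Rightarrow> real) measure" where
  "lborel_fun I \<equiv> Pi\<^sub>M I (\<lambda>_. lborel)"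

lemma ennreal_inverse_mult_assoc:
  "0 \<le> a \<Longrightarrow> 0 \<le> b \<Longrightarrow> ennreal (1 / a) * (ennreal (1 / b) * u) = ennreal (1 / (a * b)) * u"
  by (simp add: mult.assoc[symmetric] ennreal_mult[symmetric])

text \<open>With coordinate \<open>p\<close> integrated innermost this is an affine substitution on
  the line, because the shift \<open>g u\<close> does not depend on \<open>u p\<close>.\<close>

lemma nn_integral_lborel_fun_coordinate:
  fixes c :: real
  assumes I: "finite I" "p \<in> I" and c: "c \<noteq> 0"
    and [measurable]: "g \<in> borel_measurable (lborel_fun I)" "f \<in> borel_measurable (lborel_fun I)"
    and indep: "\<And>u t. g (u(p := t)) = g u"
  shows "(\<integral>\<^sup>+u. f (u(p := c * u p + g u)) \<partial>lborel_fun I) = ennreal (1 / \<bar>c\<bar>) * (\<integral>\<^sup>+u. f u \<partial>lborel_fun I)"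
proof -
  define J where "J = I - {p}"
  have IJ: "I = insert p J" "finite J" "p \<notin> J" using I by (auto simp: J_def)
  note split = PL.product_nn_integral_insert[OF IJ(2,3), folded IJ(1)]
  have upd[measurable]: "(\<lambda>u. u(p := c * u p + g u)) \<in> measurable (lborel_fun I) (lborel_fun I)"
    using I(2) by (intro measurable_fun_upd[where J=I]) (auto simp: insert_absorb)
  have upd3[measurable]: "(\<lambda>(u, t). u(p := t)) \<in> measurable (lborel_fun J \<Otimes>\<^sub>M lborel) (lborel_fun I)"
    unfolding IJ(1) by measurable
  have upd2[measurable]: "(\<lambda>t. u(p := t)) \<in> measurable lborel (lborel_fun I)" if "u \<in> space (lborel_fun J)" for u
    using measurable_Pair2[OF upd3 that] by simp
  have "(\<integral>\<^sup>+u. f (u(p := c * u p + g u)) \<partial>lborel_fun I)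
      = (\<integral>\<^sup>+u. \<integral>\<^sup>+t. f (u(p := g u + c * t)) \<partial>lborel \<partial>lborel_fun J)"
    using measurable_compose[OF upd, of f borel] by (subst split) (simp_all add: indep add.commute)
  also have "\<dots> = (\<integral>\<^sup>+u. ennreal (1 / \<bar>c\<bar>) * (\<integral>\<^sup>+t. f (u(p := t)) \<partial>lborel) \<partial>lborel_fun J)"
  proof (rule nn_integral_cong)
    fix u assume u: "u \<in> space (lborel_fun J)"
    have "(\<integral>\<^sup>+t. f (u(p := t)) \<partial>lborel) = ennreal \<bar>c\<bar> * (\<integral>\<^sup>+t. f (u(p := g u + c * t)) \<partial>lborel)"
      using measurable_compose[OF upd2[OF u], of f borel] c by (intro nn_integral_real_affine) auto
    then show "(\<integral>\<^sup>+t. f (u(p := g u + c * t)) \<partial>lborel) = ennreal (1 / \<bar>c\<bar>) * (\<integral>\<^sup>+t. f (u(p := t)) \<partial>lborel)"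
      using c by (simp add: mult.assoc[symmetric] ennreal_mult[symmetric])
  qed
  also have "\<dots> = ennreal (1 / \<bar>c\<bar>) * (\<integral>\<^sup>+u. \<integral>\<^sup>+t. f (u(p := t)) \<partial>lborel \<partial>lborel_fun J)"
    by (intro nn_integral_cmult lborel.borel_measurable_nn_integral)
      (use measurable_compose[OF upd3, of f borel] in \<open>simp add: split_beta'\<close>)
  also have "\<dots> = ennreal (1 / \<bar>c\<bar>) * (\<integral>\<^sup>+u. f u \<partial>lborel_fun I)"
    by (subst split) simp_all
  finally show ?thesis .
qed

text \<open>The coordinates in \<open>F\<close> can be substituted one at a time: the shifts
  \<open>g p\<close> read only coordinates outside \<open>F\<close>, so no substitution disturbs
  another. The elementary actions on matrices and on symmetric matrices other than permutations are
  built from this shape.\<close>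

lemma nn_integral_lborel_fun_affine:
  fixes s :: "'i \<Rightarrow> real"
  assumes I: "finite I" "F \<subseteq> I" and s: "\<And>p. p \<in> F \<Longrightarrow> s p \<noteq> 0"
    and g[measurable]: "\<And>p. p \<in> F \<Longrightarrow> g p \<in> borel_measurable (lborel_fun I)" and f[measurable]: "f \<in> borel_measurable (lborel_fun I)"
    and indep: "\<And>p q u t. p \<in> F \<Longrightarrow> q \<in> F \<Longrightarrow> g p (u(q := t)) = g p u"
  shows "(\<integral>\<^sup>+u. f (\<lambda>p. if p \<in> F then s p * u p + g p u else u p) \<partial>lborel_fun I)
     = ennreal (1 / (\<Prod>p\<in>F. \<bar>s p\<bar>)) * (\<integral>\<^sup>+u. f u \<partial>lborel_fun I)"
proof -
  have "finite F" using I finite_subset by blast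
  then show ?thesis
    using I(2) s g indep
  proof (induction F)
    case empty
    then show ?case by simp
  next
    case (insert q G)
    let ?\<Phi> = "\<lambda>u p. if p \<in> G then s p * u p + g p u else u p"
    have gm: "g p \<in> borel_measurable (lborel_fun I)" if "p \<in> insert q G" for p
      by (rule insert.prems(3)[OF that])
    have gq: "g p (u(q' := t)) = g p u" if "p \<in> insert q G" "q' \<in> insert q G" for p q' u t
      by (rule insert.prems(4)[OF that])
    have qG: "q \<in> I" "G \<subseteq> I" using insert.prems(1) by auto
    have m: "?\<Phi> \<in> measurable (lborel_fun I) (lborel_fun I)"
    proof (rule measurable_PiM_single')
      fix p assume p: "p \<in> I"
      show "(\<lambda>u. if p \<in> G then s p * u p + g p u else u p) \<in> measurable (lborel_fun I) lborel"
        using gm[of p] p by (cases "p \<in> G") auto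
    qed (use qG in \<open>auto simp: space_PiM PiE_iff extensional_def\<close>)
    have "(\<integral>\<^sup>+u. f (\<lambda>p. if p \<in> insert q G then s p * u p + g p u else u p) \<partial>lborel_fun I)
        = (\<integral>\<^sup>+u. f (?\<Phi> (u(q := s q * u q + g q u))) \<partial>lborel_fun I)"
    proof (rule nn_integral_cong, rule arg_cong[of _ _ f], rule ext)
      fix u p
      show "(if p \<in> insert q G then s p * u p + g p u else u p) = ?\<Phi> (u(q := s q * u q + g q u)) p"
        using insert.hyps(2) gq[of p q u] by (cases "p = q") auto
    qed
    also have "\<dots> = ennreal (1 / \<bar>s q\<bar>) * (\<integral>\<^sup>+u. f (?\<Phi> u) \<partial>lborel_fun I)"
      using I(1) qG(1) insert.prems(2) measurable_compose[OF m f] gm gq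
      by (intro nn_integral_lborel_fun_coordinate) blast+
    also have "(\<integral>\<^sup>+u. f (?\<Phi> u) \<partial>lborel_fun I) = ennreal (1 / (\<Prod>p\<in>G. \<bar>s p\<bar>)) * (\<integral>\<^sup>+u. f u \<partial>lborel_fun I)"
      using insert.prems(2) qG gm gq by (intro insert.IH) blast+
    also have "ennreal (1 / \<bar>s q\<bar>) * \<dots> = ennreal (1 / (\<Prod>p\<in>insert q G. \<bar>s p\<bar>)) * (\<integral>\<^sup>+u. f u \<partial>lborel_fun I)"
      using insert.hyps by (simp add: mult.assoc[symmetric] ennreal_mult[symmetric] prod_nonneg)
    finally show ?case .
  qed
qed

lemma nn_integral_lborel_fun_reindex:
  fixes \<sigma> :: "'j \<Rightarrow> 'i"
  assumes fin: "finite I" and bij: "bij_betw \<sigma> J I" and f[measurable]: "f \<in> borel_measurable (lborel_fun J)"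
  shows "(\<integral>\<^sup>+u. f (\<lambda>j\<in>J. u (\<sigma> j)) \<partial>lborel_fun I) = (\<integral>\<^sup>+u. f u \<partial>lborel_fun J)"
proof -
  have finJ: "finite J" using fin bij bij_betw_finite by blast
  have \<sigma>: "\<sigma> j \<in> I" if "j \<in> J" for j using bij that by (auto simp: bij_betw_def)
  have m: "(\<lambda>u. \<lambda>j\<in>J. u (\<sigma> j)) \<in> measurable (lborel_fun I) (lborel_fun J)"
    using \<sigma> by (intro measurable_restrict) simp
  have "distr (lborel_fun I) (lborel_fun J) (\<lambda>u. \<lambda>j\<in>J. u (\<sigma> j)) = lborel_fun J"
  proof (intro PL.PiM_eqI finJ)
    fix A :: "'j \<Rightarrow> real set" assume A: "\<And>j. j \<in> J \<Longrightarrow> A j \<in> sets lborel"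
    have inv: "the_inv_into J \<sigma> i \<in> J" "\<sigma> (the_inv_into J \<sigma> i) = i" if "i \<in> I" for i
      using bij that by (auto simp: bij_betw_def the_inv_into_into f_the_inv_into_f)
    have "emeasure (distr (lborel_fun I) (lborel_fun J) (\<lambda>u. \<lambda>j\<in>J. u (\<sigma> j))) (Pi\<^sub>E J A)
        = emeasure (lborel_fun I) ((\<lambda>u. \<lambda>j\<in>J. u (\<sigma> j)) -` Pi\<^sub>E J A \<inter> space (lborel_fun I))"
      using m finJ A by (intro emeasure_distr sets_PiM_I_finite) auto
    also have "(\<lambda>u. \<lambda>j\<in>J. u (\<sigma> j)) -` Pi\<^sub>E J A \<inter> space (lborel_fun I) = Pi\<^sub>E I (\<lambda>i. A (the_inv_into J \<sigma> i))"
    proof (rule equalityI; rule subsetI)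
      fix u assume "u \<in> (\<lambda>u. \<lambda>j\<in>J. u (\<sigma> j)) -` Pi\<^sub>E J A \<inter> space (lborel_fun I)"
      then have u: "\<And>j. j \<in> J \<Longrightarrow> u (\<sigma> j) \<in> A j" "u \<in> extensional I"
        by (auto simp: space_PiM PiE_iff)
      then show "u \<in> Pi\<^sub>E I (\<lambda>i. A (the_inv_into J \<sigma> i))"
        unfolding PiE_iff using inv by metis
    next
      fix u assume "u \<in> Pi\<^sub>E I (\<lambda>i. A (the_inv_into J \<sigma> i))"
      then show "u \<in> (\<lambda>u. \<lambda>j\<in>J. u (\<sigma> j)) -` Pi\<^sub>E J A \<inter> space (lborel_fun I)"
        using bij \<sigma> by (auto simp: space_PiM PiE_iff bij_betw_def the_inv_into_f_f)
    qed
    also have "emeasure (lborel_fun I) (Pi\<^sub>E I (\<lambda>i. A (the_inv_into J \<sigma> i))) = (\<Prod>i\<in>I. emeasure lborel (A (the_inv_into J \<sigma> i)))"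
      using A inv by (intro PL.emeasure_PiM fin) auto
    also have "\<dots> = (\<Prod>j\<in>J. emeasure lborel (A (the_inv_into J \<sigma> (\<sigma> j))))"
      using prod.reindex_bij_betw[OF bij, symmetric] .
    also have "\<dots> = (\<Prod>j\<in>J. emeasure lborel (A j))"
      using bij by (intro prod.cong refl) (simp add: bij_betw_def the_inv_into_f_f)
    finally show "emeasure (distr (lborel_fun I) (lborel_fun J) (\<lambda>u. \<lambda>j\<in>J. u (\<sigma> j))) (Pi\<^sub>E J A) = (\<Prod>j\<in>J. emeasure lborel (A j))" .
  qed simp
  then have "(\<integral>\<^sup>+u. f u \<partial>lborel_fun J) = (\<integral>\<^sup>+u. f u \<partial>distr (lborel_fun I) (lborel_fun J) (\<lambda>u. \<lambda>j\<in>J. u (\<sigma> j)))"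
    by simp
  also have "\<dots> = (\<integral>\<^sup>+u. f (\<lambda>j\<in>J. u (\<sigma> j)) \<partial>lborel_fun I)"
    using m f by (intro nn_integral_distr) auto
  finally show ?thesis ..
qed

text \<open>Change-of-variables formulas are multiplicative in the matrix, so they need checking
  only on elementary factors. A matrix with a zero row has determinant 0 and drops out, which leaves
  a rule that stays among invertible matrices.\<close>

lemma induct_invertible_matrix [consumes 1, case_names mult diagonal swap shear]:
  fixes P :: "real^'n^'n \<Rightarrow> bool"
  assumes A: "mdet A \<noteq> 0"
    and mult: "\<And>A B. mdet A \<noteq> 0 \<Longrightarrow> mdet B \<noteq> 0 \<Longrightarrow> P A \<Longrightarrow> P B \<Longrightarrow> P (A ** B)"
    and diagonal: "\<And>t. (\<And>i. t i \<noteq> 0) \<Longrightarrow> P (\<chi> i j. if i = j then t i else 0)"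
    and swap: "\<And>m n. m \<noteq> n \<Longrightarrow> P (\<chi> i j. if j = Transposition.transpose m n i then 1 else 0)"
    and shear: "\<And>m n. m \<noteq> n \<Longrightarrow> P (\<chi> i j. if i = m \<and> j = n \<or> i = j then 1 else 0)"
  shows "P A"
proof -
  have "mdet A \<noteq> 0 \<longrightarrow> P A"
  proof (induction A rule: induct_matrix_elementary_alt)
    case (1 A B)
    then show ?case by (auto simp: det_mul intro: assms(2))
  next
    case (2 A i)
    then show ?case by (auto simp: det_zero_row)
  next
    case (3 A)
    have "P A" if "mdet A \<noteq> 0"
    proof -
      have "(\<Prod>i\<in>UNIV. A $ i $ i) \<noteq> 0"
        using that det_diagonal[of A] 3 by simp
      then have "P (\<chi> i j. if i = j then A $ i $ i else 0)" by (intro assms(3)) simp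
      moreover have "(\<chi> i j. if i = j then A $ i $ i else 0) = A"
        using 3 by (auto simp: Finite_Cartesian_Product.vec_eq_iff)
      ultimately show ?thesis by simp
    qed
    then show ?case by blast
  next
    case (4 m n)
    have "(\<chi> i j. id_mat $ i $ Transposition.transpose m n j) = ((\<chi> i j. if j = Transposition.transpose m n i then 1 else 0) :: real^'n^'n)"
      by (auto simp: Finite_Cartesian_Product.vec_eq_iff Finite_Cartesian_Product.mat_def Transposition.transpose_def)
    then show ?case using swap[OF 4] by simp
  next
    case (5 m n)
    have "(\<chi> i j. of_bool (i = m \<and> j = n \<or> i = j)) = ((\<chi> i j. if i = m \<and> j = n \<or> i = j then 1 else 0) :: real^'n^'n)"
      by (simp add: Finite_Cartesian_Product.vec_eq_iff)
    then show ?case using shear[OF 5] by simp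
  qed
  with A show ?thesis by simp
qed

lemma det_swap_matrix: "m \<noteq> n \<Longrightarrow> \<bar>mdet ((\<chi> i j. if j = Transposition.transpose m n i then 1 else 0) :: real^'n^'n)\<bar> = 1"
proof -
  assume "m \<noteq> n"
  let ?\<tau> = "Transposition.transpose m n"
  have "((\<chi> i j. if j = ?\<tau> i then 1 else 0) :: real^'n^'n) = (\<chi> i. (id_mat :: real^'n^'n) $ ?\<tau> i)"
    by (auto simp: Finite_Cartesian_Product.vec_eq_iff Finite_Cartesian_Product.mat_def)
  then show ?thesis
    using Determinants.det_permute_rows[of ?\<tau> "id_mat :: real^'n^'n"]
    by (simp add: permutes_swap_id sign_def)
qed

lemma det_shear_matrix: "m \<noteq> n \<Longrightarrow> mdet ((\<chi> i j. if i = m \<and> j = n \<or> i = j then 1 else 0) :: real^'n^'n) = 1"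
proof -
  assume mn: "m \<noteq> n"
  let ?I = "id_mat :: real^'n^'n"
  have "((\<chi> i j. if i = m \<and> j = n \<or> i = j then 1 else 0) :: real^'n^'n)
      = (\<chi> k. if k = m then Finite_Cartesian_Product.row m ?I + 1 *s Finite_Cartesian_Product.row n ?I else Finite_Cartesian_Product.row k ?I)"
    using mn by (auto simp: Finite_Cartesian_Product.vec_eq_iff Finite_Cartesian_Product.mat_def Finite_Cartesian_Product.row_def)
  then show ?thesis using det_row_operation[OF mn, of ?I 1] by simp
qed

lemma det_diagonal_matrix: "mdet ((\<chi> i j. if i = j then t i else 0) :: real^'n^'n) = (\<Prod>i\<in>UNIV. t i)"
  by (subst det_diagonal) auto

subsection \<open>Matrices acting on matrices\<close>

text \<open>\<open>A\<close> acts separately on each of the \<open>CARD('c)\<close> columns, hence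
  that power of the determinant.\<close>

lemma nn_integral_left_mult_fun:
  fixes A :: "real^'r^'r" and f :: "('r::finite \<times> 'c::finite \<Rightarrow> real) \<Rightarrow> ennreal"
  assumes "mdet A \<noteq> 0" and "f \<in> borel_measurable (lborel_fun UNIV)"
  shows "(\<integral>\<^sup>+u. f (\<lambda>(i, j). \<Sum>k\<in>UNIV. A $ i $ k * u (k, j)) \<partial>lborel_fun UNIV)
     = ennreal (1 / \<bar>mdet A\<bar> ^ CARD('c)) * (\<integral>\<^sup>+u. f u \<partial>lborel_fun UNIV)"
  using assms
proof (induction A arbitrary: f rule: induct_invertible_matrix)
  case (mult A B)
  let ?act = "\<lambda>(A :: real^'r^'r) (u :: 'r \<times> 'c \<Rightarrow> real) (i, j). \<Sum>k\<in>UNIV. A $ i $ k * u (k, j)"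
  note [measurable] = mult(5)
  have m[measurable]: "?act A \<in> measurable (lborel_fun UNIV) (lborel_fun UNIV)" for A
    by (rule measurable_PiM_single') (auto simp: space_PiM split_beta)
  have "?act (A ** B) u = ?act A (?act B u)" for u
    by (auto simp: fun_eq_iff matrix_matrix_mult_def sum_distrib_left sum_distrib_right mult.assoc intro: sum.swap)
  then have "(\<integral>\<^sup>+u. f (?act (A ** B) u) \<partial>lborel_fun UNIV) = (\<integral>\<^sup>+u. f (?act A (?act B u)) \<partial>lborel_fun UNIV)"
    by simp
  also have "\<dots> = ennreal (1 / \<bar>mdet B\<bar> ^ CARD('c)) * (\<integral>\<^sup>+u. f (?act A u) \<partial>lborel_fun UNIV)"
    by (rule mult(4)) measurable
  also have "(\<integral>\<^sup>+u. f (?act A u) \<partial>lborel_fun UNIV) = ennreal (1 / \<bar>mdet A\<bar> ^ CARD('c)) * (\<integral>\<^sup>+u. f u \<partial>lborel_fun UNIV)"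
    by (rule mult(3)) measurable
  finally show ?case
    by (simp add: det_mul abs_mult power_mult_distrib ennreal_inverse_mult_assoc mult.commute[of "\<bar>mdet A\<bar> ^ _"])
next
  case (diagonal t)
  have "(\<lambda>(i, j). \<Sum>k\<in>UNIV. (\<chi> i j. if i = j then t i else 0) $ i $ k * u (k, j)) = (\<lambda>p. if p \<in> UNIV then t (fst p) * u p + 0 else u p)"
    for u :: "'r \<times> 'c \<Rightarrow> real"
    by (auto simp: fun_eq_iff if_distrib[of "\<lambda>x. x * _"] cong: if_cong)
  then have "(\<integral>\<^sup>+u. f (\<lambda>(i, j). \<Sum>k\<in>UNIV. (\<chi> i j. if i = j then t i else 0) $ i $ k * u (k, j)) \<partial>lborel_fun UNIV)
      = ennreal (1 / (\<Prod>p\<in>(UNIV :: ('r \<times> 'c) set). \<bar>t (fst p)\<bar>)) * (\<integral>\<^sup>+u. f u \<partial>lborel_fun UNIV)"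
    using diagonal nn_integral_lborel_fun_affine[of "UNIV :: ('r \<times> 'c) set" UNIV "\<lambda>p. t (fst p)" "\<lambda>_ _. 0" f] by simp
  also have "(\<Prod>p\<in>(UNIV :: ('r \<times> 'c) set). \<bar>t (fst p)\<bar>) = \<bar>\<Prod>i\<in>UNIV. t i\<bar> ^ CARD('c)"
    unfolding UNIV_Times_UNIV[symmetric] prod.cartesian_product'
    by (simp add: prod_power_distrib abs_prod)
  finally show ?case by (simp add: det_diagonal_matrix)
next
  case (swap m n)
  let ?\<tau> = "Transposition.transpose m n"
  have "bij_betw (\<lambda>(i, j). (?\<tau> i, j)) (UNIV :: ('r \<times> 'c) set) UNIV"
    by (rule bij_betw_byWitness[where f'="\<lambda>(i, j). (?\<tau> i, j)"]) auto
  from nn_integral_lborel_fun_reindex[OF _ this, of f]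
  have "(\<integral>\<^sup>+u. f (\<lambda>p. u (?\<tau> (fst p), snd p)) \<partial>lborel_fun UNIV) = (\<integral>\<^sup>+u. f u \<partial>lborel_fun UNIV)"
    using swap by (simp add: split_beta restrict_def)
  moreover have "(\<lambda>(i, j). \<Sum>k\<in>UNIV. (\<chi> i j. if j = ?\<tau> i then 1 else 0) $ i $ k * u (k, j)) = (\<lambda>p. u (?\<tau> (fst p), snd p))"
    for u :: "'r \<times> 'c \<Rightarrow> real"
    by (auto simp: fun_eq_iff of_bool_def if_distrib[of "\<lambda>x. x * _"] cong: if_cong)
  ultimately show ?case using det_swap_matrix[OF swap(1)] by simp
next
  case (shear m n)
  let ?F = "{p :: 'r \<times> 'c. fst p = m}"
  have "(\<lambda>(i, j). \<Sum>k\<in>UNIV. (\<chi> i j. if i = m \<and> j = n \<or> i = j then 1 else 0) $ i $ k * u (k, j)) = (\<lambda>p. if p \<in> ?F then 1 * u p + u (n, snd p) else u p)"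
    for u :: "'r \<times> 'c \<Rightarrow> real"
  proof (intro ext, clarify)
    fix i j
    have "(\<Sum>k\<in>UNIV. (if i = m \<and> k = n \<or> i = k then 1 else 0) * u (k, j)) = (\<Sum>k\<in>UNIV. (if k = i then u (k, j) else 0) + (if k = n then (if i = m then u (k, j) else 0) else 0))"
      using shear(1) by (intro sum.cong) auto
    also have "\<dots> = u (i, j) + (if i = m then u (n, j) else 0)" by (simp add: sum.distrib)
    finally show "(\<Sum>k\<in>UNIV. (\<chi> i j. if i = m \<and> j = n \<or> i = j then 1 else 0) $ i $ k * u (k, j)) = (if (i, j) \<in> ?F then 1 * u (i, j) + u (n, snd (i, j)) else u (i, j))"
      by simp
  qed
  then show ?case
    using shear nn_integral_lborel_fun_affine[of "UNIV :: ('r \<times> 'c) set" ?F "\<lambda>_. 1" "\<lambda>p u. u (n, snd p)" f]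
    by (auto simp: det_shear_matrix)
qed

lemma lborel_eq_distr_lborel_fun:
  fixes e :: "'i::finite \<Rightarrow> 'a::euclidean_space"
  assumes e: "bij_betw e UNIV Basis"
  shows "lborel = distr (lborel_fun UNIV) borel (\<lambda>u. \<Sum>i\<in>UNIV. u i *\<^sub>R e i)"
proof (rule lborel_eqI)
  have m[measurable]: "(\<lambda>u. \<Sum>i\<in>UNIV. u i *\<^sub>R e i) \<in> borel_measurable (lborel_fun UNIV)"
    by measurable
  have eB: "e i \<in> Basis" for i using e by (auto simp: bij_betw_def)
  have ip: "(\<Sum>i\<in>UNIV. u i *\<^sub>R e i) \<bullet> e j = u j" for u j
  proof -
    have "(\<Sum>i\<in>UNIV. u i *\<^sub>R e i) \<bullet> e j = (\<Sum>i\<in>UNIV. if i = j then u i else 0)"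
      unfolding inner_sum_left using e
      by (intro sum.cong refl) (auto simp: inner_Basis eB bij_betw_def inj_on_def)
    then show ?thesis by simp
  qed
  have all: "(\<forall>b\<in>Basis. P b) \<longleftrightarrow> (\<forall>i. P (e i))" for P
    using e by (metis UNIV_I bij_betw_iff_bijections)
  fix l u :: 'a assume lu: "\<And>b. b \<in> Basis \<Longrightarrow> l \<bullet> b \<le> u \<bullet> b"
  have "emeasure (distr (lborel_fun UNIV) borel (\<lambda>u. \<Sum>i\<in>UNIV. u i *\<^sub>R e i)) (box l u)
      = emeasure (lborel_fun UNIV) ((\<lambda>u. \<Sum>i\<in>UNIV. u i *\<^sub>R e i) -` box l u \<inter> space (lborel_fun UNIV))"
    by (intro emeasure_distr) auto
  also have "(\<lambda>u. \<Sum>i\<in>UNIV. u i *\<^sub>R e i) -` box l u \<inter> space (lborel_fun UNIV) = Pi\<^sub>E UNIV (\<lambda>i. {l \<bullet> e i <..< u \<bullet> e i})"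
    by (auto simp: box_def all ip space_PiM PiE_iff)
  also have "emeasure (lborel_fun UNIV) \<dots> = (\<Prod>i\<in>UNIV. emeasure lborel {l \<bullet> e i <..< u \<bullet> e i})"
    by (intro PL.emeasure_PiM) auto
  also have "\<dots> = (\<Prod>i\<in>UNIV. ennreal ((u - l) \<bullet> e i))"
    using lu[OF eB] by (simp add: inner_diff_left)
  also have "\<dots> = ennreal (\<Prod>i\<in>UNIV. (u - l) \<bullet> e i)"
    using lu[OF eB] by (intro prod_ennreal) (simp add: inner_diff_left)
  also have "(\<Prod>i\<in>UNIV. (u - l) \<bullet> e i) = (\<Prod>b\<in>Basis. (u - l) \<bullet> b)"
    by (rule prod.reindex_bij_betw[OF e])
  finally show "emeasure (distr (lborel_fun UNIV) borel (\<lambda>u. \<Sum>i\<in>UNIV. u i *\<^sub>R e i)) (box l u) = (\<Prod>b\<in>Basis. (u - l) \<bullet> b)" .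
qed simp

lemma measurable_vec_lambda:
  fixes f :: "'i::finite \<Rightarrow> 'a \<Rightarrow> 'b::euclidean_space"
  assumes "\<And>i. f i \<in> borel_measurable M"
  shows "(\<lambda>x. \<chi> i. f i x) \<in> borel_measurable M"
proof (subst borel_measurable_euclidean_space, rule ballI)
  fix b :: "'b^'i" assume "b \<in> Basis"
  then obtain i c where "b = axis i c" by (auto simp: Basis_vec_def)
  then show "(\<lambda>x. (\<chi> i. f i x) \<bullet> b) \<in> borel_measurable M"
    using assms[of i] by (simp add: inner_axis)
qed

lemma nn_integral_lborel_vec:
  fixes f :: "real^'n::finite \<Rightarrow> ennreal"
  assumes [measurable]: "f \<in> borel_measurable borel"
  shows "(\<integral>\<^sup>+x. f x \<partial>lborel) = (\<integral>\<^sup>+u. f (\<chi> i. u i) \<partial>lborel_fun UNIV)"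
proof -
  have "bij_betw (\<lambda>i. axis i 1) UNIV (Basis :: (real^'n) set)"
    by (auto simp: bij_betw_def inj_on_def axis_eq_axis Basis_vec_def)
  from lborel_eq_distr_lborel_fun[OF this] show ?thesis
    by (subst (1) lborel_eq_distr_lborel_fun[OF \<open>bij_betw _ _ _\<close>], subst nn_integral_distr)
      (auto intro!: nn_integral_cong arg_cong[of _ _ f] simp: Finite_Cartesian_Product.vec_eq_iff axis_def if_distrib[of "\<lambda>x. _ * x"] cong: if_cong)
qed

lemma nn_integral_lborel_matrix:
  fixes f :: "real^'c::finite^'r::finite \<Rightarrow> ennreal"
  assumes [measurable]: "f \<in> borel_measurable borel"
  shows "(\<integral>\<^sup>+x. f x \<partial>lborel) = (\<integral>\<^sup>+u. f (\<chi> i j. u (i, j)) \<partial>lborel_fun UNIV)"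
proof -
  let ?e = "\<lambda>p. axis (fst p) (axis (snd p) 1) :: real^'c^'r"
  have e: "bij_betw ?e UNIV Basis"
    by (fastforce simp: bij_betw_def inj_on_def axis_eq_axis Basis_vec_def image_iff)
  have sum: "(\<Sum>p\<in>UNIV. u p *\<^sub>R ?e p) = (\<chi> i j. u (i, j))" for u
  proof -
    have "(\<Sum>p\<in>UNIV. u p *\<^sub>R ?e p) $ i $ j = (\<Sum>p\<in>UNIV. if p = (i, j) then u p else 0)" for i j
      unfolding sum_component by (intro sum.cong) (auto simp: axis_def)
    then show ?thesis by (simp add: Finite_Cartesian_Product.vec_eq_iff)
  qed
  show ?thesis
    by (subst (1) lborel_eq_distr_lborel_fun[OF e], subst nn_integral_distr) (simp_all add: sum measurable_vec_lambda)
qed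

lemma measurable_vec_nth[measurable]:
  "(\<lambda>x::'b::euclidean_space^'i::finite. x $ i) \<in> borel_measurable borel"
  by (intro borel_measurable_continuous_onI continuous_intros)

lemma measurable_matrix_mult:
  fixes A :: "real^'n::finite^'m::finite"
  shows "(\<lambda>x :: real^'k::finite^'n. A ** x) \<in> borel_measurable borel"
    and "(\<lambda>x :: real^'m^'k. x ** A) \<in> borel_measurable borel"
  by (auto simp: matrix_matrix_mult_def intro!: borel_measurable_continuous_onI continuous_intros)

lemma nn_integral_left_mult:
  fixes A :: "real^'r::finite^'r" and f :: "real^'c::finite^'r \<Rightarrow> ennreal"
  assumes A: "mdet A \<noteq> 0" and f[measurable]: "f \<in> borel_measurable borel"
  shows "(\<integral>\<^sup>+x. f (A ** x) \<partial>lborel) = ennreal (1 / \<bar>mdet A\<bar> ^ CARD('c)) * (\<integral>\<^sup>+x. f x \<partial>lborel)"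
proof -
  have [measurable]: "(\<lambda>u. \<chi> i j. u (i, j)) \<in> measurable (lborel_fun UNIV) (borel :: (real^'c^'r) measure)"
    by (intro measurable_vec_lambda) auto
  have "(\<integral>\<^sup>+x. f (A ** x) \<partial>lborel) = (\<integral>\<^sup>+u. f (A ** (\<chi> i j. u (i, j))) \<partial>lborel_fun UNIV)"
    by (intro nn_integral_lborel_matrix measurable_compose[OF measurable_matrix_mult(1) f])
  also have "\<dots> = (\<integral>\<^sup>+u. f (\<chi> i j. (\<lambda>(i, j). \<Sum>k\<in>UNIV. A $ i $ k * u (k, j)) (i, j)) \<partial>lborel_fun UNIV)"
    by (simp add: matrix_matrix_mult_def)
  also have "\<dots> = ennreal (1 / \<bar>mdet A\<bar> ^ CARD('c)) * (\<integral>\<^sup>+u. f (\<chi> i j. u (i, j)) \<partial>lborel_fun UNIV)"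
    by (rule nn_integral_left_mult_fun[OF A, of "\<lambda>u. f (\<chi> i j. u (i, j))"]) measurable
  finally show ?thesis by (simp add: nn_integral_lborel_matrix)
qed

lemma nn_integral_transpose:
  fixes f :: "real^'c::finite^'r::finite \<Rightarrow> ennreal"
  assumes f[measurable]: "f \<in> borel_measurable borel"
  shows "(\<integral>\<^sup>+x. f (mtranspose x) \<partial>lborel) = (\<integral>\<^sup>+x. f x \<partial>lborel)"
proof -
  have m[measurable]: "(\<lambda>u. \<chi> i j. u (i, j)) \<in> measurable (lborel_fun UNIV) (borel :: (real^'c^'r) measure)"
    by (intro measurable_vec_lambda) auto
  have t: "(mtranspose :: real^'r^'c \<Rightarrow> _) \<in> borel_measurable borel"
    unfolding Finite_Cartesian_Product.transpose_def by (intro borel_measurable_continuous_onI continuous_intros)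
  have "bij_betw prod.swap (UNIV :: ('r \<times> 'c) set) (UNIV :: ('c \<times> 'r) set)"
    by (rule bij_betw_byWitness[where f'=prod.swap]) auto
  from nn_integral_lborel_fun_reindex[OF _ this, of "\<lambda>u. f (\<chi> i j. u (i, j))"]
  have "(\<integral>\<^sup>+u. f (\<chi> i j. u (j, i)) \<partial>lborel_fun UNIV) = (\<integral>\<^sup>+u. f (\<chi> i j. u (i, j)) \<partial>lborel_fun UNIV)"
    using measurable_compose[OF m f] by simp
  then show ?thesis
    using measurable_compose[OF t f]
    by (simp add: nn_integral_lborel_matrix) (simp add: Finite_Cartesian_Product.transpose_def)
qed

lemma nn_integral_right_mult:
  fixes A :: "real^'c::finite^'c" and f :: "real^'c^'r::finite \<Rightarrow> ennreal"
  assumes A: "mdet A \<noteq> 0" and f[measurable]: "f \<in> borel_measurable borel"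
  shows "(\<integral>\<^sup>+x. f (x ** A) \<partial>lborel) = ennreal (1 / \<bar>mdet A\<bar> ^ CARD('r)) * (\<integral>\<^sup>+x. f x \<partial>lborel)"
proof -
  have t: "(mtranspose :: real^'a::finite^'b::finite \<Rightarrow> _) \<in> borel_measurable borel"
    unfolding Finite_Cartesian_Product.transpose_def by (intro borel_measurable_continuous_onI continuous_intros)
  let ?g = "\<lambda>x. f (mtranspose x)"
  have "(\<integral>\<^sup>+x. f (x ** A) \<partial>lborel) = (\<integral>\<^sup>+x. f (mtranspose x ** A) \<partial>lborel)"
    by (rule nn_integral_transpose[symmetric]) (intro measurable_compose[OF measurable_matrix_mult(2) f])
  also have "\<dots> = (\<integral>\<^sup>+x. ?g (mtranspose A ** x) \<partial>lborel)"
    by (simp add: matrix_transpose_mul)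
  also have "\<dots> = ennreal (1 / \<bar>mdet (mtranspose A)\<bar> ^ CARD('r)) * (\<integral>\<^sup>+x. ?g x \<partial>lborel)"
    using A by (intro nn_integral_left_mult measurable_compose[OF t f]) simp
  also have "(\<integral>\<^sup>+x. ?g x \<partial>lborel) = (\<integral>\<^sup>+x. f x \<partial>lborel)"
    by (rule nn_integral_transpose[OF f])
  finally show ?thesis by simp
qed

text \<open>A vector is a matrix with one column, so the formula for left multiplication applies
  with exponent 1.\<close>

lemma nn_integral_mult_vec:
  fixes A :: "real^'n::finite^'n" and f :: "real^'n \<Rightarrow> ennreal"
  assumes A: "mdet A \<noteq> 0" and f[measurable]: "f \<in> borel_measurable borel"
  shows "(\<integral>\<^sup>+x. f (A *v x) \<partial>lborel) = ennreal (1 / \<bar>mdet A\<bar>) * (\<integral>\<^sup>+x. f x \<partial>lborel)"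
proof -
  have col: "(\<integral>\<^sup>+x. g x \<partial>lborel) = (\<integral>\<^sup>+x. g (\<chi> i. x $ i $ 1) \<partial>(lborel :: (real^1^'n) measure))"
    if g[measurable]: "g \<in> borel_measurable borel" for g :: "real^'n \<Rightarrow> ennreal"
  proof -
    have m[measurable]: "(\<lambda>u. \<chi> i. u i) \<in> measurable (lborel_fun UNIV) (borel :: (real^'n) measure)"
      by (intro measurable_vec_lambda) auto
    have m': "(\<lambda>x. \<chi> i. x $ i $ 1) \<in> measurable (borel :: (real^1^'n) measure) (borel :: (real^'n) measure)"
      by (intro borel_measurable_continuous_onI continuous_intros)
    have "bij_betw (\<lambda>i. (i, 1)) (UNIV :: 'n set) (UNIV :: ('n \<times> 1) set)"
      by (rule bij_betw_byWitness[where f'=fst]) (auto simp: num1_eq_iff)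
    from nn_integral_lborel_fun_reindex[OF _ this, of "\<lambda>u. g (\<chi> i. u i)"] show ?thesis
      using measurable_compose[OF m' g] by (simp add: nn_integral_lborel_vec nn_integral_lborel_matrix)
  qed
  have m': "(\<lambda>x. \<chi> i. x $ i $ 1) \<in> measurable (borel :: (real^1^'n) measure) (borel :: (real^'n) measure)"
    by (intro borel_measurable_continuous_onI continuous_intros)
  have mA: "(\<lambda>x. A *v x) \<in> borel_measurable borel"
    by (auto simp: matrix_vector_mult_def intro!: borel_measurable_continuous_onI continuous_intros)
  have "(\<integral>\<^sup>+x. f (A *v x) \<partial>lborel) = (\<integral>\<^sup>+x. f (A *v (\<chi> i. x $ i $ 1)) \<partial>(lborel :: (real^1^'n) measure))"
    by (rule col[OF measurable_compose[OF mA f]])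
  also have "\<dots> = (\<integral>\<^sup>+x. f (\<chi> i. (A ** x) $ i $ 1) \<partial>(lborel :: (real^1^'n) measure))"
    by (simp add: matrix_matrix_mult_def matrix_vector_mult_def)
  also have "\<dots> = ennreal (1 / \<bar>mdet A\<bar>) * (\<integral>\<^sup>+x. f (\<chi> i. x $ i $ 1) \<partial>(lborel :: (real^1^'n) measure))"
    using nn_integral_left_mult[OF A measurable_compose[OF m' f]] by simp
  finally show ?thesis by (simp add: col[OF f])
qed

lemma nn_integral_translate:
  fixes f :: "'a::euclidean_space \<Rightarrow> ennreal"
  assumes [measurable]: "f \<in> borel_measurable borel"
  shows "(\<integral>\<^sup>+x. f (t + x) \<partial>lborel) = (\<integral>\<^sup>+x. f x \<partial>lborel)"
  by (subst (2) lborel_distr_plus[of t, symmetric]) (simp add: nn_integral_distr)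

subsection \<open>Lebesgue measure on symmetric matrices\<close>

definition upper :: "('d::{finite,linorder} \<times> 'd) set" where
  "upper = {(i, j). i \<le> j}"

definition lborel_sym :: "('d::{finite,linorder}, 'd) rmat measure" where
  "lborel_sym = distr (lborel_fun upper) borel sym_of_upper"

lemma finite_upper [simp]: "finite upper"
  by simp

lemma sym_of_upper_measurable[measurable]: "sym_of_upper \<in> borel_measurable (lborel_fun upper)"
proof -
  have "(\<lambda>u. if i \<le> j then u (i, j) else u (j, i)) \<in> borel_measurable (lborel_fun upper)" for i j :: 'a
    by (cases "i \<le> j") (auto simp: upper_def)
  then show ?thesis unfolding sym_of_upper_def[abs_def] by (intro measurable_vec_lambda)
qed

lemma sym_of_upper_nth: "sym_of_upper u $ i $ j = u (min i j, max i j)"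
  by (simp add: sym_of_upper_def min_def max_def)

lemma nn_integral_lborel_sym:
  "f \<in> borel_measurable borel \<Longrightarrow> (\<integral>\<^sup>+S. f S \<partial>lborel_sym) = (\<integral>\<^sup>+u. f (sym_of_upper u) \<partial>lborel_fun upper)"
  unfolding lborel_sym_def by (simp add: nn_integral_distr)

lemma sym_of_upper_eqI:
  assumes "\<And>i j. i \<le> j \<Longrightarrow> S $ i $ j = v (i, j)" "\<And>i j. S $ i $ j = S $ j $ i"
  shows "S = sym_of_upper v"
  unfolding Finite_Cartesian_Product.vec_eq_iff
proof (intro allI)
  fix i j
  show "S $ i $ j = sym_of_upper v $ i $ j"
    using assms(1)[of i j] assms(1)[of j i] assms(2)[of i j] by (simp add: sym_of_upper_def)
qed

lemma congruence_nth: "(T ** S ** mtranspose T) $ i $ j = (\<Sum>k\<in>UNIV. \<Sum>l\<in>UNIV. T $ i $ k * S $ k $ l * T $ j $ l)"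
  for T :: "real^'d::finite^'d"
  by (subst sum.swap) (simp add: matrix_matrix_mult_def Finite_Cartesian_Product.transpose_def sum_distrib_right)

lemma congruence_nth2: "(T ** S ** mtranspose T) $ i $ j = (\<Sum>k\<in>UNIV. T $ i $ k * (\<Sum>l\<in>UNIV. T $ j $ l * S $ k $ l))"
  for T :: "real^'d::finite^'d"
  unfolding congruence_nth by (simp only: sum_distrib_left mult_ac)

lemma congruence_symmetric: "(T ** S ** mtranspose T) $ i $ j = (T ** S ** mtranspose T) $ j $ i"
  if "\<And>k l. S $ k $ l = S $ l $ k" for T :: "real^'d::finite^'d"
  unfolding congruence_nth by (subst sum.swap) (simp add: that mult_ac)

lemma sym_of_upper_symmetric: "sym_of_upper u $ k $ l = sym_of_upper u $ l $ k"
  by (simp add: sym_of_upper_nth min.commute max.commute)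

text \<open>An index \<open>i\<close> occurs as first component once for each
  \<open>j \<ge> i\<close> and as second component once for each \<open>j \<le> i\<close>; the pair
  \<open>(i, i)\<close> counts twice, which makes \<open>CARD('d) + 1\<close>. This is the source of
  the exponent in the Jacobian of a congruence.\<close>

lemma prod_upper_diagonal:
  fixes t :: "'d::{finite,linorder} \<Rightarrow> real"
  shows "(\<Prod>p\<in>upper. t (fst p) * t (snd p)) = (\<Prod>i\<in>UNIV. t i) ^ (CARD('d) + 1)"
proof -
  have sg: "(\<Prod>p\<in>(SIGMA i:UNIV. A i). t (fst p)) = (\<Prod>i\<in>UNIV. t i ^ card (A i))" for A :: "'d \<Rightarrow> 'd set"
    using prod.Sigma[of UNIV A "\<lambda>x y. t x"] by (simp add: split_beta)
  have 1: "(\<Prod>p\<in>upper. t (fst p)) = (\<Prod>i\<in>UNIV. t i ^ card {j. i \<le> j})"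
  proof -
    have "upper = (SIGMA i:UNIV. {j::'d. i \<le> j})" by (auto simp: upper_def)
    then show ?thesis using sg[of "\<lambda>i. {j. i \<le> j}"] by metis
  qed
  have 2: "(\<Prod>p\<in>upper. t (snd p)) = (\<Prod>j\<in>UNIV. t j ^ card {i. i \<le> j})"
  proof -
    have "(\<Prod>p\<in>upper. t (snd p)) = (\<Prod>p\<in>(SIGMA j:UNIV. {i::'d. i \<le> j}). t (fst p))"
      by (rule prod.reindex_bij_witness[of _ prod.swap prod.swap]) (auto simp: upper_def)
    then show ?thesis by (simp add: sg)
  qed
  have "card {j. i \<le> j} + card {j. j \<le> i} = CARD('d) + 1" for i :: 'd
  proof -
    have "{j. i \<le> j} \<union> {j. j \<le> i} = UNIV" "{j. i \<le> j} \<inter> {j. j \<le> i} = {i}" by auto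
    then show ?thesis using card_Un_Int[of "{j. i \<le> j}" "{j. j \<le> i}"] by simp
  qed
  then have "(\<Prod>i\<in>UNIV. t i ^ card {j. i \<le> j}) * (\<Prod>i\<in>UNIV. t i ^ card {j. j \<le> i}) = (\<Prod>i\<in>UNIV. t i ^ (CARD('d) + 1))"
    by (simp only: prod.distrib[symmetric] power_add[symmetric])
  then show ?thesis
    by (simp only: prod.distrib[of "\<lambda>p. t (fst p)"] 1 2 prod_power_distrib)
qed

lemma nn_integral_congruence:
  fixes T :: "('d::{finite,linorder}, 'd) rmat" and f :: "('d, 'd) rmat \<Rightarrow> ennreal"
  assumes "mdet T \<noteq> 0" and "f \<in> borel_measurable borel"
  shows "(\<integral>\<^sup>+S. f (T ** S ** mtranspose T) \<partial>lborel_sym)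
     = ennreal (1 / \<bar>mdet T\<bar> ^ (CARD('d) + 1)) * (\<integral>\<^sup>+S. f S \<partial>lborel_sym)"
  using assms
proof (induction T arbitrary: f rule: induct_invertible_matrix)
  case (mult A B)
  let ?c = "\<lambda>(A :: ('d, 'd) rmat) S. A ** S ** mtranspose A"
  have m: "?c A \<in> borel_measurable borel" for A
    by (rule measurable_compose[OF measurable_matrix_mult(1) measurable_matrix_mult(2)])
  have "?c (A ** B) S = ?c A (?c B S)" for S
    by (simp add: matrix_transpose_mul matrix_mul_assoc)
  then have "(\<integral>\<^sup>+S. f (?c (A ** B) S) \<partial>lborel_sym) = (\<integral>\<^sup>+S. f (?c A (?c B S)) \<partial>lborel_sym)"
    by simp
  also have "\<dots> = ennreal (1 / \<bar>mdet B\<bar> ^ (CARD('d) + 1)) * (\<integral>\<^sup>+S. f (?c A S) \<partial>lborel_sym)"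
    by (rule mult(4)[OF measurable_compose[OF m mult(5)]])
  also have "(\<integral>\<^sup>+S. f (?c A S) \<partial>lborel_sym) = ennreal (1 / \<bar>mdet A\<bar> ^ (CARD('d) + 1)) * (\<integral>\<^sup>+S. f S \<partial>lborel_sym)"
    by (rule mult(3)[OF mult(5)])
  finally show ?case
    by (simp only: det_mul abs_mult power_mult_distrib ennreal_inverse_mult_assoc abs_ge_zero zero_le_power
        mult.commute[of "\<bar>mdet A\<bar> ^ _"])
next
  case (diagonal t)
  let ?T = "(\<chi> i j. if i = j then t i else 0) :: ('d, 'd) rmat"
  let ?\<Phi> = "\<lambda>u p. if p \<in> upper then (t (fst p) * t (snd p)) * u p + 0 else u p"
  have "?T ** sym_of_upper u ** mtranspose ?T = sym_of_upper (?\<Phi> u)" for u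
  proof (rule sym_of_upper_eqI)
    fix i j :: 'd assume "i \<le> j"
    have row: "(\<Sum>k\<in>UNIV. ?T $ i $ k * g k) = t i * g i" for i and g :: "'d \<Rightarrow> real"
      by (simp add: if_distrib[of "\<lambda>x. x * _"] cong: if_cong)
    show "(?T ** sym_of_upper u ** mtranspose ?T) $ i $ j = ?\<Phi> u (i, j)"
      unfolding congruence_nth2 row using \<open>i \<le> j\<close> by (simp add: sym_of_upper_def upper_def)
  qed (rule congruence_symmetric, rule sym_of_upper_symmetric)
  then have "(\<integral>\<^sup>+S. f (?T ** S ** mtranspose ?T) \<partial>lborel_sym) = (\<integral>\<^sup>+u. f (sym_of_upper (?\<Phi> u)) \<partial>lborel_fun upper)"
    using diagonal(2) measurable_compose[OF measurable_compose[OF measurable_matrix_mult(1)] measurable_compose[OF measurable_matrix_mult(2)]]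
    by (subst nn_integral_lborel_sym)
      (auto intro!: measurable_compose[OF measurable_matrix_mult(1)] measurable_compose[OF measurable_matrix_mult(2)])
  also have "\<dots> = ennreal (1 / (\<Prod>p\<in>upper. \<bar>t (fst p) * t (snd p)\<bar>)) * (\<integral>\<^sup>+u. f (sym_of_upper u) \<partial>lborel_fun upper)"
    using diagonal by (intro nn_integral_lborel_fun_affine measurable_compose[OF sym_of_upper_measurable]) auto
  also have "(\<Prod>p\<in>upper. \<bar>t (fst p) * t (snd p)\<bar>) = \<bar>mdet ?T\<bar> ^ (CARD('d) + 1)"
    unfolding det_diagonal_matrix abs_prod[symmetric] prod_upper_diagonal by (simp add: power_abs abs_mult)
  finally show ?case using diagonal(2) by (simp add: nn_integral_lborel_sym)
next
  case (swap m n)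
  let ?\<tau> = "Transposition.transpose m n"
  let ?T = "(\<chi> i j. if j = ?\<tau> i then 1 else 0) :: ('d, 'd) rmat"
  \<comment> \<open>\<open>min\<close> and \<open>max\<close> bring a permuted pair back on or above
    the diagonal.\<close>
  let ?\<sigma> = "\<lambda>p. (min (?\<tau> (fst p)) (?\<tau> (snd p)), max (?\<tau> (fst p)) (?\<tau> (snd p)))"
  have "?T ** sym_of_upper u ** mtranspose ?T = sym_of_upper (\<lambda>p\<in>upper. u (?\<sigma> p))" for u
  proof (rule sym_of_upper_eqI)
    fix i j :: 'd assume "i \<le> j"
    then show "(?T ** sym_of_upper u ** mtranspose ?T) $ i $ j = (\<lambda>p\<in>upper. u (?\<sigma> p)) (i, j)"
      unfolding congruence_nth
      by (simp add: sym_of_upper_nth upper_def if_distrib[of "\<lambda>x. x * _"] if_distrib[of "\<lambda>x. _ * x"] cong: if_cong)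
  qed (rule congruence_symmetric, rule sym_of_upper_symmetric)
  then have "(\<integral>\<^sup>+S. f (?T ** S ** mtranspose ?T) \<partial>lborel_sym) = (\<integral>\<^sup>+u. f (sym_of_upper (\<lambda>p\<in>upper. u (?\<sigma> p))) \<partial>lborel_fun upper)"
    using swap(2)
    by (subst nn_integral_lborel_sym)
      (auto intro!: measurable_compose[OF measurable_matrix_mult(1)] measurable_compose[OF measurable_matrix_mult(2)])
  also have "\<dots> = (\<integral>\<^sup>+u. f (sym_of_upper u) \<partial>lborel_fun upper)"
  proof (rule nn_integral_lborel_fun_reindex[OF finite_upper])
    have "?\<sigma> (?\<sigma> p) = p" "?\<sigma> p \<in> upper" if "p \<in> upper" for p
      using that by (cases p; auto simp: upper_def min_def max_def)+
    then show "bij_betw ?\<sigma> upper upper"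
      by (intro bij_betw_byWitness[where f'="?\<sigma>"]) auto
  qed (intro measurable_compose[OF sym_of_upper_measurable] swap(2))
  finally show ?case using swap(2) det_swap_matrix[OF swap(1)] by (simp add: nn_integral_lborel_sym)
next
  case (shear m n)
  let ?T = "(\<chi> i j. if i = m \<and> j = n \<or> i = j then 1 else 0) :: ('d, 'd) rmat"
  \<comment> \<open>The shear adds row and column \<open>n\<close> to row and column
    \<open>m\<close>. Entry \<open>(m, m)\<close> reads the old entry at \<open>m\<close> and
    \<open>n\<close>, so \<open>?\<Phi>2\<close> acts before that one changes; the entries in
    \<open>?F\<close>, with exactly one index \<open>m\<close>, read only entries without
    \<open>m\<close>.\<close>
  let ?F = "{p \<in> upper. (fst p = m) \<noteq> (snd p = m)}"
  let ?o = "\<lambda>p. if fst p = m then snd p else fst p"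
  let ?\<Phi>1 = "\<lambda>u p. if p \<in> ?F then 1 * u p + u (min n (?o p), max n (?o p)) else u p"
  let ?\<Phi>2 = "\<lambda>u p. if p \<in> {(m, m)} then 1 * u p + (2 * u (min m n, max m n) + u (n, n)) else u p"
  have "?T ** sym_of_upper u ** mtranspose ?T = sym_of_upper (?\<Phi>1 (?\<Phi>2 u))" for u
  proof (rule sym_of_upper_eqI)
    fix i j :: 'd assume ij: "i \<le> j"
    have row: "(\<Sum>k\<in>UNIV. ?T $ i $ k * g k) = g i + (if i = m then g n else 0)" for i and g :: "'d \<Rightarrow> real"
    proof -
      have "(\<Sum>k\<in>UNIV. ?T $ i $ k * g k) = (\<Sum>k\<in>UNIV. (if k = i then g k else 0) + (if k = n then (if i = m then g k else 0) else 0))"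
        using shear(1) by (intro sum.cong) auto
      then show ?thesis by (simp add: sum.distrib)
    qed
    have "(?T ** sym_of_upper u ** mtranspose ?T) $ i $ j
        = (\<Sum>k\<in>UNIV. ?T $ i $ k * (\<Sum>l\<in>UNIV. ?T $ j $ l * sym_of_upper u $ k $ l))"
      by (rule congruence_nth2)
    also have "\<dots> = ?\<Phi>1 (?\<Phi>2 u) (i, j)"
      unfolding row using ij shear(1)
      by (auto simp: sym_of_upper_nth upper_def min_def max_def)
    finally show "(?T ** sym_of_upper u ** mtranspose ?T) $ i $ j = ?\<Phi>1 (?\<Phi>2 u) (i, j)" .
  qed (rule congruence_symmetric, rule sym_of_upper_symmetric)
  then have "(\<integral>\<^sup>+S. f (?T ** S ** mtranspose ?T) \<partial>lborel_sym) = (\<integral>\<^sup>+u. f (sym_of_upper (?\<Phi>1 (?\<Phi>2 u))) \<partial>lborel_fun upper)"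
    using shear(2)
    by (subst nn_integral_lborel_sym)
      (auto intro!: measurable_compose[OF measurable_matrix_mult(1)] measurable_compose[OF measurable_matrix_mult(2)])
  also have "\<dots> = ennreal (1 / (\<Prod>p\<in>{(m, m)}. \<bar>1\<bar>)) * (\<integral>\<^sup>+u. f (sym_of_upper (?\<Phi>1 u)) \<partial>lborel_fun upper)"
  proof (rule nn_integral_lborel_fun_affine[OF finite_upper])
    have "?\<Phi>1 \<in> measurable (lborel_fun upper) (lborel_fun upper)"
    proof (rule measurable_PiM_single')
      fix p :: "'d \<times> 'd" assume "p \<in> upper"
      then show "(\<lambda>u. ?\<Phi>1 u p) \<in> measurable (lborel_fun upper) lborel"
        by (cases "p \<in> ?F") (auto simp: upper_def min_def max_def)
    qed (auto simp: space_PiM PiE_iff extensional_def)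
    then show "(\<lambda>u. f (sym_of_upper (?\<Phi>1 u))) \<in> borel_measurable (lborel_fun upper)"
      by (rule measurable_compose[OF _ measurable_compose[OF sym_of_upper_measurable shear(2)]])
  qed (use shear(1) in \<open>auto simp: upper_def min_def max_def intro!: borel_measurable_add borel_measurable_times\<close>)
  also have "(\<integral>\<^sup>+u. f (sym_of_upper (?\<Phi>1 u)) \<partial>lborel_fun upper) = ennreal (1 / (\<Prod>p\<in>?F. \<bar>1\<bar>)) * (\<integral>\<^sup>+u. f (sym_of_upper u) \<partial>lborel_fun upper)"
    by (rule nn_integral_lborel_fun_affine[OF finite_upper _ _ _ measurable_compose[OF sym_of_upper_measurable shear(2)]])
      (use shear(1) in \<open>auto simp: upper_def min_def max_def\<close>)
  finally show ?case using shear det_shear_matrix[OF shear(1)] by (simp add: nn_integral_lborel_sym)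
qed

subsection \<open>Positive definite matrices\<close>

lemma inner_matrix_transpose: "x \<bullet> (A *v y) = (mtranspose A *v x) \<bullet> y" for A :: "real^'n::finite^'m::finite"
  by (simp add: dot_lmul_matrix[symmetric] transpose_matrix_vector)

lemma matrix_inv_eqI: "A ** B = id_mat \<Longrightarrow> matrix_inv A = B" for A B :: "real^'n::finite^'n"
proof -
  assume AB: "A ** B = id_mat"
  then have BA: "B ** A = id_mat" by (simp add: matrix_left_right_inverse)
  have "A ** matrix_inv A = id_mat \<and> matrix_inv A ** A = id_mat"
    unfolding matrix_inv_def by (rule someI[of _ B]) (simp add: AB BA)
  then have "B ** (A ** matrix_inv A) = B" by simp
  then show ?thesis by (simp add: matrix_mul_assoc BA)
qed

lemma matrix_inv_inverse:
  fixes A :: "real^'n::finite^'n"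
  assumes "mdet A \<noteq> 0"
  shows "A ** matrix_inv A = id_mat" "matrix_inv A ** A = id_mat"
proof -
  obtain B where "A ** B = id_mat"
    using assms by (auto simp: invertible_det_nz[symmetric] invertible_def)
  then show "A ** matrix_inv A = id_mat" "matrix_inv A ** A = id_mat"
    using matrix_inv_eqI by (auto simp: matrix_left_right_inverse)
qed

lemma spd_D:
  assumes "N \<in> spd_matrices"
  shows "mtranspose N = N" "v \<noteq> 0 \<Longrightarrow> 0 < v \<bullet> (N *v v)" "u \<bullet> (N *v v) = (N *v u) \<bullet> v"
proof -
  show t: "mtranspose N = N" and "v \<noteq> 0 \<Longrightarrow> 0 < v \<bullet> (N *v v)"
    using assms by (simp_all only: spd_matrices_def mem_Collect_eq) blast
  show "u \<bullet> (N *v v) = (N *v u) \<bullet> v" using inner_matrix_transpose[of u N v] t by simp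
qed

text \<open>Gram-Schmidt for the inner product of \<open>N\<close>: while fewer than
  \<open>CARD('n)\<close> vectors are chosen, some nonzero \<open>x\<close> is orthogonal to all
  \<open>N *v v j\<close>. The resulting congruence to the identity takes the place of a
  diagonalization for determinants, traces and Gaussian integrals.\<close>

lemma spd_orthonormal_basis:
  fixes N :: "real^'n::finite^'n"
  assumes N: "N \<in> spd_matrices"
  obtains V :: "real^'n^'n" where "mtranspose V ** N ** V = id_mat"
proof -
  have "\<exists>v :: 'n \<Rightarrow> real^'n. \<forall>i\<in>S. \<forall>j\<in>S. v i \<bullet> (N *v v j) = (if i = j then 1 else 0)" for S :: "'n set"
    using finite[of S]
  proof (induction S)
    case (insert k S)
    then obtain v :: "'n \<Rightarrow> real^'n" where v: "\<And>i j. i \<in> S \<Longrightarrow> j \<in> S \<Longrightarrow> v i \<bullet> (N *v v j) = (if i = j then 1 else 0)"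
      by blast
    have "dim ((\<lambda>j. N *v v j) ` S) \<le> card ((\<lambda>j. N *v v j) ` S)" by (intro dim_le_card') simp
    also have "\<dots> \<le> card S" by (rule card_image_le) simp
    also have "\<dots> < CARD('n)" using insert.hyps(2) by (intro psubset_card_mono) auto
    finally have "dim ((\<lambda>j. N *v v j) ` S) < DIM(real^'n)" by simp
    then obtain x where x0: "x \<noteq> 0" "\<And>y. y \<in> span ((\<lambda>j. N *v v j) ` S) \<Longrightarrow> Linear_Algebra.orthogonal x y"
      using orthogonal_to_subspace_exists by blast
    have x: "x \<noteq> 0" "\<And>j. j \<in> S \<Longrightarrow> x \<bullet> (N *v v j) = 0"
      using x0 by (auto simp: Linear_Algebra.orthogonal_def[symmetric] intro: span_base)
    define c where "c = sqrt (x \<bullet> (N *v x))"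
    have c: "0 < c" "x \<bullet> (N *v x) = c * c" using spd_D(2)[OF N x(1)] by (auto simp: c_def)
    have x': "v j \<bullet> (N *v x) = 0" if "j \<in> S" for j
      using x(2)[OF that] spd_D(3)[OF N, of "v j" x] by (metis inner_commute)
    have "inverse c * (inverse c * (c * c)) = 1" using c(1) by (simp add: field_simps)
    then show ?case
      using insert.hyps(2) v x x' c
      by (intro exI[of _ "v(k := x /\<^sub>R c)"]) (auto simp: matrix_vector_mult_scaleR)
  qed simp
  from this[of UNIV] obtain v :: "'n \<Rightarrow> real^'n" where v: "\<And>i j. v i \<bullet> (N *v v j) = (if i = j then 1 else 0)"
    by auto
  have "mtranspose (\<chi> i j. v j $ i) ** N ** (\<chi> i j. v j $ i) = id_mat"
  proof -
    have "(mtranspose (\<chi> i j. v j $ i) ** N ** (\<chi> i j. v j $ i)) $ i $ j = v i \<bullet> (N *v v j)" for i j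
      unfolding matrix_mul_assoc[symmetric]
      by (simp add: matrix_matrix_mult_def matrix_vector_mult_def Finite_Cartesian_Product.transpose_def inner_vec_def)
    then show ?thesis by (simp add: Finite_Cartesian_Product.vec_eq_iff v Finite_Cartesian_Product.mat_def)
  qed
  then show thesis by (rule that)
qed

lemma spd_det_pos:
  fixes N :: "real^'n::finite^'n"
  assumes "N \<in> spd_matrices"
  shows "0 < mdet N"
proof -
  obtain V :: "real^'n^'n" where "mtranspose V ** N ** V = id_mat"
    using assms by (rule spd_orthonormal_basis)
  from arg_cong[OF this, of mdet]
  have "mdet V * mdet N * mdet V = 1"
    by (simp add: det_mul)
  then have "mdet N * (mdet V)\<^sup>2 = 1" by (simp add: power2_eq_square mult_ac)
  then have "0 < mdet N * (mdet V)\<^sup>2" by simp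
  then show ?thesis by (simp add: zero_less_mult_iff)
qed

lemma spd_inv:
  fixes N :: "real^'n::finite^'n"
  assumes "N \<in> spd_matrices"
  shows "N ** matrix_inv N = id_mat" "matrix_inv N ** N = id_mat"
    "matrix_inv N \<in> spd_matrices"
proof -
  show N: "N ** matrix_inv N = id_mat" "matrix_inv N ** N = id_mat"
    using matrix_inv_inverse spd_det_pos[OF assms] by (metis less_irrefl)+
  have "N ** mtranspose (matrix_inv N) = id_mat"
    using arg_cong[OF N(2), of mtranspose] spd_D(1)[OF assms]
    by (simp add: matrix_transpose_mul)
  then have t: "mtranspose (matrix_inv N) = matrix_inv N"
    by (metis matrix_inv_eqI)
  have "0 < v \<bullet> (matrix_inv N *v v)" if "v \<noteq> 0" for v
  proof -
    let ?u = "matrix_inv N *v v"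
    have v: "v = N *v ?u" by (simp add: matrix_vector_mul_assoc N)
    then have "?u \<noteq> 0" using that by (metis matrix_vector_mult_0_right)
    then have "0 < ?u \<bullet> (N *v ?u)" by (rule spd_D(2)[OF assms])
    then show ?thesis using v by (simp add: inner_commute)
  qed
  with t show "matrix_inv N \<in> spd_matrices" by (simp add: spd_matrices_def)
qed

lemma spd_congruence_iff:
  fixes T :: "real^'n::finite^'n"
  assumes T: "mdet T \<noteq> 0"
  shows "T ** N ** mtranspose T \<in> spd_matrices \<longleftrightarrow> N \<in> spd_matrices"
proof -
  have imp: "T ** N ** mtranspose T \<in> spd_matrices"
    if N: "N \<in> spd_matrices" and T: "mdet T \<noteq> 0" for T N :: "real^'n^'n"
  proof -
    have "0 < v \<bullet> ((T ** N ** mtranspose T) *v v)" if "v \<noteq> 0" for v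
    proof -
      let ?u = "mtranspose T *v v"
      have "matrix_inv (mtranspose T) *v ?u = v"
        using T by (simp add: matrix_vector_mul_assoc matrix_inv_inverse del: transpose_matrix_vector)
      then have "?u \<noteq> 0" using that by (metis matrix_vector_mult_0_right)
      then have "0 < ?u \<bullet> (N *v ?u)" by (rule spd_D(2)[OF N])
      also have "\<dots> = v \<bullet> ((T ** N ** mtranspose T) *v v)"
        by (simp add: inner_matrix_transpose[of v T] matrix_vector_mul_assoc[symmetric])
      finally show ?thesis .
    qed
    then show ?thesis using spd_D(1)[OF N] by (simp add: spd_matrices_def matrix_transpose_mul matrix_mul_assoc)
  qed
  have undo: "matrix_inv T ** (T ** N ** mtranspose T) ** mtranspose (matrix_inv T) = N"
  proof -
    have "mtranspose T ** mtranspose (matrix_inv T) = id_mat"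
      using matrix_inv_inverse(2)[OF T] by (simp add: matrix_transpose_mul[symmetric])
    moreover have "matrix_inv T ** (T ** N ** mtranspose T) ** mtranspose (matrix_inv T)
      = (matrix_inv T ** T) ** N ** (mtranspose T ** mtranspose (matrix_inv T))"
      by (simp only: matrix_mul_assoc)
    ultimately show ?thesis using matrix_inv_inverse(2)[OF T] by simp
  qed
  have "mdet (matrix_inv T) \<noteq> 0"
    using matrix_inv_inverse(2)[OF T] by (metis det_I det_mul mult_zero_left zero_neq_one)
  then show ?thesis using imp[OF _ T] imp[of "T ** N ** mtranspose T" "matrix_inv T"] undo by metis
qed

text \<open>Since \<open>matrix_inv N = V ** mtranspose V\<close>, the trace is the sum of the
  values of the form of \<open>D\<close> at the columns of \<open>V\<close>. It serves to compare
  densities whose scatter matrices are ordered as quadratic forms.\<close>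

lemma trace_spd_inv_nonneg:
  fixes N D :: "real^'n::finite^'n"
  assumes N: "N \<in> spd_matrices" and D: "\<And>v. 0 \<le> v \<bullet> (D *v v)"
  shows "0 \<le> mtrace (matrix_inv N ** D)"
proof -
  obtain V :: "real^'n^'n" where V: "mtranspose V ** N ** V = id_mat"
    using N by (rule spd_orthonormal_basis)
  then have "V ** mtranspose V ** N = id_mat"
    by (metis matrix_left_right_inverse matrix_mul_assoc)
  then have "N ** (V ** mtranspose V) = id_mat"
    by (simp add: matrix_left_right_inverse)
  then have "matrix_inv N = V ** mtranspose V" by (rule matrix_inv_eqI)
  then have "mtrace (matrix_inv N ** D) = mtrace (mtranspose V ** D ** V)"
    by (metis matrix_mul_assoc trace_mul_sym)
  also have "\<dots> = (\<Sum>i\<in>UNIV. (\<chi> k. V $ k $ i) \<bullet> (D *v (\<chi> k. V $ k $ i)))"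
    unfolding Determinants.trace_def matrix_mul_assoc[symmetric]
    by (simp add: matrix_matrix_mult_def matrix_vector_mult_def Finite_Cartesian_Product.transpose_def inner_vec_def)
  also have "\<dots> \<ge> 0" by (intro sum_nonneg D)
  finally show ?thesis .
qed

subsection \<open>Gaussian integrals\<close>

definition gauss_const :: "'n::finite itself \<Rightarrow> real" where
  "gauss_const _ = sqrt (2 * pi) ^ CARD('n)"

lemma nn_integral_gauss_standard:
  "(\<integral>\<^sup>+x. ennreal (exp (- (x \<bullet> x) / 2)) \<partial>(lborel :: (real^'n::finite) measure)) = ennreal (gauss_const TYPE('n))"
proof -
  have 1: "(\<integral>\<^sup>+t. ennreal (exp (- (t * t) / 2)) \<partial>lborel) = ennreal (sqrt (2 * pi))"
  proof -
    have "(\<integral>\<^sup>+t. ennreal (std_normal_density t) \<partial>lborel) = 1"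
      using prob_space.emeasure_space_1[OF prob_space_normal_density[of 1 0]]
      by (simp add: emeasure_density)
    have "(\<integral>\<^sup>+t. ennreal (exp (- (t * t) / 2)) \<partial>lborel) = (\<integral>\<^sup>+t. ennreal (sqrt (2 * pi)) * ennreal (std_normal_density t) \<partial>lborel)"
      by (intro nn_integral_cong) (simp add: ennreal_mult[symmetric] std_normal_density_def power2_eq_square)
    also have "\<dots> = ennreal (sqrt (2 * pi)) * 1"
      using \<open>(\<integral>\<^sup>+t. ennreal (std_normal_density t) \<partial>lborel) = 1\<close> by (subst nn_integral_cmult) auto
    finally show ?thesis by simp
  qed
  have "(\<integral>\<^sup>+x. ennreal (exp (- (x \<bullet> x) / 2)) \<partial>(lborel :: (real^'n) measure))
      = (\<integral>\<^sup>+u. (\<Prod>i\<in>UNIV. ennreal (exp (- (u i * u i) / 2))) \<partial>lborel_fun (UNIV :: 'n set))"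
    by (subst nn_integral_lborel_vec) (auto simp: inner_vec_def prod_ennreal exp_sum[symmetric] sum_negf sum_divide_distrib intro!: nn_integral_cong)
  also have "\<dots> = (\<Prod>i\<in>(UNIV::'n set). (\<integral>\<^sup>+t. ennreal (exp (- (t * t) / 2)) \<partial>lborel))"
    by (rule PL.product_nn_integral_prod) auto
  finally show ?thesis by (simp only: 1 gauss_const_def ennreal_power prod_constant real_sqrt_ge_zero)
      (simp add: ennreal_power)
qed

lemma gauss_const_pos: "0 < gauss_const TYPE('n::finite)"
  by (simp add: gauss_const_def)

lemma nn_integral_gauss:
  fixes N :: "real^'n::finite^'n"
  assumes N: "N \<in> spd_matrices"
  shows "(\<integral>\<^sup>+x. ennreal (exp (- (x \<bullet> (N *v x)) / 2)) \<partial>lborel) = ennreal (gauss_const TYPE('n) * mdet N powr (- 1 / 2))"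
proof -
  obtain V :: "real^'n^'n" where V: "mtranspose V ** N ** V = id_mat"
    using N by (rule spd_orthonormal_basis)
  from arg_cong[OF this, of mdet]
  have "mdet V * mdet N * mdet V = 1"
    by (simp add: det_mul)
  then have V1: "mdet N * (mdet V)\<^sup>2 = 1" by (simp add: power2_eq_square mult_ac)
  then have V0: "mdet V \<noteq> 0" by auto
  have dV: "mdet N = (1 / \<bar>mdet V\<bar>)\<^sup>2" using V0 V1 by (simp add: field_simps power_divide)
  have m: "(\<lambda>x. ennreal (exp (- (x \<bullet> (N *v x)) / 2))) \<in> borel_measurable borel"
    by (auto simp: matrix_vector_mult_def intro!: measurable_compose[OF _ measurable_ennreal] borel_measurable_continuous_onI continuous_intros)
  have "(V *v x) \<bullet> (N *v (V *v x)) = x \<bullet> x" for x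
  proof -
    have "(V *v x) \<bullet> (N *v (V *v x)) = (mtranspose (mtranspose V) *v x) \<bullet> (N *v (V *v x))" by simp
    also have "\<dots> = x \<bullet> (mtranspose V *v (N *v (V *v x)))"
      by (rule inner_matrix_transpose[symmetric])
    also have "\<dots> = x \<bullet> ((mtranspose V ** N ** V) *v x)"
      by (simp add: matrix_vector_mul_assoc matrix_mul_assoc)
    finally show ?thesis by (simp add: V)
  qed
  then have "ennreal (gauss_const TYPE('n)) = ennreal (1 / \<bar>mdet V\<bar>) * (\<integral>\<^sup>+x. ennreal (exp (- (x \<bullet> (N *v x)) / 2)) \<partial>lborel)"
    using nn_integral_mult_vec[OF V0 m] nn_integral_gauss_standard[where 'n='n] by simp
  then have "ennreal \<bar>mdet V\<bar> * ennreal (gauss_const TYPE('n))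
      = ennreal \<bar>mdet V\<bar> * (ennreal (1 / \<bar>mdet V\<bar>) * (\<integral>\<^sup>+x. ennreal (exp (- (x \<bullet> (N *v x)) / 2)) \<partial>lborel))"
    by simp
  also have "\<dots> = (\<integral>\<^sup>+x. ennreal (exp (- (x \<bullet> (N *v x)) / 2)) \<partial>lborel)"
    using V0 by (simp add: mult.assoc[symmetric] ennreal_mult[symmetric])
  moreover have "mdet N powr (- 1 / 2) = \<bar>mdet V\<bar>"
    using V0 by (simp add: dV powr_minus_divide powr_half_sqrt real_sqrt_divide)
  ultimately show ?thesis
    using gauss_const_pos[where 'n='n] by (simp add: ennreal_mult[symmetric] mult.commute)
qed

subsection \<open>Gaussian marginals\<close>

definition coord_mask :: "'d set \<Rightarrow> real^'d::finite \<Rightarrow> real^'d" where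
  "coord_mask U v = (\<chi> j. if j \<in> U then v $ j else 0)"

text \<open>The principal submatrix on \<open>U\<close> without a change of type: the identity fills
  the rest, so the determinant is that of the submatrix and the inverse restricted to
  \<open>U\<close> is its inverse. \<open>block_form\<close> is accordingly the quadratic form of
  the inverse submatrix at the part of \<open>e\<close> on \<open>U\<close>.\<close>

definition pad_block :: "'d set \<Rightarrow> real^'d::finite^'d \<Rightarrow> real^'d^'d" where
  "pad_block U S = (\<chi> i j. if i \<in> U \<and> j \<in> U then S $ i $ j else if i = j then 1 else 0)"

definition block_form :: "'d set \<Rightarrow> real^'d::finite^'d \<Rightarrow> real^'d \<Rightarrow> real" where
  "block_form U S e = coord_mask U e \<bullet> (matrix_inv (pad_block U S) *v coord_mask U e)"

lemma coord_mask_simps: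
  "coord_mask U (coord_mask U v) = coord_mask U v" "coord_mask U (coord_mask (-U) v) = 0" "coord_mask (-U) (coord_mask U v) = 0"
  "coord_mask U v + coord_mask (-U) v = v" "coord_mask U (u + v) = coord_mask U u + coord_mask U v" "coord_mask U (u - v) = coord_mask U u - coord_mask U v"
  "u \<bullet> coord_mask U v = coord_mask U u \<bullet> v"
  by (auto simp: coord_mask_def Finite_Cartesian_Product.vec_eq_iff inner_vec_def intro!: sum.neutral sum.cong)

lemma pad_block_mult: "pad_block U S *v v = coord_mask U (S *v coord_mask U v) + coord_mask (-U) v"
proof -
  have "(\<Sum>j\<in>UNIV. (if i \<in> U \<and> j \<in> U then S $ i $ j else if i = j then 1 else 0) * v $ j)
      = (if i \<in> U then (\<Sum>j\<in>UNIV. S $ i $ j * (if j \<in> U then v $ j else 0)) else v $ i)" for i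
    by (auto simp: if_distrib[of "\<lambda>x. x * _"] intro!: sum.cong cong: if_cong)
  then show ?thesis
    by (auto simp: Finite_Cartesian_Product.vec_eq_iff pad_block_def coord_mask_def matrix_vector_mult_def)
qed

lemma coord_mask_eq_0: "coord_mask U v = 0 \<Longrightarrow> coord_mask (-U) v = 0 \<Longrightarrow> v = 0"
  by (metis add_0 coord_mask_simps(4))

lemma pad_block_spd: assumes S: "S \<in> spd_matrices" shows "pad_block U S \<in> spd_matrices"
proof -
  have sym: "S $ i $ j = S $ j $ i" for i j
    using arg_cong[OF spd_D(1)[OF S], of "\<lambda>A. A $ j $ i"] by (simp add: Finite_Cartesian_Product.transpose_def)
  have "0 < v \<bullet> (pad_block U S *v v)" if "v \<noteq> 0" for v
  proof -
    have "v \<bullet> (pad_block U S *v v) = coord_mask U v \<bullet> (S *v coord_mask U v) + coord_mask (-U) v \<bullet> coord_mask (-U) v"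
      by (simp add: pad_block_mult inner_add_right coord_mask_simps)
    moreover have "0 \<le> coord_mask U v \<bullet> (S *v coord_mask U v)" "coord_mask U v \<noteq> 0 \<Longrightarrow> 0 < coord_mask U v \<bullet> (S *v coord_mask U v)"
      using spd_D(2)[OF S, of "coord_mask U v"] by (cases "coord_mask U v = 0"; simp)+
    ultimately show ?thesis using that coord_mask_eq_0[of U v]
      by (metis add.commute add_nonneg_pos add_pos_nonneg inner_ge_zero inner_gt_zero_iff)
  qed
  then show ?thesis
    by (auto simp: spd_matrices_def pad_block_def Finite_Cartesian_Product.transpose_def Finite_Cartesian_Product.vec_eq_iff sym)
qed

text \<open>A permutation contributing to either determinant fixes \<open>U\<close> pointwise, hence only
  uses the entries on which the matrices agree.\<close>

lemma det_block_cong: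
  fixes A B :: "real^'n::finite^'n"
  assumes "\<And>i j. i \<in> U \<Longrightarrow> A $ i $ j = (if i = j then 1 else 0)" "\<And>i j. i \<in> U \<Longrightarrow> B $ i $ j = (if i = j then 1 else 0)"
    and "\<And>i j. i \<notin> U \<Longrightarrow> j \<notin> U \<Longrightarrow> A $ i $ j = B $ i $ j"
  shows "mdet A = mdet B"
  unfolding Determinants.det_def
proof (rule sum.cong[OF refl])
  fix p assume "p \<in> {p. p permutes (UNIV :: 'n set)}"
  then have p: "inj p" by (simp add: permutes_inj)
  have "(\<Prod>i\<in>UNIV. A $ i $ p i) = (\<Prod>i\<in>UNIV. B $ i $ p i)"
  proof (cases "\<forall>i\<in>U. p i = i")
    case True
    then have "p i \<notin> U" if "i \<notin> U" for i using p that by (metis injD)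
    then show ?thesis using assms True by (intro prod.cong) (metis, metis)
  next
    case False
    then obtain i where "i \<in> U" "p i \<noteq> i" by blast
    then have "A $ i $ p i = 0" "B $ i $ p i = 0" using assms by auto
    then have "(\<Prod>i\<in>UNIV. A $ i $ p i) = 0" "(\<Prod>i\<in>UNIV. B $ i $ p i) = 0" by (auto intro!: prod_zero)
    then show ?thesis by (simp only:)
  qed
  then show "of_int (sign p) * (\<Prod>i\<in>UNIV. A $ i $ p i) = of_int (sign p) * (\<Prod>i\<in>UNIV. B $ i $ p i)" by simp
qed

text \<open>Jacobi's identity for complementary minors, scaled by \<open>w\<close>.
  \<open>?X\<close> has identity rows on \<open>U\<close> and rows of
  \<open>w *\<^sub>R matrix_inv S\<close> elsewhere, so multiplying by \<open>S\<close> leaves the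
  rows of \<open>S\<close> on \<open>U\<close> and \<open>w\<close> times identity rows
  elsewhere.\<close>

lemma det_pad_block_complement:
  fixes S :: "real^'n::finite^'n"
  assumes S: "S \<in> spd_matrices"
  shows "mdet (pad_block (-U) (w *\<^sub>R matrix_inv S)) * mdet S = w ^ card (-U) * mdet (pad_block U S)"
proof -
  let ?Si = "matrix_inv S"
  let ?X = "(\<chi> i j. if i \<in> U then (if i = j then 1 else 0) else w * ?Si $ i $ j) :: real^'n^'n"
  let ?Y = "(\<chi> i j. if i \<in> U then S $ i $ j else (if i = j then 1 else 0)) :: real^'n^'n"
  let ?D = "(\<chi> i j. if i = j then (if i \<in> U then 1 else w) else 0) :: real^'n^'n"
  have 1: "mdet ?X = mdet (pad_block (-U) (w *\<^sub>R ?Si))"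
    by (rule det_block_cong[of U]) (auto simp: pad_block_def)
  have 2: "mdet ?Y = mdet (pad_block U S)"
    by (rule det_block_cong[of "-U"]) (auto simp: pad_block_def)
  have inv: "(\<Sum>k\<in>UNIV. ?Si $ i $ k * S $ k $ j) = (if i = j then 1 else 0)" for i j
    using spd_inv(2)[OF S] by (auto simp: Finite_Cartesian_Product.vec_eq_iff matrix_matrix_mult_def Finite_Cartesian_Product.mat_def)
  have "(?X ** S) $ i $ j = (?D ** ?Y) $ i $ j" for i j
  proof -
    have "(?D ** ?Y) $ i $ j = (if i \<in> U then 1 else w) * ?Y $ i $ j"
      by (simp add: matrix_matrix_mult_def if_distrib[of "\<lambda>x. x * _"] cong: if_cong)
    moreover have "(?X ** S) $ i $ j = (if i \<in> U then S $ i $ j else w * (\<Sum>k\<in>UNIV. ?Si $ i $ k * S $ k $ j))"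
      by (simp add: matrix_matrix_mult_def if_distrib[of "\<lambda>x. x * _"] sum_distrib_left mult.assoc cong: if_cong)
    ultimately show ?thesis by (simp add: inv)
  qed
  then have "?X ** S = ?D ** ?Y" by (simp add: Finite_Cartesian_Product.vec_eq_iff)
  then have "mdet ?X * mdet S = mdet ?D * mdet ?Y"
    by (simp only: det_mul[symmetric])
  moreover have "mdet ?D = w ^ card (-U)"
    by (simp add: det_diagonal_matrix prod.If_cases Compl_eq)
  ultimately show ?thesis by (simp add: 1 2)
qed

text \<open>Integrating out the coordinates outside \<open>U\<close>; the dummy coordinates inside \<open>U\<close> carry a
  standard Gaussian weight, so that the integral runs over the full space.\<close>

lemma nn_integral_gauss_marginal:
  fixes S :: "real^'d::finite^'d"
  assumes S: "S \<in> spd_matrices" and w: "0 < w"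
  shows "(\<integral>\<^sup>+v. ennreal (exp (- (coord_mask U v \<bullet> coord_mask U v) / 2)
      * exp (- w / 2 * ((coord_mask U e + coord_mask (-U) (v - \<mu>)) \<bullet> (matrix_inv S *v (coord_mask U e + coord_mask (-U) (v - \<mu>)))))) \<partial>lborel)
    = ennreal (gauss_const TYPE('d) * (w ^ card (-U) * mdet (pad_block U S) / mdet S) powr (- 1 / 2)
        * exp (- w / 2 * block_form U S e))"
proof -
  let ?Si = "matrix_inv S" and ?B = "pad_block U S"
  define s where "s = matrix_inv ?B *v coord_mask U e"
  have "?B *v s = coord_mask U e"
    unfolding s_def by (simp add: matrix_vector_mul_assoc spd_inv[OF pad_block_spd[OF S]])
  then have B: "coord_mask U (S *v coord_mask U s) + coord_mask (-U) s = coord_mask U e" by (simp add: pad_block_mult)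
  have s0: "coord_mask (-U) s = 0" using arg_cong[OF B, of "coord_mask (-U)"] coord_mask_simps[where U="-U"] coord_mask_simps[where U=U] by simp
  have sU: "coord_mask U s = s" using coord_mask_simps(4)[of U s] s0 by simp
  have Ss: "coord_mask U (S *v s) = coord_mask U e" using B s0 sU by simp
  \<comment> \<open>The mean of the missing coordinates given the observed ones. Shifting by it
    turns the residual vector into \<open>S *v s\<close> plus a vector supported off
    \<open>U\<close>, and the cross term vanishes because \<open>s\<close> is supported on
    \<open>U\<close>.\<close>
  define t where "t = coord_mask (-U) (\<mu> + S *v s)"
  define N where "N = pad_block (-U) (w *\<^sub>R ?Si)"
  have wS: "w *\<^sub>R ?Si \<in> spd_matrices"
    using spd_inv(3)[OF S] w
    by (auto simp: spd_matrices_def scaleR_matrix_vector_assoc[symmetric] Finite_Cartesian_Product.transpose_def Finite_Cartesian_Product.vec_eq_iff)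
  have N: "N \<in> spd_matrices" unfolding N_def by (rule pad_block_spd[OF wS])
  let ?h = "\<lambda>v. coord_mask (-U) v"
  have z: "coord_mask U e + coord_mask (-U) (t + v - \<mu>) = S *v s + ?h v" for v
  proof -
    have "S *v s = coord_mask U e + coord_mask (-U) (S *v s)" using coord_mask_simps(4)[of U "S *v s"] Ss by simp
    then show ?thesis by (simp add: t_def coord_mask_simps[where U="-U"])
  qed
  have q: "(S *v s + ?h v) \<bullet> (?Si *v (S *v s + ?h v)) = block_form U S e + ?h v \<bullet> (?Si *v ?h v)" for v
  proof -
    have 1: "?Si *v (S *v s) = s" by (simp add: matrix_vector_mul_assoc spd_inv[OF S])
    have 2: "(S *v s) \<bullet> (?Si *v ?h v) = s \<bullet> ?h v"
      using spd_D(3)[OF spd_inv(3)[OF S], of "S *v s" "?h v"] 1 by simp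
    have 3: "s \<bullet> ?h v = 0" by (simp add: coord_mask_simps s0)
    have 4: "(S *v s) \<bullet> s = block_form U S e"
    proof -
      have "(S *v s) \<bullet> s = coord_mask U (S *v s) \<bullet> s"
        using coord_mask_simps(7)[of "S *v s" U s] by (simp only: sU)
      then show ?thesis unfolding block_form_def s_def[symmetric] by (simp only: Ss)
    qed
    show ?thesis by (simp add: matrix_vector_right_distrib inner_add_left inner_add_right 1 2 3 4 inner_commute[of "?h v" s])
  qed
  have mt: "coord_mask U (t + v) = coord_mask U v" for v by (simp add: t_def coord_mask_simps)
  have vN: "v \<bullet> (N *v v) = coord_mask U v \<bullet> coord_mask U v + w * (?h v \<bullet> (?Si *v ?h v))" for v
    unfolding N_def pad_block_mult
    by (simp add: inner_add_right scaleR_matrix_vector_assoc[symmetric] coord_mask_simps)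
  let ?f = "\<lambda>v. ennreal (exp (- (coord_mask U v \<bullet> coord_mask U v) / 2)
      * exp (- w / 2 * ((coord_mask U e + coord_mask (-U) (v - \<mu>)) \<bullet> (?Si *v (coord_mask U e + coord_mask (-U) (v - \<mu>))))))"
  have cm: "continuous_on UNIV (coord_mask W)" for W :: "'d set"
    unfolding coord_mask_def
  proof (rule continuous_on_vec_lambda)
    show "continuous_on UNIV (\<lambda>x::real^'d. if j \<in> W then x $ j else 0)" for j
      by (cases "j \<in> W") (auto intro!: continuous_intros)
  qed
  have m: "?f \<in> borel_measurable borel"
    unfolding matrix_vector_mult_def
    by (intro measurable_compose[OF _ measurable_ennreal] borel_measurable_continuous_onI continuous_intros
        continuous_on_compose2[OF cm] subset_UNIV) auto
  have "(\<integral>\<^sup>+v. ?f v \<partial>lborel) = (\<integral>\<^sup>+v. ?f (t + v) \<partial>lborel)"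
    by (rule nn_integral_translate[OF m, symmetric])
  also have "\<dots> = (\<integral>\<^sup>+v. ennreal (exp (- w / 2 * block_form U S e)) * ennreal (exp (- (v \<bullet> (N *v v)) / 2)) \<partial>lborel)"
    unfolding mt z q vN
    by (intro nn_integral_cong) (simp add: ennreal_mult[symmetric] exp_add[symmetric] field_simps)
  also have "\<dots> = ennreal (exp (- w / 2 * block_form U S e)) * ennreal (gauss_const TYPE('d) * mdet N powr (- 1 / 2))"
  proof -
    have "(\<lambda>v. ennreal (exp (- (v \<bullet> (N *v v)) / 2))) \<in> borel_measurable lborel"
      by (auto simp: matrix_vector_mult_def intro!: measurable_compose[OF _ measurable_ennreal] borel_measurable_continuous_onI continuous_intros)
    then show ?thesis by (simp only: nn_integral_cmult nn_integral_gauss[OF N])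
  qed
  also have "mdet N = w ^ card (-U) * mdet ?B / mdet S"
    using det_pad_block_complement[OF S, of U w] spd_det_pos[OF S] by (simp add: N_def field_simps)
  finally show ?thesis
    using gauss_const_pos[where 'n='d] by (simp add: ennreal_mult[symmetric] mult_ac)
qed

subsection \<open>Rank-one updates\<close>

definition outer :: "real^'m::finite \<Rightarrow> real^'n::finite \<Rightarrow> real^'n^'m" where
  "outer u v = (\<chi> i j. u $ i * v $ j)"

lemma outer_mult_vec: "outer u v *v z = (v \<bullet> z) *\<^sub>R u"
  by (simp add: outer_def matrix_vector_mult_def inner_vec_def Finite_Cartesian_Product.vec_eq_iff sum_distrib_left mult_ac)

lemma transpose_outer: "mtranspose (outer u v) = outer v u"
  by (simp add: outer_def Finite_Cartesian_Product.transpose_def Finite_Cartesian_Product.vec_eq_iff mult.commute)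

lemma outer_form: "v \<bullet> (outer u u *v v) = (u \<bullet> v)\<^sup>2"
  by (simp add: outer_mult_vec inner_commute power2_eq_square)

lemma sum_matrix_mult_vec: "(\<Sum>i\<in>I. A i) *v v = (\<Sum>i\<in>I. A i *v v)" for A :: "'i \<Rightarrow> real^'n::finite^'m::finite"
  by (induction I rule: infinite_finite_induct) (simp_all add: matrix_vector_mult_add_rdistrib)

lemma transpose_linear:
  "mtranspose (A + B) = mtranspose A + mtranspose B" "mtranspose (c *\<^sub>R A) = c *\<^sub>R mtranspose A"
  "mtranspose (\<Sum>i\<in>I. F i) = (\<Sum>i\<in>I. mtranspose (F i))"
  for A B :: "real^'n::finite^'m::finite" and F :: "'i \<Rightarrow> real^'n::finite^'m::finite"
  by (simp_all add: Finite_Cartesian_Product.transpose_def Finite_Cartesian_Product.vec_eq_iff)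

text \<open>By polarization. It allows congruences of scatter matrices to be verified one direction
  \<open>v\<close> at a time.\<close>

lemma symmetric_form_eqI:
  fixes A B :: "real^'n::finite^'n"
  assumes "mtranspose A = A" "mtranspose B = B" and eq: "\<And>v. v \<bullet> (A *v v) = v \<bullet> (B *v v)"
  shows "A = B"
proof -
  have polar: "2 * (u \<bullet> (A *v v)) = (u + v) \<bullet> (A *v (u + v)) - u \<bullet> (A *v u) - v \<bullet> (A *v v)"
    if "mtranspose A = A" for A :: "real^'n^'n" and u v
  proof -
    have "v \<bullet> (A *v u) = u \<bullet> (A *v v)" using inner_matrix_transpose[of v A u] that by (simp add: inner_commute)
    then show ?thesis by (simp add: matrix_vector_right_distrib inner_add_left inner_add_right)
  qed
  have entry: "A $ i $ j = axis i 1 \<bullet> (A *v axis j 1)" for A :: "real^'n^'n" and i j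
    by (simp add: inner_axis' matrix_vector_mult_basis column_def)
  have "2 * (u \<bullet> (A *v v)) = 2 * (u \<bullet> (B *v v))" for u v
    unfolding polar[OF assms(1)] polar[OF assms(2)] by (simp only: eq)
  then have "A $ i $ j = B $ i $ j" for i j by (simp add: entry)
  then show ?thesis by (simp add: Finite_Cartesian_Product.vec_eq_iff)
qed

text \<open>Expand the rows, each a unit vector plus a multiple of \<open>v\<close>, by
  multilinearity: terms with two rows taken from \<open>v\<close> vanish, so only the identity and
  the terms with a single such row contribute.\<close>

lemma det_id_plus_outer:
  fixes u v :: "real^'n::finite"
  shows "mdet (id_mat + outer u v) = 1 + u \<bullet> v"
proof -
  define E :: "'n \<Rightarrow> real^'n" where "E = (\<lambda>i. axis i 1)"
  \<comment> \<open>With \<open>v\<close> itself as row \<open>k\<close>, the multiples of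
    \<open>v\<close> in the other rows can be removed by row operations.\<close>
  have 1: "mdet (\<chi> i. if i = k then v else if i \<in> S then E i + (u $ i) *s v else E i) = v $ k" if "k \<notin> S" for k S
    using finite[of S] that
  proof (induction S)
    case empty
    have row: "Finite_Cartesian_Product.row i (id_mat :: real^'n^'n) = E i" for i
      by (auto simp: E_def Finite_Cartesian_Product.row_def axis_def Finite_Cartesian_Product.mat_def Finite_Cartesian_Product.vec_eq_iff)
    have v: "(\<Sum>i\<in>UNIV. v $ i *s E i) = v"
      by (auto simp: E_def basis_expansion)
    from cramer_lemma_transpose[of k v "id_mat :: real^'n^'n"]
    have "mdet (\<chi> i. if i = k then v else E i) = v $ k" unfolding row v by simp
    then show ?case by (simp cong: if_cong)
  next
    case (insert j S)
    let ?A = "\<chi> i. if i = k then v else if i \<in> S then E i + (u $ i) *s v else E i"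
    have eq: "(\<chi> i. if i = k then v else if i \<in> insert j S then E i + (u $ i) *s v else E i)
        = (\<chi> i. if i = j then Finite_Cartesian_Product.row j ?A + (u $ j) *s Finite_Cartesian_Product.row k ?A else Finite_Cartesian_Product.row i ?A)"
      using insert.hyps insert.prems by (auto simp: Finite_Cartesian_Product.vec_eq_iff Finite_Cartesian_Product.row_def)
    have "j \<noteq> k" "k \<notin> S" using insert.prems by auto
    then show ?case unfolding eq using det_row_operation[of j k ?A "u $ j"] insert.IH by simp
  qed
  have 2: "mdet (\<chi> i. if i \<in> S then E i + (u $ i) *s v else E i) = 1 + (\<Sum>i\<in>S. u $ i * v $ i)" for S
    using finite[of S]
  proof (induction S)
    case empty
    have "(\<chi> i. E i) = id_mat"
      by (auto simp: E_def axis_def Finite_Cartesian_Product.mat_def Finite_Cartesian_Product.vec_eq_iff)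
    then show ?case by simp
  next
    case (insert k S)
    let ?R = "\<lambda>i. if i \<in> S then E i + (u $ i) *s v else E i"
    have "(\<chi> i. if i \<in> insert k S then E i + (u $ i) *s v else E i) = (\<chi> i. if i = k then E i + (u $ i) *s v else ?R i)"
      by (auto simp: Finite_Cartesian_Product.vec_eq_iff)
    then have "mdet (\<chi> i. if i \<in> insert k S then E i + (u $ i) *s v else E i)
        = mdet (\<chi> i. if i = k then E i else ?R i) + mdet (\<chi> i. if i = k then (u $ i) *s v else ?R i)"
      using Determinants.det_row_add[of k E "\<lambda>i. (u $ i) *s v" ?R] by simp
    also have "(\<chi> i. if i = k then E i else ?R i) = (\<chi> i. ?R i)"
      using insert.hyps by (auto simp: Finite_Cartesian_Product.vec_eq_iff)
    also have "mdet (\<chi> i. if i = k then (u $ i) *s v else ?R i) = u $ k * mdet (\<chi> i. if i = k then v else ?R i)"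
    proof -
      have "(\<chi> i. if i = k then (u $ i) *s v else ?R i) = (\<chi> i. if i = k then (u $ k) *s v else ?R i)"
        by (auto simp: Finite_Cartesian_Product.vec_eq_iff)
      then show ?thesis using Determinants.det_row_mul[of k "u $ k" "\<lambda>_. v" ?R] by simp
    qed
    finally show ?case using insert 1[of k S] by simp
  qed
  have "id_mat + outer u v = (\<chi> i. if i \<in> UNIV then E i + (u $ i) *s v else E i)"
    by (auto simp: E_def outer_def axis_def Finite_Cartesian_Product.mat_def Finite_Cartesian_Product.vec_eq_iff)
  then show ?thesis using 2[of UNIV] by (simp add: inner_vec_def)
qed

text \<open>\<open>M\<close> may be singular, so \<open>u\<close> stands in for the inverse of
  \<open>M\<close> applied to \<open>e\<close>. Domination forces \<open>e\<close> to be orthogonal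
  to the kernel of \<open>M\<close>, which for symmetric \<open>M\<close> puts it in the range;
  testing the domination at \<open>u\<close> gives
  \<open>c * (u \<bullet> e)\<^sup>2 \<le> u \<bullet> e\<close>.\<close>

lemma symmetric_range:
  fixes M :: "real^'n::finite^'n"
  assumes sym: "mtranspose M = M" and c: "0 < c" and dom: "\<And>v. c * (e \<bullet> v)\<^sup>2 \<le> v \<bullet> (M *v v)"
  obtains u where "M *v u = e" "0 \<le> u \<bullet> e" "c * (u \<bullet> e) \<le> 1"
proof -
  obtain y z where y: "y \<in> span (range (\<lambda>v. M *v v))" and z: "\<And>r. r \<in> span (range (\<lambda>v. M *v v)) \<Longrightarrow> Linear_Algebra.orthogonal z r" and e: "e = y + z"
    using orthogonal_subspace_decomp_exists[of "range (\<lambda>v. M *v v)" e] by metis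
  have sub: "subspace (range (\<lambda>v. M *v v))"
    by (intro linear_subspace_image subspace_UNIV matrix_vector_mul_linear)
  have "(M *v z) \<bullet> v = 0" for v
    using z[OF span_base[OF rangeI[of "\<lambda>v. M *v v" v]]] inner_matrix_transpose[of z M v] sym
    by (simp add: Linear_Algebra.orthogonal_def)
  then have "M *v z = 0" by (metis inner_eq_zero_iff)
  then have "c * (e \<bullet> z)\<^sup>2 \<le> 0" using dom[of z] by simp
  then have "e \<bullet> z = 0" using c by (simp add: mult_le_0_iff)
  moreover have "y \<bullet> z = 0" using z[OF y] by (simp add: Linear_Algebra.orthogonal_def inner_commute)
  ultimately have "z = 0" using e by (simp add: inner_add_left)
  then have "e \<in> range (\<lambda>v. M *v v)" using y e sub by (metis add.right_neutral span_eq_iff)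
  then obtain u where u: "M *v u = e" by auto
  have q: "c * (u \<bullet> e)\<^sup>2 \<le> u \<bullet> e" using dom[of u] by (simp add: u inner_commute)
  then have "0 \<le> u \<bullet> e" using c by (meson less_imp_le mult_nonneg_nonneg order_trans zero_le_power2)
  moreover have "c * (u \<bullet> e) \<le> 1"
  proof (cases "u \<bullet> e = 0")
    case False
    with q \<open>0 \<le> u \<bullet> e\<close> show ?thesis by (simp add: power2_eq_square mult.assoc[symmetric])
  qed simp
  ultimately show thesis using u that by blast
qed

text \<open>Try \<open>T = id_mat + outer (\<theta> *\<^sub>R e) u\<close>. Since
  \<open>M *v u = e\<close>, the congruence adds
  \<open>2 * \<theta> + \<theta>\<^sup>2 * (u \<bullet> e)\<close> times \<open>outer e e\<close>,
  so \<theta> has to solve a quadratic equation.\<close>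

lemma rank_one_congruence:
  fixes M :: "real^'n::finite^'n"
  assumes sym: "mtranspose M = M" and u: "M *v u = e" and q: "0 \<le> u \<bullet> e" and \<eta>: "0 \<le> \<eta>"
  obtains T where "T ** M ** mtranspose T = M + \<eta> *\<^sub>R outer e e" "mdet T = sqrt (1 + \<eta> * (u \<bullet> e))"
proof -
  define r where "r = sqrt (1 + \<eta> * (u \<bullet> e))"
  have r: "0 < 1 + r" "r\<^sup>2 = 1 + \<eta> * (u \<bullet> e)" using q \<eta> by (auto simp: r_def add_pos_nonneg)
  \<comment> \<open>The root \<open>(r - 1) / (u \<bullet> e)\<close>, rationalized so that it also
    makes sense for \<open>u \<bullet> e = 0\<close>.\<close>
  define \<theta> where "\<theta> = \<eta> / (1 + r)"
  have "\<theta> * (u \<bullet> e) = (r\<^sup>2 - 1) / (1 + r)" using r(2) by (simp add: \<theta>_def)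
  also have "r\<^sup>2 - 1 = (r - 1) * (1 + r)" by (simp add: power2_eq_square algebra_simps)
  also have "\<dots> / (1 + r) = r - 1" using r(1) by simp
  finally have \<theta>q: "\<theta> * (u \<bullet> e) = r - 1" .
  have "2 * \<theta> + \<theta>\<^sup>2 * (u \<bullet> e) = \<theta> * (2 + \<theta> * (u \<bullet> e))" by (simp add: power2_eq_square algebra_simps)
  also have "\<dots> = \<theta> * (1 + r)" unfolding \<theta>q by (simp add: algebra_simps)
  finally have \<theta>: "2 * \<theta> + \<theta>\<^sup>2 * (u \<bullet> e) = \<eta>" using r(1) by (simp add: \<theta>_def)
  define T where "T = id_mat + outer (\<theta> *\<^sub>R e) u"
  have "T ** M ** mtranspose T = M + \<eta> *\<^sub>R outer e e"
  proof (rule symmetric_form_eqI)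
    show "mtranspose (T ** M ** mtranspose T) = T ** M ** mtranspose T"
      by (simp add: matrix_transpose_mul sym matrix_mul_assoc)
    show "mtranspose (M + \<eta> *\<^sub>R outer e e) = M + \<eta> *\<^sub>R outer e e"
      by (simp add: transpose_linear transpose_outer sym)
    fix v
    have Tv: "mtranspose T *v v = v + (\<theta> * (e \<bullet> v)) *\<^sub>R u"
      by (simp add: T_def transpose_linear transpose_outer matrix_vector_mult_add_rdistrib outer_mult_vec del: transpose_matrix_vector)
    have uM: "u \<bullet> (M *v v) = e \<bullet> v" using inner_matrix_transpose[of u M v] by (simp add: sym u)
    have "v \<bullet> ((T ** M ** mtranspose T) *v v) = (mtranspose T *v v) \<bullet> (M *v (mtranspose T *v v))"
      by (simp add: inner_matrix_transpose[of v T] matrix_vector_mul_assoc[symmetric] del: transpose_matrix_vector)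
    also have "\<dots> = v \<bullet> (M *v v) + (2 * \<theta> + \<theta>\<^sup>2 * (u \<bullet> e)) * (e \<bullet> v)\<^sup>2"
      unfolding Tv
      by (simp add: matrix_vector_right_distrib matrix_vector_mult_scaleR u uM inner_add_left inner_add_right inner_commute[of v e] algebra_simps power2_eq_square)
    finally show "v \<bullet> ((T ** M ** mtranspose T) *v v) = v \<bullet> ((M + \<eta> *\<^sub>R outer e e) *v v)"
      by (simp add: \<theta> matrix_vector_mult_add_rdistrib inner_add_right scaleR_matrix_vector_assoc[symmetric] outer_form)
  qed
  moreover have "mdet T = r"
    unfolding T_def det_id_plus_outer using \<theta>q by (simp add: inner_commute)
  ultimately show thesis using that r_def by blast
qed

subsection \<open>The complete-data scatter matrix\<close>

text \<open>The matrix \<open>E\<close> for which the exponent of the complete-data density is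
  \<open>mtrace (matrix_inv S ** E)\<close> times -1/2.\<close>

definition scatter :: "('d::finite, 'd) rmat \<Rightarrow> ('n::finite, 'p::finite) rmat \<Rightarrow> ('n \<Rightarrow> real^'d) \<Rightarrow> ('n \<Rightarrow> real) \<Rightarrow> ('p, 'd) rmat \<Rightarrow> ('d, 'd) rmat" where
  "scatter a x Y w \<beta> = a + (\<Sum>i\<in>UNIV. w i *\<^sub>R outer (Y i - mtranspose \<beta> *v (x $ i)) (Y i - mtranspose \<beta> *v (x $ i)))"

lemma scatter_form: "v \<bullet> (scatter a x Y w \<beta> *v v) = v \<bullet> (a *v v) + (\<Sum>i\<in>UNIV. w i * (Y i \<bullet> v - x $ i \<bullet> (\<beta> *v v))\<^sup>2)"
proof -
  have "(Y i - mtranspose \<beta> *v (x $ i)) \<bullet> v = Y i \<bullet> v - x $ i \<bullet> (\<beta> *v v)" for i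
    using inner_matrix_transpose[of "x $ i" \<beta> v] by (simp add: inner_diff_left)
  then show ?thesis
    by (simp add: scatter_def matrix_vector_mult_add_rdistrib inner_add_right sum_matrix_mult_vec inner_sum_right
        scaleR_matrix_vector_assoc[symmetric] outer_form del: transpose_matrix_vector)
qed

lemma transpose_scatter: "mtranspose a = a \<Longrightarrow> mtranspose (scatter a x Y w \<beta>) = scatter a x Y w \<beta>"
  by (simp add: scatter_def transpose_linear transpose_outer)

text \<open>The normal equations are solvable even when \<open>A\<close> is singular: each
  \<open>x $ i\<close> is dominated by the form of \<open>A\<close>, so
  \<open>symmetric_range\<close> supplies \<open>u i\<close>, and \<beta> is assembled from these.
  The last conclusion is Pythagoras around \<beta> in the direction \<open>v\<close>. The bound on
  \<open>w i * (u i \<bullet> x $ i)\<close> is the usual bound on leverages; it later limits a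
  determinant.\<close>

lemma least_squares:
  fixes x :: "('n::finite, 'p::finite) rmat" and Y :: "'n \<Rightarrow> real^'d::finite" and w :: "'n \<Rightarrow> real"
  assumes w: "\<And>i. 0 < w i"
  defines "A \<equiv> \<Sum>i\<in>UNIV. w i *\<^sub>R outer (x $ i) (x $ i)"
  obtains \<beta> u where "\<And>i. A *v u i = x $ i" "\<And>i. 0 \<le> u i \<bullet> x $ i" "\<And>i. w i * (u i \<bullet> x $ i) \<le> 1" "mtranspose A = A" "\<And>v. 0 \<le> v \<bullet> (A *v v)"
    "\<And>b v. (\<Sum>i\<in>UNIV. w i * (Y i \<bullet> v - x $ i \<bullet> b)\<^sup>2) = (b - \<beta> *v v) \<bullet> (A *v (b - \<beta> *v v)) + (\<Sum>i\<in>UNIV. w i * (Y i \<bullet> v - x $ i \<bullet> (\<beta> *v v))\<^sup>2)"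
proof -
  have Av: "A *v v = (\<Sum>i\<in>UNIV. (w i * (x $ i \<bullet> v)) *\<^sub>R x $ i)" for v
    by (simp add: A_def sum_matrix_mult_vec scaleR_matrix_vector_assoc[symmetric] outer_mult_vec)
  have form: "v \<bullet> (A *v v) = (\<Sum>i\<in>UNIV. w i * (x $ i \<bullet> v)\<^sup>2)" for v
    by (simp add: Av inner_sum_right power2_eq_square inner_commute mult_ac)
  have sym: "mtranspose A = A" by (simp add: A_def transpose_linear transpose_outer)
  have "\<exists>u. A *v u = x $ i \<and> 0 \<le> u \<bullet> x $ i \<and> w i * (u \<bullet> x $ i) \<le> 1" for i
  proof -
    have "w i * (x $ i \<bullet> v)\<^sup>2 \<le> v \<bullet> (A *v v)" for v
      unfolding form using w by (intro member_le_sum) (auto simp: less_imp_le)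
    from symmetric_range[OF sym w this] show ?thesis by metis
  qed
  then obtain u where u: "\<And>i. A *v u i = x $ i" "\<And>i. 0 \<le> u i \<bullet> x $ i" "\<And>i. w i * (u i \<bullet> x $ i) \<le> 1" by metis
  define \<beta> where "\<beta> = (\<Sum>i\<in>UNIV. w i *\<^sub>R outer (u i) (Y i))"
  have A\<beta>: "A *v (\<beta> *v v) = (\<Sum>i\<in>UNIV. (w i * (Y i \<bullet> v)) *\<^sub>R x $ i)" for v
    by (simp add: \<beta>_def sum_matrix_mult_vec scaleR_matrix_vector_assoc[symmetric] outer_mult_vec
        linear_sum[OF matrix_vector_mul_linear] matrix_vector_mult_scaleR u)
  have "(\<Sum>i\<in>UNIV. w i * (Y i \<bullet> v - x $ i \<bullet> b)\<^sup>2) = (b - \<beta> *v v) \<bullet> (A *v (b - \<beta> *v v)) + (\<Sum>i\<in>UNIV. w i * (Y i \<bullet> v - x $ i \<bullet> (\<beta> *v v))\<^sup>2)" for b v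
  proof -
    let ?g = "b - \<beta> *v v" and ?r = "\<lambda>i. Y i \<bullet> v - x $ i \<bullet> (\<beta> *v v)"
    have "(\<Sum>i\<in>UNIV. w i * ?r i * (x $ i \<bullet> ?g)) = ((\<Sum>i\<in>UNIV. (w i * (Y i \<bullet> v)) *\<^sub>R x $ i) - A *v (\<beta> *v v)) \<bullet> ?g"
      by (simp only: Av inner_diff_left inner_sum_left inner_scaleR_left sum_subtractf[symmetric]) (simp add: algebra_simps)
    then have cross: "(\<Sum>i\<in>UNIV. w i * ?r i * (x $ i \<bullet> ?g)) = 0" by (simp add: A\<beta>)
    have "w i * (Y i \<bullet> v - x $ i \<bullet> b)\<^sup>2 = w i * (x $ i \<bullet> ?g)\<^sup>2 + w i * (?r i)\<^sup>2 - 2 * (w i * ?r i * (x $ i \<bullet> ?g))" for i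
      by (simp add: inner_diff_right power2_eq_square algebra_simps)
    then have "(\<Sum>i\<in>UNIV. w i * (Y i \<bullet> v - x $ i \<bullet> b)\<^sup>2) = (\<Sum>i\<in>UNIV. w i * (x $ i \<bullet> ?g)\<^sup>2) + (\<Sum>i\<in>UNIV. w i * (?r i)\<^sup>2) - 2 * (\<Sum>i\<in>UNIV. w i * ?r i * (x $ i \<bullet> ?g))"
      by (simp only: sum.distrib sum_subtractf sum_distrib_left)
    then show ?thesis using cross by (simp add: form)
  qed
  moreover have "0 \<le> v \<bullet> (A *v v)" for v
    unfolding form using w by (intro sum_nonneg) (simp add: less_imp_le)
  ultimately show thesis using that[of u \<beta>] u sym by blast
qed

text \<open>Multiplying one weight by \<open>t\<close> transforms the scatter matrix by an affine substitution in
  \<open>\<beta>\<close> and a congruence; both linear parts come from rank-one updates, so their determinants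
  lie between \<open>1\<close> and \<open>sqrt t\<close>.\<close>

lemma scatter_upweight:
  fixes x :: "('n::finite, 'p::finite) rmat" and a :: "('d::finite, 'd) rmat"
  assumes a: "psd_matrix a" and w: "\<And>i. 0 < w i" and t: "1 \<le> t"
  obtains \<beta>0 \<beta>1 K T where "1 \<le> mdet T" "mdet T \<le> sqrt t" "1 / sqrt t \<le> mdet K" "mdet K \<le> 1" "0 < mdet K"
    "\<And>\<gamma>. scatter a x Y (w(i := t * w i)) (\<beta>1 + K ** (\<gamma> - \<beta>0) ** mtranspose T) = T ** scatter a x Y w \<gamma> ** mtranspose T"
proof -
  have a_sym: "mtranspose a = a" and a_pos: "\<And>v. 0 \<le> v \<bullet> (a *v v)" using a by (auto simp: psd_matrix_def)
  let ?A = "\<Sum>i\<in>UNIV. w i *\<^sub>R outer (x $ i) (x $ i)"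
  obtain \<beta>0 u where u: "\<And>i. ?A *v u i = x $ i" "\<And>i. 0 \<le> u i \<bullet> x $ i" "\<And>i. w i * (u i \<bullet> x $ i) \<le> 1" "mtranspose ?A = ?A" "\<And>v. 0 \<le> v \<bullet> (?A *v v)"
    and ls: "\<And>b v. (\<Sum>i\<in>UNIV. w i * (Y i \<bullet> v - x $ i \<bullet> b)\<^sup>2) = (b - \<beta>0 *v v) \<bullet> (?A *v (b - \<beta>0 *v v)) + (\<Sum>i\<in>UNIV. w i * (Y i \<bullet> v - x $ i \<bullet> (\<beta>0 *v v))\<^sup>2)"
    by (rule least_squares[where w=w and x=x and Y=Y, OF w]) (rule that; assumption)
  define A where "A = ?A"
  define M where "M = scatter a x Y w \<beta>0"
  define e where "e = Y i - mtranspose \<beta>0 *v (x $ i)"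
  have ev: "e \<bullet> v = Y i \<bullet> v - x $ i \<bullet> (\<beta>0 *v v)" for v
    using inner_matrix_transpose[of "x $ i" \<beta>0 v] by (simp add: e_def inner_diff_left)
  have M_sym: "mtranspose M = M" unfolding M_def by (rule transpose_scatter[OF a_sym])
  have M_form: "v \<bullet> (M *v v) = v \<bullet> (a *v v) + (\<Sum>i\<in>UNIV. w i * (Y i \<bullet> v - x $ i \<bullet> (\<beta>0 *v v))\<^sup>2)" for v
    unfolding M_def by (rule scatter_form)
  have "w i * (e \<bullet> v)\<^sup>2 \<le> v \<bullet> (M *v v)" for v
  proof -
    have "w i * (e \<bullet> v)\<^sup>2 \<le> (\<Sum>i\<in>UNIV. w i * (Y i \<bullet> v - x $ i \<bullet> (\<beta>0 *v v))\<^sup>2)"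
      unfolding ev using w by (intro member_le_sum[of i UNIV "\<lambda>i. w i * (Y i \<bullet> v - x $ i \<bullet> (\<beta>0 *v v))\<^sup>2"]) (auto simp: less_imp_le)
    then show ?thesis using a_pos[of v] by (simp add: M_form)
  qed
  from symmetric_range[OF M_sym w this] obtain c where c: "M *v c = e" "0 \<le> c \<bullet> e" "w i * (c \<bullet> e) \<le> 1" by blast
  define \<delta> where "\<delta> = (t - 1) * w i"
  define h where "h = u i \<bullet> x $ i"
  have \<delta>: "0 \<le> \<delta>" using t w[of i] by (simp add: \<delta>_def)
  have h: "0 \<le> h" using u(2) by (simp add: h_def)
  have \<delta>h: "\<delta> * h \<le> t - 1" using mult_left_mono[OF u(3)[of i], of "t - 1"] t by (simp add: \<delta>_def h_def mult.assoc)
  \<comment> \<open>Recursive least squares: adding \<delta> to the weight moves the minimizer to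
    \<open>\<beta>1\<close> below and the minimal scatter matrix from \<open>M\<close> to
    \<open>M + \<eta> *\<^sub>R outer e e\<close>. The denominator accounts for the part of the
    residual that the refit removes.\<close>
  define \<eta> where "\<eta> = \<delta> / (1 + \<delta> * h)"
  have pos: "0 < 1 + \<delta> * h" using \<delta> h by (simp add: add_pos_nonneg)
  have \<eta>: "0 \<le> \<eta>" "\<eta> \<le> \<delta>" using \<delta> h pos by (auto simp: \<eta>_def divide_le_eq mult_le_cancel_left1)
  have \<eta>q: "\<eta> * (c \<bullet> e) \<le> t - 1"
  proof -
    have "\<eta> * (c \<bullet> e) \<le> \<delta> * (c \<bullet> e)" using \<eta> c by (intro mult_right_mono) auto
    also have "\<dots> \<le> t - 1" using mult_left_mono[OF c(3), of "t - 1"] t by (simp add: \<delta>_def mult.assoc)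
    finally show ?thesis .
  qed
  obtain L where L: "L ** A ** mtranspose L = A + \<delta> *\<^sub>R outer (x $ i) (x $ i)" "mdet L = sqrt (1 + \<delta> * h)"
    using rank_one_congruence[OF u(4) u(1)[of i] u(2) \<delta>] unfolding A_def h_def by blast
  obtain T where T: "T ** M ** mtranspose T = M + \<eta> *\<^sub>R outer e e" "mdet T = sqrt (1 + \<eta> * (c \<bullet> e))"
    using rank_one_congruence[OF M_sym c(1,2) \<eta>(1)] by blast
  have detL: "1 \<le> mdet L" "mdet L \<le> sqrt t" using \<delta> h \<delta>h by (auto simp: L(2))
  have detT: "1 \<le> mdet T" "mdet T \<le> sqrt t" using \<eta> c(2) \<eta>q by (auto simp: T(2))
  \<comment> \<open>Chosen so that \<open>z = K *v ?g\<close> satisfies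
    \<open>mtranspose L *v z = ?g\<close>; the form of the updated \<open>A\<close> at
    \<open>z\<close> is then the form of \<open>A\<close> at \<open>?g\<close>.\<close>
  define K where "K = matrix_inv (mtranspose L)"
  have LK: "mtranspose L ** K = id_mat" unfolding K_def using detL by (intro matrix_inv_inverse) auto
  have detK: "mdet K = 1 / mdet L"
    using arg_cong[OF LK, of mdet] detL by (simp add: det_mul field_simps)
  define \<beta>1 where "\<beta>1 = \<beta>0 + \<eta> *\<^sub>R outer (u i) e"
  have main: "scatter a x Y (w(i := t * w i)) (\<beta>1 + K ** (\<gamma> - \<beta>0) ** mtranspose T) = T ** scatter a x Y w \<gamma> ** mtranspose T" for \<gamma>
  proof (rule symmetric_form_eqI)
    show "mtranspose (T ** scatter a x Y w \<gamma> ** mtranspose T) = T ** scatter a x Y w \<gamma> ** mtranspose T"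
      by (simp add: matrix_transpose_mul transpose_scatter[OF a_sym] matrix_mul_assoc)
    fix v
    let ?v = "mtranspose T *v v"
    let ?g = "(\<gamma> - \<beta>0) *v ?v"
    define b where "b = \<beta>1 *v v + K *v ?g"
    have b: "(\<beta>1 + K ** (\<gamma> - \<beta>0) ** mtranspose T) *v v = b"
      by (simp add: b_def matrix_vector_mult_add_rdistrib matrix_vector_mul_assoc[symmetric] del: transpose_matrix_vector)
    define z where "z = K *v ?g"
    have Lz: "mtranspose L *v z = ?g" by (simp only: z_def matrix_vector_mul_assoc[of "mtranspose L" K] LK matrix_vector_mul_lid)
    have bz: "b - \<beta>0 *v v = z + (\<eta> * (e \<bullet> v)) *\<^sub>R u i"
      by (simp add: b_def \<beta>1_def z_def matrix_vector_mult_add_rdistrib scaleR_matrix_vector_assoc[symmetric] outer_mult_vec)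
    have Aui: "A *v u i = x $ i" using u(1) by (simp add: A_def)
    have uA: "u i \<bullet> (A *v z) = x $ i \<bullet> z" using inner_matrix_transpose[of "u i" A z] u(4) Aui by (simp add: A_def)
    have "v \<bullet> (scatter a x Y (w(i := t * w i)) (\<beta>1 + K ** (\<gamma> - \<beta>0) ** mtranspose T) *v v)
        = v \<bullet> (a *v v) + (\<Sum>j\<in>UNIV. w j * (Y j \<bullet> v - x $ j \<bullet> b)\<^sup>2 + (if j = i then \<delta> * (Y i \<bullet> v - x $ i \<bullet> b)\<^sup>2 else 0))"
    proof -
      have "(w(i := t * w i)) j * q j = w j * q j + (if j = i then \<delta> * q i else 0)" for j and q :: "'n \<Rightarrow> real"
        by (simp add: \<delta>_def algebra_simps)
      then show ?thesis unfolding scatter_form b by (intro arg_cong2[of _ _ _ _ "(+)"] refl sum.cong)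
    qed
    also have "\<dots> = v \<bullet> (M *v v) + (b - \<beta>0 *v v) \<bullet> (A *v (b - \<beta>0 *v v)) + \<delta> * (Y i \<bullet> v - x $ i \<bullet> b)\<^sup>2"
      unfolding sum.distrib ls[of v b] by (simp add: A_def M_form)
    also have "Y i \<bullet> v - x $ i \<bullet> b = e \<bullet> v - x $ i \<bullet> (b - \<beta>0 *v v)"
      by (simp add: ev inner_diff_right)
    also have "v \<bullet> (M *v v) + (b - \<beta>0 *v v) \<bullet> (A *v (b - \<beta>0 *v v)) + \<delta> * (e \<bullet> v - x $ i \<bullet> (b - \<beta>0 *v v))\<^sup>2
        = v \<bullet> (M *v v) + \<eta> * (e \<bullet> v)\<^sup>2 + (z \<bullet> (A *v z) + \<delta> * (x $ i \<bullet> z)\<^sup>2)"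
    proof -
      have 1: "(b - \<beta>0 *v v) \<bullet> (A *v (b - \<beta>0 *v v)) = z \<bullet> (A *v z) + 2 * \<eta> * (e \<bullet> v) * (x $ i \<bullet> z) + (\<eta> * (e \<bullet> v))\<^sup>2 * h"
        unfolding bz by (simp add: matrix_vector_right_distrib matrix_vector_mult_scaleR Aui uA inner_add_left inner_add_right inner_commute[of z "x $ i"] h_def power2_eq_square algebra_simps)
      have 2: "x $ i \<bullet> (b - \<beta>0 *v v) = x $ i \<bullet> z + \<eta> * (e \<bullet> v) * h"
        unfolding bz by (simp add: inner_add_right h_def inner_commute[of "x $ i" "u i"])
      have \<eta>\<delta>: "\<eta> * (1 + \<delta> * h) = \<delta>" using pos by (simp add: \<eta>_def)
      define E where "E = e \<bullet> v"
      define X where "X = x $ i \<bullet> z"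
      \<comment> \<open>The two sides of the update differ by a multiple of
        \<open>\<eta> * (1 + \<delta> * h) - \<delta>\<close>, which is 0 by the choice of
        \<eta>.\<close>
      have "2 * \<eta> * E * X + (\<eta> * E)\<^sup>2 * h + \<delta> * (E - (X + \<eta> * E * h))\<^sup>2 - \<eta> * E\<^sup>2 - \<delta> * X\<^sup>2
          = (\<eta> * (1 + \<delta> * h) - \<delta>) * (2 * E * X + \<eta> * h * E\<^sup>2 - E\<^sup>2)"
        by (simp add: power2_eq_square algebra_simps)
      then have "2 * \<eta> * E * X + (\<eta> * E)\<^sup>2 * h + \<delta> * (E - (X + \<eta> * E * h))\<^sup>2 = \<eta> * E\<^sup>2 + \<delta> * X\<^sup>2"
        by (simp add: \<eta>\<delta>)
      then show ?thesis unfolding 1 2 E_def[symmetric] X_def[symmetric] by (simp add: algebra_simps)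
    qed
    also have "z \<bullet> (A *v z) + \<delta> * (x $ i \<bullet> z)\<^sup>2 = z \<bullet> ((L ** A ** mtranspose L) *v z)"
      by (simp add: L(1) matrix_vector_mult_add_rdistrib inner_add_right scaleR_matrix_vector_assoc[symmetric] outer_form)
    also have "\<dots> = ?g \<bullet> (A *v ?g)"
      by (simp add: inner_matrix_transpose[of z L] matrix_vector_mul_assoc[symmetric] Lz del: transpose_matrix_vector)
    also have "v \<bullet> (M *v v) + \<eta> * (e \<bullet> v)\<^sup>2 = v \<bullet> ((T ** M ** mtranspose T) *v v)"
      by (simp add: T(1) matrix_vector_mult_add_rdistrib inner_add_right scaleR_matrix_vector_assoc[symmetric] outer_form)
    also have "\<dots> = ?v \<bullet> (M *v ?v)"
      by (simp add: inner_matrix_transpose[of v T] matrix_vector_mul_assoc[symmetric] del: transpose_matrix_vector)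
    also have "?v \<bullet> (M *v ?v) + ?g \<bullet> (A *v ?g) = ?v \<bullet> (scatter a x Y w \<gamma> *v ?v)"
      unfolding scatter_form M_form ls[of ?v "\<gamma> *v ?v"] by (simp add: A_def matrix_vector_mult_diff_rdistrib)
    also have "\<dots> = v \<bullet> ((T ** scatter a x Y w \<gamma> ** mtranspose T) *v v)"
      by (simp add: inner_matrix_transpose[of v T] matrix_vector_mul_assoc[symmetric] del: transpose_matrix_vector)
    finally show "v \<bullet> (scatter a x Y (w(i := t * w i)) (\<beta>1 + K ** (\<gamma> - \<beta>0) ** mtranspose T) *v v) = v \<bullet> ((T ** scatter a x Y w \<gamma> ** mtranspose T) *v v)" .
  qed (rule transpose_scatter[OF a_sym])
  show thesis
    using detL detT by (intro that[OF detT _ _ _ main]) (auto simp: detK intro!: frac_le)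
qed

text \<open>The witness \<open>\<beta>0\<close> is the least squares solution.\<close>

lemma scatter_dilate:
  fixes x :: "('n::finite, 'p::finite) rmat" and a :: "('d::finite, 'd) rmat"
  assumes a: "psd_matrix a" and w: "\<And>i. 0 < w i" and s: "1 \<le> s"
  obtains \<beta>0 where "\<And>\<gamma> v. v \<bullet> (scatter a x Y w (\<beta>0 + s *\<^sub>R (\<gamma> - \<beta>0)) *v v) \<le> s\<^sup>2 * (v \<bullet> (scatter a x Y w \<gamma> *v v))"
proof -
  have a_pos: "\<And>v. 0 \<le> v \<bullet> (a *v v)" using a by (auto simp: psd_matrix_def)
  let ?A = "\<Sum>i\<in>UNIV. w i *\<^sub>R outer (x $ i) (x $ i)"
  obtain \<beta>0 u where "\<And>i. ?A *v u i = x $ i" "\<And>i. 0 \<le> u i \<bullet> x $ i" "\<And>i. w i * (u i \<bullet> x $ i) \<le> 1" "mtranspose ?A = ?A" "\<And>v. 0 \<le> v \<bullet> (?A *v v)"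
    and ls: "\<And>b v. (\<Sum>i\<in>UNIV. w i * (Y i \<bullet> v - x $ i \<bullet> b)\<^sup>2) = (b - \<beta>0 *v v) \<bullet> (?A *v (b - \<beta>0 *v v)) + (\<Sum>i\<in>UNIV. w i * (Y i \<bullet> v - x $ i \<bullet> (\<beta>0 *v v))\<^sup>2)"
    by (rule least_squares[where w=w and x=x and Y=Y, OF w]) (rule that; assumption)
  have s2: "1 \<le> s\<^sup>2" using s by simp
  have "v \<bullet> (scatter a x Y w (\<beta>0 + s *\<^sub>R (\<gamma> - \<beta>0)) *v v) \<le> s\<^sup>2 * (v \<bullet> (scatter a x Y w \<gamma> *v v))" for \<gamma> v
  proof -
    let ?M = "v \<bullet> (a *v v) + (\<Sum>i\<in>UNIV. w i * (Y i \<bullet> v - x $ i \<bullet> (\<beta>0 *v v))\<^sup>2)"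
    let ?g = "(\<gamma> - \<beta>0) *v v"
    have M: "0 \<le> ?M" using a_pos w by (intro add_nonneg_nonneg sum_nonneg) (auto simp: less_imp_le)
    have "(\<beta>0 + s *\<^sub>R (\<gamma> - \<beta>0)) *v v - \<beta>0 *v v = s *\<^sub>R ?g"
      by (simp add: matrix_vector_mult_add_rdistrib scaleR_matrix_vector_assoc[symmetric])
    then have "v \<bullet> (scatter a x Y w (\<beta>0 + s *\<^sub>R (\<gamma> - \<beta>0)) *v v) = s\<^sup>2 * (?g \<bullet> (?A *v ?g)) + ?M"
      unfolding scatter_form ls[of v "(\<beta>0 + s *\<^sub>R (\<gamma> - \<beta>0)) *v v"]
      by (simp add: matrix_vector_mult_scaleR power2_eq_square)
    \<comment> \<open>The dilation scales only the part around the minimizer; the minimal part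
      \<open>?M\<close> is nonnegative and may be enlarged by the same factor.\<close>
    also have "\<dots> \<le> s\<^sup>2 * (?g \<bullet> (?A *v ?g)) + s\<^sup>2 * ?M"
      using mult_right_mono[OF s2 M] by simp
    also have "\<dots> = s\<^sup>2 * (v \<bullet> (scatter a x Y w \<gamma> *v v))"
      unfolding scatter_form ls[of v "\<gamma> *v v"] by (simp add: matrix_vector_mult_diff_rdistrib algebra_simps)
    finally show ?thesis .
  qed
  then show thesis by (rule that)
qed

subsection \<open>Measurability\<close>

lemma measurable_mdet:
  assumes "\<And>i j. (\<lambda>x. A x $ i $ j) \<in> borel_measurable M"
  shows "(\<lambda>x. mdet (A x :: real^'n::finite^'n)) \<in> borel_measurable M"
  unfolding Determinants.det_def using assms by (intro borel_measurable_sum borel_measurable_times borel_measurable_prod) auto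

text \<open>Cramer's rule entry by entry. It exhibits the inverse as a quotient of polynomials in
  the entries, on which its measurability rests.\<close>

lemma matrix_inv_nth:
  fixes A :: "real^'n::finite^'n"
  assumes "mdet A \<noteq> 0"
  shows "matrix_inv A $ i $ j = mdet (\<chi> r c. if c = i then (if r = j then 1 else 0) else A $ r $ c) / mdet A"
proof -
  let ?x = "matrix_inv A *v axis j 1"
  have "A *v ?x = axis j 1" by (simp add: matrix_vector_mul_assoc matrix_inv_inverse[OF assms])
  then have "?x = (\<chi> k. mdet (\<chi> r c. if c = k then axis j 1 $ r else A $ r $ c) / mdet A)"
    using Determinants.cramer[OF assms] by blast
  then have "?x $ i = mdet (\<chi> r c. if c = i then axis j 1 $ r else A $ r $ c) / mdet A" by simp
  moreover have "?x $ i = matrix_inv A $ i $ j" by (simp add: matrix_vector_mult_basis column_def)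
  moreover have "(\<chi> r c. if c = i then axis j 1 $ r else A $ r $ c) = (\<chi> r c. if c = i then (if r = j then 1 else 0) else A $ r $ c)"
    by (auto simp: axis_def Finite_Cartesian_Product.vec_eq_iff)
  ultimately show ?thesis by simp
qed

lemma measurable_matrix_inv_nth:
  assumes A: "\<And>i j. (\<lambda>x. A x $ i $ j) \<in> borel_measurable M" and nz: "\<And>x. x \<in> space M \<Longrightarrow> mdet (A x :: real^'n::finite^'n) \<noteq> 0"
  shows "(\<lambda>x. matrix_inv (A x) $ i $ j) \<in> borel_measurable M"
proof -
  have "(\<lambda>x. mdet (\<chi> r c. if c = i then (if r = j then 1 else 0) else A x $ r $ c) / mdet (A x)) \<in> borel_measurable M"
  proof (intro borel_measurable_divide measurable_mdet A)
    show "(\<lambda>x. (\<chi> r c. if c = i then (if r = j then 1 else 0) else A x $ r $ c) $ r $ c) \<in> borel_measurable M" for r c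
      using A by (cases "c = i"; cases "r = j") simp_all
  qed
  then show ?thesis by (rule measurable_cong[THEN iffD1, rotated]) (simp add: matrix_inv_nth nz)
qed

text \<open>Positivity at every nonzero \<open>v\<close> is an uncountable intersection. Compactness
  of the unit sphere makes it uniform, so that the set becomes a countable union of closed
  sets.\<close>

lemma spd_matrices_borel[measurable]: "(spd_matrices :: (real^'n::finite^'n) set) \<in> sets borel"
proof -
  let ?C = "\<lambda>k::nat. {A :: real^'n^'n. mtranspose A = A} \<inter> (\<Inter>v. {A. (v \<bullet> v) / real (Suc k) \<le> v \<bullet> (A *v v)})"
  have "closed (?C k)" for k
    unfolding Finite_Cartesian_Product.transpose_def matrix_vector_mult_def
    by (intro closed_Int closed_INT ballI closed_Collect_le closed_Collect_eq continuous_intros)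
  then have "(\<Union>k. ?C k) \<in> sets borel" by (intro sets.countable_UN) (auto intro: borel_closed)
  moreover have "spd_matrices = (\<Union>k. ?C k)"
  proof (intro equalityI subsetI)
    fix A :: "real^'n^'n" assume A: "A \<in> spd_matrices"
    have "continuous_on (sphere 0 1) (\<lambda>v. v \<bullet> (A *v v))"
      by (intro continuous_intros)
    moreover have "sphere (0::real^'n) 1 \<noteq> {}" by simp
    ultimately obtain v0 where v0: "v0 \<in> sphere 0 1" "\<And>v. v \<in> sphere 0 1 \<Longrightarrow> v0 \<bullet> (A *v v0) \<le> v \<bullet> (A *v v)"
      using continuous_attains_inf[OF compact_sphere] by blast
    have "0 < v0 \<bullet> (A *v v0)" using v0(1) by (intro spd_D(2)[OF A]) auto
    then obtain k where k: "1 / real (Suc k) < v0 \<bullet> (A *v v0)" using nat_approx_posE by blast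
    have "(v \<bullet> v) / real (Suc k) \<le> v \<bullet> (A *v v)" for v
    proof (cases "v = 0")
      case False
      let ?u = "v /\<^sub>R norm v"
      have "1 / real (Suc k) \<le> ?u \<bullet> (A *v ?u)" using k v0(2)[of ?u] False by simp
      also have "\<dots> = (v \<bullet> (A *v v)) / (v \<bullet> v)"
        by (simp add: matrix_vector_mult_scaleR dot_square_norm power2_eq_square divide_inverse)
      finally show ?thesis using False by (simp add: field_simps)
    qed simp
    then show "A \<in> (\<Union>k. ?C k)" using spd_D(1)[OF A] by blast
  next
    fix A :: "real^'n^'n" assume "A \<in> (\<Union>k. ?C k)"
    then obtain k where A: "mtranspose A = A" "\<And>v. (v \<bullet> v) / real (Suc k) \<le> v \<bullet> (A *v v)" by auto
    have "0 < v \<bullet> (A *v v)" if "v \<noteq> 0" for v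
      using A(2)[of v] that by (meson divide_pos_pos inner_gt_zero_iff less_le_trans of_nat_0_less_iff zero_less_Suc)
    with A(1) show "A \<in> spd_matrices" by (simp add: spd_matrices_def)
  qed
  ultimately show ?thesis by simp
qed

subsection \<open>The parameter space\<close>

lemma sets_lborel_sym[measurable_cong, simp]: "sets lborel_sym = sets borel" and space_lborel_sym[simp]: "space lborel_sym = UNIV"
  by (simp_all add: lborel_sym_def)

lemma emeasure_lborel_sym: "A \<in> sets borel \<Longrightarrow> emeasure lborel_sym A = emeasure (lborel_fun upper) (sym_of_upper -` A \<inter> space (lborel_fun upper))"
  unfolding lborel_sym_def by (rule emeasure_distr) auto

lemma sigma_finite_lborel_sym: "sigma_finite_measure (lborel_sym :: ('d::{finite,linorder}, 'd) rmat measure)"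
proof
  let ?B = "\<lambda>N::nat. {S :: ('d, 'd) rmat. \<forall>i j. \<bar>S $ i $ j\<bar> \<le> real N}"
  have B: "?B N \<in> sets borel" for N
    by (intro borel_closed closed_Collect_all closed_Collect_le continuous_intros)
  have fin: "emeasure lborel_sym (?B N) \<noteq> \<infinity>" for N
  proof -
    have "emeasure lborel_sym (?B N) \<le> emeasure (lborel_fun upper) (Pi\<^sub>E (upper :: ('d \<times> 'd) set) (\<lambda>_. {- real N..real N}))"
      unfolding emeasure_lborel_sym[OF B]
    proof (rule emeasure_mono)
      show "sym_of_upper -` ?B N \<inter> space (lborel_fun upper) \<subseteq> Pi\<^sub>E (upper :: ('d \<times> 'd) set) (\<lambda>_. {- real N..real N})"
      proof
        fix u :: "'d \<times> 'd \<Rightarrow> real" assume "u \<in> sym_of_upper -` ?B N \<inter> space (lborel_fun upper)"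
        then have u: "u \<in> space (lborel_fun upper)" "\<forall>i j. \<bar>sym_of_upper u $ i $ j\<bar> \<le> real N" by auto
        have "\<bar>u p\<bar> \<le> real N" if "p \<in> upper" for p
          using u(2)[rule_format, of "fst p" "snd p"] that by (simp add: sym_of_upper_def upper_def split_beta)
        then show "u \<in> Pi\<^sub>E upper (\<lambda>_. {- real N..real N})"
          using u(1) by (auto simp: space_PiM PiE_iff abs_le_iff minus_le_iff)
      qed
    qed (intro sets_PiM_I_finite, auto)
    also have "\<dots> = (\<Prod>p\<in>(upper :: ('d \<times> 'd) set). ennreal (2 * real N))"
      by (subst PL.emeasure_PiM) auto
    also have "\<dots> < \<infinity>" by (simp add: ennreal_power)
    finally show ?thesis by simp
  qed
  have "\<exists>N::nat. \<forall>i j. \<bar>S $ i $ j\<bar> \<le> real N" for S :: "('d, 'd) rmat"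
  proof -
    obtain N :: nat where N: "Max (range (\<lambda>(i, j). \<bar>S $ i $ j\<bar>)) \<le> real N" using real_arch_simple by blast
    have "\<bar>S $ i $ j\<bar> \<le> Max (range (\<lambda>(i, j). \<bar>S $ i $ j\<bar>))" for i j
      by (rule Max_ge) (auto intro: image_eqI[of _ _ "(i, j)"])
    with N show ?thesis by (meson order_trans)
  qed
  then show "\<exists>A. countable A \<and> A \<subseteq> sets (lborel_sym :: ('d, 'd) rmat measure) \<and> \<Union> A = space lborel_sym \<and> (\<forall>a\<in>A. emeasure lborel_sym a \<noteq> \<infinity>)"
    using B fin by (intro exI[of _ "range ?B"]) auto
qed

text \<open>Provides a box in the free entries that lies inside the cone, so that the cone has
  positive measure. The bound off the diagonal keeps the cross terms at most half of
  \<open>v \<bullet> v\<close>.\<close>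

lemma diagonally_dominant_spd:
  fixes S :: "real^'n::finite^'n"
  assumes sym: "\<And>i j. S $ i $ j = S $ j $ i" and diag: "\<And>i. 1 \<le> S $ i $ i"
    and off: "\<And>i j. i \<noteq> j \<Longrightarrow> \<bar>S $ i $ j\<bar> \<le> 1 / (2 * real CARD('n))"
  shows "S \<in> spd_matrices"
proof -
  let ?e = "1 / (2 * real CARD('n))"
  have "0 < v \<bullet> (S *v v)" if "v \<noteq> 0" for v
  proof -
    have ij: "S $ i $ j * (v $ i * v $ j) \<ge> (if j = i then (v $ i)\<^sup>2 else 0) - ?e * ((v $ i)\<^sup>2 + (v $ j)\<^sup>2) / 2" for i j
    proof (cases "i = j")
      case True
      have 1: "(v $ i)\<^sup>2 \<le> S $ i $ j * (v $ i)\<^sup>2" using True mult_right_mono[OF diag, of "(v $ i)\<^sup>2"] by simp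
      have vv: "v $ i * v $ j = (v $ i)\<^sup>2" using True by (simp add: power2_eq_square)
      have if1: "(if j = i then (v $ i)\<^sup>2 else 0) = (v $ i)\<^sup>2" using True by simp
      show ?thesis unfolding vv if1 by (rule order_trans[OF _ 1]) simp
    next
      case False
      have "2 * (\<bar>v $ i\<bar> * \<bar>v $ j\<bar>) \<le> (v $ i)\<^sup>2 + (v $ j)\<^sup>2"
        using sum_squares_bound[of "\<bar>v $ i\<bar>" "\<bar>v $ j\<bar>"] by (simp add: mult.assoc)
      then have "\<bar>S $ i $ j\<bar> * (\<bar>v $ i\<bar> * \<bar>v $ j\<bar>) \<le> ?e * (((v $ i)\<^sup>2 + (v $ j)\<^sup>2) / 2)"
        by (intro mult_mono off False) auto
      moreover have "- (S $ i $ j * (v $ i * v $ j)) \<le> \<bar>S $ i $ j\<bar> * (\<bar>v $ i\<bar> * \<bar>v $ j\<bar>)"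
        by (metis abs_ge_minus_self abs_mult)
      ultimately show ?thesis using False by simp
    qed
    have "v \<bullet> v / 2 = (\<Sum>i\<in>UNIV. \<Sum>j\<in>UNIV. (if j = i then (v $ i)\<^sup>2 else 0) - ?e * ((v $ i)\<^sup>2 + (v $ j)\<^sup>2) / 2)"
    proof -
      have "(\<Sum>i\<in>UNIV. \<Sum>j\<in>UNIV. (if j = i then (v $ i)\<^sup>2 else 0) - ?e * ((v $ i)\<^sup>2 + (v $ j)\<^sup>2) / 2)
          = (\<Sum>i\<in>UNIV. (v $ i)\<^sup>2) - ?e / 2 * (\<Sum>i\<in>UNIV. \<Sum>j\<in>UNIV. (v $ i)\<^sup>2 + (v $ j)\<^sup>2)"
        by (simp add: sum_subtractf sum_distrib_left)
      also have "(\<Sum>i\<in>UNIV. \<Sum>j\<in>UNIV. (v $ i)\<^sup>2 + (v $ j)\<^sup>2) = 2 * real CARD('n) * (\<Sum>i\<in>UNIV. (v $ i)\<^sup>2)"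
        by (simp add: sum.distrib sum_distrib_left mult.assoc)
      finally show ?thesis by (simp add: inner_vec_def power2_eq_square)
    qed
    also have "\<dots> \<le> (\<Sum>i\<in>UNIV. \<Sum>j\<in>UNIV. S $ i $ j * (v $ i * v $ j))"
      by (intro sum_mono ij)
    also have "\<dots> = v \<bullet> (S *v v)"
      by (simp add: inner_vec_def matrix_vector_mult_def sum_distrib_left mult_ac)
    finally show ?thesis using that by (smt (verit) half_gt_zero inner_gt_zero_iff)
  qed
  then show ?thesis using sym by (simp add: spd_matrices_def Finite_Cartesian_Product.transpose_def Finite_Cartesian_Product.vec_eq_iff)
qed

lemma emeasure_spd_pos: "0 < emeasure lborel_sym (spd_matrices :: ('d::{finite,linorder}, 'd) rmat set)"
proof -
  let ?e = "1 / (2 * real CARD('d))"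
  let ?I = "\<lambda>p::'d \<times> 'd. if fst p = snd p then {1..2} else {- ?e..?e}"
  have "0 < (\<Prod>p\<in>(upper :: ('d \<times> 'd) set). ennreal (if fst p = snd p then 1 else 2 * ?e))"
    by (subst prod_ennreal) (auto intro!: prod_pos)
  also have "\<dots> = (\<Prod>p\<in>upper. emeasure lborel (?I p))"
    by (intro prod.cong) auto
  also have "\<dots> = emeasure (lborel_fun upper) (Pi\<^sub>E upper ?I)"
    by (intro PL.emeasure_PiM[symmetric]) auto
  also have "\<dots> \<le> emeasure (lborel_fun upper) (sym_of_upper -` (spd_matrices :: ('d, 'd) rmat set) \<inter> space (lborel_fun upper))"
  proof (rule emeasure_mono)
    show "Pi\<^sub>E upper ?I \<subseteq> sym_of_upper -` (spd_matrices :: ('d, 'd) rmat set) \<inter> space (lborel_fun upper)"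
    proof
      fix u assume u: "u \<in> Pi\<^sub>E upper ?I"
      have "sym_of_upper u $ i $ j \<in> ?I (i, j)" for i j
        using u PiE_mem[OF u, of "(i, j)"] PiE_mem[OF u, of "(j, i)"] by (auto simp: sym_of_upper_def upper_def split: if_splits)
      then have "sym_of_upper u \<in> spd_matrices"
        by (intro diagonally_dominant_spd sym_of_upper_symmetric) (force simp: abs_le_iff minus_le_iff split: if_splits)+
      then show "u \<in> sym_of_upper -` (spd_matrices :: ('d, 'd) rmat set) \<inter> space (lborel_fun upper)"
        using u by (auto simp: space_PiM PiE_iff)
    qed
  qed measurable
  finally show ?thesis by (simp add: emeasure_lborel_sym)
qed

lemma lborel_spd_eq: "lborel_spd = restrict_space lborel_sym spd_matrices"
  by (simp add: lborel_spd_def lborel_sym_def upper_def)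

lemma space_param_space: "space param_space = UNIV \<times> spd_matrices"
  by (simp add: param_space_def space_pair_measure lborel_spd_eq space_restrict_space)

lemma sigma_finite_lborel_spd: "sigma_finite_measure lborel_spd"
  unfolding lborel_spd_eq by (intro sigma_finite_measure_restrict_space sigma_finite_lborel_sym) simp

interpretation PS: pair_sigma_finite "lborel :: ('p::finite, 'd::{finite,linorder}) rmat measure" "lborel_spd :: ('d, 'd) rmat measure"
  by (intro pair_sigma_finite.intro lborel.sigma_finite_measure_axioms sigma_finite_lborel_spd)

lemma sigma_finite_param_space: "sigma_finite_measure param_space"
  unfolding param_space_def by (rule PS.sigma_finite_measure_axioms)

lemma nn_integral_param_space:
  fixes f :: "('p::finite, 'd::{finite,linorder}) rmat \<times> ('d, 'd) rmat \<Rightarrow> ennreal"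
  assumes "f \<in> borel_measurable param_space"
  shows "(\<integral>\<^sup>+z. f z \<partial>param_space) = (\<integral>\<^sup>+S. (\<integral>\<^sup>+\<beta>. f (\<beta>, S) * indicator spd_matrices S \<partial>lborel) \<partial>lborel_sym)"
proof -
  have "(\<integral>\<^sup>+z. f z \<partial>param_space) = (\<integral>\<^sup>+S. \<integral>\<^sup>+\<beta>. f (\<beta>, S) \<partial>lborel \<partial>lborel_spd)"
    using assms unfolding param_space_def by (intro PS.nn_integral_snd[symmetric])
  also have "\<dots> = (\<integral>\<^sup>+S. (\<integral>\<^sup>+\<beta>. f (\<beta>, S) \<partial>lborel) * indicator spd_matrices S \<partial>lborel_sym)"
    unfolding lborel_spd_eq by (rule nn_integral_restrict_space) simp
  also have "\<dots> = (\<integral>\<^sup>+S. (\<integral>\<^sup>+\<beta>. f (\<beta>, S) * indicator spd_matrices S \<partial>lborel) \<partial>lborel_sym)"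
    by (intro nn_integral_cong) (auto split: split_indicator)
  finally show ?thesis .
qed

lemma measurable_param_space:
  "(\<lambda>z. fst z) \<in> borel_measurable param_space" "(\<lambda>z. snd z) \<in> borel_measurable param_space"
proof -
  show "(\<lambda>z. fst z) \<in> borel_measurable param_space"
    unfolding param_space_def by (rule measurable_compose[OF measurable_fst]) simp
  have "(\<lambda>S. S) \<in> measurable lborel_spd borel"
    unfolding lborel_spd_eq by (intro measurable_restrict_space1) simp
  then show "(\<lambda>z. snd z) \<in> borel_measurable param_space"
    unfolding param_space_def by (rule measurable_compose[OF measurable_snd])
qed

lemma emeasure_param_space_pos: "0 < emeasure (param_space :: (('p::finite, 'd::{finite,linorder}) rmat \<times> ('d, 'd) rmat) measure) (space param_space)"
proof -
  have "emeasure (param_space :: (('p, 'd) rmat \<times> ('d, 'd) rmat) measure) (UNIV \<times> spd_matrices)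
      = emeasure (lborel :: ('p, 'd) rmat measure) UNIV * emeasure lborel_spd (spd_matrices :: ('d, 'd) rmat set)"
    unfolding param_space_def
    by (intro PS.M2.emeasure_pair_measure_Times) (auto simp: lborel_spd_eq sets_restrict_space_iff)
  also have "emeasure lborel_spd (spd_matrices :: ('d, 'd) rmat set) = emeasure lborel_sym (spd_matrices :: ('d, 'd) rmat set)"
    unfolding lborel_spd_eq by (intro emeasure_restrict_space) auto
  finally show ?thesis using emeasure_spd_pos[where 'd='d]
    by (simp add: space_param_space emeasure_lborel_UNIV ennreal_zero_less_mult_iff)
qed

subsection \<open>The complete-data normalizing integral\<close>

text \<open>The inverse Wishart kernel with scale matrix \<open>E\<close>. The indicator extends it
  to all symmetric matrices, the domain on which the congruence substitution is stated.\<close>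

definition full_dens :: "real \<Rightarrow> ('d::finite, 'd) rmat \<Rightarrow> ('d, 'd) rmat \<Rightarrow> ennreal" where
  "full_dens r E S = ennreal (mdet S powr (- r / 2) * exp (- (1 / 2) * mtrace (matrix_inv S ** E))) * indicator spd_matrices S"

lemma measurable_full_dens:
  assumes E: "E \<in> borel_measurable M" and S[measurable]: "S \<in> borel_measurable M"
  shows "(\<lambda>x. full_dens r (E x) (S x)) \<in> borel_measurable M"
proof -
  let ?\<Omega> = "{x \<in> space M. S x \<in> spd_matrices}"
  have \<Omega>: "?\<Omega> \<in> sets M" by measurable
  have nth: "(\<lambda>x. S x $ i $ j) \<in> borel_measurable (restrict_space M ?\<Omega>)" "(\<lambda>x. E x $ i $ j) \<in> borel_measurable (restrict_space M ?\<Omega>)" for i j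
    using measurable_compose[OF measurable_compose[OF S measurable_vec_nth] measurable_vec_nth]
      measurable_compose[OF measurable_compose[OF E measurable_vec_nth] measurable_vec_nth]
    by (auto intro: measurable_restrict_space1)
  have nz: "mdet (S x) \<noteq> 0" if "x \<in> space (restrict_space M ?\<Omega>)" for x
    using that spd_det_pos[of "S x"] by (auto simp: space_restrict_space)
  have "(\<lambda>x. ennreal (mdet (S x) powr (- r / 2) * exp (- (1 / 2) * mtrace (matrix_inv (S x) ** E x)))) \<in> borel_measurable (restrict_space M ?\<Omega>)"
    unfolding Determinants.trace_def matrix_matrix_mult_def
    using measurable_mdet[OF nth(1)] nth(2) measurable_matrix_inv_nth[OF nth(1) nz] by simp
  then have "(\<lambda>x. ennreal (mdet (S x) powr (- r / 2) * exp (- (1 / 2) * mtrace (matrix_inv (S x) ** E x))) * indicator ?\<Omega> x) \<in> borel_measurable M"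
    using \<Omega> by (subst (asm) borel_measurable_restrict_space_iff_ennreal) auto
  then show ?thesis
    by (rule measurable_cong[THEN iffD1, rotated]) (auto simp: full_dens_def split: split_indicator)
qed

lemma trace_congruence:
  fixes T S E :: "real^'d::finite^'d"
  assumes T: "mdet T \<noteq> 0" and S: "mdet S \<noteq> 0"
  shows "mtrace (matrix_inv (T ** S ** mtranspose T) ** (T ** E ** mtranspose T)) = mtrace (matrix_inv S ** E)"
proof -
  have inv: "matrix_inv (T ** S ** mtranspose T) = matrix_inv (mtranspose T) ** matrix_inv S ** matrix_inv T"
  proof (rule matrix_inv_eqI)
    have "T ** S ** mtranspose T ** (matrix_inv (mtranspose T) ** matrix_inv S ** matrix_inv T)
        = T ** (S ** (mtranspose T ** matrix_inv (mtranspose T)) ** matrix_inv S) ** matrix_inv T"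
      by (simp only: matrix_mul_assoc)
    then show "T ** S ** mtranspose T ** (matrix_inv (mtranspose T) ** matrix_inv S ** matrix_inv T) = id_mat"
      using T S by (simp add: matrix_inv_inverse)
  qed
  have "mtrace (matrix_inv (T ** S ** mtranspose T) ** (T ** E ** mtranspose T)) = mtrace (matrix_inv (mtranspose T) ** (matrix_inv S ** (matrix_inv T ** T) ** E ** mtranspose T))"
    unfolding inv by (simp only: matrix_mul_assoc)
  also have "\<dots> = mtrace (matrix_inv S ** (matrix_inv T ** T) ** E ** mtranspose T ** matrix_inv (mtranspose T))"
    by (rule trace_mul_sym)
  also have "\<dots> = mtrace (matrix_inv S ** E)"
    using T by (simp add: matrix_inv_inverse matrix_mul_assoc[symmetric])
  finally show ?thesis .
qed

lemma full_dens_congruence: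
  assumes T: "0 < mdet T"
  shows "full_dens r (T ** E ** mtranspose T) (T ** S ** mtranspose T) = ennreal (mdet T powr (- r)) * full_dens r E S"
proof (cases "S \<in> spd_matrices")
  case True
  then have S: "0 < mdet S" by (rule spd_det_pos)
  have "mdet (T ** S ** mtranspose T) powr (- r / 2) = mdet T powr (- r) * mdet S powr (- r / 2)"
  proof -
    have "mdet (T ** S ** mtranspose T) = mdet T powr 2 * mdet S" using T by (simp add: det_mul power2_eq_square)
    then have "mdet (T ** S ** mtranspose T) powr (- r / 2) = (mdet T powr 2) powr (- r / 2) * mdet S powr (- r / 2)"
      by (simp only: powr_mult powr_ge_zero less_imp_le[OF S])
    then show ?thesis by (simp only: powr_powr) simp
  qed
  then show ?thesis using True T S spd_congruence_iff[of T S]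
    by (simp add: full_dens_def trace_congruence ennreal_mult[symmetric] mult.assoc)
next
  case False
  then show ?thesis using T spd_congruence_iff[of T S] by (simp add: full_dens_def)
qed

text \<open>The Jacobian has one factor for each action: \<open>K\<close> on the
  \<open>CARD('d)\<close> columns of \<beta>, \<open>R\<close> on its \<open>CARD('p)\<close> rows,
  and \<open>T\<close> on the symmetric matrix.\<close>

lemma nn_integral_param_substitution:
  fixes f :: "('p::finite, 'd::{finite,linorder}) rmat \<Rightarrow> ('d, 'd) rmat \<Rightarrow> ennreal"
  assumes f: "(\<lambda>z. f (fst z) (snd z)) \<in> borel_measurable (borel \<Otimes>\<^sub>M borel)"
    and K: "mdet K \<noteq> 0" and R: "mdet R \<noteq> 0" and T: "mdet T \<noteq> 0"
  shows "(\<integral>\<^sup>+S. \<integral>\<^sup>+\<beta>. f \<beta> S \<partial>lborel \<partial>lborel_sym)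
    = ennreal (\<bar>mdet K\<bar> ^ CARD('d) * \<bar>mdet R\<bar> ^ CARD('p) * \<bar>mdet T\<bar> ^ (CARD('d) + 1)) *
      (\<integral>\<^sup>+S. \<integral>\<^sup>+\<gamma>. f (\<beta>1 + K ** (\<gamma> - \<beta>0) ** R) (T ** S ** mtranspose T) \<partial>lborel \<partial>lborel_sym)"
proof -
  have cancel: "c * (1 / c) = 1" if "c \<noteq> 0" for c :: real using that by simp
  have step: "v = ennreal c * u" if "u = ennreal (1 / c) * v" "0 < c" for u v :: ennreal and c :: real
    unfolding that(1) mult.assoc[symmetric] using that(2) by (simp add: ennreal_mult[symmetric])
  have fS: "(\<lambda>\<beta>. f \<beta> S) \<in> borel_measurable borel" for S
    using measurable_compose[OF measurable_Pair2' f, of S] by simp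
  have inner: "(\<integral>\<^sup>+\<beta>. g \<beta> \<partial>lborel) = ennreal (\<bar>mdet K\<bar> ^ CARD('d)) * (ennreal (\<bar>mdet R\<bar> ^ CARD('p)) * (\<integral>\<^sup>+\<gamma>. g (\<beta>1 + K ** (\<gamma> - \<beta>0) ** R) \<partial>lborel))"
    if g: "g \<in> borel_measurable borel" for g :: "('p, 'd) rmat \<Rightarrow> ennreal"
  proof -
    have gt: "(\<lambda>\<beta>. g (\<beta>1 + \<beta>)) \<in> borel_measurable borel" by (rule measurable_compose[OF _ g]) simp
    have gR: "(\<lambda>\<beta>. g (\<beta>1 + \<beta> ** R)) \<in> borel_measurable borel"
      by (rule measurable_compose[OF measurable_matrix_mult(2) gt])
    have gK: "(\<lambda>\<beta>. g (\<beta>1 + K ** \<beta> ** R)) \<in> borel_measurable borel"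
      by (rule measurable_compose[OF measurable_matrix_mult(1) gR])
    have "(\<integral>\<^sup>+\<beta>. g \<beta> \<partial>lborel) = (\<integral>\<^sup>+\<beta>. g (\<beta>1 + \<beta>) \<partial>lborel)" by (rule nn_integral_translate[OF g, symmetric])
    also have "\<dots> = ennreal (\<bar>mdet R\<bar> ^ CARD('p)) * (\<integral>\<^sup>+\<beta>. g (\<beta>1 + \<beta> ** R) \<partial>lborel)"
      using R by (intro step[OF nn_integral_right_mult[OF R gt]]) simp
    also have "(\<integral>\<^sup>+\<beta>. g (\<beta>1 + \<beta> ** R) \<partial>lborel) = ennreal (\<bar>mdet K\<bar> ^ CARD('d)) * (\<integral>\<^sup>+\<beta>. g (\<beta>1 + K ** \<beta> ** R) \<partial>lborel)"
      using K by (intro step[OF nn_integral_left_mult[OF K gR]]) simp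
    also have "(\<integral>\<^sup>+\<beta>. g (\<beta>1 + K ** \<beta> ** R) \<partial>lborel) = (\<integral>\<^sup>+\<gamma>. g (\<beta>1 + K ** (- \<beta>0 + \<gamma>) ** R) \<partial>lborel)"
      by (rule nn_integral_translate[OF gK, symmetric])
    finally show ?thesis by (simp add: mult_ac)
  qed
  have m: "(\<lambda>z. f (\<beta>1 + K ** (fst z - \<beta>0) ** R) (snd z)) \<in> borel_measurable (borel \<Otimes>\<^sub>M borel)"
  proof -
    have "(\<lambda>z :: ('p, 'd) rmat \<times> ('d, 'd) rmat. \<beta>1 + K ** (fst z - \<beta>0) ** R) \<in> borel_measurable (borel \<Otimes>\<^sub>M borel)"
      by (intro borel_measurable_add borel_measurable_const measurable_compose[OF _ measurable_matrix_mult(2)]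
          measurable_compose[OF _ measurable_matrix_mult(1)] borel_measurable_diff measurable_fst)
    from measurable_compose[OF measurable_Pair[OF this measurable_snd] f] show ?thesis by simp
  qed
  define h where "h S = (\<integral>\<^sup>+\<gamma>. f (\<beta>1 + K ** (\<gamma> - \<beta>0) ** R) S \<partial>lborel)" for S
  have h: "h \<in> borel_measurable borel"
  proof -
    have "(\<lambda>(S, \<gamma>). f (\<beta>1 + K ** (\<gamma> - \<beta>0) ** R) S) \<in> borel_measurable (borel \<Otimes>\<^sub>M lborel)"
      using measurable_compose[OF measurable_Pair[OF measurable_snd measurable_fst] m]
      by (simp add: split_beta measurable_cong_sets[OF sets_pair_measure_cong[OF refl sets_lborel] refl])
    then show ?thesis unfolding h_def by (rule lborel.borel_measurable_nn_integral)
  qed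
  have "(\<integral>\<^sup>+S. \<integral>\<^sup>+\<beta>. f \<beta> S \<partial>lborel \<partial>lborel_sym) = (\<integral>\<^sup>+S. ennreal (\<bar>mdet K\<bar> ^ CARD('d) * \<bar>mdet R\<bar> ^ CARD('p)) * h S \<partial>lborel_sym)"
    unfolding h_def by (intro nn_integral_cong) (simp add: inner[OF fS] mult.assoc[symmetric] ennreal_mult)
  also have "\<dots> = ennreal (\<bar>mdet K\<bar> ^ CARD('d) * \<bar>mdet R\<bar> ^ CARD('p)) * (\<integral>\<^sup>+S. h S \<partial>lborel_sym)"
    using h by (intro nn_integral_cmult) simp
  also have "(\<integral>\<^sup>+S. h S \<partial>lborel_sym) = ennreal (\<bar>mdet T\<bar> ^ (CARD('d) + 1)) * (\<integral>\<^sup>+S. h (T ** S ** mtranspose T) \<partial>lborel_sym)"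
    using T by (intro step[OF nn_integral_congruence[OF T h]]) simp
  finally show ?thesis by (simp add: h_def mult.assoc[symmetric] ennreal_mult)
qed

definition complete_integral :: "real \<Rightarrow> ('d::{finite,linorder}, 'd) rmat \<Rightarrow> ('n::finite, 'p::finite) rmat \<Rightarrow> ('n \<Rightarrow> 'd rvec) \<Rightarrow> ('n \<Rightarrow> real) \<Rightarrow> ennreal" where
  "complete_integral r a x Y w = (\<integral>\<^sup>+S. \<integral>\<^sup>+\<beta>. full_dens r (scatter a x Y w \<beta>) S \<partial>lborel \<partial>lborel_sym)"

lemma measurable_scatter:
  assumes Y: "\<And>i. (\<lambda>q. Y q i) \<in> borel_measurable M" and \<beta>: "\<beta> \<in> borel_measurable M"
  shows "(\<lambda>q. scatter a x (Y q) w (\<beta> q)) \<in> borel_measurable M"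
proof -
  have nth: "(\<lambda>q. Y q i $ j) \<in> borel_measurable M" "(\<lambda>q. \<beta> q $ k $ j) \<in> borel_measurable M" for i j k
    using measurable_compose[OF Y measurable_vec_nth] measurable_compose[OF measurable_compose[OF \<beta> measurable_vec_nth] measurable_vec_nth] by auto
  have "scatter a x (Y q) w (\<beta> q) = (\<chi> j l. a $ j $ l + (\<Sum>i\<in>UNIV. w i * ((Y q i $ j - (\<Sum>k\<in>UNIV. \<beta> q $ k $ j * x $ i $ k)) * (Y q i $ l - (\<Sum>k\<in>UNIV. \<beta> q $ k $ l * x $ i $ k)))))" for q
    by (simp add: scatter_def outer_def matrix_vector_mult_def Finite_Cartesian_Product.transpose_def Finite_Cartesian_Product.vec_eq_iff del: transpose_matrix_vector)
  then show ?thesis using nth by (simp, intro measurable_vec_lambda) auto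
qed

text \<open>Substituting by \<open>scatter_upweight\<close> leaves \<open>mdet K\<close> to the
  power \<open>d\<close> times \<open>mdet T\<close> to the power \<open>- (r - p - d - 1)\<close>.
  The assumption on \<open>r\<close> makes the second factor nonincreasing in \<open>mdet T\<close>,
  so the worst case is \<open>mdet K = 1 / sqrt t\<close> with \<open>mdet T = sqrt t\<close>, and
  the two powers of \<open>t\<close> combine.\<close>

lemma complete_integral_upweight:
  fixes x :: "('n::finite, 'p::finite) rmat" and a :: "('d::{finite,linorder}, 'd) rmat"
  assumes a: "psd_matrix a" and w: "\<And>i. 0 < w i" and t: "1 \<le> t" and \<nu>: "0 \<le> r - real CARD('p) - real CARD('d) - 1"
  shows "ennreal (t powr (- (r - real CARD('p) - 1) / 2)) * complete_integral r a x Y w \<le> complete_integral r a x Y (w(i := t * w i))"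
proof -
  obtain \<beta>0 \<beta>1 K T where T: "1 \<le> mdet T" "mdet T \<le> sqrt t" and K: "1 / sqrt t \<le> mdet K" "mdet K \<le> 1" "0 < mdet K"
    and sc: "\<And>\<gamma>. scatter a x Y (w(i := t * w i)) (\<beta>1 + K ** (\<gamma> - \<beta>0) ** mtranspose T) = T ** scatter a x Y w \<gamma> ** mtranspose T"
    by (rule scatter_upweight[where a=a and x=x and Y=Y and w=w and i=i, OF a w t]) (rule that; assumption)
  have m: "(\<lambda>z. full_dens r (scatter a x Y w' (fst z)) (snd z)) \<in> borel_measurable (borel \<Otimes>\<^sub>M borel)" for w'
    by (intro measurable_full_dens measurable_scatter measurable_fst measurable_snd) simp
  have mi: "(\<lambda>S. \<integral>\<^sup>+\<beta>. full_dens r (scatter a x Y w \<beta>) S \<partial>lborel) \<in> borel_measurable lborel_sym"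
  proof -
    have "(\<lambda>(S, \<beta>). full_dens r (scatter a x Y w \<beta>) S) \<in> borel_measurable (borel \<Otimes>\<^sub>M lborel)"
      using measurable_compose[OF measurable_Pair[OF measurable_snd measurable_fst] m]
      by (simp add: split_beta measurable_cong_sets[OF sets_pair_measure_cong[OF refl sets_lborel] refl])
    then show ?thesis using lborel.borel_measurable_nn_integral by simp
  qed
  have mi2: "(\<lambda>\<beta>. full_dens r (scatter a x Y w \<beta>) S) \<in> borel_measurable lborel" for S
    using measurable_compose[OF measurable_Pair2' m, of S] by simp
  let ?c = "\<bar>mdet K\<bar> ^ CARD('d) * \<bar>mdet (mtranspose T)\<bar> ^ CARD('p) * \<bar>mdet T\<bar> ^ (CARD('d) + 1)"
  have "complete_integral r a x Y (w(i := t * w i)) = ennreal ?c *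
      (\<integral>\<^sup>+S. \<integral>\<^sup>+\<gamma>. full_dens r (scatter a x Y (w(i := t * w i)) (\<beta>1 + K ** (\<gamma> - \<beta>0) ** mtranspose T)) (T ** S ** mtranspose T) \<partial>lborel \<partial>lborel_sym)"
    unfolding complete_integral_def using T K by (intro nn_integral_param_substitution m) auto
  also have "\<dots> = ennreal ?c * (ennreal (mdet T powr (- r)) * complete_integral r a x Y w)"
  proof -
    have "0 < mdet T" using T by simp
    then show ?thesis unfolding complete_integral_def sc
      by (simp only: full_dens_congruence nn_integral_cmult[OF mi2] nn_integral_cmult[OF mi])
  qed
  also have "\<dots> = ennreal (?c * mdet T powr (- r)) * complete_integral r a x Y w"
    by (simp add: ennreal_mult mult.assoc)
  finally have eq: "complete_integral r a x Y (w(i := t * w i)) = ennreal (?c * mdet T powr (- r)) * complete_integral r a x Y w" .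
  have "?c * mdet T powr (- r) = mdet K powr real CARD('d) * mdet T powr (- (r - real CARD('p) - real CARD('d) - 1))"
  proof -
    have "?c * mdet T powr (- r) = mdet K powr real CARD('d) * (mdet T powr real CARD('p) * mdet T powr real (CARD('d) + 1) * mdet T powr (- r))"
      using T K by (simp add: powr_realpow mult.assoc del: of_nat_Suc of_nat_add)
    also have "mdet T powr real CARD('p) * mdet T powr real (CARD('d) + 1) * mdet T powr (- r) = mdet T powr (- (r - real CARD('p) - real CARD('d) - 1))"
      unfolding powr_add[symmetric] by (rule arg_cong[of _ _ "\<lambda>e. mdet T powr e"]) simp
    finally show ?thesis .
  qed
  also have "\<dots> \<ge> (1 / sqrt t) powr real CARD('d) * sqrt t powr (- (r - real CARD('p) - real CARD('d) - 1))"
    using T K t \<nu> by (intro mult_mono powr_mono2 powr_mono2') auto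
  also have "(1 / sqrt t) powr real CARD('d) * sqrt t powr (- (r - real CARD('p) - real CARD('d) - 1)) = t powr (- (r - real CARD('p) - 1) / 2)"
  proof -
    have "(1 / sqrt t) powr real CARD('d) = t powr (- real CARD('d) / 2)"
      using t by (simp add: powr_half_sqrt[symmetric] powr_powr powr_divide powr_minus_divide)
    moreover have "sqrt t powr (- (r - real CARD('p) - real CARD('d) - 1)) = t powr (- (r - real CARD('p) - real CARD('d) - 1) / 2)"
      using t by (simp add: powr_half_sqrt[symmetric] powr_powr)
    ultimately show ?thesis using t by (simp add: powr_add[symmetric] add_divide_distrib[symmetric] diff_divide_distrib[symmetric] algebra_simps)
  qed
  finally show ?thesis unfolding eq by (intro mult_right_mono ennreal_leI) auto
qed

subsection \<open>Selection matrices\<close>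

definition obs_set :: "('n::finite, 'd::finite) bmat \<Rightarrow> 'n \<Rightarrow> 'd set" where
  "obs_set k i = {j. k $ i $ j}"

definition obs_index :: "('n::finite, 'd::{finite,linorder}) bmat \<Rightarrow> 'n \<Rightarrow> nat \<Rightarrow> 'd" where
  "obs_index k i l = sorted_list_of_set (obs_set k i) ! l"

lemma num_obs_eq: "num_obs k i = card (obs_set k i)"
  by (simp add: num_obs_def obs_set_def)

lemma bij_betw_obs_index: "bij_betw (obs_index k i) {0..<num_obs k i} (obs_set k i)"
proof -
  have "bij_betw ((!) (sorted_list_of_set (obs_set k i))) {..<num_obs k i} (set (sorted_list_of_set (obs_set k i)))"
    by (intro bij_betw_nth) (simp_all add: num_obs_eq)
  then show ?thesis by (simp add: obs_index_def[abs_def] atLeast0LessThan)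
qed

lemma bij_betw_nth_index: "bij_betw nth_index {0..<CARD('d)} (UNIV :: 'd::{finite,linorder} set)"
proof -
  have "bij_betw ((!) (sorted_list_of_set (UNIV :: 'd set))) {..<CARD('d)} (set (sorted_list_of_set (UNIV :: 'd set)))"
    by (intro bij_betw_nth) simp_all
  then show ?thesis by (simp add: nth_index_def[abs_def] atLeast0LessThan)
qed

lemma sum_nth_index: "(\<Sum>q\<in>{0..<CARD('d)}. f (nth_index q :: 'd::{finite,linorder})) = (\<Sum>j\<in>UNIV. f j)"
  by (rule sum.reindex_bij_betw[OF bij_betw_nth_index])

lemma sum_obs_index: "(\<Sum>l\<in>{0..<num_obs k i}. f (obs_index k i l)) = (\<Sum>j\<in>obs_set k i. f j)"
  by (rule sum.reindex_bij_betw[OF bij_betw_obs_index])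

lemma sel_mat_eq: "sel_mat k i = Matrix.mat (num_obs k i) CARD('d) (\<lambda>(l, q). if nth_index q = obs_index k i l then 1 else 0)"
  for k :: "('n::finite, 'd::{finite,linorder}) bmat"
  by (simp add: sel_mat_def obs_index_def obs_set_def)

lemma sel_mat_mult_vec: "sel_mat k i *\<^sub>v to_vec v = Matrix.vec (num_obs k i) (\<lambda>l. v $ obs_index k i l)"
proof (rule eq_vecI)
  fix l assume "l < dim_vec (Matrix.vec (num_obs k i) (\<lambda>l. v $ obs_index k i l))"
  then have l: "l < num_obs k i" by simp
  have "vec_index (sel_mat k i *\<^sub>v to_vec v) l = (\<Sum>q\<in>{0..<CARD('a)}. (if nth_index q = obs_index k i l then 1 else 0) * v $ nth_index q)"
    using l by (simp add: sel_mat_eq to_vec_def scalar_prod_def)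
  also have "\<dots> = v $ obs_index k i l"
    by (subst sum_nth_index) (simp add: if_distrib[of "\<lambda>x. x * _"] cong: if_cong)
  finally show "vec_index (sel_mat k i *\<^sub>v to_vec v) l = vec_index (Matrix.vec (num_obs k i) (\<lambda>l. v $ obs_index k i l)) l"
    using l by simp
qed (simp add: sel_mat_eq)

lemma obs_scale_eq: "obs_scale k i S = Matrix.mat (num_obs k i) (num_obs k i) (\<lambda>(l, q). S $ obs_index k i l $ obs_index k i q)"
  for k :: "('n::finite, 'd::{finite,linorder}) bmat"
proof (rule eq_matI)
  fix l q assume "l < dim_row (Matrix.mat (num_obs k i) (num_obs k i) (\<lambda>(l, q). S $ obs_index k i l $ obs_index k i q))"
    "q < dim_col (Matrix.mat (num_obs k i) (num_obs k i) (\<lambda>(l, q). S $ obs_index k i l $ obs_index k i q))"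
  then have l: "l < num_obs k i" and q: "q < num_obs k i" by auto
  have 1: "index_mat (sel_mat k i * to_mat S) (l, r) = S $ obs_index k i l $ nth_index r" if "r < CARD('d)" for r
  proof -
    have "index_mat (sel_mat k i * to_mat S) (l, r) = (\<Sum>q\<in>{0..<CARD('d)}. (if nth_index q = obs_index k i l then 1 else 0) * S $ nth_index q $ nth_index r)"
      using l that by (simp add: sel_mat_eq to_mat_def scalar_prod_def)
    also have "\<dots> = S $ obs_index k i l $ nth_index r"
      by (subst sum_nth_index) (simp add: if_distrib[of "\<lambda>x. x * _"] cong: if_cong)
    finally show ?thesis .
  qed
  have "index_mat (obs_scale k i S) (l, q) = (\<Sum>r\<in>{0..<CARD('d)}. S $ obs_index k i l $ nth_index r * (if nth_index r = obs_index k i q then 1 else 0))"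
  proof -
    have "index_mat (obs_scale k i S) (l, q) = (\<Sum>r\<in>{0..<CARD('d)}. index_mat (sel_mat k i * to_mat S) (l, r) * index_mat (sel_mat k i) (q, r))"
      using l q by (simp add: obs_scale_def sel_mat_eq to_mat_def scalar_prod_def)
    also have "\<dots> = (\<Sum>r\<in>{0..<CARD('d)}. S $ obs_index k i l $ nth_index r * (if nth_index r = obs_index k i q then 1 else 0))"
      by (intro sum.cong refl arg_cong2[of _ _ _ _ "(*)"]) (use q in \<open>simp_all only: 1 atLeastLessThan_iff\<close>, simp add: sel_mat_eq)
    finally show ?thesis .
  qed
  also have "\<dots> = S $ obs_index k i l $ obs_index k i q"
    by (subst sum_nth_index) (simp add: if_distrib[of "\<lambda>x. _ * x"] cong: if_cong)
  finally show "index_mat (obs_scale k i S) (l, q) = index_mat (Matrix.mat (num_obs k i) (num_obs k i) (\<lambda>(l, q). S $ obs_index k i l $ obs_index k i q)) (l, q)"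
    using l q by simp
qed (simp_all add: obs_scale_def sel_mat_eq)

text \<open>The Leibniz sums run over different index types. A permutation that moves a padded index
  meets a zero entry; the remaining ones permute \<open>obs_set k i\<close> and correspond through
  \<open>obs_index\<close> to permutations of the positions, with equal sign.\<close>

lemma det_obs_scale:
  fixes k :: "('n::finite, 'd::{finite,linorder}) bmat"
  shows "Determinant.det (obs_scale k i S) = mdet (pad_block (obs_set k i) S)"
proof -
  let ?U = "obs_set k i" and ?r = "num_obs k i" and ?f = "obs_index k i"
  let ?P = "pad_block ?U S"
  note bij = bij_betw_obs_index[of k i]
  have inj: "inj_on ?f {0..<?r}" using bij by (simp add: bij_betw_def)
  have "map_permutation {0..<?r} ?f = (\<lambda>\<pi> x. if x \<in> ?U then ?f (\<pi> (inv_into {0..<?r} ?f x)) else x)"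
    using bij by (auto simp: map_permutation_def restrict_id_def bij_betw_def fun_eq_iff)
  then have perms: "bij_betw (map_permutation {0..<?r} ?f) {p. p permutes {0..<?r}} {p. p permutes ?U}"
    using bij_betw_permutations[OF bij] by simp
  have "mdet ?P = (\<Sum>p | p permutes UNIV. of_int (sign p) * (\<Prod>i\<in>UNIV. ?P $ i $ p i))"
    by (simp add: Determinants.det_def)
  also have "\<dots> = (\<Sum>p | p permutes ?U. of_int (sign p) * (\<Prod>i\<in>UNIV. ?P $ i $ p i))"
  proof (rule sum.mono_neutral_right)
    show "\<forall>p\<in>{p. p permutes UNIV} - {p. p permutes ?U}. of_int (sign p) * (\<Prod>i\<in>UNIV. ?P $ i $ p i) = 0"
    proof
      fix p assume p: "p \<in> {p. p permutes UNIV} - {p. p permutes ?U}"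
      then obtain j where "j \<notin> ?U" "p j \<noteq> j" by (auto simp: permutes_def)
      then have "?P $ j $ p j = 0" by (simp add: pad_block_def)
      then have "(\<Prod>i\<in>UNIV. ?P $ i $ p i) = 0" by (auto intro!: prod_zero)
      then show "of_int (sign p) * (\<Prod>i\<in>UNIV. ?P $ i $ p i) = 0" by (simp only: mult_zero_right)
    qed
  qed (auto intro: permutes_subset finite_permutations)
  also have "\<dots> = (\<Sum>p | p permutes ?U. of_int (sign p) * (\<Prod>i\<in>?U. S $ i $ p i))"
  proof (intro sum.cong refl arg_cong2[of _ _ _ _ "(*)"])
    fix p assume "p \<in> {p. p permutes ?U}"
    then have p: "p permutes ?U" by simp
    have "(\<Prod>i\<in>UNIV. ?P $ i $ p i) = (\<Prod>i\<in>?U. ?P $ i $ p i)"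
      using p by (intro prod.mono_neutral_right) (auto simp: pad_block_def permutes_not_in)
    also have "\<dots> = (\<Prod>i\<in>?U. S $ i $ p i)"
      using permutes_in_image[OF p] by (intro prod.cong) (auto simp: pad_block_def)
    finally show "(\<Prod>i\<in>UNIV. ?P $ i $ p i) = (\<Prod>i\<in>?U. S $ i $ p i)" .
  qed
  also have "\<dots> = (\<Sum>p | p permutes {0..<?r}. of_int (sign (map_permutation {0..<?r} ?f p)) * (\<Prod>i\<in>?U. S $ i $ map_permutation {0..<?r} ?f p i))"
    by (rule sum.reindex_bij_betw[OF perms, symmetric])
  also have "\<dots> = (\<Sum>p | p permutes {0..<?r}. of_int (sign p) * (\<Prod>l\<in>{0..<?r}. S $ ?f l $ ?f (p l)))"
  proof (intro sum.cong refl arg_cong2[of _ _ _ _ "(*)"])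
    fix p assume "p \<in> {p. p permutes {0..<?r}}"
    then have p: "p permutes {0..<?r}" by simp
    show "(of_int (sign (map_permutation {0..<?r} ?f p)) :: real) = of_int (sign p)"
      using sign_map_permutation[OF inj p] by simp
    have "(\<Prod>i\<in>?U. S $ i $ map_permutation {0..<?r} ?f p i) = (\<Prod>l\<in>{0..<?r}. S $ ?f l $ map_permutation {0..<?r} ?f p (?f l))"
      by (rule prod.reindex_bij_betw[OF bij, symmetric])
    then show "(\<Prod>i\<in>?U. S $ i $ map_permutation {0..<?r} ?f p i) = (\<Prod>l\<in>{0..<?r}. S $ ?f l $ ?f (p l))"
      by (simp add: map_permutation_apply[OF inj])
  qed
  also have "\<dots> = Determinant.det (obs_scale k i S)"
    unfolding obs_scale_eq Determinant.det_def
    by (auto intro!: sum.cong prod.cong dest: permutes_in_image)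
  finally show ?thesis ..
qed

lemma obs_resid_eq: "obs_resid x k y i \<beta> = Matrix.vec (num_obs k i) (\<lambda>l. (y $ i - mtranspose \<beta> *v (x $ i)) $ obs_index k i l)"
  unfolding obs_resid_def sel_mat_mult_vec by (rule eq_vecI) auto

text \<open>Neither inverse is computed. The vector \<open>s\<close> solves the system of the
  submatrix both in padded and in explicit-dimension form, so the inverse of \<open>?C\<close> takes
  the residual to \<open>s\<close>.\<close>

lemma quad_resid_eq:
  fixes k :: "('n::finite, 'd::{finite,linorder}) bmat"
  assumes S: "S \<in> spd_matrices"
  shows "quad_resid x k y i \<beta> S = block_form (obs_set k i) S (y $ i - mtranspose \<beta> *v (x $ i))"
proof -
  let ?U = "obs_set k i" and ?r = "num_obs k i" and ?f = "obs_index k i"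
  define e where "e = y $ i - mtranspose \<beta> *v (x $ i)"
  define s where "s = matrix_inv (pad_block ?U S) *v coord_mask ?U e"
  have "pad_block ?U S *v s = coord_mask ?U e"
    unfolding s_def by (simp add: matrix_vector_mul_assoc spd_inv[OF pad_block_spd[OF S]])
  then have B: "coord_mask ?U (S *v coord_mask ?U s) + coord_mask (- ?U) s = coord_mask ?U e" by (simp add: pad_block_mult)
  have Ss: "(\<Sum>j\<in>?U. S $ l $ j * s $ j) = e $ l" if "l \<in> ?U" for l
  proof -
    have "(\<Sum>j\<in>UNIV. S $ l $ j * (if j \<in> ?U then s $ j else 0)) = e $ l"
      using arg_cong[OF B, of "\<lambda>v. v $ l"] that by (simp add: coord_mask_def matrix_vector_mult_def)
    moreover have "(\<Sum>j\<in>UNIV. S $ l $ j * (if j \<in> ?U then s $ j else 0)) = (\<Sum>j\<in>?U. S $ l $ j * s $ j)"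
      by (rule sum.mono_neutral_cong_right) auto
    ultimately show ?thesis by simp
  qed
  let ?C = "obs_scale k i S" and ?e = "Matrix.vec ?r (\<lambda>l. e $ ?f l)" and ?s = "Matrix.vec ?r (\<lambda>l. s $ ?f l)"
  have C: "?C \<in> carrier_mat ?r ?r" by (simp add: obs_scale_eq)
  have fU: "?f l \<in> ?U" if "l < ?r" for l using bij_betw_obs_index[of k i] that by (auto simp: bij_betw_def)
  have Cs: "?C *\<^sub>v ?s = ?e"
  proof (rule eq_vecI)
    fix l assume "l < dim_vec ?e"
    then have l: "l < ?r" by simp
    have "vec_index (?C *\<^sub>v ?s) l = (\<Sum>q\<in>{0..<?r}. S $ ?f l $ ?f q * s $ ?f q)"
      using l by (simp add: obs_scale_eq scalar_prod_def)
    also have "\<dots> = e $ ?f l" using sum_obs_index[of "\<lambda>j. S $ ?f l $ j * s $ j" k i] Ss[OF fU[OF l]] by simp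
    finally show "vec_index (?C *\<^sub>v ?s) l = vec_index ?e l" using l by simp
  qed (simp add: obs_scale_eq)
  have "Determinant.det ?C \<noteq> 0"
    using spd_det_pos[OF pad_block_spd[OF S]] by (simp add: det_obs_scale less_imp_neq[symmetric])
  then have "mat_inverse ?C \<noteq> None"
    using det_non_zero_imp_unit[OF C, of "()"] mat_inverse(1)[OF C, of "()"] by blast
  then obtain B where "mat_inverse ?C = Some B" by blast
  then have the: "the (mat_inverse ?C) = B" and B: "B * ?C = 1\<^sub>m ?r" "B \<in> carrier_mat ?r ?r"
    using mat_inverse(2)[OF C] by auto
  have "B *\<^sub>v ?e = B *\<^sub>v (?C *\<^sub>v ?s)" by (simp only: Cs)
  also have "\<dots> = ?s" using B C by (simp add: assoc_mult_mat_vec[symmetric])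
  finally have Be: "B *\<^sub>v ?e = ?s" .
  have "quad_resid x k y i \<beta> S = scalar_prod ?e ?s"
    unfolding quad_resid_def obs_resid_eq e_def[symmetric] the Be ..
  also have "\<dots> = (\<Sum>j\<in>?U. e $ j * s $ j)"
    using sum_obs_index[of "\<lambda>j. e $ j * s $ j" k i] by (simp add: scalar_prod_def)
  also have "\<dots> = coord_mask ?U e \<bullet> s"
    unfolding coord_mask_def inner_vec_def by (rule sum.mono_neutral_cong_left) auto
  finally show ?thesis by (simp add: block_form_def s_def e_def)
qed

subsection \<open>Inverse moments near the origin\<close>

text \<open>The derivative is required only in the interior because a power of \<open>w\<close> with
  exponent between 0 and 1 is continuous but not differentiable at 0.\<close>

lemma has_integral_FTC_open:
  fixes F F' :: "real \<Rightarrow> real"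
  assumes "a \<le> b" "continuous_on {a..b} F" "\<And>x. x \<in> {a<..<b} \<Longrightarrow> (F has_real_derivative F' x) (at x)"
  shows "((\<lambda>x. if x \<in> {a<..<b} then F' x else 0) has_integral (F b - F a)) UNIV"
proof -
  let ?g = "\<lambda>x. if x \<in> {a<..<b} then F' x else 0"
  have "(?g has_integral (F b - F a)) {a..b}"
    using assms(1,2)
  proof (rule fundamental_theorem_of_calculus_interior)
    fix x assume "x \<in> {a<..<b}"
    then show "(F has_vector_derivative ?g x) (at x)"
      using assms(3) by (simp add: has_real_derivative_iff_has_vector_derivative[symmetric])
  qed
  then have "((\<lambda>x. if x \<in> {a..b} then ?g x else 0) has_integral (F b - F a)) UNIV"
    by (subst has_integral_restrict_UNIV)
  then show ?thesis by (rule has_integral_eq[rotated]) auto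
qed

lemma indicator_times_cong: "(w \<in> A \<Longrightarrow> f = g) \<Longrightarrow> f * indicator A w = (g * indicator A w :: ennreal)"
  by (cases "w \<in> A") auto

text \<open>For \<open>r > 0\<close> the mean of \<open>1 / w\<close> under the full Gamma law with
  kernel \<open>w powr \<alpha> * exp (- r * w / 2)\<close> is \<open>r / (2 * \<alpha>)\<close>.
  Truncation at \<delta> keeps this leading coefficient and costs only a term free of
  \<open>r\<close>.\<close>

lemma gamma_kernel_bound:
  fixes \<alpha> \<delta> r :: real
  assumes \<alpha>: "0 < \<alpha>" and \<delta>: "0 < \<delta>" and r: "0 \<le> r"
  defines "c \<equiv> r / (2 * \<alpha>) + (1 + 1 / \<alpha>) / \<delta>"
  shows "(\<integral>\<^sup>+w. ennreal (w powr (\<alpha> - 1) * exp (- r * w / 2)) * indicator {0<..<\<delta>} w \<partial>lborel)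
      \<le> ennreal c * (\<integral>\<^sup>+w. ennreal (w powr \<alpha> * exp (- r * w / 2)) * indicator {0<..<\<delta>} w \<partial>lborel)"
    and "(\<integral>\<^sup>+w. ennreal (w powr \<alpha> * exp (- r * w / 2)) * indicator {0<..<\<delta>} w \<partial>lborel) < \<infinity>"
proof -
  let ?I = "{0<..<\<delta>}"
  define k where "k \<beta> w = (if w \<in> ?I then w powr \<beta> * exp (- r * w / 2) else 0)" for \<beta> w
  have k_nonneg: "0 \<le> k \<beta> w" for \<beta> w by (simp add: k_def)
  have k_meas[measurable]: "k \<beta> \<in> borel_measurable borel" for \<beta> unfolding k_def by measurable
  have k_eq: "(\<integral>\<^sup>+w. ennreal (w powr \<beta> * exp (- r * w / 2)) * indicator ?I w \<partial>lborel) = (\<integral>\<^sup>+w. ennreal (k \<beta> w) \<partial>lborel)" for \<beta>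
    by (intro nn_integral_cong) (auto simp: k_def split: split_indicator)
  have powr_cont: "continuous_on {0..\<delta>} (\<lambda>w. w powr \<alpha>)"
    using \<alpha> by (intro continuous_on_powr' continuous_intros) auto
  have fin1: "(\<integral>\<^sup>+w. ennreal (k (\<alpha> - 1) w) \<partial>lborel) < \<infinity>"
  proof -
    have "((\<lambda>w. if w \<in> ?I then w powr (\<alpha> - 1) else 0) has_integral (\<delta> powr \<alpha> / \<alpha> - 0 powr \<alpha> / \<alpha>)) UNIV"
    proof (rule has_integral_FTC_open)
      show "continuous_on {0..\<delta>} (\<lambda>w. w powr \<alpha> / \<alpha>)" using \<alpha> by (intro continuous_on_divide powr_cont continuous_on_const) auto
      show "((\<lambda>w. w powr \<alpha> / \<alpha>) has_real_derivative w powr (\<alpha> - 1)) (at w)" if "w \<in> ?I" for w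
        using that \<alpha> by (auto intro!: derivative_eq_intros)
    qed (use \<delta> in simp)
    then have "(\<integral>\<^sup>+w. ennreal (if w \<in> ?I then w powr (\<alpha> - 1) else 0) \<partial>lborel) = ennreal (\<delta> powr \<alpha> / \<alpha> - 0 powr \<alpha> / \<alpha>)"
      by (intro nn_integral_has_integral_lborel) auto
    moreover have "(\<integral>\<^sup>+w. ennreal (k (\<alpha> - 1) w) \<partial>lborel) \<le> (\<integral>\<^sup>+w. ennreal (if w \<in> ?I then w powr (\<alpha> - 1) else 0) \<partial>lborel)"
      using r by (intro nn_integral_mono ennreal_leI) (auto simp: k_def mult_left_le)
    ultimately show ?thesis using le_less_trans by fastforce
  qed
  have fin2: "(\<integral>\<^sup>+w. ennreal (k \<alpha> w) \<partial>lborel) < \<infinity>"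
  proof -
    have "(\<integral>\<^sup>+w. ennreal (k \<alpha> w) \<partial>lborel) \<le> (\<integral>\<^sup>+w. ennreal \<delta> * ennreal (k (\<alpha> - 1) w) \<partial>lborel)"
    proof (intro nn_integral_mono)
      fix w
      have "w powr \<alpha> \<le> \<delta> * w powr (\<alpha> - 1)" if "w \<in> ?I"
      proof -
        have "w powr \<alpha> = w * w powr (\<alpha> - 1)" using that by (simp add: powr_diff)
        then show ?thesis using that by (simp add: mult_right_mono)
      qed
      then have "k \<alpha> w \<le> \<delta> * k (\<alpha> - 1) w" by (auto simp: k_def mult.assoc[symmetric] intro!: mult_right_mono)
      then show "ennreal (k \<alpha> w) \<le> ennreal \<delta> * ennreal (k (\<alpha> - 1) w)"
        using \<delta> by (simp add: ennreal_mult[symmetric] k_nonneg ennreal_leI)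
    qed
    also have "\<dots> = ennreal \<delta> * (\<integral>\<^sup>+w. ennreal (k (\<alpha> - 1) w) \<partial>lborel)" by (intro nn_integral_cmult) simp
    also have "\<dots> < \<infinity>" using fin1 by (simp add: ennreal_mult_less_top)
    finally show ?thesis .
  qed
  obtain I1 I2 where I: "(\<integral>\<^sup>+w. ennreal (k (\<alpha> - 1) w) \<partial>lborel) = ennreal I1" "0 \<le> I1" "(\<integral>\<^sup>+w. ennreal (k \<alpha> w) \<partial>lborel) = ennreal I2" "0 \<le> I2"
    using fin1 fin2 by (metis ennreal_cases infinity_ennreal_def less_irrefl)
  have h1: "(k (\<alpha> - 1) has_integral I1) UNIV" "(k \<alpha> has_integral I2) UNIV"
    using I by (auto intro!: nn_integral_has_integral k_nonneg)
  have c: "0 \<le> c" using \<alpha> \<delta> r by (simp add: c_def)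
  \<comment> \<open>The factor \<open>w / \<delta> - 1\<close> makes \<open>?F\<close> vanish at
    \<delta> as well as at 0, so \<open>?F'\<close> integrates to 0. It also produces the kernel of
    exponent \<open>\<alpha> - 1\<close> with coefficient -1, and what is left between
    \<open>?F'\<close> and \<open>c * k \<alpha> w - k (\<alpha> - 1) w\<close> has a sign.\<close>
  let ?F = "\<lambda>w. (1 / \<alpha>) * (w powr \<alpha> * ((w / \<delta> - 1) * exp (- r * w / 2)))"
  let ?F' = "\<lambda>w. (1 / \<alpha>) * (\<alpha> * w powr (\<alpha> - 1) * ((w / \<delta> - 1) * exp (- r * w / 2))
      + w powr \<alpha> * (1 / \<delta> * exp (- r * w / 2) + (w / \<delta> - 1) * (exp (- r * w / 2) * (- r / 2))))"
  have "((\<lambda>w. if w \<in> ?I then ?F' w else 0) has_integral (?F \<delta> - ?F 0)) UNIV"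
  proof (rule has_integral_FTC_open)
    show "continuous_on {0..\<delta>} ?F" using \<delta> by (intro continuous_on_mult powr_cont continuous_intros) auto
    show "(?F has_real_derivative ?F' w) (at w)" if "w \<in> ?I" for w
      using that \<delta> \<alpha> by (auto intro!: derivative_eq_intros simp: field_simps)
  qed (use \<delta> in simp)
  moreover have "?F \<delta> - ?F 0 = 0" using \<delta> \<alpha> by simp
  ultimately have h2: "((\<lambda>w. if w \<in> ?I then ?F' w else 0) has_integral 0) UNIV" by (simp only:)
  have h3: "((\<lambda>w. c * k \<alpha> w - k (\<alpha> - 1) w) has_integral (c * I2 - I1)) UNIV"
    using h1 by (intro has_integral_diff has_integral_mult_right)
  have "0 \<le> c * I2 - I1"
  proof (rule has_integral_le[OF h2 h3])
    fix w
    show "(if w \<in> ?I then ?F' w else 0) \<le> c * k \<alpha> w - k (\<alpha> - 1) w"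
    proof (cases "w \<in> ?I")
      case True
      let ?e = "exp (- r * w / 2)" and ?p = "w powr (\<alpha> - 1)"
      have p: "w powr \<alpha> = w * ?p" using True by (simp add: powr_diff)
      have "(c * k \<alpha> w - k (\<alpha> - 1) w) - ?F' w = (?p * ?e) * ((r / (2 * \<alpha>)) * w * (w / \<delta>))"
        using True \<alpha> \<delta> by (simp add: k_def c_def p field_simps)
      also have "\<dots> \<ge> 0" using True \<alpha> \<delta> r by (intro mult_nonneg_nonneg) auto
      finally show ?thesis using True by simp
    qed (auto simp: k_def)
  qed
  then show "(\<integral>\<^sup>+w. ennreal (w powr (\<alpha> - 1) * exp (- r * w / 2)) * indicator ?I w \<partial>lborel)
      \<le> ennreal c * (\<integral>\<^sup>+w. ennreal (w powr \<alpha> * exp (- r * w / 2)) * indicator ?I w \<partial>lborel)"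
    unfolding k_eq I using c I by (simp add: ennreal_mult[symmetric] ennreal_leI)
  show "(\<integral>\<^sup>+w. ennreal (w powr \<alpha> * exp (- r * w / 2)) * indicator ?I w \<partial>lborel) < \<infinity>"
    unfolding k_eq by (rule fin2)
qed

text \<open>An increasing weight only shifts mass to the right: compare \<open>g\<close> with its value at the point
  \<open>1 / c\<close> where the difference of the two integrands changes sign.\<close>

lemma gamma_kernel_bound_mono:
  fixes \<alpha> \<delta> r :: real
  assumes \<alpha>: "0 < \<alpha>" and \<delta>: "0 < \<delta>" and r: "0 \<le> r"
    and g[measurable]: "g \<in> borel_measurable borel" and g_nonneg: "\<And>w. w \<in> {0<..<\<delta>} \<Longrightarrow> 0 \<le> g w"
    and mono: "\<And>v w. v \<in> {0<..<\<delta>} \<Longrightarrow> w \<in> {0<..<\<delta>} \<Longrightarrow> v \<le> w \<Longrightarrow> g v \<le> g w"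
  defines "c \<equiv> r / (2 * \<alpha>) + (1 + 1 / \<alpha>) / \<delta>"
  shows "(\<integral>\<^sup>+w. ennreal (w powr (\<alpha> - 1) * exp (- r * w / 2) * g w) * indicator {0<..<\<delta>} w \<partial>lborel)
      \<le> ennreal c * (\<integral>\<^sup>+w. ennreal (w powr \<alpha> * exp (- r * w / 2) * g w) * indicator {0<..<\<delta>} w \<partial>lborel)"
proof -
  let ?I = "{0<..<\<delta>}"
  let ?k = "\<lambda>\<beta> w. ennreal (w powr \<beta> * exp (- r * w / 2)) * indicator ?I w"
  let ?kg = "\<lambda>\<beta> w. ennreal (w powr \<beta> * exp (- r * w / 2) * g w) * indicator ?I w"
  \<comment> \<open>Ensures that the crossing point \<open>1 / c\<close> lies inside the
    interval.\<close>
  have "1 / \<delta> < (1 + 1 / \<alpha>) / \<delta>" using \<alpha> \<delta> by (intro divide_strict_right_mono) auto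
  also have "\<dots> \<le> c" using \<alpha> r by (simp add: c_def)
  finally have c1: "1 / \<delta> < c" .
  have "0 < 1 / \<delta>" using \<delta> by simp
  with c1 have c0: "0 < c" by linarith
  have v: "1 / c \<in> ?I" using c1 c0 \<delta> by (simp add: field_simps)
  define G where "G = g (1 / c)"
  have G: "0 \<le> G" using g_nonneg[OF v] by (simp add: G_def)
  \<comment> \<open>This is \<open>(c * w - 1) * (g w - G) \<ge> 0\<close> times the kernel, with
    the negative terms moved across so that everything stays in \<open>ennreal\<close>. The terms
    carrying the constant \<open>G\<close> are then compared by the bound without \<open>g\<close>
    and cancel, being finite.\<close>
  have pw: "?kg (\<alpha> - 1) w + ennreal (c * G) * ?k \<alpha> w \<le> ennreal c * ?kg \<alpha> w + ennreal G * ?k (\<alpha> - 1) w" for w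
  proof (cases "w \<in> ?I")
    case True
    let ?q = "w powr (\<alpha> - 1) * exp (- r * w / 2)"
    have q: "w powr \<alpha> * exp (- r * w / 2) = w * ?q" using True by (simp add: powr_diff)
    have "0 \<le> (c * w - 1) * (g w - G)"
    proof (cases "w \<le> 1 / c")
      case True
      then have "g w \<le> G" unfolding G_def using \<open>w \<in> ?I\<close> v by (intro mono) auto
      moreover have "c * w - 1 \<le> 0" using True c0 by (simp add: field_simps)
      ultimately show ?thesis by (simp add: mult_nonpos_nonpos)
    next
      case False
      then have "G \<le> g w" unfolding G_def using \<open>w \<in> ?I\<close> v by (intro mono) auto
      moreover have "c * w - 1 \<ge> 0" using False c0 by (simp add: field_simps)
      ultimately show ?thesis by simp
    qed
    then have "0 \<le> ?q * ((c * w - 1) * (g w - G))" by simp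
    then have le: "?q * g w + c * G * (w * ?q) \<le> c * (w * ?q * g w) + G * ?q" by (simp add: algebra_simps)
    have nn: "0 \<le> ?q" "0 \<le> g w" "0 \<le> w" using True g_nonneg by auto
    show ?thesis using True le nn G c0 unfolding q
      by (simp add: ennreal_mult[symmetric] ennreal_plus[symmetric] ennreal_leI del: ennreal_plus)
  qed simp
  have "(\<integral>\<^sup>+w. ?kg (\<alpha> - 1) w \<partial>lborel) + ennreal (c * G) * (\<integral>\<^sup>+w. ?k \<alpha> w \<partial>lborel)
      = (\<integral>\<^sup>+w. ?kg (\<alpha> - 1) w + ennreal (c * G) * ?k \<alpha> w \<partial>lborel)"
    by (subst nn_integral_add) (auto simp: nn_integral_cmult)
  also have "\<dots> \<le> (\<integral>\<^sup>+w. ennreal c * ?kg \<alpha> w + ennreal G * ?k (\<alpha> - 1) w \<partial>lborel)"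
    by (intro nn_integral_mono pw)
  also have "\<dots> = ennreal c * (\<integral>\<^sup>+w. ?kg \<alpha> w \<partial>lborel) + ennreal G * (\<integral>\<^sup>+w. ?k (\<alpha> - 1) w \<partial>lborel)"
    by (subst nn_integral_add) (auto simp: nn_integral_cmult)
  also have "\<dots> \<le> ennreal c * (\<integral>\<^sup>+w. ?kg \<alpha> w \<partial>lborel) + ennreal G * (ennreal c * (\<integral>\<^sup>+w. ?k \<alpha> w \<partial>lborel))"
    unfolding c_def using gamma_kernel_bound(1)[OF \<alpha> \<delta> r] by (intro add_left_mono mult_left_mono) auto
  also have "ennreal G * (ennreal c * (\<integral>\<^sup>+w. ?k \<alpha> w \<partial>lborel)) = ennreal (c * G) * (\<integral>\<^sup>+w. ?k \<alpha> w \<partial>lborel)"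
    using G c0 by (simp add: ennreal_mult mult_ac)
  finally have "ennreal (c * G) * (\<integral>\<^sup>+w. ?k \<alpha> w \<partial>lborel) + (\<integral>\<^sup>+w. ?kg (\<alpha> - 1) w \<partial>lborel)
      \<le> ennreal (c * G) * (\<integral>\<^sup>+w. ?k \<alpha> w \<partial>lborel) + ennreal c * (\<integral>\<^sup>+w. ?kg \<alpha> w \<partial>lborel)"
    by (simp add: add.commute)
  moreover have "ennreal (c * G) * (\<integral>\<^sup>+w. ?k \<alpha> w \<partial>lborel) \<noteq> \<infinity>"
    using gamma_kernel_bound(2)[OF \<alpha> \<delta> r] by (simp add: ennreal_mult_eq_top_iff)
  ultimately show ?thesis by (simp add: ennreal_add_left_cancel_le)
qed

section \<open>From the behaviour of the mixing distribution near 0 to moment bounds\<close>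

lemma mixing_measurable:
  assumes "mixing_distribution P" "f \<in> borel_measurable borel"
  shows "f \<in> borel_measurable P"
proof -
  have "f \<in> borel_measurable (restrict_space borel {0<..})" using assms(2) by (rule measurable_restrict_space1)
  then show ?thesis using assms(1) measurable_cong_sets[of P "restrict_space borel {0<..}" borel borel]
    by (auto simp: mixing_distribution_def)
qed

text \<open>Replaces the density by a Borel function on the whole line, so that integrals against
  \<open>P\<close> become Lebesgue integrals to which the kernel bounds apply.\<close>

lemma mixing_density:
  assumes P: "mixing_distribution P" and f: "has_lebesgue_density P f"
  obtains f0 where "f0 \<in> borel_measurable borel" "\<And>w. 0 \<le> f0 w" "\<And>w. 0 < w \<Longrightarrow> f0 w = f w"
    "\<And>h. h \<in> borel_measurable borel \<Longrightarrow> (\<integral>\<^sup>+w. h w \<partial>P) = (\<integral>\<^sup>+w. h w * ennreal (f0 w) * indicator {0<..} w \<partial>lborel)"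
proof -
  define f0 where "f0 w = indicator {0<..} w *\<^sub>R f w" for w
  have fm[measurable]: "f \<in> borel_measurable (restrict_space lborel {0<..})" and f_nonneg: "\<And>w. 0 < w \<Longrightarrow> 0 \<le> f w"
    and Pd: "P = density (restrict_space lborel {0<..}) (\<lambda>w. ennreal (f w))"
    using f by (auto simp: has_lebesgue_density_def)
  have m: "f0 \<in> borel_measurable borel"
    using fm unfolding f0_def by (subst (asm) borel_measurable_restrict_space_iff) auto
  have "(\<integral>\<^sup>+w. h w \<partial>P) = (\<integral>\<^sup>+w. h w * ennreal (f0 w) * indicator {0<..} w \<partial>lborel)" if h[measurable]: "h \<in> borel_measurable borel" for h
  proof -
    have [measurable]: "h \<in> borel_measurable (restrict_space lborel {0<..})"
      by (rule measurable_restrict_space1) simp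
    have "(\<integral>\<^sup>+w. h w \<partial>P) = (\<integral>\<^sup>+w. ennreal (f w) * h w \<partial>restrict_space lborel {0<..})"
      unfolding Pd by (rule nn_integral_density) measurable
    also have "\<dots> = (\<integral>\<^sup>+w. ennreal (f w) * h w * indicator {0<..} w \<partial>lborel)"
      by (rule nn_integral_restrict_space) simp
    also have "\<dots> = (\<integral>\<^sup>+w. h w * ennreal (f0 w) * indicator {0<..} w \<partial>lborel)"
      by (intro nn_integral_cong) (auto simp: f0_def mult.commute split: split_indicator)
    finally show ?thesis .
  qed
  moreover have "0 \<le> f0 w" for w using f_nonneg by (simp add: f0_def split: split_indicator)
  ultimately show thesis using m by (intro that[of f0]) (auto simp: f0_def)
qed

text \<open>Both density conditions enter only through the bound \<open>loc\<close> on a neighbourhood of \<open>0\<close>.\<close>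

lemma inverse_moment_density:
  assumes f0: "f0 \<in> borel_measurable borel" "\<And>w. 0 \<le> f0 w"
    and P: "\<And>h. h \<in> borel_measurable borel \<Longrightarrow> (\<integral>\<^sup>+w. h w \<partial>P) = (\<integral>\<^sup>+w. h w * ennreal (f0 w) * indicator {0<..} w \<partial>lborel)"
    and \<delta>: "0 < \<delta>" and c: "0 \<le> c"
    and loc: "(\<integral>\<^sup>+w. ennreal (w powr (s - 1) * exp (- r * w / 2) * f0 w) * indicator {0<..<\<delta>} w \<partial>lborel)
      \<le> ennreal c * (\<integral>\<^sup>+w. ennreal (w powr s * exp (- r * w / 2) * f0 w) * indicator {0<..<\<delta>} w \<partial>lborel)"
  shows "(\<integral>\<^sup>+w. ennreal (w powr (s - 1) * exp (- r * w / 2)) \<partial>P) \<le> ennreal (c + 1 / \<delta>) * (\<integral>\<^sup>+w. ennreal (w powr s * exp (- r * w / 2)) \<partial>P)"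
proof -
  note f0(1)[measurable]
  let ?h = "\<lambda>s w. ennreal (w powr s * exp (- r * w / 2))"
  let ?q = "\<lambda>s w. ennreal (w powr s * exp (- r * w / 2) * f0 w)"
  have eq: "(\<integral>\<^sup>+w. ?h s w \<partial>P) = (\<integral>\<^sup>+w. ?q s w * indicator {0<..<\<delta>} w \<partial>lborel) + (\<integral>\<^sup>+w. ?q s w * indicator {\<delta>..} w \<partial>lborel)" for s
  proof -
    have "(\<integral>\<^sup>+w. ?h s w \<partial>P) = (\<integral>\<^sup>+w. ?q s w * indicator {0<..<\<delta>} w + ?q s w * indicator {\<delta>..} w \<partial>lborel)"
      by (subst P) (use \<delta> f0(2) in \<open>auto intro!: nn_integral_cong simp: ennreal_mult split: split_indicator\<close>)
    also have "\<dots> = (\<integral>\<^sup>+w. ?q s w * indicator {0<..<\<delta>} w \<partial>lborel) + (\<integral>\<^sup>+w. ?q s w * indicator {\<delta>..} w \<partial>lborel)"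
      by (rule nn_integral_add) auto
    finally show ?thesis .
  qed
  have "?q (s - 1) w * indicator {\<delta>..} w \<le> ennreal (1 / \<delta>) * (?q s w * indicator {\<delta>..} w)" for w
  proof (cases "\<delta> \<le> w")
    case True
    then have "w powr (s - 1) \<le> 1 / \<delta> * w powr s"
      using \<delta> by (simp add: powr_diff divide_simps mult_right_mono)
    then have "w powr (s - 1) * exp (- r * w / 2) * f0 w \<le> (1 / \<delta> * w powr s) * exp (- r * w / 2) * f0 w"
      using f0(2) by (intro mult_right_mono) auto
    then show ?thesis using True \<delta> f0(2) by (simp add: ennreal_mult[symmetric] ennreal_leI mult.assoc)
  qed simp
  then have "(\<integral>\<^sup>+w. ?q (s - 1) w * indicator {\<delta>..} w \<partial>lborel) \<le> (\<integral>\<^sup>+w. ennreal (1 / \<delta>) * (?q s w * indicator {\<delta>..} w) \<partial>lborel)"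
    by (intro nn_integral_mono)
  also have "\<dots> = ennreal (1 / \<delta>) * (\<integral>\<^sup>+w. ?q s w * indicator {\<delta>..} w \<partial>lborel)"
    by (intro nn_integral_cmult) auto
  finally have "(\<integral>\<^sup>+w. ?h (s - 1) w \<partial>P) \<le> ennreal c * (\<integral>\<^sup>+w. ?q s w * indicator {0<..<\<delta>} w \<partial>lborel) + ennreal (1 / \<delta>) * (\<integral>\<^sup>+w. ?q s w * indicator {\<delta>..} w \<partial>lborel)"
    unfolding eq[of "s - 1"] by (intro add_mono loc)
  also have "\<dots> \<le> ennreal (c + 1 / \<delta>) * (\<integral>\<^sup>+w. ?q s w * indicator {0<..<\<delta>} w \<partial>lborel) + ennreal (c + 1 / \<delta>) * (\<integral>\<^sup>+w. ?q s w * indicator {\<delta>..} w \<partial>lborel)"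
    using c \<delta> by (intro add_mono mult_right_mono ennreal_leI) auto
  finally show ?thesis by (simp only: eq[of s] distrib_left)
qed

text \<open>Below \<delta> the integrand is bounded because \<open>c - \<gamma>\<close> is
  nonnegative; from \<delta> on the power itself is bounded. This moment makes the later bound on
  \<open>Z\<close> integrable over the weights.\<close>

lemma negative_moment_density:
  assumes f0: "f0 \<in> borel_measurable borel" "\<And>w. 0 \<le> f0 w"
    and P: "prob_space P" "\<And>h. h \<in> borel_measurable borel \<Longrightarrow> (\<integral>\<^sup>+w. h w \<partial>P) = (\<integral>\<^sup>+w. h w * ennreal (f0 w) * indicator {0<..} w \<partial>lborel)"
    and \<delta>: "0 < \<delta>" and \<gamma>: "0 \<le> \<gamma>" "\<gamma> \<le> c" and C: "0 \<le> C"
    and le: "\<And>w. w \<in> {0<..<\<delta>} \<Longrightarrow> f0 w \<le> C * w powr c"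
  shows "(\<integral>\<^sup>+w. ennreal (w powr (- \<gamma>)) \<partial>P) < \<infinity>"
proof -
  note f0(1)[measurable]
  interpret prob_space P by fact
  have pw: "ennreal (w powr (- \<gamma>)) * ennreal (f0 w) * indicator {0<..} w
      \<le> ennreal (C * \<delta> powr (c - \<gamma>)) * indicator {0<..<\<delta>} w + ennreal (\<delta> powr (- \<gamma>)) * (ennreal (f0 w) * indicator {0<..} w)" for w
  proof (cases "w \<in> {0<..<\<delta>}")
    case True
    have "w powr (- \<gamma>) * f0 w \<le> w powr (- \<gamma>) * (C * w powr c)" using le[OF True] by (intro mult_left_mono) auto
    also have "\<dots> = C * w powr (c - \<gamma>)" by (simp add: powr_add[symmetric])
    also have "\<dots> \<le> C * \<delta> powr (c - \<gamma>)" using True \<gamma> C by (intro mult_left_mono powr_mono2) auto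
    finally show ?thesis using True f0(2) by (auto simp: ennreal_mult[symmetric] ennreal_leI intro!: add_increasing2)
  next
    case False
    show ?thesis
    proof (cases "0 < w")
      case True
      then have "w powr (- \<gamma>) \<le> \<delta> powr (- \<gamma>)" using False \<delta> \<gamma> by (intro powr_mono2') auto
      then show ?thesis using True False by (auto intro!: mult_right_mono ennreal_leI)
    qed simp
  qed
  have "(\<integral>\<^sup>+w. ennreal (w powr (- \<gamma>)) \<partial>P) = (\<integral>\<^sup>+w. ennreal (w powr (- \<gamma>)) * ennreal (f0 w) * indicator {0<..} w \<partial>lborel)"
    by (rule P(2)) measurable
  also have "\<dots> \<le> (\<integral>\<^sup>+w. ennreal (C * \<delta> powr (c - \<gamma>)) * indicator {0<..<\<delta>} w + ennreal (\<delta> powr (- \<gamma>)) * (ennreal (f0 w) * indicator {0<..} w) \<partial>lborel)"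
    by (intro nn_integral_mono pw)
  also have "\<dots> = ennreal (C * \<delta> powr (c - \<gamma>)) * ennreal \<delta> + ennreal (\<delta> powr (- \<gamma>)) * (\<integral>\<^sup>+w. 1 * ennreal (f0 w) * indicator {0<..} w \<partial>lborel)"
    using \<delta> by (subst nn_integral_add) (auto simp: nn_integral_cmult)
  also have "(\<integral>\<^sup>+w. 1 * ennreal (f0 w) * indicator {0<..} w \<partial>lborel) = (\<integral>\<^sup>+w. 1 \<partial>P)" by (rule P(2)[symmetric]) simp
  also have "(\<integral>\<^sup>+w. 1 \<partial>P) = 1" using emeasure_space_1 by simp
  also have "ennreal (C * \<delta> powr (c - \<gamma>)) * ennreal \<delta> + ennreal (\<delta> powr (- \<gamma>)) * 1 < \<infinity>"
    using C \<delta> by (simp add: ennreal_mult[symmetric])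
  finally show ?thesis .
qed

text \<open>The first claim is for propriety of the posterior, the second for the drift: there
  \<open>s\<close> is half the number of observed entries of a row, and \<open>\<nu> + 2 * s\<close>
  is the coefficient of \<open>1 / w i\<close> in the bound on the mean residual. For a distribution
  that is zero near the origin \<open>1 / w\<close> is bounded, and \<open>l = 0\<close>
  works.\<close>

lemma mixing_moments:
  assumes P: "mixing_distribution P" and \<nu>: "0 \<le> \<nu>"
    and near: "zero_near_origin P \<or> faster_than_polynomial_near_origin P \<or> (\<exists>c. polynomial_near_origin P c \<and> \<nu> / 2 < c)"
  shows "(\<integral>\<^sup>+w. ennreal (w powr (- \<nu> / 2)) \<partial>P) < \<infinity>"
    and "0 < s \<Longrightarrow> \<exists>l L. 0 \<le> l \<and> 0 \<le> L \<and> (\<nu> + 2 * s) * l < 1 \<and> (\<forall>r\<ge>0. (\<integral>\<^sup>+w. ennreal (w powr (s - 1) * exp (- r * w / 2)) \<partial>P)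
        \<le> ennreal (l * r + L) * (\<integral>\<^sup>+w. ennreal (w powr s * exp (- r * w / 2)) \<partial>P))" (is "_ \<Longrightarrow> ?Q s")
proof -
  interpret prob_space P using P by (simp add: mixing_distribution_def)
  note mP = mixing_measurable[OF P]
  have "(\<integral>\<^sup>+w. ennreal (w powr (- \<nu> / 2)) \<partial>P) < \<infinity> \<and> (\<forall>s>0. ?Q s)"
    using near
  proof (elim disjE exE conjE)
    assume "zero_near_origin P"
    then obtain \<theta> where \<theta>: "0 < \<theta>" "emeasure P {0<..<\<theta>} = 0" by (auto simp: zero_near_origin_def)
    have "{0<..<\<theta>} \<in> sets P" using P by (auto simp: mixing_distribution_def sets_restrict_space_iff)
    then have AE: "AE w in P. \<theta> \<le> w"
      using \<theta> P by (intro AE_I[where N="{0<..<\<theta>}"]) (auto simp: mixing_distribution_def)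
    have "(\<integral>\<^sup>+w. ennreal (w powr (- \<nu> / 2)) \<partial>P) \<le> (\<integral>\<^sup>+w. ennreal (\<theta> powr (- \<nu> / 2)) \<partial>P)"
      using AE \<theta> \<nu> by (intro nn_integral_mono_AE) (auto elim!: eventually_mono intro!: ennreal_leI powr_mono2')
    also have "\<dots> < \<infinity>" using emeasure_space_1 by simp
    finally have 1: "(\<integral>\<^sup>+w. ennreal (w powr (- \<nu> / 2)) \<partial>P) < \<infinity>" .
    have "(\<integral>\<^sup>+w. ennreal (w powr (s - 1) * exp (- r * w / 2)) \<partial>P) \<le> ennreal (0 * r + 1 / \<theta>) * (\<integral>\<^sup>+w. ennreal (w powr s * exp (- r * w / 2)) \<partial>P)" for s r
    proof -
      have "(\<integral>\<^sup>+w. ennreal (w powr (s - 1) * exp (- r * w / 2)) \<partial>P) \<le> (\<integral>\<^sup>+w. ennreal (1 / \<theta>) * ennreal (w powr s * exp (- r * w / 2)) \<partial>P)"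
      proof (rule nn_integral_mono_AE)
        show "AE w in P. ennreal (w powr (s - 1) * exp (- r * w / 2)) \<le> ennreal (1 / \<theta>) * ennreal (w powr s * exp (- r * w / 2))"
          using AE
        proof eventually_elim
          fix w assume "\<theta> \<le> w"
          then have "w powr (s - 1) \<le> 1 / \<theta> * w powr s"
            using \<theta> by (simp add: powr_diff divide_simps mult_right_mono)
          then have "w powr (s - 1) * exp (- r * w / 2) \<le> (1 / \<theta> * w powr s) * exp (- r * w / 2)"
            by (intro mult_right_mono) auto
          then show "ennreal (w powr (s - 1) * exp (- r * w / 2)) \<le> ennreal (1 / \<theta>) * ennreal (w powr s * exp (- r * w / 2))"
            using \<theta> by (simp add: ennreal_mult[symmetric] ennreal_leI mult.assoc)
        qed
      qed
      also have "\<dots> = ennreal (1 / \<theta>) * (\<integral>\<^sup>+w. ennreal (w powr s * exp (- r * w / 2)) \<partial>P)"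
        by (intro nn_integral_cmult mP) simp
      finally show ?thesis by simp
    qed
    then have "?Q s" for s
      using \<theta> by (intro exI[of _ "0::real"] exI[of _ "1 / \<theta>"] conjI allI impI) simp_all
    then show ?thesis using 1 by blast
  next
    assume "faster_than_polynomial_near_origin P"
    \<comment> \<open>Any exponent above \<open>\<nu> / 2\<close> would serve, and the condition
      supplies every positive one.\<close>
    define c where "c = \<nu> / 2 + 1"
    have c: "0 < c" "\<nu> / 2 < c" using \<nu> by (auto simp: c_def)
    obtain f \<kappa> where f: "has_lebesgue_density P f" and \<kappa>: "0 < \<kappa>" and inc: "strict_mono_on {0<..<\<kappa>} (\<lambda>w. f w / w powr c)"
      using \<open>faster_than_polynomial_near_origin P\<close> c(1) unfolding faster_than_polynomial_near_origin_def by metis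
    obtain f0 where f0: "f0 \<in> borel_measurable borel" "\<And>w. 0 \<le> f0 w" "\<And>w. 0 < w \<Longrightarrow> f0 w = f w"
      and Pf: "\<And>h. h \<in> borel_measurable borel \<Longrightarrow> (\<integral>\<^sup>+w. h w \<partial>P) = (\<integral>\<^sup>+w. h w * ennreal (f0 w) * indicator {0<..} w \<partial>lborel)"
      using mixing_density[OF P f] by blast
    define g where "g w = f0 w / w powr c" for w
    have g: "g \<in> borel_measurable borel" "0 \<le> g w" for w using f0 by (auto simp: g_def[abs_def])
    have g_mono: "g v \<le> g w" if "v \<in> {0<..<\<kappa>}" "w \<in> {0<..<\<kappa>}" "v \<le> w" for v w
      using strict_mono_onD[OF inc that(1,2)] that f0(3) by (cases "v = w") (auto simp: g_def less_imp_le)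
    have fg: "f0 w = w powr c * g w" if "0 < w" for w using that by (simp add: g_def)
    have 1: "(\<integral>\<^sup>+w. ennreal (w powr (- \<nu> / 2)) \<partial>P) < \<infinity>"
      unfolding minus_divide_left[symmetric]
    proof (rule negative_moment_density[OF f0(1,2) prob_space_axioms Pf])
      show "f0 w \<le> g (\<kappa> / 2) * w powr c" if "w \<in> {0<..<\<kappa> / 2}" for w
        using that g_mono[of w "\<kappa> / 2"] \<kappa> by (simp add: fg mult.commute mult_left_mono)
    qed (use \<kappa> \<nu> c g in auto)
    \<comment> \<open>Writing \<open>f0 w = w powr c * g w\<close> turns the integrals near 0 into
      Gamma kernels of exponent \<open>c + s\<close> with the increasing weight \<open>g\<close>, so
      the leading coefficient is \<open>1 / (2 * (c + s))\<close>.\<close>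
    have "?Q s" if s: "0 < s" for s
    proof (rule exI[of _ "1 / (2 * (c + s))"], rule exI[of _ "(1 + 1 / (c + s)) / \<kappa> + 1 / \<kappa>"], intro conjI allI impI)
      show "(\<nu> + 2 * s) * (1 / (2 * (c + s))) < 1" using c s by (simp add: field_simps)
      fix r :: real assume r: "0 \<le> r"
      have cs: "0 < c + s" using c s by simp
      have shift: "w powr q * exp (- r * w / 2) * f0 w = w powr (c + q) * exp (- r * w / 2) * g w" if "w \<in> {0<..<\<kappa>}" for w q
        using that by (simp add: fg powr_add)
      have "(\<integral>\<^sup>+w. ennreal (w powr (s - 1) * exp (- r * w / 2)) \<partial>P) \<le> ennreal ((r / (2 * (c + s)) + (1 + 1 / (c + s)) / \<kappa>) + 1 / \<kappa>) * (\<integral>\<^sup>+w. ennreal (w powr s * exp (- r * w / 2)) \<partial>P)"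
      proof (rule inverse_moment_density[OF f0(1,2) Pf \<kappa>])
        have "(\<integral>\<^sup>+w. ennreal (w powr (s - 1) * exp (- r * w / 2) * f0 w) * indicator {0<..<\<kappa>} w \<partial>lborel)
            = (\<integral>\<^sup>+w. ennreal (w powr ((c + s) - 1) * exp (- r * w / 2) * g w) * indicator {0<..<\<kappa>} w \<partial>lborel)"
          by (intro nn_integral_cong indicator_times_cong) (simp only: shift add_diff_eq)
        also have "\<dots> \<le> ennreal (r / (2 * (c + s)) + (1 + 1 / (c + s)) / \<kappa>) * (\<integral>\<^sup>+w. ennreal (w powr (c + s) * exp (- r * w / 2) * g w) * indicator {0<..<\<kappa>} w \<partial>lborel)"
          by (rule gamma_kernel_bound_mono[OF cs \<kappa> r g g_mono])
        also have "(\<integral>\<^sup>+w. ennreal (w powr (c + s) * exp (- r * w / 2) * g w) * indicator {0<..<\<kappa>} w \<partial>lborel)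
            = (\<integral>\<^sup>+w. ennreal (w powr s * exp (- r * w / 2) * f0 w) * indicator {0<..<\<kappa>} w \<partial>lborel)"
          by (intro nn_integral_cong indicator_times_cong) (simp only: shift)
        finally show "(\<integral>\<^sup>+w. ennreal (w powr (s - 1) * exp (- r * w / 2) * f0 w) * indicator {0<..<\<kappa>} w \<partial>lborel)
          \<le> ennreal (r / (2 * (c + s)) + (1 + 1 / (c + s)) / \<kappa>) * (\<integral>\<^sup>+w. ennreal (w powr s * exp (- r * w / 2) * f0 w) * indicator {0<..<\<kappa>} w \<partial>lborel)" .
      qed (use r cs \<kappa> in auto)
      then show "(\<integral>\<^sup>+w. ennreal (w powr (s - 1) * exp (- r * w / 2)) \<partial>P) \<le> ennreal (1 / (2 * (c + s)) * r + ((1 + 1 / (c + s)) / \<kappa> + 1 / \<kappa>)) * (\<integral>\<^sup>+w. ennreal (w powr s * exp (- r * w / 2)) \<partial>P)"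
        by (simp only: add.assoc times_divide_eq_left mult_1_left)
    qed (use c s \<kappa> in auto)
    with 1 show ?thesis by blast
  next
    fix c assume "polynomial_near_origin P c" and c: "\<nu> / 2 < c"
    then obtain f M where f: "has_lebesgue_density P f" and M: "0 < M" "((\<lambda>w. f w / w powr c) \<longlongrightarrow> M) (at_right 0)"
      by (auto simp: polynomial_near_origin_def)
    have c0: "0 < c" using c \<nu> by simp
    obtain f0 where f0: "f0 \<in> borel_measurable borel" "\<And>w. 0 \<le> f0 w" "\<And>w. 0 < w \<Longrightarrow> f0 w = f w"
      and Pf: "\<And>h. h \<in> borel_measurable borel \<Longrightarrow> (\<integral>\<^sup>+w. h w \<partial>P) = (\<integral>\<^sup>+w. h w * ennreal (f0 w) * indicator {0<..} w \<partial>lborel)"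
      using mixing_density[OF P f] by blast
    have bounds: "\<exists>\<delta>>0. \<forall>w\<in>{0<..<\<delta>}. (1 - e) * M * w powr c \<le> f0 w \<and> f0 w \<le> (1 + e) * M * w powr c" if e: "0 < e" for e
    proof -
      have "\<forall>\<^sub>F w in at_right 0. dist (f w / w powr c) M < e * M" using M e by (intro tendstoD) auto
      then obtain \<delta> where \<delta>: "0 < \<delta>" "\<And>w. 0 < w \<Longrightarrow> w < \<delta> \<Longrightarrow> \<bar>f w / w powr c - M\<bar> < e * M"
        by (auto simp: eventually_at_right_field dist_real_def)
      have "(1 - e) * M * w powr c \<le> f0 w \<and> f0 w \<le> (1 + e) * M * w powr c" if "w \<in> {0<..<\<delta>}" for w
      proof -
        have "(1 - e) * M \<le> f w / w powr c" "f w / w powr c \<le> (1 + e) * M"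
          using \<delta>(2)[of w] that by (auto simp: algebra_simps abs_less_iff)
        then show ?thesis using that f0(3) by (simp add: divide_le_eq le_divide_eq)
      qed
      with \<delta>(1) show ?thesis by blast
    qed
    obtain \<delta>1 where \<delta>1: "0 < \<delta>1" "\<And>w. w \<in> {0<..<\<delta>1} \<Longrightarrow> f0 w \<le> (1 + 1) * M * w powr c"
      using bounds[of 1] by auto
    have 1: "(\<integral>\<^sup>+w. ennreal (w powr (- \<nu> / 2)) \<partial>P) < \<infinity>"
      unfolding minus_divide_left[symmetric]
      by (rule negative_moment_density[OF f0(1,2) prob_space_axioms Pf \<delta>1(1) _ _ _ \<delta>1(2)]) (use \<nu> c M in auto)
    have "?Q s" if s: "0 < s" for s
    proof -
      \<comment> \<open>Sandwiching the density between \<open>1 - e\<close> and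
        \<open>1 + e\<close> times \<open>M * w powr c\<close> costs the factor
        \<open>(1 + e) / (1 - e)\<close> in \<open>l\<close>. The strict inequality
        \<open>key\<close> then amounts to \<open>e * D < 2 * c - \<nu>\<close>, and
        \<open>e\<close> takes half of the available room.\<close>
      define D where "D = \<nu> + 2 * c + 4 * s"
      define e where "e = (2 * c - \<nu>) / (2 * D)"
      have den: "0 < D" "2 * c - \<nu> < 2 * D" using \<nu> c0 s by (auto simp: D_def)
      have e: "0 < e" "e < 1" using den c by (auto simp: e_def field_simps)
      have cs: "0 < c + s" using c0 s by simp
      have key: "(\<nu> + 2 * s) * (1 + e) < (2 * c + 2 * s) * (1 - e)"
      proof -
        have "e * D = (2 * c - \<nu>) / 2" using den by (simp add: e_def)
        also have "\<dots> < 2 * c - \<nu>" using c by simp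
        finally show ?thesis by (simp add: D_def algebra_simps)
      qed
      obtain \<delta> where \<delta>: "0 < \<delta>" "\<And>w. w \<in> {0<..<\<delta>} \<Longrightarrow> (1 - e) * M * w powr c \<le> f0 w" "\<And>w. w \<in> {0<..<\<delta>} \<Longrightarrow> f0 w \<le> (1 + e) * M * w powr c"
        using bounds[OF e(1)] by blast
      let ?\<rho> = "(1 + e) / (1 - e)"
      have \<rho>: "0 < ?\<rho>" using e by simp
      let ?c = "\<lambda>r. r / (2 * (c + s)) + (1 + 1 / (c + s)) / \<delta>"
      have nn: "0 \<le> ?\<rho> * (1 / (2 * (c + s)))" "0 \<le> ?\<rho> * ((1 + 1 / (c + s)) / \<delta>) + 1 / \<delta>"
        using \<delta>(1) cs by (intro add_nonneg_nonneg mult_nonneg_nonneg less_imp_le[OF \<rho>]; simp)+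
      show ?thesis
      proof (rule exI[of _ "?\<rho> * (1 / (2 * (c + s)))"], rule exI[of _ "?\<rho> * ((1 + 1 / (c + s)) / \<delta>) + 1 / \<delta>"], intro conjI allI impI)
        have "(\<nu> + 2 * s) * (?\<rho> * (1 / (2 * (c + s)))) = (\<nu> + 2 * s) * (1 + e) / ((1 - e) * (2 * (c + s)))" by simp
        also have "\<dots> < 1"
        proof -
          have "0 < (1 - e) * (2 * (c + s))" using e cs by simp
          moreover have "(1 - e) * (2 * (c + s)) = (2 * c + 2 * s) * (1 - e)" by (simp add: algebra_simps)
          ultimately show ?thesis using key by (simp only: pos_divide_less_eq mult_1_left)
        qed
        finally show "(\<nu> + 2 * s) * (?\<rho> * (1 / (2 * (c + s)))) < 1" .
        fix r :: real assume r: "0 \<le> r"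
        let ?K = "\<lambda>q. (\<integral>\<^sup>+w. ennreal (w powr (c + q) * exp (- r * w / 2)) * indicator {0<..<\<delta>} w \<partial>lborel)"
        let ?Kf = "\<lambda>q. (\<integral>\<^sup>+w. ennreal (w powr q * exp (- r * w / 2) * f0 w) * indicator {0<..<\<delta>} w \<partial>lborel)"
        have up: "?Kf q \<le> ennreal ((1 + e) * M) * ?K q" for q
        proof -
          have "?Kf q \<le> (\<integral>\<^sup>+w. ennreal ((1 + e) * M) * (ennreal (w powr (c + q) * exp (- r * w / 2)) * indicator {0<..<\<delta>} w) \<partial>lborel)"
          proof (intro nn_integral_mono)
            fix w
            have "w powr q * exp (- r * w / 2) * f0 w \<le> (1 + e) * M * (w powr (c + q) * exp (- r * w / 2))" if "w \<in> {0<..<\<delta>}"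
              using mult_left_mono[OF \<delta>(3)[OF that], of "w powr q * exp (- r * w / 2)"] by (simp add: powr_add mult_ac)
            then show "ennreal (w powr q * exp (- r * w / 2) * f0 w) * indicator {0<..<\<delta>} w \<le> ennreal ((1 + e) * M) * (ennreal (w powr (c + q) * exp (- r * w / 2)) * indicator {0<..<\<delta>} w)"
              using e M by (auto simp: ennreal_mult[symmetric] ennreal_leI split: split_indicator)
          qed
          then show ?thesis by (subst (asm) nn_integral_cmult) auto
        qed
        have lo: "ennreal ((1 - e) * M) * ?K q \<le> ?Kf q" for q
        proof -
          have "(\<integral>\<^sup>+w. ennreal ((1 - e) * M) * (ennreal (w powr (c + q) * exp (- r * w / 2)) * indicator {0<..<\<delta>} w) \<partial>lborel) \<le> ?Kf q"
          proof (intro nn_integral_mono)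
            fix w
            have "(1 - e) * M * (w powr (c + q) * exp (- r * w / 2)) \<le> w powr q * exp (- r * w / 2) * f0 w" if "w \<in> {0<..<\<delta>}"
              using mult_left_mono[OF \<delta>(2)[OF that], of "w powr q * exp (- r * w / 2)"] by (simp add: powr_add mult_ac)
            then show "ennreal ((1 - e) * M) * (ennreal (w powr (c + q) * exp (- r * w / 2)) * indicator {0<..<\<delta>} w) \<le> ennreal (w powr q * exp (- r * w / 2) * f0 w) * indicator {0<..<\<delta>} w"
              using e M by (auto simp: ennreal_mult[symmetric] ennreal_leI split: split_indicator)
          qed
          then show ?thesis by (subst (asm) nn_integral_cmult) auto
        qed
        have cr: "0 \<le> ?c r" using cs \<delta>(1) r by simp
        have "?Kf (s - 1) \<le> ennreal ((1 + e) * M) * ?K (s - 1)" by (rule up)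
        also have "\<dots> \<le> ennreal ((1 + e) * M) * (ennreal (?c r) * ?K s)"
          using gamma_kernel_bound(1)[OF cs \<delta>(1) r] by (intro mult_left_mono) (auto simp: add_diff_eq)
        also have "\<dots> = ennreal (?\<rho> * ?c r) * (ennreal ((1 - e) * M) * ?K s)"
        proof -
          have "(1 + e) * M * ?c r = ?\<rho> * ?c r * ((1 - e) * M)" using e by simp
          then show ?thesis using e M cr \<rho> by (simp only: mult.assoc[symmetric] ennreal_mult[symmetric] mult_nonneg_nonneg less_imp_le[OF \<rho>] less_imp_le[OF M(1)] add_nonneg_nonneg diff_ge_0_iff_ge less_imp_le)
        qed
        also have "\<dots> \<le> ennreal (?\<rho> * ?c r) * ?Kf s" by (intro mult_left_mono lo) simp
        finally have loc: "?Kf (s - 1) \<le> ennreal (?\<rho> * ?c r) * ?Kf s" .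
        have "0 \<le> ?\<rho> * ?c r" by (rule mult_nonneg_nonneg[OF less_imp_le[OF \<rho>] cr])
        from inverse_moment_density[OF f0(1,2) Pf \<delta>(1) this loc]
        show "(\<integral>\<^sup>+w. ennreal (w powr (s - 1) * exp (- r * w / 2)) \<partial>P) \<le> ennreal (?\<rho> * (1 / (2 * (c + s))) * r + (?\<rho> * ((1 + 1 / (c + s)) / \<delta>) + 1 / \<delta>)) * (\<integral>\<^sup>+w. ennreal (w powr s * exp (- r * w / 2)) \<partial>P)"
          by (simp only: distrib_left add.assoc times_divide_eq_right times_divide_eq_left mult.assoc mult_1_right mult_1_left)
      qed (fact nn)+
    qed
    with 1 show ?thesis by blast
  qed
  then show "(\<integral>\<^sup>+w. ennreal (w powr (- \<nu> / 2)) \<partial>P) < \<infinity>" and "0 < s \<Longrightarrow> ?Q s" by auto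
qed

subsection \<open>Positivity of the complete-data integral\<close>

lemma complete_integral_measurable:
  fixes x :: "('n::finite, 'p::finite) rmat" and a :: "('d::{finite,linorder}, 'd) rmat"
  shows "(\<lambda>z. full_dens r (scatter a x Y w (fst z)) (snd z)) \<in> borel_measurable (borel \<Otimes>\<^sub>M borel)"
    and "(\<lambda>S. \<integral>\<^sup>+\<beta>. full_dens r (scatter a x Y w \<beta>) S \<partial>lborel) \<in> borel_measurable lborel_sym"
    and "(\<lambda>\<beta>. full_dens r (scatter a x Y w \<beta>) S) \<in> borel_measurable lborel"
proof -
  show m: "(\<lambda>z. full_dens r (scatter a x Y w (fst z)) (snd z)) \<in> borel_measurable (borel \<Otimes>\<^sub>M borel)"
    by (intro measurable_full_dens measurable_scatter measurable_fst measurable_snd) simp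
  have "(\<lambda>(S, \<beta>). full_dens r (scatter a x Y w \<beta>) S) \<in> borel_measurable (borel \<Otimes>\<^sub>M lborel)"
    using measurable_compose[OF measurable_Pair[OF measurable_snd measurable_fst] m]
    by (simp add: split_beta measurable_cong_sets[OF sets_pair_measure_cong[OF refl sets_lborel] refl])
  then show "(\<lambda>S. \<integral>\<^sup>+\<beta>. full_dens r (scatter a x Y w \<beta>) S \<partial>lborel) \<in> borel_measurable lborel_sym"
    using lborel.borel_measurable_nn_integral by simp
  show "(\<lambda>\<beta>. full_dens r (scatter a x Y w \<beta>) S) \<in> borel_measurable lborel"
    using measurable_compose[OF measurable_Pair2' m, of S] by simp
qed

lemma complete_integral_pos:
  fixes x :: "('n::finite, 'p::finite) rmat" and a :: "('d::{finite,linorder}, 'd) rmat"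
  shows "0 < complete_integral r a x Y w"
proof -
  have "0 < (\<integral>\<^sup>+\<beta>. full_dens r (scatter a x Y w \<beta>) S \<partial>lborel)" if "S \<in> spd_matrices" for S
  proof -
    have "0 < (\<integral>\<^sup>+\<beta>. full_dens r (scatter a x Y w \<beta>) S * indicator UNIV \<beta> \<partial>lborel)"
      using spd_det_pos[OF that] that
      by (intro nn_integral_pos complete_integral_measurable) (auto simp: full_dens_def emeasure_lborel_UNIV)
    then show ?thesis by simp
  qed
  then have "0 < (\<integral>\<^sup>+S. (\<integral>\<^sup>+\<beta>. full_dens r (scatter a x Y w \<beta>) S \<partial>lborel) * indicator spd_matrices S \<partial>lborel_sym)"
    by (intro nn_integral_pos complete_integral_measurable emeasure_spd_pos) auto
  also have "\<dots> \<le> complete_integral r a x Y w"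
    unfolding complete_integral_def by (intro nn_integral_mono) (auto split: split_indicator)
  finally show ?thesis .
qed

lemma scaling_matrix:
  fixes X :: "real^'m::finite^'n::finite" and s :: real
  defines "D \<equiv> (\<chi> i j. if i = j then s else 0) :: real^'n^'n"
  shows "D ** X = s *\<^sub>R X" "mdet D = s ^ CARD('n)" "mtranspose D = D"
  by (auto simp: D_def matrix_matrix_mult_def Finite_Cartesian_Product.vec_eq_iff Finite_Cartesian_Product.transpose_def det_diagonal_matrix
      if_distrib[of "\<lambda>x. x * _"] cong: if_cong)

text \<open>Dilating \<open>S\<close> and \<open>\<beta>\<close> bounds the integral below by a power of the factor times itself;
  finiteness therefore forces the exponent to have the right sign.\<close>

lemma complete_integral_exponent:
  fixes x :: "('n::finite, 'p::finite) rmat" and a :: "('d::{finite,linorder}, 'd) rmat"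
  assumes a: "psd_matrix a" and w: "\<And>i. 0 < w i" and fin: "complete_integral r a x Y w < \<infinity>"
  shows "0 \<le> r - real CARD('p) - real CARD('d) - 1"
proof -
  obtain \<beta>0 where dil: "\<And>\<gamma> v. v \<bullet> (scatter a x Y w (\<beta>0 + 2 *\<^sub>R (\<gamma> - \<beta>0)) *v v) \<le> 2\<^sup>2 * (v \<bullet> (scatter a x Y w \<gamma> *v v))"
    by (rule scatter_dilate[where a=a and x=x and Y=Y and w=w and s=2, OF a w]) (simp, rule that)
  let ?K = "(\<chi> i j. if i = j then 2 else 0) :: ('p, 'p) rmat"
  let ?T = "(\<chi> i j. if i = j then 2 else 0) :: ('d, 'd) rmat"
  \<comment> \<open>The Jacobians of doubling \<beta> and of multiplying \<open>S\<close> by 4,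
    times the power of the determinant in the density; together 2 to the power
    \<open>- d * (r - p - d - 1)\<close>.\<close>
  let ?c = "2 ^ (CARD('p) * CARD('d)) * 2 ^ (CARD('d) * (CARD('d) + 1)) * (2 ^ CARD('d)) powr (- r) :: real"
  have detT: "mdet ?T = 2 ^ CARD('d)" by (rule scaling_matrix)
  have low: "ennreal ((2 ^ CARD('d)) powr (- r)) * full_dens r (scatter a x Y w \<gamma>) S
      \<le> full_dens r (scatter a x Y w (\<beta>0 + ?K ** (\<gamma> - \<beta>0) ** id_mat)) (?T ** S ** mtranspose ?T)" for \<gamma> S
  proof -
    let ?E = "scatter a x Y w (\<beta>0 + 2 *\<^sub>R (\<gamma> - \<beta>0))"
    have "?T ** B ** mtranspose ?T = 4 *\<^sub>R B" for B
      by (simp add: Finite_Cartesian_Product.vec_eq_iff congruence_nth2 if_distrib[of "\<lambda>x. x * _"] cong: if_cong)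
    then have E: "?T ** ((1/4) *\<^sub>R ?E) ** mtranspose ?T = ?E" by simp
    \<comment> \<open>The dilation multiplies the scatter form by at most 4, so a quarter of
      \<open>?E\<close> lies below the original scatter matrix and gives the larger density.\<close>
    have "full_dens r (scatter a x Y w \<gamma>) S \<le> full_dens r ((1/4) *\<^sub>R ?E) S"
    proof (cases "S \<in> spd_matrices")
      case True
      have "0 \<le> mtrace (matrix_inv S ** (scatter a x Y w \<gamma> - (1/4) *\<^sub>R ?E))"
        using dil by (intro trace_spd_inv_nonneg[OF True]) (simp add: matrix_vector_mult_diff_rdistrib inner_diff_right scaleR_matrix_vector_assoc[symmetric] mult.commute)
      then have "mtrace (matrix_inv S ** ((1/4) *\<^sub>R ?E)) \<le> mtrace (matrix_inv S ** scatter a x Y w \<gamma>)"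
        by (simp add: Determinants.trace_def matrix_matrix_mult_def right_diff_distrib sum_subtractf)
      then show ?thesis using True by (auto simp: full_dens_def intro!: ennreal_leI mult_left_mono)
    qed (simp add: full_dens_def)
    then have "ennreal (mdet ?T powr (- r)) * full_dens r (scatter a x Y w \<gamma>) S \<le> ennreal (mdet ?T powr (- r)) * full_dens r ((1/4) *\<^sub>R ?E) S"
      by (rule mult_left_mono) simp
    also have "\<dots> = full_dens r (?T ** ((1/4) *\<^sub>R ?E) ** mtranspose ?T) (?T ** S ** mtranspose ?T)"
      by (rule full_dens_congruence[symmetric]) (simp add: detT)
    finally show ?thesis unfolding E by (simp add: scaling_matrix)
  qed
  have "complete_integral r a x Y w = ennreal (\<bar>mdet ?K\<bar> ^ CARD('d) * \<bar>mdet (id_mat :: ('d, 'd) rmat)\<bar> ^ CARD('p) * \<bar>mdet ?T\<bar> ^ (CARD('d) + 1)) *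
      (\<integral>\<^sup>+S. \<integral>\<^sup>+\<gamma>. full_dens r (scatter a x Y w (\<beta>0 + ?K ** (\<gamma> - \<beta>0) ** id_mat)) (?T ** S ** mtranspose ?T) \<partial>lborel \<partial>lborel_sym)"
    unfolding complete_integral_def
    by (intro nn_integral_param_substitution complete_integral_measurable) (simp_all add: scaling_matrix)
  also have "\<dots> \<ge> ennreal (\<bar>mdet ?K\<bar> ^ CARD('d) * \<bar>mdet (id_mat :: ('d, 'd) rmat)\<bar> ^ CARD('p) * \<bar>mdet ?T\<bar> ^ (CARD('d) + 1)) *
      (\<integral>\<^sup>+S. \<integral>\<^sup>+\<gamma>. ennreal ((2 ^ CARD('d)) powr (- r)) * full_dens r (scatter a x Y w \<gamma>) S \<partial>lborel \<partial>lborel_sym)"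
    by (intro mult_left_mono nn_integral_mono low) simp
  also have "(\<integral>\<^sup>+S. \<integral>\<^sup>+\<gamma>. ennreal ((2 ^ CARD('d)) powr (- r)) * full_dens r (scatter a x Y w \<gamma>) S \<partial>lborel \<partial>lborel_sym)
      = ennreal ((2 ^ CARD('d)) powr (- r)) * complete_integral r a x Y w"
    unfolding complete_integral_def by (simp only: nn_integral_cmult complete_integral_measurable)
  also have "ennreal (\<bar>mdet ?K\<bar> ^ CARD('d) * \<bar>mdet (id_mat :: ('d, 'd) rmat)\<bar> ^ CARD('p) * \<bar>mdet ?T\<bar> ^ (CARD('d) + 1)) * (ennreal ((2 ^ CARD('d)) powr (- r)) * complete_integral r a x Y w)
      = ennreal ?c * complete_integral r a x Y w"
  proof -
    have assoc: "ennreal X * (ennreal Y * Z) = ennreal (X * Y) * Z" if "0 \<le> X" "0 \<le> Y" for X Y Z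
      using that by (simp add: ennreal_mult mult.assoc)
    have "\<bar>mdet ?K\<bar> ^ CARD('d) * \<bar>mdet (id_mat :: ('d, 'd) rmat)\<bar> ^ CARD('p) * \<bar>mdet ?T\<bar> ^ (CARD('d) + 1) * (2 ^ CARD('d)) powr (- r) = ?c"
      by (simp add: scaling_matrix power_mult[symmetric] power_add[symmetric])
    then show ?thesis by (subst assoc) simp_all
  qed
  finally have le: "ennreal ?c * complete_integral r a x Y w \<le> complete_integral r a x Y w" .
  have pw: "(2::real) ^ k = 2 powr real k" for k by (simp add: powr_realpow)
  have "?c = 2 powr (- real CARD('d) * (r - real CARD('p) - real CARD('d) - 1))"
    unfolding pw powr_powr powr_add[symmetric] by (simp add: algebra_simps)
  moreover have "?c \<le> 1"
  proof (rule ccontr)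
    assume "\<not> ?c \<le> 1"
    obtain q where q: "complete_integral r a x Y w = ennreal q" "0 \<le> q" using fin by (cases "complete_integral r a x Y w") auto
    have "0 < q" using complete_integral_pos[of r a x Y w] q by auto
    then have "q < ?c * q" using \<open>\<not> ?c \<le> 1\<close> by (simp add: mult_less_cancel_right1)
    moreover have "ennreal (?c * q) \<le> ennreal q" using le q by (subst ennreal_mult) auto
    then have "?c * q \<le> q" by (subst (asm) ennreal_le_iff) (use q in auto)
    ultimately show False by linarith
  qed
  ultimately have "2 powr (- real CARD('d) * (r - real CARD('p) - real CARD('d) - 1)) \<le> 2 powr (0::real)" by simp
  then have "- real CARD('d) * (r - real CARD('p) - real CARD('d) - 1) \<le> 0" by (subst (asm) powr_le_cancel_iff) auto
  then show ?thesis by (simp add: mult_le_0_iff zero_le_mult_iff)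
qed

subsection \<open>The observed data as a marginal of completed data\<close>

interpretation PV: product_sigma_finite "\<lambda>_. lborel :: (real^'d::finite) measure"
  by standard

definition completed :: "('n::finite, 'd::finite) bmat \<Rightarrow> ('n, 'd) rmat \<Rightarrow> ('n \<Rightarrow> real^'d) \<Rightarrow> 'n \<Rightarrow> real^'d" where
  "completed k y v i = coord_mask (obs_set k i) (y $ i) + coord_mask (- obs_set k i) (v i)"

text \<open>Puts a Gaussian weight on the coordinates of \<open>v\<close> that
  \<open>completed\<close> ignores, so that each row is integrated over the same space whatever its
  pattern.\<close>

definition dummy_weight :: "('n::finite, 'd::finite) bmat \<Rightarrow> ('n \<Rightarrow> real^'d) \<Rightarrow> real" where
  "dummy_weight k v = (\<Prod>i\<in>UNIV. exp (- (coord_mask (obs_set k i) (v i) \<bullet> coord_mask (obs_set k i) (v i)) / 2))"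

text \<open>Integrating out the \<open>d - d i\<close> missing coordinates of a row produces
  \<open>w i\<close> to the power \<open>- (d - d i) / 2\<close>; the power \<open>d / 2\<close>
  brings this to the required \<open>d i / 2\<close>. The division removes the Gaussian constant of
  the row.\<close>

definition completion_factor :: "'d::finite itself \<Rightarrow> ('n::finite \<Rightarrow> real) \<Rightarrow> real" where
  "completion_factor _ w = (\<Prod>i\<in>UNIV. w i powr (real CARD('d) / 2) / gauss_const TYPE('d))"

lemma coord_mask_measurable[measurable]: "coord_mask U \<in> borel_measurable borel"
  unfolding coord_mask_def[abs_def]
proof (rule measurable_vec_lambda)
  show "(\<lambda>x::real^'a. if j \<in> U then x $ j else 0) \<in> borel_measurable borel" for j
    by (cases "j \<in> U") auto
qed

lemma completed_measurable[measurable]: "(\<lambda>v. completed k y v i) \<in> borel_measurable (Pi\<^sub>M UNIV (\<lambda>_. lborel))"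
  unfolding completed_def by measurable

lemma dummy_weight_measurable[measurable]: "dummy_weight k \<in> borel_measurable (Pi\<^sub>M UNIV (\<lambda>_. lborel))"
  unfolding dummy_weight_def[abs_def] by measurable

lemma trace_scatter:
  fixes N :: "('d::finite, 'd) rmat" and x :: "('n::finite, 'p::finite) rmat"
  shows "mtrace (N ** scatter a x Y w \<beta>) = mtrace (N ** a) + (\<Sum>i\<in>UNIV. w i * ((Y i - mtranspose \<beta> *v (x $ i)) \<bullet> (N *v (Y i - mtranspose \<beta> *v (x $ i)))))"
proof -
  have outer: "mtrace (N ** outer u u) = u \<bullet> (N *v u)" for u
    by (simp add: Determinants.trace_def matrix_matrix_mult_def outer_def inner_vec_def matrix_vector_mult_def sum_distrib_left mult_ac)
  have sum: "mtrace (N ** (\<Sum>i\<in>I. w i *\<^sub>R outer (u i) (u i))) = (\<Sum>i\<in>I. w i * (u i \<bullet> (N *v u i)))" for I :: "'n set" and u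
  proof (induction I rule: infinite_finite_induct)
    case (insert j I)
    have "N ** (w j *\<^sub>R outer (u j) (u j)) = w j *\<^sub>R (N ** outer (u j) (u j))"
      by (simp add: matrix_matrix_mult_def Finite_Cartesian_Product.vec_eq_iff sum_distrib_left mult_ac)
    then have "mtrace (N ** (w j *\<^sub>R outer (u j) (u j))) = w j * mtrace (N ** outer (u j) (u j))"
      by (simp add: Determinants.trace_def sum_distrib_left)
    then show ?case using insert by (simp add: matrix_add_ldistrib trace_add outer)
  qed (simp_all add: Determinants.trace_def matrix_matrix_mult_def)
  show ?thesis unfolding scatter_def by (simp only: matrix_add_ldistrib trace_add sum)
qed

text \<open>Given the parameters the rows are independent, so the integral over the completions
  factors into instances of \<open>nn_integral_gauss_marginal\<close>. The exponent
  \<open>m + 1 + real CARD('n)\<close> collects \<open>m + 1\<close> from the prior and 1 from each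
  complete row.\<close>

lemma observed_density_marginal:
  fixes x :: "('n::finite, 'p::finite) rmat" and a :: "('d::{finite,linorder}, 'd) rmat" and k :: "('n, 'd) bmat"
  assumes S: "S \<in> spd_matrices" and w: "\<And>i. 0 < w i"
  shows "param_dens x m a k y w (\<beta>, S) = ennreal (completion_factor TYPE('d) w) *
    (\<integral>\<^sup>+v. ennreal (dummy_weight k v) * full_dens (m + 1 + real CARD('n)) (scatter a x (completed k y v) w \<beta>) S \<partial>(Pi\<^sub>M UNIV (\<lambda>_. lborel)))"
proof -
  let ?G = "gauss_const TYPE('d)"
  let ?O = "obs_set k" and ?b = "\<lambda>i. mtranspose \<beta> *v (x $ i)"
  let ?z = "\<lambda>v i. completed k y v i - ?b i"
  have G: "0 < ?G" by (rule gauss_const_pos)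
  have dS: "0 < mdet S" by (rule spd_det_pos[OF S])
  let ?f = "\<lambda>i v. ennreal (exp (- (coord_mask (?O i) v \<bullet> coord_mask (?O i) v) / 2)
      * exp (- w i / 2 * ((coord_mask (?O i) (y $ i - ?b i) + coord_mask (- ?O i) (v - ?b i)) \<bullet> (matrix_inv S *v (coord_mask (?O i) (y $ i - ?b i) + coord_mask (- ?O i) (v - ?b i))))))"
  define P where "P i = mdet (pad_block (?O i) S)" for i
  define q where "q i = quad_resid x k y i \<beta> S" for i
  have P: "0 < P i" for i unfolding P_def by (rule spd_det_pos[OF pad_block_spd[OF S]])
  have fi: "(\<integral>\<^sup>+v. ?f i v \<partial>lborel) = ennreal (?G * (w i ^ card (- ?O i) * P i / mdet S) powr (- 1 / 2) * exp (- w i / 2 * q i))" for i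
    unfolding P_def q_def quad_resid_eq[OF S] by (rule nn_integral_gauss_marginal[OF S w])
  have fm: "?f i \<in> borel_measurable lborel" for i
  proof -
    have [measurable (raw)]: "(\<lambda>v. matrix_inv S *v g v) \<in> borel_measurable M" if "g \<in> borel_measurable M" for g and M :: "'d rvec measure"
    proof -
      have "(\<lambda>v. matrix_inv S *v v) \<in> borel_measurable borel"
        by (auto simp: matrix_vector_mult_def intro!: borel_measurable_continuous_onI continuous_intros)
      from measurable_compose[OF that this] show ?thesis .
    qed
    show ?thesis by measurable
  qed
  have z: "coord_mask (?O i) (y $ i - ?b i) + coord_mask (- ?O i) (v i - ?b i) = ?z v i" for i v
  proof -
    have "?z v i = completed k y v i - (coord_mask (?O i) (?b i) + coord_mask (- ?O i) (?b i))"
      by (simp only: coord_mask_simps(4))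
    then show ?thesis by (simp only: completed_def coord_mask_simps(6)) (simp add: algebra_simps)
  qed
  have "(\<integral>\<^sup>+v. ennreal (dummy_weight k v) * full_dens (m + 1 + real CARD('n)) (scatter a x (completed k y v) w \<beta>) S \<partial>(Pi\<^sub>M UNIV (\<lambda>_. lborel)))
      = (\<integral>\<^sup>+v. ennreal (mdet S powr (- (m + 1 + real CARD('n)) / 2) * exp (- (1 / 2) * mtrace (matrix_inv S ** a))) * (\<Prod>i\<in>UNIV. ?f i (v i)) \<partial>(Pi\<^sub>M UNIV (\<lambda>_. lborel)))"
  proof (rule nn_integral_cong)
    fix v
    have "exp (- (1 / 2) * mtrace (matrix_inv S ** scatter a x (completed k y v) w \<beta>))
        = exp (- (1 / 2) * mtrace (matrix_inv S ** a)) * (\<Prod>i\<in>UNIV. exp (- w i / 2 * (?z v i \<bullet> (matrix_inv S *v ?z v i))))"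
      unfolding trace_scatter
      by (simp add: exp_sum[symmetric] exp_add[symmetric] distrib_left sum_distrib_left sum_negf[symmetric] algebra_simps del: transpose_matrix_vector)
    then show "ennreal (dummy_weight k v) * full_dens (m + 1 + real CARD('n)) (scatter a x (completed k y v) w \<beta>) S
        = ennreal (mdet S powr (- (m + 1 + real CARD('n)) / 2) * exp (- (1 / 2) * mtrace (matrix_inv S ** a))) * (\<Prod>i\<in>UNIV. ?f i (v i))"
      unfolding z using S
      by (simp add: full_dens_def dummy_weight_def prod_ennreal prod.distrib ennreal_mult[symmetric] prod_nonneg mult_ac del: transpose_matrix_vector)
  qed
  also have "\<dots> = ennreal (mdet S powr (- (m + 1 + real CARD('n)) / 2) * exp (- (1 / 2) * mtrace (matrix_inv S ** a))) * (\<integral>\<^sup>+v. (\<Prod>i\<in>UNIV. ?f i (v i)) \<partial>(Pi\<^sub>M UNIV (\<lambda>_. lborel)))"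
  proof -
    have [measurable]: "(\<lambda>v. ?f i (v i)) \<in> borel_measurable (Pi\<^sub>M UNIV (\<lambda>_. lborel))" for i
      by (rule measurable_compose[where f="\<lambda>v. v i" and g="?f i", OF _ fm]) simp
    show ?thesis by (rule nn_integral_cmult) measurable
  qed
  also have "(\<integral>\<^sup>+v. (\<Prod>i\<in>UNIV. ?f i (v i)) \<partial>(Pi\<^sub>M UNIV (\<lambda>_. lborel))) = (\<Prod>i\<in>UNIV. \<integral>\<^sup>+v. ?f i v \<partial>lborel)"
    by (intro PV.product_nn_integral_prod fm) simp
  also have "\<dots> = ennreal (\<Prod>i\<in>UNIV. ?G * (w i ^ card (- ?O i) * P i / mdet S) powr (- 1 / 2) * exp (- w i / 2 * q i))"
    unfolding fi using G by (intro prod_ennreal) auto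
  finally have rhs: "(\<integral>\<^sup>+v. ennreal (dummy_weight k v) * full_dens (m + 1 + real CARD('n)) (scatter a x (completed k y v) w \<beta>) S \<partial>(Pi\<^sub>M UNIV (\<lambda>_. lborel)))
      = ennreal (mdet S powr (- (m + 1 + real CARD('n)) / 2) * exp (- (1 / 2) * mtrace (matrix_inv S ** a)))
        * ennreal (\<Prod>i\<in>UNIV. ?G * (w i ^ card (- ?O i) * P i / mdet S) powr (- 1 / 2) * exp (- w i / 2 * q i))" .
  \<comment> \<open>In each row the factor \<open>mdet S powr (- 1 / 2)\<close> of the complete
    density cancels against the one in the Gaussian marginal, and only the determinant of the
    observed block remains.\<close>
  have fac: "w i powr (real CARD('d) / 2) / ?G * (mdet S powr (- 1 / 2) * (?G * (w i ^ card (- ?O i) * P i / mdet S) powr (- 1 / 2) * exp (- w i / 2 * q i)))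
      = w i powr (real (num_obs k i) / 2) * P i powr (- 1 / 2) * exp (- q i * w i / 2)" for i
  proof -
    have card: "card (- ?O i) = CARD('d) - num_obs k i" "num_obs k i \<le> CARD('d)"
      by (auto simp: num_obs_eq Compl_eq_Diff_UNIV card_Diff_subset card_mono)
    have "(w i ^ card (- ?O i) * P i / mdet S) powr (- 1 / 2) = (w i powr real (card (- ?O i))) powr (- 1 / 2) * P i powr (- 1 / 2) / mdet S powr (- 1 / 2)"
      using w[of i] P[of i] dS by (simp add: powr_mult powr_divide powr_realpow)
    also have "(w i powr real (card (- ?O i))) powr (- 1 / 2) = w i powr (real (num_obs k i) / 2 - real CARD('d) / 2)"
      using card by (simp add: powr_powr of_nat_diff diff_divide_distrib)
    finally have e: "(w i ^ card (- ?O i) * P i / mdet S) powr (- 1 / 2) = w i powr (real (num_obs k i) / 2 - real CARD('d) / 2) * P i powr (- 1 / 2) / mdet S powr (- 1 / 2)" .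
    have "w i powr (real CARD('d) / 2) * w i powr (real (num_obs k i) / 2 - real CARD('d) / 2) = w i powr (real (num_obs k i) / 2)"
      by (simp add: powr_add[symmetric])
    moreover have "mdet S powr (- 1 / 2) \<noteq> 0" using dS by simp
    moreover have "exp (- w i / 2 * q i) = exp (- q i * w i / 2)" by (simp add: mult.commute)
    ultimately show ?thesis unfolding e using G by (simp add: field_simps)
  qed
  have prodS: "mdet S powr (- (m + 1 + real CARD('n)) / 2) = mdet S powr (- (m + 1) / 2) * (\<Prod>i\<in>(UNIV::'n set). mdet S powr (- 1 / 2))"
  proof -
    have "- (m + 1 + real CARD('n)) / 2 = - (m + 1) / 2 + - 1 / 2 * real CARD('n)" by (simp add: field_simps)
    then show ?thesis using dS by (simp only: powr_add) (simp add: powr_power)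
  qed
  have "param_dens x m a k y w (\<beta>, S) = ennreal (prior_dens m a S * (\<Prod>i\<in>UNIV. w i powr (real (num_obs k i) / 2) * P i powr (- 1 / 2) * exp (- q i * w i / 2)))"
    by (simp add: param_dens_def det_obs_scale P_def q_def)
  also have "(\<Prod>i\<in>UNIV. w i powr (real (num_obs k i) / 2) * P i powr (- 1 / 2) * exp (- q i * w i / 2))
      = completion_factor TYPE('d) w * ((\<Prod>i\<in>(UNIV::'n set). mdet S powr (- 1 / 2)) * (\<Prod>i\<in>UNIV. ?G * (w i ^ card (- ?O i) * P i / mdet S) powr (- 1 / 2) * exp (- w i / 2 * q i)))"
    unfolding fac[symmetric] completion_factor_def prod.distrib[symmetric] ..
  also have "prior_dens m a S * \<dots> = completion_factor TYPE('d) w * (mdet S powr (- (m + 1 + real CARD('n)) / 2) * exp (- (1 / 2) * mtrace (matrix_inv S ** a))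
      * (\<Prod>i\<in>UNIV. ?G * (w i ^ card (- ?O i) * P i / mdet S) powr (- 1 / 2) * exp (- w i / 2 * q i)))"
    unfolding prodS prior_dens_def by (simp only: mult_ac)
  also have "ennreal \<dots> = ennreal (completion_factor TYPE('d) w) * (ennreal (mdet S powr (- (m + 1 + real CARD('n)) / 2) * exp (- (1 / 2) * mtrace (matrix_inv S ** a)))
        * ennreal (\<Prod>i\<in>UNIV. ?G * (w i ^ card (- ?O i) * P i / mdet S) powr (- 1 / 2) * exp (- w i / 2 * q i)))"
  proof -
    have nn: "0 \<le> completion_factor TYPE('d) w" "0 \<le> (\<Prod>i\<in>UNIV. ?G * (w i ^ card (- ?O i) * P i / mdet S) powr (- 1 / 2) * exp (- w i / 2 * q i))"
      using G by (auto simp: completion_factor_def intro!: prod_nonneg)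
    show ?thesis by (simp only: ennreal_mult mult_nonneg_nonneg nn powr_ge_zero exp_ge_zero)
  qed
  finally show ?thesis unfolding rhs .
qed

subsection \<open>Measurability of the densities\<close>

lemma param_space_nth:
  "(\<lambda>z. snd z $ i $ j) \<in> borel_measurable (param_space :: (('p::finite, 'd::{finite,linorder}) rmat \<times> ('d, 'd) rmat) measure)"
  "(\<lambda>z. fst z $ l $ j) \<in> borel_measurable (param_space :: (('p::finite, 'd::{finite,linorder}) rmat \<times> ('d, 'd) rmat) measure)"
  by (rule measurable_compose[OF measurable_compose[OF measurable_param_space(2) measurable_vec_nth] measurable_vec_nth],
      rule measurable_compose[OF measurable_compose[OF measurable_param_space(1) measurable_vec_nth] measurable_vec_nth])

lemma pad_block_nth_measurable:
  "(\<lambda>z. pad_block U (snd z) $ i $ j) \<in> borel_measurable (param_space :: (('p::finite, 'd::{finite,linorder}) rmat \<times> ('d, 'd) rmat) measure)"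
  using param_space_nth(1)[of i j, where 'p='p] by (cases "i \<in> U \<and> j \<in> U"; cases "i = j") (auto simp: pad_block_def)

lemma quad_resid_measurable:
  fixes x :: "('n::finite, 'p::finite) rmat" and k :: "('n, 'd::{finite,linorder}) bmat"
  shows "(\<lambda>z. quad_resid x k y i (fst z) (snd z)) \<in> borel_measurable param_space"
proof -
  let ?U = "obs_set k i"
  have nz: "mdet (pad_block ?U (snd z)) \<noteq> 0" if "z \<in> space param_space" for z :: "('p, 'd) rmat \<times> ('d, 'd) rmat"
    using that spd_det_pos[OF pad_block_spd, of "snd z" ?U] by (auto simp: space_param_space)
  have e: "(\<lambda>z. coord_mask ?U (y $ i - mtranspose (fst z) *v (x $ i)) $ j) \<in> borel_measurable (param_space :: (('p, 'd) rmat \<times> ('d, 'd) rmat) measure)" for j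
    using param_space_nth(2)[where 'p='p and 'd='d]
    by (cases "j \<in> ?U") (auto simp: coord_mask_def matrix_vector_mult_def Finite_Cartesian_Product.transpose_def simp del: transpose_matrix_vector)
  have "(\<lambda>z. block_form ?U (snd z) (y $ i - mtranspose (fst z) *v (x $ i))) \<in> borel_measurable (param_space :: (('p, 'd) rmat \<times> ('d, 'd) rmat) measure)"
    unfolding block_form_def inner_vec_def matrix_vector_mult_def[of "matrix_inv _"]
    using measurable_matrix_inv_nth[OF pad_block_nth_measurable nz] e by simp
  then show ?thesis
    by (rule measurable_cong[THEN iffD1, rotated]) (auto simp: space_param_space quad_resid_eq)
qed

lemma det_obs_scale_measurable:
  fixes k :: "('n::finite, 'd::{finite,linorder}) bmat"
  shows "(\<lambda>z. Determinant.det (obs_scale k i (snd z))) \<in> borel_measurable (param_space :: (('p::finite, 'd) rmat \<times> ('d, 'd) rmat) measure)"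
  unfolding det_obs_scale by (intro measurable_mdet pad_block_nth_measurable)

lemma prior_dens_measurable:
  "(\<lambda>z. prior_dens m a (snd z)) \<in> borel_measurable (param_space :: (('p::finite, 'd::{finite,linorder}) rmat \<times> ('d, 'd) rmat) measure)"
proof -
  have nz: "mdet (snd z) \<noteq> 0" if "z \<in> space param_space" for z :: "('p, 'd) rmat \<times> ('d, 'd) rmat"
    using that spd_det_pos by (fastforce simp: space_param_space)
  note measurable_mdet[OF param_space_nth(1), measurable] measurable_matrix_inv_nth[OF param_space_nth(1) nz, measurable]
  show ?thesis
    unfolding prior_dens_def Determinants.trace_def matrix_matrix_mult_def by simp
qed

lemma quad_resid_nonneg:
  fixes k :: "('n::finite, 'd::{finite,linorder}) bmat"
  assumes S: "S \<in> spd_matrices" shows "0 \<le> quad_resid x k y i \<beta> S"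
  unfolding quad_resid_eq[OF S] block_form_def
  using spd_D(2)[OF spd_inv(3)[OF pad_block_spd[OF S]]]
  by (metis inner_zero_left less_eq_real_def)

lemma param_dens_factor:
  "param_dens x m a k y w z = ennreal (prior_dens m a (snd z) * (\<Prod>i\<in>UNIV. Determinant.det (obs_scale k i (snd z)) powr (- 1 / 2)))
    * weight_dens x k y z w"
proof -
  have "prior_dens m a S \<ge> 0" for S by (simp add: prior_dens_def)
  then show ?thesis
    by (cases z) (simp add: param_dens_def weight_dens_def ennreal_mult[symmetric] prod_nonneg prod.distrib mult_ac)
qed

lemma param_dens_measurable:
  fixes x :: "('n::finite, 'p::finite) rmat" and k :: "('n, 'd::{finite,linorder}) bmat"
  assumes W: "\<And>i. (\<lambda>w. w i) \<in> borel_measurable Q"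
  shows "(\<lambda>(z, w). param_dens x m a k y w z) \<in> borel_measurable (param_space \<Otimes>\<^sub>M Q)"
proof -
  note quad_resid_measurable[measurable] det_obs_scale_measurable[measurable] prior_dens_measurable[measurable] W[measurable]
  have "(\<lambda>q. ennreal (prior_dens m a (snd (fst q)) *
    (\<Prod>i\<in>UNIV. snd q i powr (num_obs k i / 2) * Determinant.det (obs_scale k i (snd (fst q))) powr (- 1 / 2)
        * exp (- quad_resid x k y i (fst (fst q)) (snd (fst q)) * snd q i / 2)))) \<in> borel_measurable ((param_space :: (('p, 'd) rmat \<times> ('d, 'd) rmat) measure) \<Otimes>\<^sub>M Q)"
    by measurable
  then show ?thesis by (simp add: param_dens_def split_beta)
qed

lemma param_dens_measurable1:
  fixes x :: "('n::finite, 'p::finite) rmat" and k :: "('n, 'd::{finite,linorder}) bmat"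
  shows "param_dens x m a k y w \<in> borel_measurable param_space"
proof -
  note quad_resid_measurable[measurable] det_obs_scale_measurable[measurable] prior_dens_measurable[measurable]
  have "(\<lambda>z. ennreal (prior_dens m a (snd z) *
    (\<Prod>i\<in>UNIV. w i powr (num_obs k i / 2) * Determinant.det (obs_scale k i (snd z)) powr (- 1 / 2)
        * exp (- quad_resid x k y i (fst z) (snd z) * w i / 2)))) \<in> borel_measurable (param_space :: (('p, 'd) rmat \<times> ('d, 'd) rmat) measure)"
    by measurable
  then show ?thesis by (simp add: param_dens_def split_beta)
qed

text \<open>Changing one weight tilts the density exponentially in the residual of that row. Up to a
  power, ratios of normalizing integrals are thus values of the Laplace transform of the residual,
  which is how a bound on such ratios yields a moment.\<close>

lemma param_dens_rescale:
  assumes w: "\<And>i. 0 < w i" and s: "0 < s"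
  shows "param_dens x m a k y (w(i := s)) z = ennreal ((s / w i) powr (num_obs k i / 2) * exp (- (s - w i) * quad_resid x k y i (fst z) (snd z) / 2)) * param_dens x m a k y w z"
proof -
  let ?q = "\<lambda>j. quad_resid x k y j (fst z) (snd z)"
  let ?g = "\<lambda>w j. w j powr (num_obs k j / 2) * exp (- ?q j * w j / 2)"
  have "(\<Prod>j\<in>UNIV. ?g (w(i := s)) j) = ?g (w(i := s)) i * (\<Prod>j\<in>UNIV - {i}. ?g (w(i := s)) j)"
    by (rule prod.remove) auto
  also have "(\<Prod>j\<in>UNIV - {i}. ?g (w(i := s)) j) = (\<Prod>j\<in>UNIV - {i}. ?g w j)"
    by (intro prod.cong) auto
  also have "?g (w(i := s)) i = (s / w i) powr (num_obs k i / 2) * exp (- (s - w i) * ?q i / 2) * ?g w i"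
  proof -
    have "s powr (num_obs k i / 2) = (s / w i) powr (num_obs k i / 2) * w i powr (num_obs k i / 2)"
      using w[of i] s by (simp add: powr_divide)
    moreover have "exp (- ?q i * s / 2) = exp (- (s - w i) * ?q i / 2) * exp (- ?q i * w i / 2)"
      by (simp add: exp_add[symmetric] algebra_simps diff_divide_distrib add_divide_distrib)
    ultimately show ?thesis by (simp add: mult_ac)
  qed
  also have "(s / w i) powr (num_obs k i / 2) * exp (- (s - w i) * ?q i / 2) * ?g w i * (\<Prod>j\<in>UNIV - {i}. ?g w j)
      = (s / w i) powr (num_obs k i / 2) * exp (- (s - w i) * ?q i / 2) * (\<Prod>j\<in>UNIV. ?g w j)"
    by (subst (2) prod.remove[of _ i]) auto
  finally have "weight_dens x k y z (w(i := s)) = ennreal ((s / w i) powr (num_obs k i / 2) * exp (- (s - w i) * ?q i / 2)) * weight_dens x k y z w"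
    by (simp add: weight_dens_def split_beta ennreal_mult[symmetric] prod_nonneg)
  then show ?thesis by (simp add: param_dens_factor mult_ac)
qed

subsection \<open>The observed-data normalizing integral\<close>

text \<open>With \<open>r = m + 1 + real CARD('n)\<close>, \<nu> is the quantity
  \<open>r - p - d - 1\<close> that has to be nonnegative in the complete-data inequality.\<close>

locale incomplete_regression =
  fixes x :: "('n::finite, 'p::finite) rmat" and m :: real and a :: "('d::{finite,linorder}, 'd) rmat"
    and k :: "('n, 'd) bmat" and y :: "('n, 'd) rmat" and \<nu> :: real
  assumes \<nu>: "\<nu> = m + real CARD('n) - real CARD('p) - real CARD('d)"
    and a: "psd_matrix a" and k: "missing_structure k"
    and proper: "\<And>w :: 'n \<Rightarrow> real. (\<And>i. 0 < w i) \<Longrightarrow>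
          proper_density (param_space :: (('p, 'd) rmat \<times> ('d, 'd) rmat) measure) (param_dens x m a k y w)"
begin

definition "Z w = (\<integral>\<^sup>+z. param_dens x m a k y w z \<partial>(param_space :: (('p, 'd) rmat \<times> ('d, 'd) rmat) measure))"

abbreviation "dummies \<equiv> Pi\<^sub>M UNIV (\<lambda>_ :: 'n. lborel :: 'd rvec measure)"

lemma Z_finite: "(\<And>i. 0 < w i) \<Longrightarrow> Z w < \<infinity>"
  using proper[of w] by (simp add: proper_density_def Z_def)

lemma sigma_finite_dummies: "sigma_finite_measure dummies"
  by (rule PV.sigma_finite) simp

text \<open>Tonelli moves the integral over the completions outermost, so that inequalities for the
  complete-data integral at each \<open>v\<close> pass to \<open>Z\<close>.\<close>

lemma Z_eq:
  assumes w: "\<And>i. 0 < w i"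
  shows "Z w = ennreal (completion_factor TYPE('d) w) *
    (\<integral>\<^sup>+v. ennreal (dummy_weight k v) * complete_integral (m + 1 + real CARD('n)) a x (completed k y v) w \<partial>dummies)"
proof -
  let ?r = "m + 1 + real CARD('n)" and ?c = "ennreal (completion_factor TYPE('d) w)"
  let ?f = "\<lambda>v \<beta> S. ennreal (dummy_weight k v) * full_dens ?r (scatter a x (completed k y v) w \<beta>) S"
  have fm: "(\<lambda>q. ?f (v q) (\<beta> q) (S q)) \<in> borel_measurable M"
    if "v \<in> measurable M dummies" "\<beta> \<in> borel_measurable M" "S \<in> borel_measurable M" for v \<beta> S and M :: "'q measure"
    by (intro borel_measurable_times_ennreal measurable_compose[OF _ measurable_ennreal] measurable_compose[OF that(1) dummy_weight_measurable]
        measurable_full_dens measurable_scatter measurable_compose[OF that(1) completed_measurable] that)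
  interpret D: sigma_finite_measure dummies by (rule sigma_finite_dummies)
  interpret L: sigma_finite_measure "lborel_sym :: ('d, 'd) rmat measure" by (rule sigma_finite_lborel_sym)
  interpret LD: pair_sigma_finite "lborel :: ('p, 'd) rmat measure" dummies ..
  interpret SD: pair_sigma_finite "lborel_sym :: ('d, 'd) rmat measure" dummies ..
  have "Z w = (\<integral>\<^sup>+S. \<integral>\<^sup>+\<beta>. param_dens x m a k y w (\<beta>, S) * indicator spd_matrices S \<partial>lborel \<partial>lborel_sym)"
    unfolding Z_def by (rule nn_integral_param_space[OF param_dens_measurable1])
  also have "\<dots> = (\<integral>\<^sup>+S. \<integral>\<^sup>+\<beta>. ?c * (\<integral>\<^sup>+v. ?f v \<beta> S \<partial>dummies) \<partial>lborel \<partial>lborel_sym)"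
  proof (rule nn_integral_cong, rule nn_integral_cong)
    fix S \<beta>
    show "param_dens x m a k y w (\<beta>, S) * indicator spd_matrices S = ?c * (\<integral>\<^sup>+v. ?f v \<beta> S \<partial>dummies)"
    proof (cases "S \<in> spd_matrices")
      case True
      then show ?thesis
        using observed_density_marginal[OF True w, where x=x and m=m and a=a and k=k and y=y and \<beta>=\<beta>] by simp
    qed (simp add: full_dens_def)
  qed
  also have "\<dots> = (\<integral>\<^sup>+S. ?c * (\<integral>\<^sup>+\<beta>. \<integral>\<^sup>+v. ?f v \<beta> S \<partial>dummies \<partial>lborel) \<partial>lborel_sym)"
  proof (rule nn_integral_cong, rule nn_integral_cmult)
    fix S
    have "(\<lambda>q. ?f (snd q) (fst q) S) \<in> borel_measurable (lborel \<Otimes>\<^sub>M dummies)"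
      by (rule fm) measurable
    then show "(\<lambda>\<beta>. \<integral>\<^sup>+v. ?f v \<beta> S \<partial>dummies) \<in> borel_measurable lborel"
      using D.borel_measurable_nn_integral[of "\<lambda>\<beta> v. ?f v \<beta> S" lborel] by (simp add: split_beta')
  qed
  also have "\<dots> = (\<integral>\<^sup>+S. ?c * (\<integral>\<^sup>+v. \<integral>\<^sup>+\<beta>. ?f v \<beta> S \<partial>lborel \<partial>dummies) \<partial>lborel_sym)"
  proof (rule nn_integral_cong, rule arg_cong[of _ _ "\<lambda>u. ?c * u"])
    fix S
    have "(\<lambda>q. ?f (snd q) (fst q) S) \<in> borel_measurable (lborel \<Otimes>\<^sub>M dummies)"
      by (rule fm) measurable
    from LD.Fubini'[of "\<lambda>\<beta> v. ?f v \<beta> S"] this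
    show "(\<integral>\<^sup>+\<beta>. \<integral>\<^sup>+v. ?f v \<beta> S \<partial>dummies \<partial>lborel) = (\<integral>\<^sup>+v. \<integral>\<^sup>+\<beta>. ?f v \<beta> S \<partial>lborel \<partial>dummies)"
      by (simp add: split_beta')
  qed
  also have "\<dots> = ?c * (\<integral>\<^sup>+S. \<integral>\<^sup>+v. \<integral>\<^sup>+\<beta>. ?f v \<beta> S \<partial>lborel \<partial>dummies \<partial>lborel_sym)"
  proof -
    have 3: "(\<lambda>q. ?f (snd (fst q)) (snd q) (fst (fst q))) \<in> borel_measurable ((lborel_sym \<Otimes>\<^sub>M dummies) \<Otimes>\<^sub>M lborel)"
      by (rule fm) measurable
    then have "(\<lambda>q. \<integral>\<^sup>+\<beta>. ?f (snd q) \<beta> (fst q) \<partial>lborel) \<in> borel_measurable (lborel_sym \<Otimes>\<^sub>M dummies)"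
      using lborel.borel_measurable_nn_integral[of "\<lambda>q \<beta>. ?f (snd q) \<beta> (fst q)" "lborel_sym \<Otimes>\<^sub>M dummies"] by (simp add: split_beta')
    then have "(\<lambda>S. \<integral>\<^sup>+v. \<integral>\<^sup>+\<beta>. ?f v \<beta> S \<partial>lborel \<partial>dummies) \<in> borel_measurable lborel_sym"
      using D.borel_measurable_nn_integral[of "\<lambda>S v. \<integral>\<^sup>+\<beta>. ?f v \<beta> S \<partial>lborel" lborel_sym] by (simp add: split_beta')
    then show ?thesis by (rule nn_integral_cmult)
  qed
  also have "(\<integral>\<^sup>+S. \<integral>\<^sup>+v. \<integral>\<^sup>+\<beta>. ?f v \<beta> S \<partial>lborel \<partial>dummies \<partial>lborel_sym) = (\<integral>\<^sup>+v. \<integral>\<^sup>+S. \<integral>\<^sup>+\<beta>. ?f v \<beta> S \<partial>lborel \<partial>lborel_sym \<partial>dummies)"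
  proof -
    have 3: "(\<lambda>q. ?f (snd (fst q)) (snd q) (fst (fst q))) \<in> borel_measurable ((lborel_sym \<Otimes>\<^sub>M dummies) \<Otimes>\<^sub>M lborel)"
      by (rule fm) measurable
    then have "(\<lambda>q. \<integral>\<^sup>+\<beta>. ?f (snd q) \<beta> (fst q) \<partial>lborel) \<in> borel_measurable (lborel_sym \<Otimes>\<^sub>M dummies)"
      using lborel.borel_measurable_nn_integral[of "\<lambda>q \<beta>. ?f (snd q) \<beta> (fst q)" "lborel_sym \<Otimes>\<^sub>M dummies"] by (simp add: split_beta')
    then show ?thesis
      using SD.Fubini'[of "\<lambda>S v. \<integral>\<^sup>+\<beta>. ?f v \<beta> S \<partial>lborel"] by (simp add: split_beta')
  qed
  also have "\<dots> = (\<integral>\<^sup>+v. ennreal (dummy_weight k v) * complete_integral ?r a x (completed k y v) w \<partial>dummies)"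
    unfolding complete_integral_def by (simp only: nn_integral_cmult complete_integral_measurable)
  finally show ?thesis .
qed

lemma complete_integral_dummies_measurable:
  "(\<lambda>v. complete_integral r a x (completed k y v) w) \<in> borel_measurable dummies"
proof -
  interpret L: sigma_finite_measure "lborel_sym :: ('d, 'd) rmat measure" by (rule sigma_finite_lborel_sym)
  have "(\<lambda>q. full_dens r (scatter a x (completed k y (fst (fst q))) w (snd q)) (snd (fst q))) \<in> borel_measurable ((dummies \<Otimes>\<^sub>M (lborel_sym :: ('d, 'd) rmat measure)) \<Otimes>\<^sub>M (lborel :: ('p, 'd) rmat measure))"
    by (intro measurable_full_dens measurable_scatter measurable_compose[OF _ completed_measurable]) measurable
  then have "(\<lambda>q. \<integral>\<^sup>+\<beta>. full_dens r (scatter a x (completed k y (fst q)) w \<beta>) (snd q) \<partial>lborel) \<in> borel_measurable (dummies \<Otimes>\<^sub>M lborel_sym)"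
    using lborel.borel_measurable_nn_integral[of "\<lambda>q \<beta>. full_dens r (scatter a x (completed k y (fst q)) w \<beta>) (snd q)" "dummies \<Otimes>\<^sub>M lborel_sym"] by (simp add: split_beta')
  then show ?thesis unfolding complete_integral_def
    using L.borel_measurable_nn_integral[of "\<lambda>v S. \<integral>\<^sup>+\<beta>. full_dens r (scatter a x (completed k y v) w \<beta>) S \<partial>lborel" dummies] by (simp add: split_beta')
qed

lemma completion_factor_pos: "(\<And>i. 0 < w i) \<Longrightarrow> 0 < completion_factor TYPE('d) (w :: 'n \<Rightarrow> real)"
  using gauss_const_pos[where 'n='d] by (auto simp: completion_factor_def less_imp_neq[symmetric] intro!: prod_pos divide_pos_pos)

text \<open>Propriety at unit weights makes the complete-data integral finite for almost every
  completion, hence for at least one, and \<open>complete_integral_exponent\<close> applies to that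
  one.\<close>

lemma \<nu>_nonneg: "0 \<le> \<nu>"
proof -
  let ?w = "\<lambda>_ :: 'n. 1 :: real" and ?r = "m + 1 + real CARD('n)"
  note complete_integral_dummies_measurable[measurable]
  let ?I = "\<integral>\<^sup>+v. ennreal (dummy_weight k v) * complete_integral ?r a x (completed k y v) ?w \<partial>dummies"
  have "ennreal (completion_factor TYPE('d) ?w) * ?I < \<infinity>"
    using Z_finite[of ?w] Z_eq[of ?w] by simp
  then have "?I < \<infinity>" using completion_factor_pos[of ?w] by (auto simp: ennreal_mult_less_top)
  then have "AE v in dummies. ennreal (dummy_weight k v) * complete_integral ?r a x (completed k y v) ?w \<noteq> \<infinity>"
    by (intro nn_integral_PInf_AE) auto
  moreover have "0 < dummy_weight k v" for v unfolding dummy_weight_def by (intro prod_pos) simp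
  ultimately have AE: "AE v in dummies. complete_integral ?r a x (completed k y v) ?w < \<infinity>"
    by (elim eventually_mono) (auto simp: ennreal_mult_eq_top_iff less_top[symmetric] ennreal_eq_0_iff not_le)
  have "emeasure dummies (space dummies) = (\<Prod>i\<in>(UNIV::'n set). emeasure (lborel :: 'd rvec measure) UNIV)"
    using PV.emeasure_PiM[of "UNIV :: 'n set" "\<lambda>_. UNIV :: 'd rvec set"] by (simp add: space_PiM)
  then have "emeasure dummies (space dummies) \<noteq> 0" by (simp add: emeasure_lborel_UNIV)
  then have "\<not> (AE v in dummies. False)"
    using AE_iff_measurable[of "space dummies" dummies "\<lambda>_. False"] by auto
  then obtain v where "complete_integral ?r a x (completed k y v) ?w < \<infinity>"
    using AE by (metis (mono_tags, lifting) eventually_mono)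
  from complete_integral_exponent[OF a _ this] show ?thesis by (simp add: \<nu>)
qed

text \<open>Raising one weight multiplies the completion factor by \<open>t\<close> to the power
  \<open>d / 2\<close> and the complete-data integral by at least \<open>t\<close> to the power
  \<open>- (\<nu> + d) / 2\<close>, uniformly in the completion.\<close>

lemma Z_upweight:
  assumes w: "\<And>i. 0 < w i" and t: "1 \<le> t"
  shows "ennreal (t powr (- \<nu> / 2)) * Z w \<le> Z (w(i := t * w i))"
proof -
  let ?r = "m + 1 + real CARD('n)" and ?w' = "w(i := t * w i)"
  let ?e = "t powr (- (?r - real CARD('p) - 1) / 2)"
  have w': "0 < ?w' j" for j using w[of j] w[of i] t by auto
  note complete_integral_dummies_measurable[measurable]
  have cf: "completion_factor TYPE('d) ?w' = t powr (real CARD('d) / 2) * completion_factor TYPE('d) w"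
  proof -
    have "completion_factor TYPE('d) ?w' = (\<Prod>j\<in>UNIV. (if j = i then t powr (real CARD('d) / 2) else 1) * (w j powr (real CARD('d) / 2) / gauss_const TYPE('d)))"
      unfolding completion_factor_def using t w by (intro prod.cong) (auto simp: powr_mult less_imp_le)
    then show ?thesis by (simp only: prod.distrib completion_factor_def) simp
  qed
  have exps: "t powr (- \<nu> / 2) = t powr (real CARD('d) / 2) * ?e"
  proof -
    have "- \<nu> / 2 = real CARD('d) / 2 + - (?r - real CARD('p) - 1) / 2" by (simp add: \<nu> field_simps)
    then show ?thesis by (simp only: powr_add)
  qed
  have "ennreal ?e * (\<integral>\<^sup>+v. ennreal (dummy_weight k v) * complete_integral ?r a x (completed k y v) w \<partial>dummies)
      = (\<integral>\<^sup>+v. ennreal ?e * (ennreal (dummy_weight k v) * complete_integral ?r a x (completed k y v) w) \<partial>dummies)"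
    by (rule nn_integral_cmult[symmetric]) measurable
  also have "\<dots> \<le> (\<integral>\<^sup>+v. ennreal (dummy_weight k v) * complete_integral ?r a x (completed k y v) ?w' \<partial>dummies)"
  proof (rule nn_integral_mono)
    fix v
    have "ennreal ?e * complete_integral ?r a x (completed k y v) w \<le> complete_integral ?r a x (completed k y v) ?w'"
      using \<nu>_nonneg by (intro complete_integral_upweight a w t) (simp add: \<nu>)
    then show "ennreal ?e * (ennreal (dummy_weight k v) * complete_integral ?r a x (completed k y v) w) \<le> ennreal (dummy_weight k v) * complete_integral ?r a x (completed k y v) ?w'"
      by (subst mult.left_commute) (rule mult_left_mono, simp_all)
  qed
  finally have "ennreal (completion_factor TYPE('d) ?w') * (ennreal ?e * (\<integral>\<^sup>+v. ennreal (dummy_weight k v) * complete_integral ?r a x (completed k y v) w \<partial>dummies))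
      \<le> Z ?w'"
    unfolding Z_eq[OF w'] by (rule mult_left_mono) simp
  also have "ennreal (completion_factor TYPE('d) ?w') * (ennreal ?e * (\<integral>\<^sup>+v. ennreal (dummy_weight k v) * complete_integral ?r a x (completed k y v) w \<partial>dummies))
      = ennreal (t powr (- \<nu> / 2)) * Z w"
    using completion_factor_pos[of w, OF w] unfolding Z_eq[OF w] cf exps by (simp add: ennreal_mult mult_ac)
  finally show ?thesis .
qed

lemma Z_rescale:
  assumes w: "\<And>i. 0 < w i" and s: "0 < s"
  shows "Z (w(i := s)) = ennreal ((s / w i) powr (num_obs k i / 2)) *
    (\<integral>\<^sup>+z. ennreal (exp (- (s - w i) * quad_resid x k y i (fst z) (snd z) / 2)) * param_dens x m a k y w z \<partial>param_space)"
proof -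
  note quad_resid_measurable[measurable] param_dens_measurable1[measurable]
  have "Z (w(i := s)) = (\<integral>\<^sup>+z. ennreal ((s / w i) powr (num_obs k i / 2)) *
    (ennreal (exp (- (s - w i) * quad_resid x k y i (fst z) (snd z) / 2)) * param_dens x m a k y w z) \<partial>param_space)"
    unfolding Z_def by (intro nn_integral_cong) (simp only: param_dens_rescale[where w=w and s=s, OF w s], simp add: ennreal_mult mult.assoc)
  also have "\<dots> = ennreal ((s / w i) powr (num_obs k i / 2)) *
    (\<integral>\<^sup>+z. ennreal (exp (- (s - w i) * quad_resid x k y i (fst z) (snd z) / 2)) * param_dens x m a k y w z \<partial>param_space)"
    by (rule nn_integral_cmult) measurable
  finally show ?thesis .
qed

text \<open>
  Raising the weight of row \<open>i\<close> by the factor \<open>1 + 2 / N\<close> multiplies the density by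
  \<open>exp (- w i * r / N)\<close> up to a constant. The lower bound \<open>Z_upweight\<close> therefore controls the
  integral of \<open>N * (1 - exp (- w i * r / N))\<close>, which tends to \<open>w i * r\<close>.
\<close>

lemma quad_resid_moment:
  assumes w: "\<And>i. 0 < w i"
  shows "(\<integral>\<^sup>+z. ennreal (quad_resid x k y i (fst z) (snd z)) * param_dens x m a k y w z \<partial>param_space)
    \<le> ennreal ((\<nu> + num_obs k i) / w i) * Z w"
proof -
  note quad_resid_measurable[measurable] param_dens_measurable1[measurable]
  let ?q = "\<lambda>z. quad_resid x k y i (fst z) (snd z)" and ?p = "param_dens x m a k y w" and ?\<kappa> = "\<nu> + num_obs k i"
  let ?X = "param_space :: (('p, 'd) rmat \<times> ('d, 'd) rmat) measure"
  have q0: "0 \<le> ?q z" if "z \<in> space ?X" for z using that by (auto simp: space_param_space quad_resid_nonneg)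
  have \<kappa>0: "0 \<le> ?\<kappa>" using \<nu>_nonneg by simp
  obtain \<zeta> where \<zeta>: "Z w = ennreal \<zeta>" "0 \<le> \<zeta>" using Z_finite[of w] w by (cases "Z w") auto
  \<comment> \<open>With \<open>h = w i * r / n\<close> the integrand is
    \<open>n * (h / (1 + h))\<close>. It stands in for \<open>n * (1 - exp (- h))\<close>: it lies
    below that, and its limit in \<open>n\<close> is immediate.\<close>
  have step: "(\<integral>\<^sup>+z. ennreal (w i * ?q z / (1 + w i * ?q z * inverse (real (Suc N)))) * ?p z \<partial>?X) \<le> ennreal (?\<kappa> * \<zeta>)" for N
  proof -
    define n where "n = real (Suc N)"
    have n: "0 < n" by (simp add: n_def)
    \<comment> \<open>With this \<open>t\<close> the tilt \<open>(t * w i - w i) / 2\<close> equals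
      \<open>w i / n\<close>.\<close>
    define t where "t = 1 + 2 / n"
    have t: "1 \<le> t" using n by (simp add: t_def)
    let ?e = "\<lambda>z. exp (- (w i * ?q z / n))"
    have e: "- (t * w i - w i) * ?q z / 2 = - (w i * ?q z / n)" for z using n by (simp add: t_def field_simps)
    have "ennreal (t powr (- \<nu> / 2)) * Z w \<le> Z (w(i := t * w i))" by (rule Z_upweight[where w=w, OF w t])
    also have "\<dots> = ennreal (t powr (num_obs k i / 2)) * (\<integral>\<^sup>+z. ennreal (?e z) * ?p z \<partial>?X)"
      using Z_rescale[where w=w and i=i and s="t * w i", OF w] w[of i] t unfolding e by simp
    finally have 1: "ennreal (t powr (- \<nu> / 2) * \<zeta>) \<le> ennreal (t powr (num_obs k i / 2)) * (\<integral>\<^sup>+z. ennreal (?e z) * ?p z \<partial>?X)"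
      using \<zeta> by (simp add: ennreal_mult)
    have "(\<integral>\<^sup>+z. ennreal (?e z) * ?p z \<partial>?X) \<le> Z w" unfolding Z_def
    proof (rule nn_integral_mono)
      fix z assume "z \<in> space ?X"
      then have "?e z \<le> 1" using q0[of z] w[of i] n by simp
      then show "ennreal (?e z) * ?p z \<le> ?p z" using mult_right_mono[of "ennreal (?e z)" 1 "?p z"] by simp
    qed
    then obtain \<eta> where \<eta>: "(\<integral>\<^sup>+z. ennreal (?e z) * ?p z \<partial>?X) = ennreal \<eta>" "0 \<le> \<eta>"
      using \<zeta> by (cases "\<integral>\<^sup>+z. ennreal (?e z) * ?p z \<partial>?X") (auto simp: top_unique)
    have "t powr (- \<nu> / 2) * \<zeta> \<le> t powr (num_obs k i / 2) * \<eta>"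
      using 1 \<eta> by (simp add: ennreal_mult[symmetric])
    then have "t powr (- (num_obs k i / 2)) * (t powr (- \<nu> / 2) * \<zeta>) \<le> t powr (- (num_obs k i / 2)) * (t powr (num_obs k i / 2) * \<eta>)"
      by (rule mult_left_mono) simp
    also have "t powr (- (num_obs k i / 2)) * (t powr (num_obs k i / 2) * \<eta>) = \<eta>"
      using t by (simp add: mult.assoc[symmetric] powr_add[symmetric])
    also have "t powr (- (num_obs k i / 2)) * (t powr (- \<nu> / 2) * \<zeta>) = t powr (- ?\<kappa> / 2) * \<zeta>"

    proof -
      have "- (real (num_obs k i) / 2) + - \<nu> / 2 = - ?\<kappa> / 2" by (simp add: field_simps)
      then show ?thesis by (simp only: mult.assoc[symmetric] powr_add[symmetric])
    qed
    finally have \<eta>_ge: "t powr (- ?\<kappa> / 2) * \<zeta> \<le> \<eta>" .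
    have "1 - ?\<kappa> / n \<le> t powr (- ?\<kappa> / 2)"
    proof -
      have "ln t \<le> 2 / n" using ln_add_one_self_le_self[of "2 / n"] n by (simp add: t_def)
      then have "?\<kappa> / 2 * ln t \<le> ?\<kappa> / 2 * (2 / n)" using \<kappa>0 by (intro mult_left_mono) auto
      moreover have "?\<kappa> / 2 * (2 / n) = ?\<kappa> / n" using n by (simp add: divide_simps)
      moreover have "- ?\<kappa> / 2 * ln t = - (?\<kappa> / 2 * ln t)" by (simp only: minus_divide_left mult_minus_left)
      ultimately have "1 - ?\<kappa> / n \<le> 1 + (- ?\<kappa> / 2 * ln t)" by linarith
      also have "\<dots> \<le> exp (- ?\<kappa> / 2 * ln t)" by (rule exp_ge_add_one_self)
      also have "\<dots> = t powr (- ?\<kappa> / 2)" using t by (simp add: powr_def)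
      finally show ?thesis .
    qed
    then have "(1 - ?\<kappa> / n) * \<zeta> \<le> \<eta>" using \<eta>_ge \<zeta>(2) mult_right_mono by fastforce
    then have "n * ((1 - ?\<kappa> / n) * \<zeta>) \<le> n * \<eta>" using n by (intro mult_left_mono) auto
    moreover have "n * ((1 - ?\<kappa> / n) * \<zeta>) = n * \<zeta> - ?\<kappa> * \<zeta>" using n by (simp add: field_simps)
    ultimately have bd: "n * \<zeta> - n * \<eta> \<le> ?\<kappa> * \<zeta>" by linarith
    have "(\<integral>\<^sup>+z. ennreal (w i * ?q z / (1 + w i * ?q z * inverse n)) * ?p z \<partial>?X) + ennreal (n * \<eta>)
        = (\<integral>\<^sup>+z. ennreal (w i * ?q z / (1 + w i * ?q z * inverse n)) * ?p z + ennreal n * (ennreal (?e z) * ?p z) \<partial>?X)"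
      using n \<eta> by (subst nn_integral_add) (auto simp: nn_integral_cmult ennreal_mult)
    also have "\<dots> \<le> (\<integral>\<^sup>+z. ennreal n * ?p z \<partial>?X)"
    proof (rule nn_integral_mono)
      fix z assume z: "z \<in> space ?X"
      define h where "h = w i * ?q z / n"
      have h: "0 \<le> h" using q0[OF z] w[of i] n by (simp add: h_def)
      have "exp (- h) \<le> inverse (1 + h)"
        using exp_ge_add_one_self[of h] h le_imp_inverse_le[of "1 + h" "exp h"] by (simp add: exp_minus)
      moreover have "h / (1 + h) = 1 - inverse (1 + h)" using h by (simp add: divide_simps)
      ultimately have "h / (1 + h) + exp (- h) \<le> 1" by linarith
      then have "n * (h / (1 + h) + exp (- h)) \<le> n" using n by simp
      moreover have "w i * ?q z = n * h" "w i * ?q z * inverse n = h" using n by (simp_all add: h_def divide_inverse)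
      ultimately have "w i * ?q z / (1 + w i * ?q z * inverse n) + n * ?e z \<le> n"
        unfolding h_def[symmetric] by (simp only: distrib_left times_divide_eq_right)
      moreover have "0 \<le> w i * ?q z / (1 + w i * ?q z * inverse n)" using q0[OF z] w[of i] n by simp
      ultimately have "ennreal (w i * ?q z / (1 + w i * ?q z * inverse n)) + ennreal n * ennreal (?e z) \<le> ennreal n"
        using n by (metis ennreal_leI ennreal_mult'' ennreal_plus exp_ge_zero mult_nonneg_nonneg less_imp_le)
      then have "(ennreal (w i * ?q z / (1 + w i * ?q z * inverse n)) + ennreal n * ennreal (?e z)) * ?p z \<le> ennreal n * ?p z"
        by (rule mult_right_mono) simp
      then show "ennreal (w i * ?q z / (1 + w i * ?q z * inverse n)) * ?p z + ennreal n * (ennreal (?e z) * ?p z) \<le> ennreal n * ?p z"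
        by (simp add: distrib_right mult.assoc)
    qed
    also have "\<dots> = ennreal (n * \<zeta>)" using n \<zeta> by (simp add: nn_integral_cmult Z_def[symmetric] ennreal_mult)
    also have "\<dots> \<le> ennreal (?\<kappa> * \<zeta>) + ennreal (n * \<eta>)"
      using bd n \<eta> \<kappa>0 \<zeta> by (simp add: ennreal_plus[symmetric] ennreal_leI del: ennreal_plus)
    finally show ?thesis unfolding n_def by (simp add: add.commute ennreal_add_left_cancel_le)
  qed
  have "(\<integral>\<^sup>+z. ennreal (w i * ?q z) * ?p z \<partial>?X)
      = (\<integral>\<^sup>+z. liminf (\<lambda>N. ennreal (w i * ?q z / (1 + w i * ?q z * inverse (real (Suc N)))) * ?p z) \<partial>?X)"
  proof (rule nn_integral_cong)
    fix z assume z: "z \<in> space ?X"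
    have "(\<lambda>N. w i * ?q z / (1 + w i * ?q z * inverse (real (Suc N)))) \<longlonglongrightarrow> w i * ?q z / (1 + w i * ?q z * 0)"
      by (intro tendsto_intros LIMSEQ_inverse_real_of_nat) simp
    then have "(\<lambda>N. ennreal (w i * ?q z / (1 + w i * ?q z * inverse (real (Suc N)))) * ?p z) \<longlonglongrightarrow> ennreal (w i * ?q z) * ?p z"
      by (intro tendsto_mult_ennreal tendsto_ennrealI tendsto_const) (auto simp: param_dens_def split_beta)
    then show "ennreal (w i * ?q z) * ?p z = liminf (\<lambda>N. ennreal (w i * ?q z / (1 + w i * ?q z * inverse (real (Suc N)))) * ?p z)"
      by (simp add: lim_imp_Liminf)
  qed
  also have "\<dots> \<le> liminf (\<lambda>N. \<integral>\<^sup>+z. ennreal (w i * ?q z / (1 + w i * ?q z * inverse (real (Suc N)))) * ?p z \<partial>?X)"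
    by (rule nn_integral_liminf) measurable
  also have "\<dots> \<le> ennreal (?\<kappa> * \<zeta>)"
    using step by (intro Liminf_le) auto
  finally have "(\<integral>\<^sup>+z. ennreal (w i * ?q z) * ?p z \<partial>?X) \<le> ennreal (?\<kappa> * \<zeta>)" .
  then have "ennreal (1 / w i) * (\<integral>\<^sup>+z. ennreal (w i * ?q z) * ?p z \<partial>?X) \<le> ennreal (1 / w i) * ennreal (?\<kappa> * \<zeta>)"
    by (rule mult_left_mono) simp
  also have "ennreal (1 / w i) * (\<integral>\<^sup>+z. ennreal (w i * ?q z) * ?p z \<partial>?X) = (\<integral>\<^sup>+z. ennreal (?q z) * ?p z \<partial>?X)"
  proof (subst nn_integral_cmult[symmetric])
    show "(\<integral>\<^sup>+z. ennreal (1 / w i) * (ennreal (w i * ?q z) * ?p z) \<partial>?X) = (\<integral>\<^sup>+z. ennreal (?q z) * ?p z \<partial>?X)"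
      using w[of i] by (intro nn_integral_cong) (simp add: mult.assoc[symmetric] ennreal_mult''[symmetric] ennreal_mult'[symmetric])
  qed measurable
  also have "ennreal (1 / w i) * ennreal (?\<kappa> * \<zeta>) = ennreal (?\<kappa> / w i) * Z w"
    using \<zeta> \<kappa>0 w[of i] by (simp add: ennreal_mult[symmetric])
  finally show ?thesis .
qed

text \<open>The weights are moved to 1 in turn. One that is at most 1 is raised by
  \<open>Z_upweight\<close>, at the cost \<open>w i powr (- \<nu> / 2)\<close>. For one above 1 the
  density itself is at most \<open>w i powr (num_obs k i / 2)\<close> times that at weight 1, since
  the exponential only decreases. Adding both powers covers the two cases and keeps a product over
  the rows, which independent weights can integrate.\<close>

lemma Z_le_standard:
  assumes w: "\<And>i. 0 < w i"
  shows "Z w \<le> ennreal (\<Prod>i\<in>UNIV. w i powr (- \<nu> / 2) + w i powr (num_obs k i / 2)) * Z (\<lambda>_. 1)"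
proof -
  have one: "Z w \<le> ennreal (w i powr (- \<nu> / 2) + w i powr (num_obs k i / 2)) * Z (w(i := 1))"
    if w: "\<And>i. 0 < w i" for w :: "'n \<Rightarrow> real" and i
  proof (cases "w i \<le> 1")
    case True
    have wi: "0 < w i" by (rule that)
    have "ennreal ((1 / w i) powr (- \<nu> / 2)) * Z w \<le> Z (w(i := 1))"
      using Z_upweight[where w=w and t="1 / w i" and i=i, OF w] True wi by (simp add: fun_upd_def cong: if_cong)
    then have "ennreal (w i powr (- \<nu> / 2)) * (ennreal ((1 / w i) powr (- \<nu> / 2)) * Z w) \<le> ennreal (w i powr (- \<nu> / 2)) * Z (w(i := 1))"
      by (rule mult_left_mono) simp
    also have "ennreal (w i powr (- \<nu> / 2)) * (ennreal ((1 / w i) powr (- \<nu> / 2)) * Z w) = Z w"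
      using wi by (simp add: mult.assoc[symmetric] ennreal_mult[symmetric] powr_mult[symmetric])
    also have "ennreal (w i powr (- \<nu> / 2)) * Z (w(i := 1)) \<le> ennreal (w i powr (- \<nu> / 2) + w i powr (num_obs k i / 2)) * Z (w(i := 1))"
      by (intro mult_right_mono ennreal_leI) auto
    finally show ?thesis .
  next
    case False
    have w': "0 < (w(i := 1)) j" for j using w by simp
    have "Z w = Z ((w(i := 1))(i := w i))" by simp
    also have "\<dots> \<le> ennreal (w i powr (num_obs k i / 2)) * Z (w(i := 1))"
    proof -
      have "ennreal (exp (- (w i - 1) * quad_resid x k y i (fst z) (snd z) / 2)) * param_dens x m a k y (w(i := 1)) z
          \<le> 1 * param_dens x m a k y (w(i := 1)) z" if z: "z \<in> space param_space" for z :: "('p, 'd) rmat \<times> ('d, 'd) rmat"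
      proof (rule mult_right_mono)
        have "0 \<le> quad_resid x k y i (fst z) (snd z)" using z by (auto simp: space_param_space quad_resid_nonneg)
        then have "0 \<le> (w i - 1) * quad_resid x k y i (fst z) (snd z)" using False by simp
        then have "- (w i - 1) * quad_resid x k y i (fst z) (snd z) / 2 \<le> 0" by (simp only: mult_minus_left)
        then show "ennreal (exp (- (w i - 1) * quad_resid x k y i (fst z) (snd z) / 2)) \<le> 1"
          by (simp only: ennreal_le_1 exp_le_one_iff)
      qed simp
      then have "(\<integral>\<^sup>+z. ennreal (exp (- (w i - 1) * quad_resid x k y i (fst z) (snd z) / 2)) * param_dens x m a k y (w(i := 1)) z \<partial>param_space)
          \<le> Z (w(i := 1))"
        unfolding Z_def by (intro nn_integral_mono) simp
      moreover have "Z ((w(i := 1))(i := w i)) = ennreal (w i powr (num_obs k i / 2)) *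
          (\<integral>\<^sup>+z. ennreal (exp (- (w i - 1) * quad_resid x k y i (fst z) (snd z) / 2)) * param_dens x m a k y (w(i := 1)) z \<partial>param_space)"
        using Z_rescale[where w="w(i := 1)" and i=i and s="w i", OF w' w] by simp
      ultimately show ?thesis by (simp only:) (rule mult_left_mono, simp_all)
    qed
    also have "\<dots> \<le> ennreal (w i powr (- \<nu> / 2) + w i powr (num_obs k i / 2)) * Z (w(i := 1))"
      by (intro mult_right_mono ennreal_leI) auto
    finally show ?thesis .
  qed
  have "Z w \<le> ennreal (\<Prod>i\<in>A. w i powr (- \<nu> / 2) + w i powr (num_obs k i / 2)) * Z (\<lambda>i. if i \<in> A then 1 else w i)" if "finite A" for A
    using that
  proof induction
    case (insert j A)
    let ?w = "\<lambda>i. if i \<in> A then 1 else w i"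
    have e: "?w(j := 1) = (\<lambda>i. if i \<in> insert j A then 1 else w i)" by auto
    have "Z ?w \<le> ennreal (w j powr (- \<nu> / 2) + w j powr (num_obs k j / 2)) * Z (?w(j := 1))"
      using one[of ?w j] w insert.hyps by simp
    then have "ennreal (\<Prod>i\<in>A. w i powr (- \<nu> / 2) + w i powr (num_obs k i / 2)) * Z ?w
        \<le> ennreal (\<Prod>i\<in>A. w i powr (- \<nu> / 2) + w i powr (num_obs k i / 2)) * (ennreal (w j powr (- \<nu> / 2) + w j powr (num_obs k j / 2)) * Z (?w(j := 1)))"
      by (rule mult_left_mono) simp
    with insert.IH have "Z w \<le> ennreal (\<Prod>i\<in>A. w i powr (- \<nu> / 2) + w i powr (num_obs k i / 2)) * (ennreal (w j powr (- \<nu> / 2) + w j powr (num_obs k j / 2)) * Z (?w(j := 1)))"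
      by (rule order_trans)
    then show ?case unfolding e prod.insert[OF insert.hyps]
      by (subst mult.commute[of "w j powr (- \<nu> / 2) + w j powr (num_obs k j / 2)"], subst ennreal_mult) (auto intro: prod_nonneg simp: mult.assoc)
  qed simp
  from this[of UNIV] show ?thesis by simp
qed

end

subsection \<open>The data augmentation chain\<close>

lemma prod_less_top_ennreal: "(\<And>i. i \<in> A \<Longrightarrow> f i < (\<top> :: ennreal)) \<Longrightarrow> (\<Prod>i\<in>A. f i) < \<top>"
  by (induction A rule: infinite_finite_induct) (auto simp: ennreal_mult_less_top)

locale incomplete_regression_mixture = incomplete_regression x m a k y \<nu>
  for x :: "('n::finite, 'p::finite) rmat" and m :: real and a :: "('d::{finite,linorder}, 'd) rmat"
    and k :: "('n, 'd) bmat" and y :: "('n, 'd) rmat" and \<nu> :: real +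
  fixes Pmix :: "real measure"
  assumes Pmix: "mixing_distribution Pmix"
    and moment: "(\<integral>\<^sup>+w. ennreal (w powr (real CARD('d) / 2)) \<partial>Pmix) < \<infinity>"
    and near: "zero_near_origin Pmix \<or> faster_than_polynomial_near_origin Pmix \<or> (\<exists>c. polynomial_near_origin Pmix c \<and> \<nu> / 2 < c)"
begin

abbreviation "params \<equiv> param_space :: (('p, 'd) rmat \<times> ('d, 'd) rmat) measure"
abbreviation "weights \<equiv> Pi\<^sub>M UNIV (\<lambda>_ :: 'n. Pmix)"
abbreviation "resid i z \<equiv> quad_resid x k y i (fst z) (snd z)"

sublocale P: prob_space Pmix using Pmix by (simp add: mixing_distribution_def)

lemma prob_space_weights: "prob_space weights"
  by (intro prob_space_PiM P.prob_space_axioms)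

lemma space_Pmix: "space Pmix = {0<..}"
  using Pmix by (simp add: mixing_distribution_def)

lemma weights_pos: "w \<in> space weights \<Longrightarrow> 0 < w i"
  by (auto simp: space_PiM space_Pmix PiE_iff)

lemma component_measurable: "(\<lambda>w. w i) \<in> borel_measurable weights"
  using measurable_compose[OF measurable_component_singleton[of i UNIV "\<lambda>_. Pmix"] mixing_measurable[OF Pmix measurable_ident]]
  by (simp add: id_def)

lemma nn_integral_prod_weights:
  assumes "\<And>i. f i \<in> borel_measurable borel"
  shows "(\<integral>\<^sup>+w. (\<Prod>i\<in>UNIV. f i (w i)) \<partial>weights) = (\<Prod>i\<in>UNIV. \<integral>\<^sup>+w. f i w \<partial>Pmix)"
proof -
  interpret product_sigma_finite "\<lambda>_ :: 'n. Pmix" ..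
  show ?thesis using assms by (intro product_nn_integral_prod mixing_measurable[OF Pmix]) auto
qed

section \<open>Normalizers of the weight conditionals\<close>

definition "G i r = (\<integral>\<^sup>+w. ennreal (w powr (num_obs k i / 2) * exp (- r * w / 2)) \<partial>Pmix)"

lemma num_obs_pos: "0 < num_obs k i"
  using k by (auto simp: num_obs_def missing_structure_def card_gt_0_iff)

lemma num_obs_le: "num_obs k i \<le> CARD('d)"
  unfolding num_obs_def by (rule card_mono) auto

lemma power_moment_finite:
  "(\<integral>\<^sup>+w. ennreal (w powr (num_obs k i / 2)) \<partial>Pmix) < \<infinity>"
proof -
  have "(\<integral>\<^sup>+w. ennreal (w powr (num_obs k i / 2)) \<partial>Pmix) \<le> (\<integral>\<^sup>+w. 1 + ennreal (w powr (real CARD('d) / 2)) \<partial>Pmix)"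
  proof (rule nn_integral_mono)
    fix w assume "w \<in> space Pmix"
    then have w: "0 < w" by (simp add: space_Pmix)
    have "w powr (num_obs k i / 2) \<le> 1 + w powr (real CARD('d) / 2)"
    proof (cases "w \<le> 1")
      case True
      then have "w powr (num_obs k i / 2) \<le> 1" using w by (simp add: powr_le1)
      then show ?thesis by (simp add: add_increasing2)
    next
      case False
      then have "w powr (num_obs k i / 2) \<le> w powr (real CARD('d) / 2)"
        using num_obs_le[of i] by (intro powr_mono) auto
      then show ?thesis by simp
    qed
    then have "ennreal (w powr (num_obs k i / 2)) \<le> ennreal (1 + w powr (real CARD('d) / 2))" by (rule ennreal_leI)
    then show "ennreal (w powr (num_obs k i / 2)) \<le> 1 + ennreal (w powr (real CARD('d) / 2))" by simp
  qed
  also have "\<dots> = 1 + (\<integral>\<^sup>+w. ennreal (w powr (real CARD('d) / 2)) \<partial>Pmix)"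
    by (subst nn_integral_add) (auto intro!: mixing_measurable[OF Pmix] simp: P.emeasure_space_1)
  also have "\<dots> < \<infinity>" using moment by simp
  finally show ?thesis .
qed

lemma G_antimono: "r \<le> r' \<Longrightarrow> G i r' \<le> G i r"
  unfolding G_def by (intro nn_integral_mono ennreal_leI mult_left_mono) (auto simp: space_Pmix intro!: mult_right_mono)

lemma G_finite: "0 \<le> r \<Longrightarrow> G i r < \<infinity>"
  using G_antimono[of 0 r i] power_moment_finite[of i] by (simp add: G_def)

lemma G_pos: "0 < G i r"
proof -
  have "0 < (\<integral>\<^sup>+w. ennreal (w powr (num_obs k i / 2) * exp (- r * w / 2)) * indicator (space Pmix) w \<partial>Pmix)"
    by (intro nn_integral_pos mixing_measurable[OF Pmix]) (auto simp: space_Pmix[symmetric] P.emeasure_space_1, simp add: space_Pmix)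
  also have "\<dots> = G i r" unfolding G_def by (intro nn_integral_cong) simp
  finally show ?thesis .
qed

lemma resid_nonneg: "z \<in> space params \<Longrightarrow> 0 \<le> resid i z"
  by (auto simp: space_param_space quad_resid_nonneg)

definition "dens_const z = prior_dens m a (snd z) * (\<Prod>i\<in>UNIV. Determinant.det (obs_scale k i (snd z)) powr (- 1 / 2))"

lemma dens_const_pos: assumes "z \<in> space params" shows "0 < dens_const z"
proof -
  have S: "snd z \<in> spd_matrices" using assms by (auto simp: space_param_space)
  have "0 < mdet (pad_block U (snd z)) powr (- 1 / 2)" for U
    using spd_det_pos[OF pad_block_spd[OF S, of U]] by simp
  then show ?thesis using spd_det_pos[OF S]
    unfolding dens_const_def prior_dens_def det_obs_scale by (intro mult_pos_pos prod_pos) auto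
qed

lemma param_dens_eq:
  "param_dens x m a k y w z = ennreal (dens_const z) * (\<Prod>i\<in>UNIV. ennreal (w i powr (num_obs k i / 2) * exp (- resid i z * w i / 2)))"
  by (simp add: param_dens_factor dens_const_def weight_dens_def split_beta prod_ennreal)

lemma param_dens_integral: "(\<integral>\<^sup>+w. param_dens x m a k y w z \<partial>weights) = ennreal (dens_const z) * (\<Prod>i\<in>UNIV. G i (resid i z))"
proof -
  note component_measurable[measurable]
  have "(\<integral>\<^sup>+w. param_dens x m a k y w z \<partial>weights) = ennreal (dens_const z) * (\<integral>\<^sup>+w. (\<Prod>i\<in>UNIV. ennreal (w i powr (num_obs k i / 2) * exp (- resid i z * w i / 2))) \<partial>weights)"
    unfolding param_dens_eq by (rule nn_integral_cmult) measurable
  also have "(\<integral>\<^sup>+w. (\<Prod>i\<in>UNIV. ennreal (w i powr (num_obs k i / 2) * exp (- resid i z * w i / 2))) \<partial>weights) = (\<Prod>i\<in>UNIV. G i (resid i z))"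
    unfolding G_def by (rule nn_integral_prod_weights[of "\<lambda>i w. ennreal (w powr (num_obs k i / 2) * exp (- resid i z * w / 2))"]) measurable
  finally show ?thesis .
qed

text \<open>The weights are independent under the mixing distribution, so the product of
  one-dimensional integrals is one integral over all weights. This makes the posterior a marginal of
  the joint density.\<close>

lemma posterior_dens_eq: "posterior_dens x m a Pmix k y z = (\<integral>\<^sup>+w. param_dens x m a k y w z \<partial>weights)"
proof -
  have "(\<integral>\<^sup>+w. ennreal (w powr (num_obs k i / 2) * Determinant.det (obs_scale k i (snd z)) powr (- 1 / 2) * exp (- resid i z * w / 2)) \<partial>Pmix)
      = ennreal (Determinant.det (obs_scale k i (snd z)) powr (- 1 / 2)) * G i (resid i z)" for i
    unfolding G_def
    by (subst nn_integral_cmult[symmetric])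
      (auto intro!: mixing_measurable[OF Pmix] nn_integral_cong simp: ennreal_mult[symmetric] mult_ac)
  then have "posterior_dens x m a Pmix k y z = ennreal (prior_dens m a (snd z)) *
      (\<Prod>i\<in>UNIV. ennreal (Determinant.det (obs_scale k i (snd z)) powr (- 1 / 2)) * G i (resid i z))"
    by (simp add: posterior_dens_def split_beta)
  then show ?thesis
    by (simp add: param_dens_integral dens_const_def prod.distrib prod_ennreal ennreal_mult prior_dens_def prod_nonneg mult.assoc)
qed

text \<open>The bound \<open>Z_le_standard\<close> splits into one-dimensional moments: the negative
  power is integrable by the behaviour near 0, the positive one by the moment assumption, as
  \<open>num_obs k i\<close> is at most \<open>CARD('d)\<close>.\<close>

lemma Z_integral_finite: "(\<integral>\<^sup>+w. Z w \<partial>weights) < \<infinity>"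
proof -
  let ?c = "\<lambda>i w. w powr (- \<nu> / 2) + w powr (num_obs k i / 2)"
  note component_measurable[measurable]
  have "(\<integral>\<^sup>+w. Z w \<partial>weights) \<le> (\<integral>\<^sup>+w. (\<Prod>i\<in>UNIV. ennreal (?c i (w i))) * Z (\<lambda>_. 1) \<partial>weights)"
    using Z_le_standard weights_pos by (intro nn_integral_mono) (simp add: prod_ennreal del: ennreal_plus)
  also have "\<dots> = (\<integral>\<^sup>+w. (\<Prod>i\<in>UNIV. ennreal (?c i (w i))) \<partial>weights) * Z (\<lambda>_. 1)"
    by (rule nn_integral_multc) measurable
  also have "(\<integral>\<^sup>+w. (\<Prod>i\<in>UNIV. ennreal (?c i (w i))) \<partial>weights) = (\<Prod>i\<in>UNIV. \<integral>\<^sup>+w. ennreal (?c i w) \<partial>Pmix)"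
    by (rule nn_integral_prod_weights[of "\<lambda>i w. ennreal (?c i w)"]) measurable
  also have "(\<Prod>i\<in>UNIV. \<integral>\<^sup>+w. ennreal (?c i w) \<partial>Pmix) * Z (\<lambda>_. 1) < \<infinity>"
  proof -
    have "(\<integral>\<^sup>+w. ennreal (?c i w) \<partial>Pmix) < \<infinity>" for i
      using mixing_moments(1)[OF Pmix \<nu>_nonneg near] power_moment_finite[of i]
      by (simp add: nn_integral_add mixing_measurable[OF Pmix])
    then show ?thesis using Z_finite[of "\<lambda>_. 1"] by (simp add: ennreal_mult_less_top prod_less_top_ennreal del: ennreal_plus)
  qed
  finally show ?thesis .
qed

text \<open>The joint density is \<open>param_dens\<close> as a function of both blocks. Its total
  finiteness, which is propriety of the posterior, comes from the integral of \<open>Z\<close> by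
  exchanging the integrals.\<close>

sublocale DA: data_augmentation params weights "\<lambda>z w. param_dens x m a k y w z" "\<lambda>z. normalized_density weights (weight_dens x k y z)"
proof (rule data_augmentation.intro)
  interpret XQ: pair_sigma_finite params weights
    by (intro pair_sigma_finite.intro sigma_finite_param_space prob_space_imp_sigma_finite prob_space_weights)
  show "sigma_finite_measure params" by (rule sigma_finite_param_space)
  show "0 < emeasure params (space params)" by (rule emeasure_param_space_pos)
  show "sigma_finite_measure weights" by (intro prob_space_imp_sigma_finite prob_space_weights)
  show "0 < emeasure weights (space weights)" by (simp add: prob_space.emeasure_space_1[OF prob_space_weights])
  show h: "(\<lambda>(z, w). param_dens x m a k y w z) \<in> borel_measurable (params \<Otimes>\<^sub>M weights)"
    by (rule param_dens_measurable[OF component_measurable])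
  show "0 < param_dens x m a k y w z" if "z \<in> space params" "w \<in> space weights" for z w
  proof -
    have "w i powr (num_obs k i / 2) \<noteq> 0" for i using weights_pos[OF that(2), of i] by simp
    then have "0 < (\<Prod>i\<in>UNIV. w i powr (num_obs k i / 2) * exp (- resid i z * w i / 2))"
      by (intro prod_pos ballI mult_pos_pos) (auto simp: less_le)
    then show ?thesis using dens_const_pos[OF that(1)]
      by (simp add: param_dens_eq ennreal_zero_less_mult_iff prod_ennreal)
  qed
  show "(\<integral>\<^sup>+w. param_dens x m a k y w z \<partial>weights) < \<infinity>" if "z \<in> space params" for z
    unfolding param_dens_integral using G_finite resid_nonneg[OF that]
    by (simp add: ennreal_mult_less_top prod_less_top_ennreal del: ennreal_plus)
  show "(\<integral>\<^sup>+z. param_dens x m a k y w z \<partial>params) < \<infinity>" if "w \<in> space weights" for w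
    using Z_finite[of w] weights_pos[OF that] by (simp add: Z_def)
  show "(\<integral>\<^sup>+z. \<integral>\<^sup>+w. param_dens x m a k y w z \<partial>weights \<partial>params) < \<infinity>"
    using Z_integral_finite XQ.Fubini'[OF h] by (simp add: Z_def)
  show "normalized_density weights (weight_dens x k y z) = normalized_density weights (\<lambda>w. param_dens x m a k y w z)"
    if "z \<in> space params" for z
  proof (rule normalized_density_scale[symmetric])
    show "weight_dens x k y z \<in> borel_measurable weights"
      using component_measurable by (simp add: weight_dens_def split_beta)
    show "param_dens x m a k y w z = ennreal (dens_const z) * weight_dens x k y z w" for w
      by (simp add: param_dens_factor dens_const_def)
  qed (use dens_const_pos[OF that] in auto)
qed

lemma da_kernel_eq: "da_kernel x m a Pmix k y = DA.step"
  by (rule ext) (simp add: da_kernel_def DA.step_def DA.update_def[abs_def])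

lemma posterior_eq: "posterior x m a Pmix k y = DA.target"
  unfolding posterior_def DA.target_def by (simp add: posterior_dens_eq[abs_def])

lemma posterior_proper: "proper_density params (posterior_dens x m a Pmix k y)"
  using DA.fin by (simp add: proper_density_def posterior_dens_eq[abs_def])

section \<open>Drift and minorization for the sum of residuals\<close>

definition "V z = (\<Sum>i\<in>UNIV. resid i z)"

lemma V_measurable: "V \<in> borel_measurable params"
  unfolding V_def[abs_def] by (intro borel_measurable_sum quad_resid_measurable)

lemma V_update:
  assumes w: "w \<in> space weights"
  shows "(\<integral>\<^sup>+u. ennreal (V u) \<partial>DA.update w) \<le> (\<Sum>i\<in>UNIV. ennreal ((\<nu> + num_obs k i) / w i))"
proof -
  note quad_resid_measurable[measurable] param_dens_measurable1[measurable] V_measurable[measurable]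
  have wp: "0 < w i" for i by (rule weights_pos[OF w])
  have "(\<integral>\<^sup>+u. ennreal (V u) \<partial>DA.update w) = (\<integral>\<^sup>+u. param_dens x m a k y w u * ennreal (V u) \<partial>params) / Z w"
    unfolding DA.update_def by (subst nn_integral_normalized_density) (simp_all add: Z_def)
  also have "(\<integral>\<^sup>+u. param_dens x m a k y w u * ennreal (V u) \<partial>params) = (\<integral>\<^sup>+u. (\<Sum>i\<in>UNIV. ennreal (resid i u) * param_dens x m a k y w u) \<partial>params)"
  proof (rule nn_integral_cong)
    fix u assume u: "u \<in> space params"
    have "ennreal (V u) = (\<Sum>i\<in>UNIV. ennreal (resid i u))" unfolding V_def using resid_nonneg[OF u] by (intro sum_ennreal[symmetric])
    then show "param_dens x m a k y w u * ennreal (V u) = (\<Sum>i\<in>UNIV. ennreal (resid i u) * param_dens x m a k y w u)"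
      by (simp only: sum_distrib_right mult.commute[of "param_dens x m a k y w u"])
  qed
  also have "\<dots> = (\<Sum>i\<in>UNIV. \<integral>\<^sup>+u. ennreal (resid i u) * param_dens x m a k y w u \<partial>params)"
    by (rule nn_integral_sum) measurable
  also have "\<dots> \<le> (\<Sum>i\<in>UNIV. ennreal ((\<nu> + num_obs k i) / w i) * Z w)"
    by (intro sum_mono quad_resid_moment wp)
  also have "\<dots> = (\<Sum>i\<in>UNIV. ennreal ((\<nu> + num_obs k i) / w i)) * Z w" by (simp add: sum_distrib_right)
  also have "\<dots> / Z w = (\<Sum>i\<in>UNIV. ennreal ((\<nu> + num_obs k i) / w i))"
    using DA.pos_X[OF w] Z_finite[of w] wp by (intro ennreal_mult_divide_eq) (auto simp: Z_def)
  finally show ?thesis by (simp add: divide_right_mono_ennreal)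
qed

text \<open>Given the parameters the weights are independent, so the factor \<open>1 / w i\<close>
  alters only the one-dimensional integral of row \<open>i\<close>, where it lowers the exponent by
  1.\<close>

lemma inverse_weight_integral:
  assumes bd: "\<And>r. 0 \<le> r \<Longrightarrow> (\<integral>\<^sup>+w. ennreal (w powr (num_obs k i / 2 - 1) * exp (- r * w / 2)) \<partial>Pmix) \<le> ennreal (l * r + L) * G i r"
    and z: "z \<in> space params"
  shows "(\<integral>\<^sup>+w. param_dens x m a k y w z * ennreal (1 / w i) \<partial>weights)
    \<le> ennreal (l * resid i z + L) * (\<integral>\<^sup>+w. param_dens x m a k y w z \<partial>weights)"
proof -
  note component_measurable[measurable]
  let ?f = "\<lambda>j w. ennreal (w powr (num_obs k j / 2 - (if j = i then 1 else 0)) * exp (- resid j z * w / 2))"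
  have "(\<integral>\<^sup>+w. param_dens x m a k y w z * ennreal (1 / w i) \<partial>weights) = (\<integral>\<^sup>+w. ennreal (dens_const z) * (\<Prod>j\<in>UNIV. ?f j (w j)) \<partial>weights)"
  proof (rule nn_integral_cong)
    fix w assume w: "w \<in> space weights"
    have wi: "0 < w i" by (rule weights_pos[OF w])
    have "?f i (w i) = ennreal (w i powr (num_obs k i / 2) * exp (- resid i z * w i / 2)) * ennreal (1 / w i)"
      using wi by (simp add: powr_diff ennreal_mult'[symmetric])
    then have "(\<Prod>j\<in>UNIV. ?f j (w j)) = (\<Prod>j\<in>UNIV. ennreal (w j powr (num_obs k j / 2) * exp (- resid j z * w j / 2))) * ennreal (1 / w i)"
      by (subst (1 2) prod.remove[of UNIV i]) (simp_all add: mult_ac)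
    then show "param_dens x m a k y w z * ennreal (1 / w i) = ennreal (dens_const z) * (\<Prod>j\<in>UNIV. ?f j (w j))"
      by (simp add: param_dens_eq mult.assoc)
  qed
  also have "\<dots> = ennreal (dens_const z) * (\<integral>\<^sup>+w. (\<Prod>j\<in>UNIV. ?f j (w j)) \<partial>weights)"
    by (rule nn_integral_cmult) measurable
  also have "(\<integral>\<^sup>+w. (\<Prod>j\<in>UNIV. ?f j (w j)) \<partial>weights) = (\<Prod>j\<in>UNIV. \<integral>\<^sup>+w. ?f j w \<partial>Pmix)"
    by (rule nn_integral_prod_weights) measurable
  also have "\<dots> = (\<integral>\<^sup>+w. ?f i w \<partial>Pmix) * (\<Prod>j\<in>UNIV - {i}. G j (resid j z))"
    unfolding G_def by (subst prod.remove[of UNIV i]) (auto intro!: arg_cong2[of _ _ _ _ "(*)"] prod.cong)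
  also have "\<dots> \<le> ennreal (l * resid i z + L) * G i (resid i z) * (\<Prod>j\<in>UNIV - {i}. G j (resid j z))"
    using bd[OF resid_nonneg[OF z]] by (intro mult_right_mono) auto
  also have "\<dots> = ennreal (l * resid i z + L) * (\<Prod>j\<in>UNIV. G j (resid j z))"
    by (subst prod.remove[of UNIV i]) (simp_all add: mult.assoc)
  finally show ?thesis by (simp add: param_dens_integral mult.left_commute mult_left_mono)
qed

lemma drift_condition:
  "\<exists>l b. 0 \<le> l \<and> l < 1 \<and> 0 \<le> b \<and>
    (\<forall>z\<in>space params. (\<integral>\<^sup>+u. ennreal (V u) \<partial>DA.step z) \<le> ennreal (l * V z + b))"
proof -
  let ?\<kappa> = "\<lambda>i. \<nu> + num_obs k i"
  have \<kappa>: "0 \<le> ?\<kappa> i" for i using \<nu>_nonneg by simp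
  let ?P = "\<lambda>i l L. 0 \<le> l \<and> 0 \<le> L \<and> ?\<kappa> i * l < 1 \<and> (\<forall>r\<ge>0. (\<integral>\<^sup>+w. ennreal (w powr (num_obs k i / 2 - 1) * exp (- r * w / 2)) \<partial>Pmix)
      \<le> ennreal (l * r + L) * G i r)"
  have "\<forall>i. \<exists>l L. ?P i l L"
  proof
    fix i show "\<exists>l L. ?P i l L"
      unfolding G_def using mixing_moments(2)[OF Pmix \<nu>_nonneg near, of "num_obs k i / 2"] num_obs_pos[of i] by simp
  qed
  from choice[OF this] obtain l where "\<forall>i. \<exists>L. ?P i (l i) L" ..
  from choice[OF this] obtain L where "\<forall>i. ?P i (l i) (L i)" ..
  then have lL: "\<And>i. 0 \<le> l i" "\<And>i. 0 \<le> L i" "\<And>i. ?\<kappa> i * l i < 1"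
    "\<And>i r. 0 \<le> r \<Longrightarrow> (\<integral>\<^sup>+w. ennreal (w powr (num_obs k i / 2 - 1) * exp (- r * w / 2)) \<partial>Pmix) \<le> ennreal (l i * r + L i) * G i r"
    by blast+
  \<comment> \<open>There are finitely many rows, so the largest of their factors is still below
    1.\<close>
  define l' where "l' = Max (range (\<lambda>i. ?\<kappa> i * l i))"
  have l'_ge: "?\<kappa> i * l i \<le> l'" for i unfolding l'_def by (rule Max_ge) auto
  \<comment> \<open>\<open>undefined\<close> is just some row; the index type is nonempty.\<close>
  have l': "0 \<le> l'" using l'_ge[of undefined] \<kappa>[of undefined] lL(1)[of undefined] by (meson mult_nonneg_nonneg order_trans)
  have l'1: "l' < 1" unfolding l'_def using lL(3) by (subst Max_less_iff) auto
  have b: "0 \<le> (\<Sum>i\<in>UNIV. ?\<kappa> i * L i)" using \<kappa> lL(2) by (intro sum_nonneg mult_nonneg_nonneg) auto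
  have "(\<integral>\<^sup>+u. ennreal (V u) \<partial>DA.step z) \<le> ennreal (l' * V z + (\<Sum>i\<in>UNIV. ?\<kappa> i * L i))" if z: "z \<in> space params" for z
  proof -
    note component_measurable[measurable]
    let ?h = "\<lambda>w. param_dens x m a k y w z" and ?H = "\<integral>\<^sup>+w. param_dens x m a k y w z \<partial>weights"
    have hm[measurable]: "?h \<in> borel_measurable weights" by (rule DA.h1[OF z])
    have r: "0 \<le> resid i z" for i by (rule resid_nonneg[OF z])
    have "(\<integral>\<^sup>+u. ennreal (V u) \<partial>DA.step z) = (\<integral>\<^sup>+w. ?h w * (\<integral>\<^sup>+u. ennreal (V u) \<partial>DA.update w) \<partial>weights) / ?H"
      using V_measurable by (intro DA.nn_integral_kernel z) auto
    also have "\<dots> \<le> ennreal (\<Sum>i\<in>UNIV. ?\<kappa> i * (l i * resid i z + L i)) * ?H / ?H"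
    proof (rule divide_right_mono_ennreal)
      have "(\<integral>\<^sup>+w. ?h w * (\<integral>\<^sup>+u. ennreal (V u) \<partial>DA.update w) \<partial>weights)
          \<le> (\<integral>\<^sup>+w. (\<Sum>i\<in>UNIV. ennreal (?\<kappa> i) * (?h w * ennreal (1 / w i))) \<partial>weights)"
      proof (rule nn_integral_mono)
        fix w assume w: "w \<in> space weights"
        have "ennreal (?\<kappa> i / w i) = ennreal (?\<kappa> i) * ennreal (1 / w i)" for i
          using \<kappa>[of i] weights_pos[OF w, of i] by (simp add: ennreal_mult[symmetric])
        then have "?h w * (\<integral>\<^sup>+u. ennreal (V u) \<partial>DA.update w) \<le> ?h w * (\<Sum>i\<in>UNIV. ennreal (?\<kappa> i) * ennreal (1 / w i))"
          using V_update[OF w] by (intro mult_left_mono) auto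
        then show "?h w * (\<integral>\<^sup>+u. ennreal (V u) \<partial>DA.update w) \<le> (\<Sum>i\<in>UNIV. ennreal (?\<kappa> i) * (?h w * ennreal (1 / w i)))"
          by (simp add: sum_distrib_left mult.left_commute)
      qed
      also have "\<dots> = (\<Sum>i\<in>UNIV. ennreal (?\<kappa> i) * (\<integral>\<^sup>+w. ?h w * ennreal (1 / w i) \<partial>weights))"
        by (subst nn_integral_sum) (auto intro!: sum.cong nn_integral_cmult)
      also have "\<dots> \<le> (\<Sum>i\<in>UNIV. ennreal (?\<kappa> i) * (ennreal (l i * resid i z + L i) * ?H))"
        by (intro sum_mono mult_left_mono inverse_weight_integral lL(4) z) auto
      also have "\<dots> = ennreal (\<Sum>i\<in>UNIV. ?\<kappa> i * (l i * resid i z + L i)) * ?H"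
        using \<kappa> lL(1,2) r by (simp add: sum_ennreal[symmetric] sum_distrib_right ennreal_mult mult.assoc)
      finally show "(\<integral>\<^sup>+w. ?h w * (\<integral>\<^sup>+u. ennreal (V u) \<partial>DA.update w) \<partial>weights) \<le> ennreal (\<Sum>i\<in>UNIV. ?\<kappa> i * (l i * resid i z + L i)) * ?H" .
    qed
    also have "\<dots> = ennreal (\<Sum>i\<in>UNIV. ?\<kappa> i * (l i * resid i z + L i))"
      using DA.pos_Q[OF z] DA.fin_Q[OF z] by (intro ennreal_mult_divide_eq) auto
    also have "\<dots> \<le> ennreal (l' * V z + (\<Sum>i\<in>UNIV. ?\<kappa> i * L i))"
    proof (rule ennreal_leI)
      have "(\<Sum>i\<in>UNIV. ?\<kappa> i * (l i * resid i z + L i)) = (\<Sum>i\<in>UNIV. ?\<kappa> i * l i * resid i z) + (\<Sum>i\<in>UNIV. ?\<kappa> i * L i)"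
        by (simp only: distrib_left sum.distrib mult.assoc)
      also have "(\<Sum>i\<in>UNIV. ?\<kappa> i * l i * resid i z) \<le> (\<Sum>i\<in>UNIV. l' * resid i z)"
        by (intro sum_mono mult_right_mono l'_ge r)
      finally show "(\<Sum>i\<in>UNIV. ?\<kappa> i * (l i * resid i z + L i)) \<le> l' * V z + (\<Sum>i\<in>UNIV. ?\<kappa> i * L i)"
        by (simp add: V_def sum_distrib_left)
    qed
    finally show ?thesis .
  qed
  with l' l'1 b show ?thesis by blast
qed

text \<open>Residuals are nonnegative, so on the sublevel set each of them is at most
  \<open>R'\<close>. The unnormalized weight density is then at least the one with \<open>R'\<close>
  in every row, and its normalizer at most the one with residual 0; the quotient of these two is a
  common lower bound for the weight conditionals.\<close>

lemma minorization_sublevel: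
  "\<exists>\<mu>. finite_measure \<mu> \<and> sets \<mu> = sets params \<and> emeasure \<mu> (space params) > 0 \<and>
    (\<forall>z\<in>{z \<in> space params. V z \<le> R}. \<forall>A\<in>sets params. emeasure \<mu> A \<le> emeasure (DA.step z) A)"
proof -
  \<comment> \<open>\<open>R\<close> may be negative, whereas \<open>G i r\<close> is known to be
    finite only for \<open>r \<ge> 0\<close>.\<close>
  define R' where "R' = max 0 R"
  have R': "0 \<le> R'" "R \<le> R'" by (auto simp: R'_def)
  let ?g = "\<lambda>i w. ennreal (w powr (num_obs k i / 2) * exp (- R' * w / 2))"
  let ?q = "\<lambda>w. \<Prod>i\<in>UNIV. ?g i (w i) / G i 0"
  note component_measurable[measurable]
  show ?thesis
  proof (rule DA.minorization)
    show "?q \<in> borel_measurable weights" by measurable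
    have "(\<integral>\<^sup>+w. ?q w \<partial>weights) = (\<Prod>i\<in>UNIV. \<integral>\<^sup>+w. ?g i w / G i 0 \<partial>Pmix)"
      by (rule nn_integral_prod_weights[of "\<lambda>i w. ?g i w / G i 0"]) measurable
    also have "\<dots> = (\<Prod>i\<in>UNIV. G i R' / G i 0)"
      by (intro prod.cong refl) (simp add: nn_integral_divide mixing_measurable[OF Pmix] G_def)
    finally have e: "(\<integral>\<^sup>+w. ?q w \<partial>weights) = (\<Prod>i\<in>UNIV. G i R' / G i 0)" .
    have f: "0 < G i R' / G i 0" "G i R' / G i 0 < \<top>" for i
      using G_pos[of i] G_finite[OF R'(1), of i] G_finite[of 0 i]
      by (auto simp: ennreal_zero_less_divide ennreal_divide_eq_top_iff less_top[symmetric] zero_less_iff_neq_zero)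
    show "0 < (\<integral>\<^sup>+w. ?q w \<partial>weights)" unfolding e using f(1) by (simp add: zero_less_iff_neq_zero)
    show "(\<integral>\<^sup>+w. ?q w \<partial>weights) < \<infinity>" unfolding e using f(2) by (simp add: prod_less_top_ennreal)
    fix z w assume "z \<in> {z \<in> space params. V z \<le> R}" and w: "w \<in> space weights"
    then have z: "z \<in> space params" and Vz: "V z \<le> R'" using R' by auto
    have r: "0 \<le> resid i z" "resid i z \<le> R'" for i
      using resid_nonneg[OF z] member_le_sum[of i UNIV "\<lambda>i. resid i z"] Vz by (auto simp: V_def)
    have "?q w * (\<Prod>i\<in>UNIV. G i (resid i z)) = (\<Prod>i\<in>UNIV. ?g i (w i) / G i 0 * G i (resid i z))"
      by (simp add: prod.distrib)
    also have "\<dots> \<le> (\<Prod>i\<in>UNIV. ennreal (w i powr (num_obs k i / 2) * exp (- resid i z * w i / 2)))"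
    proof (rule prod_mono_ennreal)
      fix i
      have "?g i (w i) / G i 0 * G i (resid i z) \<le> ?g i (w i) / G i 0 * G i 0"
        using G_antimono[OF r(1)] by (rule mult_left_mono) simp
      also have "\<dots> = ?g i (w i)"
        using G_pos[of i 0] G_finite[of 0 i] by (simp add: ennreal_divide_times ennreal_mult_divide_eq less_top)
      also have "\<dots> \<le> ennreal (w i powr (num_obs k i / 2) * exp (- resid i z * w i / 2))"
        using weights_pos[OF w, of i] r(2)[of i] by (intro ennreal_leI mult_left_mono) auto
      finally show "?g i (w i) / G i 0 * G i (resid i z) \<le> ennreal (w i powr (num_obs k i / 2) * exp (- resid i z * w i / 2))" .
    qed
    finally have "ennreal (dens_const z) * (?q w * (\<Prod>i\<in>UNIV. G i (resid i z)))
        \<le> ennreal (dens_const z) * (\<Prod>i\<in>UNIV. ennreal (w i powr (num_obs k i / 2) * exp (- resid i z * w i / 2)))"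
      by (rule mult_left_mono) simp
    then show "?q w * (\<integral>\<^sup>+w. param_dens x m a k y w z \<partial>weights) \<le> param_dens x m a k y w z"
      unfolding param_dens_integral unfolding param_dens_eq by (simp only: mult.left_commute)
  qed auto
qed

lemma geometrically_ergodic_da_kernel: "geometrically_ergodic params (da_kernel x m a Pmix k y) (posterior x m a Pmix k y)"
proof -
  obtain l b where lb: "0 \<le> l" "l < 1" "0 \<le> b"
    "\<And>z. z \<in> space params \<Longrightarrow> (\<integral>\<^sup>+u. ennreal (V u) \<partial>DA.step z) \<le> ennreal (l * V z + b)"
    using drift_condition by blast
  interpret drift_minorization params DA.step V l b DA.target
  proof
    show "0 \<le> V z" if "z \<in> space params" for z
      unfolding V_def using resid_nonneg[OF that] by (simp add: sum_nonneg)
    show "\<exists>\<nu>. finite_measure \<nu> \<and> sets \<nu> = sets params \<and> emeasure \<nu> (space params) > 0 \<and>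
        (\<forall>z\<in>space params. V z \<le> R \<longrightarrow> (\<forall>A\<in>sets params. emeasure \<nu> A \<le> emeasure (DA.step z) A))" for R
      using minorization_sublevel[of R] by auto
  qed (use lb V_measurable DA.kernel_measurable DA.stationary_target in auto)
  show ?thesis
    unfolding da_kernel_eq posterior_eq by (rule geometrically_ergodic[OF DA.irreducible DA.aperiodic])
qed

end

theorem theorem4:
  fixes x :: "('n::finite, 'p::finite) rmat"
    and m :: real
    and a :: "('d::{finite,linorder}, 'd) rmat"
    and Pmix :: "real measure"
    and k :: "('n, 'd) bmat"
    and y :: "('n, 'd) rmat"
  assumes a_psd: "psd_matrix a"
    and Pmix: "mixing_distribution Pmix"
    and k: "missing_structure k"
    and moment: "(\<integral>\<^sup>+w. ennreal (w powr (real CARD('d) / 2)) \<partial>Pmix) < \<infinity>"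
    and cond_proper: "\<And>w :: 'n \<Rightarrow> real. (\<And>i. 0 < w i) \<Longrightarrow>
          proper_density (param_space :: (('p, 'd) rmat \<times> ('d, 'd) rmat) measure)
            (param_dens x m a k y w)"
    and near_origin: "zero_near_origin Pmix \<or> faster_than_polynomial_near_origin Pmix \<or>
          (\<exists>c. polynomial_near_origin Pmix c \<and>
             c > (real CARD('n) - real CARD('p) + m - real (Min (range (num_obs k)))) / 2)"
  shows "proper_density (param_space :: (('p, 'd) rmat \<times> ('d, 'd) rmat) measure)
           (posterior_dens x m a Pmix k y) \<and>
         geometrically_ergodic (param_space :: (('p, 'd) rmat \<times> ('d, 'd) rmat) measure)
           (da_kernel x m a Pmix k y) (posterior x m a Pmix k y)"
proof -
  \<comment> \<open>A row has at most \<open>CARD('d)\<close> observed entries, so the threshold for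
    \<open>c\<close> in the statement is at least \<open>\<nu> / 2\<close>, the form in which the
    locale asks for it. \<open>undefined\<close> stands for some row.\<close>
  have "Min (range (num_obs k)) \<le> num_obs k undefined" by (rule Min_le) auto
  also have "\<dots> \<le> CARD('d)" unfolding num_obs_def by (rule card_mono) auto
  finally have Min: "real (Min (range (num_obs k))) \<le> real CARD('d)" by simp
  interpret incomplete_regression_mixture x m a k y "m + real CARD('n) - real CARD('p) - real CARD('d)" Pmix
  proof
    have "(m + real CARD('n) - real CARD('p) - real CARD('d)) / 2 < c"
      if "(real CARD('n) - real CARD('p) + m - real (Min (range (num_obs k)))) / 2 < c" for c
    proof (rule order_le_less_trans[OF _ that])
      show "(m + real CARD('n) - real CARD('p) - real CARD('d)) / 2 \<le> (real CARD('n) - real CARD('p) + m - real (Min (range (num_obs k)))) / 2"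
        using Min by (intro divide_right_mono) auto
    qed
    then show "zero_near_origin Pmix \<or> faster_than_polynomial_near_origin Pmix \<or>
        (\<exists>c. polynomial_near_origin Pmix c \<and> (m + real CARD('n) - real CARD('p) - real CARD('d)) / 2 < c)"
      using near_origin by blast
  qed (use a_psd Pmix k moment cond_proper in auto)
  show ?thesis using posterior_proper geometrically_ergodic_da_kernel by blast
qed

end
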